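(* Let $n\ge2$ and $s\in[\frac14,\frac12)$. Let $\Omega\subset\mathbb{R}^n$ be a bounded Lipschitz domain satisfying an exterior ball condition. Assume the standing assumptions on $a$ and $L$ given in the context and, in addition, that for all $\mathfrak m>0$ there is a constant $C_{\mathfrak m}>0$ such that $|a(x,u)|\le C_{\mathfrak m}$ and $\left|\frac{\partial L}{\partial u}(x,u)\right|\le C_{\mathfrak m}$ for a.e. $x\in\Omega$ and all $u\in[-\mathfrak m,\mathfrak m]$. Let $(\bar u,\bar p,\bar z)$ be an optimal triplet of the fractional semilinear optimal control problem. Then $\bar u\in C^s(\mathbb{R}^n)$, $\bar p\in C^s(\mathbb{R}^n)$, and $\bar z\in C^s(\overline\Omega)$.
   Context: Spaces and bilinear form: $\tilde H^s(\Omega)=\{v|_\Omega: v\in H^s(\mathbb{R}^n),\ \operatorname{supp}v\subset\overline\Omega\}$ (functions extended by zero outside $\Omega$); $\mathcal A(v,w)=\frac{C(n,s)}2\iint_{\mathbb{R}^n\times\mathbb{R}^n}\frac{(v(x)-v(y))(w(x)-w(y))}{|x-y|^{n+2s}}dx\,dy$, $C(n,s)=\frac{2^{2s}s\Gamma(s+n/2)}{\pi^{n/2}\Gamma(1-s)}$. Standing assumptions. $a:\Omega\times\mathbb{R}\to\mathbb{R}$ is Carath\'eodory, of class $C^2$ in the second variable, $a(\cdot,0)\in L^r(\Omega)$ with $r>n/(2s)$; $\frac{\partial a}{\partial u}(x,u)\ge0$ for a.e. $x\in\Omega$ and all $u\in\mathbb{R}$; for all $\mathfrak m>0$ there is $C_{\mathfrak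 m}>0$ with $\sum_{i=1}^2|\frac{\partial^ia}{\partial u^i}(x,u)|\le C_{\mathfrak m}$ and $|\frac{\partial^2a}{\partial u^2}(x,v)-\frac{\partial^2a}{\partial u^2}(x,w)|\le C_{\mathfrak m}|v-w|$ for a.e. $x\in\Omega$ and $u,v,w\in[-\mathfrak m,\mathfrak m]$. $L:\Omega\times\mathbb{R}\to\mathbb{R}$ is Carath\'eodory, of class $C^2$ in the second variable, $L(\cdot,0)\in L^1(\Omega)$; for all $\mathfrak m>0$ there are $\psi_{\mathfrak m},\phi_{\mathfrak m}\in L^r(\Omega)$, $r>n/(2s)$, with $|\frac{\partial L}{\partial u}(x,u)|\le\psi_{\mathfrak m}(x)$ and $|\frac{\partial^2L}{\partial u^2}(x,u)|\le\phi_{\mathfrak m}(x)$ for a.e. $x\in\Omega$ and $u\in[-\mathfrak m,\mathfrak m]$. Control problem: let $\alpha>0$ and $\mathfrak a<\mathfrak b$ be real, $\mathbb Z_{ad}=\{v\in L^2(\Omega):\mathfrak a\le v\le\mathfrak b\text{ a.e. in }\Omega\}$, $J(u,z)=\int_\Omega L(x,u(x))dx+\frac\alpha2\|z\|_{L^2(\Omega)}^2$. Minimize $J(u,z)$ over $(u,z)\in\tilde H^s(\Omega)\times\mathbb Z_{ad}$ subject to the state equation $\mathcal A(u,v)+(a(\cdot,u),v)_{L^2(\Omega)}=(z,v)_{L^2(\Omega)}$ for all $v\in\tilde H^s(\Omega)$; its unique solution is $u=\mathcal Sz\in\tilde H^s(\Omega)\cap L^\infty(\Omega)$. Optimal triplet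 $(\bar u,\bar p,\bar z)$: $\bar z\in\mathbb Z_{ad}$ is a locally optimal control (a local minimizer of $z\mapsto J(\mathcal Sz,z)$ on $\mathbb Z_{ad}$ in the sense of $L^2(\Omega)$), $\bar u=\mathcal S\bar z$, and $\bar p\in\tilde H^s(\Omega)\cap L^\infty(\Omega)$ solves the adjoint equation $\mathcal A(v,\bar p)+(\frac{\partial a}{\partial u}(\cdot,\bar u)\bar p,v)_{L^2(\Omega)}=(\frac{\partial L}{\partial u}(\cdot,\bar u),v)_{L^2(\Omega)}$ for all $v\in\tilde H^s(\Omega)$. These satisfy $(\bar p+\alpha\bar z,z-\bar z)_{L^2(\Omega)}\ge0$ for all $z\in\mathbb Z_{ad}$. *)

theory Defs
  imports "HOL-Analysis.Analysis"
begin

text \<open>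
  Elements of Lebesgue and Sobolev spaces are represented by functions on all of \<open>\<real>\<^sup>n\<close>,
  and two representatives are identified when they agree almost everywhere. A function on
  \<open>\<Omega>\<close> is a function on \<open>\<real>\<^sup>n\<close> whose values outside \<open>\<Omega>\<close> are never used, except that
  elements of \<open>Hs_tilde\<close> are extended by zero.
\<close>

section \<open>Domains\<close>

text \<open>
  Near every boundary point, \<open>\<Omega>\<close> is the strict epigraph of a Lipschitz function in the
  direction of some unit vector \<open>e\<close>; the hyperplane orthogonal to \<open>e\<close> plays the role of
  \<open>\<real>\<^sup>n\<^sup>-\<^sup>1\<close>.
\<close>

definition lipschitz_boundary :: "(real ^ 'n) set \<Rightarrow> bool" where
  "lipschitz_boundary \<Omega> \<longleftrightarrow>
    (\<forall>p\<in>frontier \<Omega>. \<exists>\<rho>>0. \<exists>e K \<gamma>. norm e = 1 \<and> K-lipschitz_on {y. y \<bullet> e = 0} \<gamma> \<and>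
       \<Omega> \<inter> ball p \<rho> = {x \<in> ball p \<rho>. x \<bullet> e > (\<gamma> (x - (x \<bullet> e) *\<^sub>R e) :: real)})"

definition bounded_lipschitz_domain :: "(real ^ 'n) set \<Rightarrow> bool" where
  "bounded_lipschitz_domain \<Omega> \<longleftrightarrow>
    open \<Omega> \<and> connected \<Omega> \<and> \<Omega> \<noteq> {} \<and> bounded \<Omega> \<and> lipschitz_boundary \<Omega>"

text \<open>The radius of the touching balls is uniform in the boundary point.\<close>

definition exterior_ball_condition :: "(real ^ 'n) set \<Rightarrow> bool" where
  "exterior_ball_condition \<Omega> \<longleftrightarrow>
    (\<exists>\<rho>>0. \<forall>p\<in>frontier \<Omega>. \<exists>c. dist c p = \<rho> \<and> ball c \<rho> \<inter> \<Omega> = {})"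


section \<open>Function spaces\<close>

definition Lp_space :: "real \<Rightarrow> (real ^ 'n) set \<Rightarrow> (real ^ 'n \<Rightarrow> real) set" where
  "Lp_space p \<Omega> = {f. f \<in> borel_measurable (lebesgue_on \<Omega>) \<and>
     integrable (lebesgue_on \<Omega>) (\<lambda>x. \<bar>f x\<bar> powr p)}"

definition Linf_space :: "(real ^ 'n) set \<Rightarrow> (real ^ 'n \<Rightarrow> real) set" where
  "Linf_space \<Omega> = {f. f \<in> borel_measurable (lebesgue_on \<Omega>) \<and>
     (\<exists>C. AE x in lebesgue_on \<Omega>. \<bar>f x\<bar> \<le> C)}"

definition L2_inner :: "(real ^ 'n) set \<Rightarrow> (real ^ 'n \<Rightarrow> real) \<Rightarrow> (real ^ 'n \<Rightarrow> real) \<Rightarrow> real" where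
  "L2_inner \<Omega> f g = (\<integral>x. f x * g x \<partial>lebesgue_on \<Omega>)"

definition L2_norm :: "(real ^ 'n) set \<Rightarrow> (real ^ 'n \<Rightarrow> real) \<Rightarrow> real" where
  "L2_norm \<Omega> f = sqrt (L2_inner \<Omega> f f)"

text \<open>\<open>H\<^sup>s(\<real>\<^sup>n)\<close> for \<open>0 < s < 1\<close>, by finiteness of the Gagliardo seminorm.\<close>

definition Hs_space :: "real \<Rightarrow> (real ^ 'n \<Rightarrow> real) set" where
  "Hs_space s = {v. v \<in> Lp_space 2 UNIV \<and>
     integrable (lebesgue \<Otimes>\<^sub>M lebesgue)
       (\<lambda>(x, y). (v x - v y)\<^sup>2 / norm (x - y) powr (real CARD('n) + 2 * s))}"

definition ess_support :: "(real ^ 'n \<Rightarrow> real) \<Rightarrow> (real ^ 'n) set" where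
  "ess_support v = - \<Union>{U. open U \<and> (AE x in lebesgue_on U. v x = 0)}"

definition Hs_tilde :: "real \<Rightarrow> (real ^ 'n) set \<Rightarrow> (real ^ 'n \<Rightarrow> real) set" where
  "Hs_tilde s \<Omega> = {v \<in> Hs_space s. ess_support v \<subseteq> closure \<Omega>}"

definition holder_space :: "real \<Rightarrow> (real ^ 'n) set \<Rightarrow> (real ^ 'n \<Rightarrow> real) set" where
  "holder_space s S = {g. bounded (g ` S) \<and>
     (\<exists>C. \<forall>x\<in>S. \<forall>y\<in>S. \<bar>g x - g y\<bar> \<le> C * norm (x - y) powr s)}"


section \<open>The fractional bilinear form\<close>

definition frac_const :: "nat \<Rightarrow> real \<Rightarrow> real" where
  "frac_const n s = 2 powr (2 * s) * s * Gamma (s + real n / 2) /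
     (pi powr (real n / 2) * Gamma (1 - s))"

text \<open>The integrand vanishes on the diagonal because \<open>0 / 0 = 0\<close>; the diagonal is a null set.\<close>

definition frac_form :: "real \<Rightarrow> (real ^ 'n \<Rightarrow> real) \<Rightarrow> (real ^ 'n \<Rightarrow> real) \<Rightarrow> real" where
  "frac_form s v w = frac_const CARD('n) s / 2 *
     (\<integral>(x, y). (v x - v y) * (w x - w y) / norm (x - y) powr (real CARD('n) + 2 * s)
        \<partial>(lebesgue \<Otimes>\<^sub>M lebesgue))"


section \<open>Assumptions on the nonlinearities\<close>

text \<open>
  Partial derivatives in the second variable of \<open>f :: real ^ 'n \<Rightarrow> real \<Rightarrow> real\<close> are
  \<open>deriv (f x) u\<close> and \<open>(deriv ^^ 2) (f x) u\<close>.
\<close>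

definition C2_function :: "(real \<Rightarrow> real) \<Rightarrow> bool" where
  "C2_function f \<longleftrightarrow> (\<forall>u. f field_differentiable at u) \<and>
     (\<forall>u. deriv f field_differentiable at u) \<and> continuous_on UNIV ((deriv ^^ 2) f)"

definition caratheodory_function :: "(real ^ 'n) set \<Rightarrow> (real ^ 'n \<Rightarrow> real \<Rightarrow> real) \<Rightarrow> bool" where
  "caratheodory_function \<Omega> f \<longleftrightarrow>
     (\<forall>u. (\<lambda>x. f x u) \<in> borel_measurable (lebesgue_on \<Omega>)) \<and>
     (AE x in lebesgue_on \<Omega>. continuous_on UNIV (f x))"

definition nonlinearity_assms ::
    "real \<Rightarrow> (real ^ 'n) set \<Rightarrow> (real ^ 'n \<Rightarrow> real \<Rightarrow> real) \<Rightarrow> bool" where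
  "nonlinearity_assms s \<Omega> a \<longleftrightarrow>
     caratheodory_function \<Omega> a \<and>
     (AE x in lebesgue_on \<Omega>. C2_function (a x)) \<and>
     (\<exists>r > real CARD('n) / (2 * s). (\<lambda>x. a x 0) \<in> Lp_space r \<Omega>) \<and>
     (AE x in lebesgue_on \<Omega>. \<forall>u. 0 \<le> deriv (a x) u) \<and>
     (\<forall>m>0. \<exists>C>0. AE x in lebesgue_on \<Omega>. \<forall>u\<in>{-m..m}. \<forall>v\<in>{-m..m}. \<forall>w\<in>{-m..m}.
        (\<Sum>i=1..2. \<bar>(deriv ^^ i) (a x) u\<bar>) \<le> C \<and>
        \<bar>(deriv ^^ 2) (a x) v - (deriv ^^ 2) (a x) w\<bar> \<le> C * \<bar>v - w\<bar>)"

definition integrand_assms ::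
    "real \<Rightarrow> (real ^ 'n) set \<Rightarrow> (real ^ 'n \<Rightarrow> real \<Rightarrow> real) \<Rightarrow> bool" where
  "integrand_assms s \<Omega> L \<longleftrightarrow>
     caratheodory_function \<Omega> L \<and>
     (AE x in lebesgue_on \<Omega>. C2_function (L x)) \<and>
     (\<lambda>x. L x 0) \<in> Lp_space 1 \<Omega> \<and>
     (\<forall>m>0. \<exists>r > real CARD('n) / (2 * s). \<exists>\<psi>\<in>Lp_space r \<Omega>. \<exists>\<phi>\<in>Lp_space r \<Omega>.
        AE x in lebesgue_on \<Omega>. \<forall>u\<in>{-m..m}.
          \<bar>deriv (L x) u\<bar> \<le> \<psi> x \<and> \<bar>(deriv ^^ 2) (L x) u\<bar> \<le> \<phi> x)"


section \<open>The optimal control problem\<close>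

definition Z_ad :: "real \<Rightarrow> real \<Rightarrow> (real ^ 'n) set \<Rightarrow> (real ^ 'n \<Rightarrow> real) set" where
  "Z_ad lo hi \<Omega> = {z \<in> Lp_space 2 \<Omega>. AE x in lebesgue_on \<Omega>. lo \<le> z x \<and> z x \<le> hi}"

definition cost :: "(real ^ 'n) set \<Rightarrow> (real ^ 'n \<Rightarrow> real \<Rightarrow> real) \<Rightarrow> real \<Rightarrow>
    (real ^ 'n \<Rightarrow> real) \<Rightarrow> (real ^ 'n \<Rightarrow> real) \<Rightarrow> real" where
  "cost \<Omega> L \<alpha> u z = (\<integral>x. L x (u x) \<partial>lebesgue_on \<Omega>) + \<alpha> / 2 * (L2_norm \<Omega> z)\<^sup>2"

definition is_state :: "real \<Rightarrow> (real ^ 'n) set \<Rightarrow> (real ^ 'n \<Rightarrow> real \<Rightarrow> real) \<Rightarrow>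
    (real ^ 'n \<Rightarrow> real) \<Rightarrow> (real ^ 'n \<Rightarrow> real) \<Rightarrow> bool" where
  "is_state s \<Omega> a z u \<longleftrightarrow> u \<in> Hs_tilde s \<Omega> \<inter> Linf_space \<Omega> \<and>
     (\<forall>v\<in>Hs_tilde s \<Omega>. frac_form s u v + L2_inner \<Omega> (\<lambda>x. a x (u x)) v = L2_inner \<Omega> z v)"

text \<open>
  The state is unique only up to null sets, so the operator selects a representative and
  \<open>u = S z\<close> is expressed by \<open>is_state\<close>. The cost does not depend on the representative.
\<close>

definition control_to_state :: "real \<Rightarrow> (real ^ 'n) set \<Rightarrow> (real ^ 'n \<Rightarrow> real \<Rightarrow> real) \<Rightarrow>
    (real ^ 'n \<Rightarrow> real) \<Rightarrow> (real ^ 'n \<Rightarrow> real)" where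
  "control_to_state s \<Omega> a z = (SOME u. is_state s \<Omega> a z u)"

definition is_adjoint_state :: "real \<Rightarrow> (real ^ 'n) set \<Rightarrow> (real ^ 'n \<Rightarrow> real \<Rightarrow> real) \<Rightarrow>
    (real ^ 'n \<Rightarrow> real \<Rightarrow> real) \<Rightarrow> (real ^ 'n \<Rightarrow> real) \<Rightarrow> (real ^ 'n \<Rightarrow> real) \<Rightarrow> bool" where
  "is_adjoint_state s \<Omega> a L u p \<longleftrightarrow> p \<in> Hs_tilde s \<Omega> \<inter> Linf_space \<Omega> \<and>
     (\<forall>v\<in>Hs_tilde s \<Omega>.
        frac_form s v p + L2_inner \<Omega> (\<lambda>x. deriv (a x) (u x) * p x) v =
        L2_inner \<Omega> (\<lambda>x. deriv (L x) (u x)) v)"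

definition locally_optimal_control :: "real \<Rightarrow> (real ^ 'n) set \<Rightarrow>
    (real ^ 'n \<Rightarrow> real \<Rightarrow> real) \<Rightarrow> (real ^ 'n \<Rightarrow> real \<Rightarrow> real) \<Rightarrow>
    real \<Rightarrow> real \<Rightarrow> real \<Rightarrow> (real ^ 'n \<Rightarrow> real) \<Rightarrow> bool" where
  "locally_optimal_control s \<Omega> a L \<alpha> lo hi zbar \<longleftrightarrow> zbar \<in> Z_ad lo hi \<Omega> \<and>
     (\<exists>\<epsilon>>0. \<forall>z\<in>Z_ad lo hi \<Omega>. L2_norm \<Omega> (\<lambda>x. z x - zbar x) \<le> \<epsilon> \<longrightarrow>
        cost \<Omega> L \<alpha> (control_to_state s \<Omega> a zbar) zbar \<le>
        cost \<Omega> L \<alpha> (control_to_state s \<Omega> a z) z)"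

definition optimal_triplet :: "real \<Rightarrow> (real ^ 'n) set \<Rightarrow>
    (real ^ 'n \<Rightarrow> real \<Rightarrow> real) \<Rightarrow> (real ^ 'n \<Rightarrow> real \<Rightarrow> real) \<Rightarrow> real \<Rightarrow> real \<Rightarrow> real \<Rightarrow>
    (real ^ 'n \<Rightarrow> real) \<Rightarrow> (real ^ 'n \<Rightarrow> real) \<Rightarrow> (real ^ 'n \<Rightarrow> real) \<Rightarrow> bool" where
  "optimal_triplet s \<Omega> a L \<alpha> lo hi u p z \<longleftrightarrow>
     locally_optimal_control s \<Omega> a L \<alpha> lo hi z \<and>
     is_state s \<Omega> a z u \<and>
     is_adjoint_state s \<Omega> a L u p"

end

theory Submission
  imports Defs
begin

text \<open>
  The state and the adjoint state are bounded weak solutions of linear equations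
  \<open>(-\<Delta>)\<^sup>s u = f\<close> in \<open>\<Omega>\<close>, \<open>u = 0\<close> outside \<open>\<Omega>\<close>, with bounded \<open>f\<close>, and the optimal control is
  the pointwise projection of \<open>- p / \<alpha>\<close> onto \<open>[lo, hi]\<close>. So everything follows from three
  facts: bounded data give \<open>C\<^sup>s\<close> solutions (\<open>bounded_rhs_holder_regularity\<close>), the projection
  formula, which comes from the first-order condition (\<open>first_order_condition\<close>), and the
  Lipschitz continuity of the projection. For \<open>s < 1/2\<close> the kernel
  \<open>\<bar>z\<bar> powr (- n - 2 s)\<close> times a Lipschitz increment is integrable, so the fractional Laplacian of
  a bounded Lipschitz function is an absolutely convergent integral. This permits a direct proof
  of the regularity theorem, without potential theory or interior estimates.

  Comparison is the basic instrument. If \<open>\<phi> \<ge> 0\<close> has a large fractional Laplacian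
  wherever \<open>u > \<phi>\<close>, then testing with the positive part of \<open>u - \<phi>\<close> shows \<open>u \<le> \<phi>\<close>
  (\<open>energy_comparison\<close>). With \<open>\<phi>\<close> a multiple of the indicator of a large ball this bounds
  solutions (\<open>energy_sup_bound\<close>). The same indicator yields a Poincare inequality. With \<open>\<phi>\<close> a
  barrier attached to an exterior ball it yields \<open>\<bar>u x\<bar> \<le> M * \<bar>x - p\<bar> powr s\<close> at each boundary
  point \<open>p\<close> (\<open>energy_boundary_decay\<close>). The barrier starts from the profile
  \<open>(max 0 (x \<bullet> e)) powr s\<close>, which is \<open>s\<close>-harmonic in a half-space (\<open>flat_profile\<close>); replacing
  the plane by a sphere costs an error of lower order, and a strictly concave modification of the
  profile produces a gain that dominates this error (\<open>frac_lap_ball_barrier\<close>).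

  The boundary decay becomes a global Hoelder bound by doubling the variables
  (\<open>doubling_holder_estimate\<close>). A mollified solution satisfies the equation pointwise away from
  the boundary. At an interior maximum of \<open>\<phi> x - \<phi> y - M * \<bar>x - y\<bar> powr s\<close> the increments at \<open>x\<close>
  and at \<open>y\<close> are compared, those near \<open>\<plusminus> (x - y) / 2\<close> after a reflection;
  concavity of the power then bounds the difference of the two fractional Laplacians from below by
  a multiple of \<open>M * \<bar>x - y\<bar> powr (- s)\<close> (\<open>reflected_coupling_gain\<close>). This is impossible for
  large \<open>M\<close>, since both are bounded. The mollification parameter then tends to zero.

  The first-order condition needs states for the perturbed controls \<open>z + t (\<zeta> - z)\<close>. They exist by
  minimization of a convex energy with truncated nonlinearity (\<open>semilinear_solution_exists\<close>,
  \<open>weak_state_exists\<close>) and differ from the given state by \<open>O(t)\<close> in the supremum norm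
  (\<open>weak_state_stability\<close>), again by comparison. Expanding the cost to first order in \<open>t\<close> and
  using the adjoint equation gives the variational inequality.
\<close>

section \<open>Lebesgue measure\<close>

lemma lborel_distr_reflect:
  fixes c :: "'a::euclidean_space"
  shows "distr lborel borel (\<lambda>x. c - x) = lborel"
  by (subst lborel_affine[of "-1" c], auto simp: density_1)

lemma nn_integral_reflect:
  fixes c :: "'a::euclidean_space"
  assumes [measurable]: "f \<in> borel_measurable borel"
  shows "(\<integral>\<^sup>+x. f (c - x) \<partial>lborel) = (\<integral>\<^sup>+x. f x \<partial>lborel)"
proof -
  have "(\<integral>\<^sup>+x. f x \<partial>lborel) = (\<integral>\<^sup>+x. f x \<partial>distr lborel borel (\<lambda>x. c - x))"
    by (simp add: lborel_distr_reflect)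
  also have "\<dots> = (\<integral>\<^sup>+x. f (c - x) \<partial>lborel)" by (subst nn_integral_distr) auto
  finally show ?thesis by simp
qed

lemma nn_integral_shift:
  fixes c :: "'a::euclidean_space"
  assumes [measurable]: "f \<in> borel_measurable borel"
  shows "(\<integral>\<^sup>+x. f (c + x) \<partial>lborel) = (\<integral>\<^sup>+x. f x \<partial>lborel)"
proof -
  have "(\<integral>\<^sup>+x. f x \<partial>lborel) = (\<integral>\<^sup>+x. f x \<partial>distr lborel borel ((+) c))"
    by (simp add: lborel_distr_plus)
  also have "\<dots> = (\<integral>\<^sup>+x. f (c + x) \<partial>lborel)" by (subst nn_integral_distr) auto
  finally show ?thesis by simp
qed

lemma integral_reflect:
  fixes c :: "'a::euclidean_space" and f :: "'a \<Rightarrow> real"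
  assumes [measurable]: "f \<in> borel_measurable borel"
  shows "(\<integral>x. f (c - x) \<partial>lborel) = (\<integral>x. f x \<partial>lborel)"
    and "integrable lborel (\<lambda>x. f (c - x)) \<longleftrightarrow> integrable lborel f"
proof -
  have "(\<integral>x. f x \<partial>lborel) = (\<integral>x. f x \<partial>distr lborel borel (\<lambda>x. c - x))"
    by (simp add: lborel_distr_reflect)
  also have "\<dots> = (\<integral>x. f (c - x) \<partial>lborel)" by (subst integral_distr) auto
  finally show "(\<integral>x. f (c - x) \<partial>lborel) = (\<integral>x. f x \<partial>lborel)" by simp
  have "integrable lborel f \<longleftrightarrow> integrable (distr lborel borel (\<lambda>x. c - x)) f"
    by (simp add: lborel_distr_reflect)
  also have "\<dots> \<longleftrightarrow> integrable lborel (\<lambda>x. f (c - x))" by (subst integrable_distr_eq) auto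
  finally show "integrable lborel (\<lambda>x. f (c - x)) \<longleftrightarrow> integrable lborel f" by simp
qed

lemma integral_shift:
  fixes c :: "'a::euclidean_space" and f :: "'a \<Rightarrow> real"
  assumes [measurable]: "f \<in> borel_measurable borel"
  shows "(\<integral>x. f (c + x) \<partial>lborel) = (\<integral>x. f x \<partial>lborel)"
    and "integrable lborel (\<lambda>x. f (c + x)) \<longleftrightarrow> integrable lborel f"
proof -
  have "(\<integral>x. f x \<partial>lborel) = (\<integral>x. f x \<partial>distr lborel borel ((+) c))"
    by (simp add: lborel_distr_plus)
  also have "\<dots> = (\<integral>x. f (c + x) \<partial>lborel)" by (subst integral_distr) auto
  finally show "(\<integral>x. f (c + x) \<partial>lborel) = (\<integral>x. f x \<partial>lborel)" by simp
  have "integrable lborel f \<longleftrightarrow> integrable (distr lborel borel ((+) c)) f"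
    by (simp add: lborel_distr_plus)
  also have "\<dots> \<longleftrightarrow> integrable lborel (\<lambda>x. f (c + x))" by (subst integrable_distr_eq) auto
  finally show "integrable lborel (\<lambda>x. f (c + x)) \<longleftrightarrow> integrable lborel f" by simp
qed

lemma nn_integral_scale:
  fixes f :: "'a::euclidean_space \<Rightarrow> ennreal"
  assumes [measurable]: "f \<in> borel_measurable borel" and "0 < t"
  shows "(\<integral>\<^sup>+x. f x \<partial>lborel) = ennreal (t ^ DIM('a)) * (\<integral>\<^sup>+x. f (t *\<^sub>R x) \<partial>lborel)"
proof -
  have "(\<integral>\<^sup>+x. f x \<partial>lborel) =
      (\<integral>\<^sup>+x. f x \<partial>density (distr lborel borel (\<lambda>x. 0 + t *\<^sub>R x)) (\<lambda>_. \<bar>t\<bar>^DIM('a)))"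
    using assms lborel_affine[of t "0::'a"] by simp
  also have "\<dots> = (\<integral>\<^sup>+x. ennreal (t ^ DIM('a)) * f (t *\<^sub>R x) \<partial>lborel)"
    using assms by (subst nn_integral_density, simp, simp, subst nn_integral_distr) auto
  also have "\<dots> = ennreal (t ^ DIM('a)) * (\<integral>\<^sup>+x. f (t *\<^sub>R x) \<partial>lborel)"
    by (rule nn_integral_cmult) simp
  finally show ?thesis .
qed

lemma dyadic_interval:
  fixes x :: real
  assumes "1 \<le> x"
  obtains k :: nat where "2 ^ k \<le> x" "x < 2 ^ Suc k"
proof -
  define k where "k = (LEAST k. x < 2 ^ Suc k)"
  obtain m where "x < 2 ^ m" using real_arch_pow[of 2 x] by auto
  then have "x < 2 ^ Suc m" using assms by (simp add: less_le_trans)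
  then have "x < 2 ^ Suc k" unfolding k_def by (rule LeastI)
  moreover have "2 ^ k \<le> x"
  proof (cases k)
    case (Suc j)
    then have "\<not> x < 2 ^ Suc j" using not_less_Least[of j "\<lambda>k. x < 2 ^ Suc k"] unfolding k_def by auto
    then show ?thesis using Suc by simp
  qed (use assms in simp)
  ultimately show ?thesis using that by blast
qed

text \<open>
  A function bounded by \<open>c k\<close> on the part of its support assigned to the ball of radius \<open>r k\<close> is
  dominated by a series of multiples of indicators. Integrals of powers of the norm are
  estimated by this instead of polar coordinates.
\<close>

lemma nn_integral_dyadic_balls:
  fixes f :: "'a::euclidean_space \<Rightarrow> ennreal" and c r :: "nat \<Rightarrow> real"
  assumes le: "\<And>z. f z \<noteq> 0 \<Longrightarrow> \<exists>k. z \<in> ball 0 (r k) \<and> f z \<le> ennreal (c k)"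
    and r: "\<And>k. 0 \<le> r k" and c: "\<And>k. 0 \<le> c k"
    and sm: "summable (\<lambda>k. c k * r k ^ DIM('a))"
  shows "(\<integral>\<^sup>+z. f z \<partial>lborel) < \<infinity>"
proof -
  let ?V = "measure lborel (ball (0::'a) 1)"
  have ind: "(\<lambda>x. ennreal (c k) * indicator (ball (0::'a) (r k)) x) \<in> borel_measurable borel" for k
    using borel_open[OF open_ball, of "0::'a" "r k"] by measurable
  have em: "emeasure lborel (ball (0::'a) (r k)) = ennreal (r k ^ DIM('a) * ?V)" for k
    using content_ball_conv_unit_ball[OF r, of "0::'a" k] emeasure_lborel_ball_finite[of "0::'a" "r k"]
    by (simp add: emeasure_eq_ennreal_measure)
  have "(\<integral>\<^sup>+z. f z \<partial>lborel) \<le> (\<integral>\<^sup>+z. (\<Sum>k. ennreal (c k) * indicator (ball (0::'a) (r k)) z) \<partial>lborel)"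
  proof (rule nn_integral_mono)
    fix z :: 'a
    show "f z \<le> (\<Sum>k. ennreal (c k) * indicator (ball 0 (r k)) z)"
    proof (cases "f z = 0")
      case False
      then obtain k where k: "z \<in> ball 0 (r k)" "f z \<le> ennreal (c k)" using le by blast
      have "f z \<le> (\<Sum>k\<in>{k}. ennreal (c k) * indicator (ball 0 (r k)) z)" using k by simp
      also have "\<dots> \<le> (\<Sum>k. ennreal (c k) * indicator (ball 0 (r k)) z)"
        by (rule sum_le_suminf) auto
      finally show ?thesis .
    qed simp
  qed
  also have "\<dots> = (\<Sum>k. \<integral>\<^sup>+z. ennreal (c k) * indicator (ball (0::'a) (r k)) z \<partial>lborel)"
    by (rule nn_integral_suminf) (simp add: ind)
  also have "\<dots> = (\<Sum>k. ennreal (c k * r k ^ DIM('a) * ?V))"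
    using c r by (intro suminf_cong) (simp add: nn_integral_cmult_indicator em ennreal_mult' mult.assoc)
  also have "\<dots> < \<infinity>"
    using summable_mult2[OF sm, of ?V] c r
    by (subst suminf_ennreal2) (auto intro!: mult_nonneg_nonneg)
  finally show ?thesis .
qed

lemma nn_integral_powr_at_infinity:
  assumes "0 < b"
  shows "(\<integral>\<^sup>+z. ennreal (if norm (z::'a::euclidean_space) < 1 then 0 else norm z powr (- b - real DIM('a))) \<partial>lborel) < \<infinity>"
proof (rule nn_integral_dyadic_balls[where r = "\<lambda>k. 2 ^ Suc k" and c = "\<lambda>k. (2 ^ k) powr (- b - real DIM('a))"])
  fix z :: 'a
  assume "ennreal (if norm z < 1 then 0 else norm z powr (- b - real DIM('a))) \<noteq> 0"
  then have z: "1 \<le> norm z" by (auto split: if_splits)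
  from dyadic_interval[OF this] obtain k where k: "2 ^ k \<le> norm z" "norm z < 2 ^ Suc k" .
  have "norm z powr (- b - real DIM('a)) \<le> (2 ^ k) powr (- b - real DIM('a))"
    using k assms by (intro powr_mono2') (auto simp: add_nonneg_nonneg)
  then show "\<exists>k. z \<in> ball 0 (2 ^ Suc k) \<and>
      ennreal (if norm z < 1 then 0 else norm z powr (- b - real DIM('a))) \<le> ennreal ((2 ^ k) powr (- b - real DIM('a)))"
    using k z by (intro exI[of _ k]) (auto intro!: ennreal_leI)
next
  let ?q = "2 powr - b :: real"
  have "(2 ^ k :: real) powr (- b - real DIM('a)) * (2 ^ Suc k) ^ DIM('a) = 2 ^ DIM('a) * ?q ^ k" for k
  proof -
    have "(2 ^ k :: real) powr (- b - real DIM('a)) = (2 ^ k) powr (- b) / (2 ^ k) ^ DIM('a)"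
      by (simp add: powr_diff powr_realpow)
    moreover have "(2 ^ k :: real) powr (- b) = ?q ^ k"
      by (simp add: powr_realpow[symmetric] powr_powr mult.commute)
    ultimately show ?thesis by (simp add: power_mult_distrib field_simps)
  qed
  moreover have "summable (\<lambda>k. 2 ^ DIM('a) * ?q ^ k)"
    using assms by (intro summable_mult summable_geometric) (simp add: powr_less_one)
  ultimately show "summable (\<lambda>k. (2 ^ k :: real) powr (- b - real DIM('a)) * (2 ^ Suc k) ^ DIM('a))"
    by (simp only:)
qed auto

text \<open>
  On the shell \<open>2\<^sup>-\<^sup>k\<^sup>-\<^sup>1 < \<bar>z\<bar> \<le> 2\<^sup>-\<^sup>k\<close> the factor \<open>\<bar>z\<bar> powr a\<close> is estimated from the outer radius
  and the factor \<open>\<bar>z\<bar> powr (- n)\<close> from the inner one, because the sign of \<open>a - n\<close> is not known.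
\<close>

lemma nn_integral_powr_at_zero:
  assumes "0 < a"
  shows "(\<integral>\<^sup>+z. ennreal (if norm (z::'a::euclidean_space) < 1 then norm z powr (a - real DIM('a)) else 0) \<partial>lborel) < \<infinity>"
proof (rule nn_integral_dyadic_balls[where r = "\<lambda>k. 2 * (1/2) ^ k"
      and c = "\<lambda>k. (2 * (1/2) ^ k) powr a * (2 ^ Suc k) ^ DIM('a)"])
  fix z :: 'a
  assume "ennreal (if norm z < 1 then norm z powr (a - real DIM('a)) else 0) \<noteq> 0"
  then have z: "norm z < 1" "z \<noteq> 0" by (auto split: if_splits)
  then have "1 \<le> 1 / norm z" by simp
  from dyadic_interval[OF this] obtain k where k: "2 ^ k \<le> 1 / norm z" "1 / norm z < 2 ^ Suc k" .
  have k1: "norm z \<le> (1/2) ^ k" using k z by (simp add: field_simps power_one_over)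
  have "norm z powr (a - real DIM('a)) = norm z powr a * (1 / norm z) ^ DIM('a)"
    using z by (simp add: powr_diff powr_realpow power_one_over field_simps)
  also have "\<dots> \<le> (2 * (1/2) ^ k) powr a * (2 ^ Suc k) ^ DIM('a)"
    using k k1 z assms by (intro mult_mono power_mono powr_mono2) (auto intro: order_trans)
  finally have "norm z powr (a - real DIM('a)) \<le> (2 * (1/2) ^ k) powr a * (2 ^ Suc k) ^ DIM('a)" .
  moreover have "norm z < 2 * (1/2) ^ k"
    using k1 by (rule order.strict_trans1) simp
  ultimately show "\<exists>k. z \<in> ball 0 (2 * (1/2) ^ k) \<and>
      ennreal (if norm z < 1 then norm z powr (a - real DIM('a)) else 0) \<le> ennreal ((2 * (1/2) ^ k) powr a * (2 ^ Suc k) ^ DIM('a))"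
    using z by (intro exI[of _ k]) (auto intro!: ennreal_leI)
next
  let ?q = "2 powr - a :: real"
  have "(2 * (1/2) ^ k) powr a * (2 ^ Suc k) ^ DIM('a) * (2 * (1/2) ^ k) ^ DIM('a)
      = 2 powr a * 4 ^ DIM('a) * ?q ^ k" for k
  proof -
    have "(2 * (1/2) ^ k) powr a = 2 powr a * ?q ^ k"
      by (simp add: powr_mult powr_realpow[symmetric] powr_powr mult.commute power_one_over powr_divide powr_minus_divide)
    moreover have "(2 ^ Suc k) ^ DIM('a) * (2 * (1/2) ^ k) ^ DIM('a) = (4::real) ^ DIM('a)"
    proof -
      have "2 ^ Suc k * (2 * (1/2) ^ k) = (4::real)" by (simp add: power_one_over)
      then show ?thesis by (metis power_mult_distrib)
    qed
    ultimately show ?thesis by (simp add: field_simps)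
  qed
  moreover have "summable (\<lambda>k. 2 powr a * 4 ^ DIM('a) * ?q ^ k)"
    using assms by (intro summable_mult summable_geometric) (simp add: powr_less_one)
  ultimately show "summable (\<lambda>k. (2 * (1/2) ^ k) powr a * (2 ^ Suc k) ^ DIM('a) * (2 * (1/2) ^ k :: real) ^ DIM('a))"
    by (simp only:)
qed auto

text \<open>
  The common majorant of the singular integrands of this theory: \<open>a\<close> is the margin of
  integrability at the origin and \<open>b\<close> the margin at infinity.
\<close>

definition two_sided_powr :: "real \<Rightarrow> real \<Rightarrow> 'a::euclidean_space \<Rightarrow> real" where
  "two_sided_powr a b z =
     (if norm z < 1 then norm z powr (a - real DIM('a)) else norm z powr (- b - real DIM('a)))"

lemma two_sided_powr_nonneg [simp]: "0 \<le> two_sided_powr a b z"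
  by (simp add: two_sided_powr_def)

lemma two_sided_powr_measurable [measurable]:
  "(two_sided_powr a b :: 'a::euclidean_space \<Rightarrow> real) \<in> borel_measurable borel"
  unfolding two_sided_powr_def by measurable

lemma integrable_two_sided_powr:
  assumes "0 < a" "0 < b"
  shows "integrable lborel (two_sided_powr a b :: 'a::euclidean_space \<Rightarrow> real)"
proof (rule integrableI_bounded)
  have "(\<integral>\<^sup>+z. ennreal (norm (two_sided_powr a b (z::'a))) \<partial>lborel) =
     (\<integral>\<^sup>+z. ennreal (if norm (z::'a) < 1 then norm z powr (a - real DIM('a)) else 0) +
         ennreal (if norm z < 1 then 0 else norm z powr (- b - real DIM('a))) \<partial>lborel)"
    by (intro nn_integral_cong) (simp add: two_sided_powr_def)
  also have "\<dots> < \<infinity>"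
    using nn_integral_powr_at_zero[OF assms(1), where 'a='a] nn_integral_powr_at_infinity[OF assms(2), where 'a='a]
    by (subst nn_integral_add) auto
  finally show "(\<integral>\<^sup>+z. ennreal (norm (two_sided_powr a b (z::'a))) \<partial>lborel) < \<infinity>" .
qed simp

section \<open>The kernel and the energy form\<close>

definition frac_kernel :: "real \<Rightarrow> real ^ 'n \<Rightarrow> real" where
  "frac_kernel s z = 1 / norm z powr (real CARD('n) + 2 * s)"

lemma frac_kernel_measurable [measurable]: "frac_kernel s \<in> borel_measurable borel"
  unfolding frac_kernel_def by measurable

lemma frac_kernel_nonneg [simp]: "0 \<le> frac_kernel s z"
  by (simp add: frac_kernel_def)

lemma frac_kernel_minus [simp]: "frac_kernel s (- z) = frac_kernel s z"
  by (simp add: frac_kernel_def)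

lemma frac_kernel_commute: "frac_kernel s (x - y) = frac_kernel s (y - x)"
  by (simp add: frac_kernel_def norm_minus_commute)

lemma frac_kernel_powr: "frac_kernel s (z :: real ^ 'n) = norm z powr (- 2 * s - real CARD('n))"
proof -
  have "- 2 * s - real CARD('n) = - (real CARD('n) + 2 * s)" by simp
  then show ?thesis unfolding frac_kernel_def by (metis powr_minus_divide)
qed

lemma frac_kernel_antimono:
  assumes "0 < s" "z \<noteq> 0" "norm z \<le> r"
  shows "r powr (- 2 * s - real CARD('n)) \<le> frac_kernel s (z :: real ^ 'n)"
  unfolding frac_kernel_powr using assms by (intro powr_mono2') auto

text \<open>
  The Gagliardo form without its normalising constant, for Borel functions. On the Borel product,
  reflections, translations and Tonelli's theorem apply without completion of the measures;
  Lebesgue measurable functions enter only through Borel representatives.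
\<close>

definition energy_form :: "real \<Rightarrow> (real ^ 'n \<Rightarrow> real) \<Rightarrow> (real ^ 'n \<Rightarrow> real) \<Rightarrow> real" where
  "energy_form s v w =
     (\<integral>(x, y). (v x - v y) * (w x - w y) * frac_kernel s (x - y) \<partial>(lborel \<Otimes>\<^sub>M lborel))"

definition finite_energy :: "real \<Rightarrow> (real ^ 'n \<Rightarrow> real) \<Rightarrow> bool" where
  "finite_energy s v \<longleftrightarrow>
     integrable (lborel \<Otimes>\<^sub>M lborel) (\<lambda>(x, y). (v x - v y)\<^sup>2 * frac_kernel s (x - y))"

text \<open>
  A positive multiple of the fractional Laplacian of order \<open>s\<close>. For \<open>s < 1/2\<close> the singularity is
  integrable at points where \<open>\<phi>\<close> is Lipschitz, so there is no principal value.
\<close>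

definition frac_lap :: "real \<Rightarrow> (real ^ 'n \<Rightarrow> real) \<Rightarrow> real ^ 'n \<Rightarrow> real" where
  "frac_lap s \<phi> x = (\<integral>y. (\<phi> x - \<phi> y) * frac_kernel s (x - y) \<partial>lborel)"

text \<open>
  A bound on this integral is the form in which absolute convergence of the fractional Laplacian
  is carried through the theory.
\<close>

definition abs_lap :: "real \<Rightarrow> (real ^ 'n \<Rightarrow> real) \<Rightarrow> real ^ 'n \<Rightarrow> ennreal" where
  "abs_lap s \<phi> x = (\<integral>\<^sup>+y. ennreal (\<bar>\<phi> x - \<phi> y\<bar> * frac_kernel s (x - y)) \<partial>lborel)"

lemma energy_form_commute: "energy_form s v w = energy_form s w v"
  unfolding energy_form_def by (simp add: mult.commute)

lemma finite_energy_integrable: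
  assumes [measurable]: "v \<in> borel_measurable borel" "w \<in> borel_measurable borel"
    and "finite_energy s v" "finite_energy s w"
  shows "integrable (lborel \<Otimes>\<^sub>M lborel) (\<lambda>(x, y). (v x - v y) * (w x - w y) * frac_kernel s (x - y))"
proof (rule Bochner_Integration.integrable_bound)
  show "integrable (lborel \<Otimes>\<^sub>M lborel) (\<lambda>z. (\<lambda>(x, y). (v x - v y)\<^sup>2 * frac_kernel s (x - y)) z
      + (\<lambda>(x, y). (w x - w y)\<^sup>2 * frac_kernel s (x - y)) z)"
    using assms unfolding finite_energy_def by (intro Bochner_Integration.integrable_add)
  have *: "\<bar>a * b\<bar> \<le> a\<^sup>2 + b\<^sup>2" for a b :: real
  proof -
    have "0 \<le> (\<bar>a\<bar> - \<bar>b\<bar>)\<^sup>2" "0 \<le> \<bar>a\<bar> * \<bar>b\<bar>" by auto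
    moreover have "(\<bar>a\<bar> - \<bar>b\<bar>)\<^sup>2 = a\<^sup>2 + b\<^sup>2 - 2 * (\<bar>a\<bar> * \<bar>b\<bar>)" by (simp add: power2_diff)
    ultimately show ?thesis unfolding abs_mult by linarith
  qed
  have "\<bar>a * b * k\<bar> \<le> a\<^sup>2 * k + b\<^sup>2 * k" if "0 \<le> k" for a b k :: real
    using mult_right_mono[OF * that, of a b] that by (simp add: abs_mult algebra_simps)
  then show "AE z in lborel \<Otimes>\<^sub>M lborel. norm ((\<lambda>(x, y). (v x - v y) * (w x - w y) * frac_kernel s (x - y)) z)
     \<le> norm ((\<lambda>(x, y). (v x - v y)\<^sup>2 * frac_kernel s (x - y)) z
      + (\<lambda>(x, y). (w x - w y)\<^sup>2 * frac_kernel s (x - y)) z)"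
    by (intro AE_I2) (auto simp: split_beta)
qed measurable

text \<open>
  The bound on \<open>abs_lap\<close> makes \<open>v x * (\<phi> x - \<phi> y)\<close> times the kernel integrable on the product space.
  By symmetry of the kernel the form is this integral plus the one with the variables exchanged,
  and Fubini's theorem applies to each.
\<close>

lemma energy_form_by_parts:
  fixes \<phi> v :: "real ^ 'n \<Rightarrow> real"
  assumes [measurable]: "\<phi> \<in> borel_measurable borel" "v \<in> borel_measurable borel"
    and v: "integrable lborel v"
    and B: "AE x in lborel. v x \<noteq> 0 \<longrightarrow> abs_lap s \<phi> x \<le> ennreal B"
  shows "integrable (lborel \<Otimes>\<^sub>M lborel) (\<lambda>(x, y). (\<phi> x - \<phi> y) * (v x - v y) * frac_kernel s (x - y))"
    and "energy_form s \<phi> v = 2 * (\<integral>x. v x * frac_lap s \<phi> x \<partial>lborel)"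
    and "integrable lborel (\<lambda>x. v x * frac_lap s \<phi> x)"
proof -
  define h where "h = (\<lambda>(x, y). v x * ((\<phi> x - \<phi> y) * frac_kernel s (x - y)))"
  have hm [measurable]: "h \<in> borel_measurable (lborel \<Otimes>\<^sub>M lborel)" unfolding h_def by measurable
  have hi: "integrable (lborel \<Otimes>\<^sub>M lborel) h"
  proof (rule integrableI_bounded)
    have "(\<integral>\<^sup>+z. ennreal (norm (h z)) \<partial>(lborel \<Otimes>\<^sub>M lborel)) = (\<integral>\<^sup>+x. \<integral>\<^sup>+y. ennreal (norm (h (x, y))) \<partial>lborel \<partial>lborel)"
      by (rule lborel.nn_integral_fst[symmetric]) measurable
    also have "\<dots> = (\<integral>\<^sup>+x. ennreal \<bar>v x\<bar> * abs_lap s \<phi> x \<partial>lborel)"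
    proof (rule nn_integral_cong)
      fix x
      have "(\<integral>\<^sup>+y. ennreal (norm (h (x, y))) \<partial>lborel) =
          (\<integral>\<^sup>+y. ennreal \<bar>v x\<bar> * ennreal (\<bar>\<phi> x - \<phi> y\<bar> * frac_kernel s (x - y)) \<partial>lborel)"
        by (intro nn_integral_cong) (simp add: h_def abs_mult ennreal_mult[symmetric])
      also have "\<dots> = ennreal \<bar>v x\<bar> * abs_lap s \<phi> x"
        unfolding abs_lap_def by (rule nn_integral_cmult) measurable
      finally show "(\<integral>\<^sup>+y. ennreal (norm (h (x, y))) \<partial>lborel) = ennreal \<bar>v x\<bar> * abs_lap s \<phi> x" .
    qed
    also have "\<dots> \<le> (\<integral>\<^sup>+x. ennreal B * ennreal (norm (v x)) \<partial>lborel)"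
    proof (rule nn_integral_mono_AE)
      show "AE x in lborel. ennreal \<bar>v x\<bar> * abs_lap s \<phi> x \<le> ennreal B * ennreal (norm (v x))"
        using B
      proof eventually_elim
        case (elim x)
        then show ?case
          using mult_left_mono[of "abs_lap s \<phi> x" "ennreal B" "ennreal \<bar>v x\<bar>"]
          by (cases "v x = 0") (simp_all add: mult.commute)
      qed
    qed
    also have "\<dots> = ennreal B * (\<integral>\<^sup>+x. ennreal (norm (v x)) \<partial>lborel)"
      by (rule nn_integral_cmult) measurable
    also have "\<dots> < \<infinity>"
      using v by (simp add: integrable_iff_bounded ennreal_mult_less_top)
    finally show "(\<integral>\<^sup>+z. ennreal (norm (h z)) \<partial>(lborel \<Otimes>\<^sub>M lborel)) < \<infinity>" .
  qed measurable
  have hs: "integrable (lborel \<Otimes>\<^sub>M lborel) (\<lambda>(x, y). h (y, x))"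
    by (rule lborel_pair.integrable_product_swap[OF hi])
  have eq: "(\<lambda>(x, y). (\<phi> x - \<phi> y) * (v x - v y) * frac_kernel s (x - y)) = (\<lambda>z. h z + (\<lambda>(x, y). h (y, x)) z)"
    by (auto simp: h_def fun_eq_iff frac_kernel_commute[of s] algebra_simps)
  show "integrable (lborel \<Otimes>\<^sub>M lborel) (\<lambda>(x, y). (\<phi> x - \<phi> y) * (v x - v y) * frac_kernel s (x - y))"
    unfolding eq by (intro Bochner_Integration.integrable_add hi hs)
  have inner: "(\<integral>y. h (x, y) \<partial>lborel) = v x * frac_lap s \<phi> x" for x
    by (simp add: h_def frac_lap_def)
  have "energy_form s \<phi> v = integral\<^sup>L (lborel \<Otimes>\<^sub>M lborel) h + integral\<^sup>L (lborel \<Otimes>\<^sub>M lborel) (\<lambda>(x, y). h (y, x))"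
    unfolding energy_form_def eq by (intro Bochner_Integration.integral_add hi hs)
  also have "integral\<^sup>L (lborel \<Otimes>\<^sub>M lborel) (\<lambda>(x, y). h (y, x)) = integral\<^sup>L (lborel \<Otimes>\<^sub>M lborel) h"
    by (rule lborel_pair.integral_product_swap) measurable
  also have "integral\<^sup>L (lborel \<Otimes>\<^sub>M lborel) h = (\<integral>x. \<integral>y. h (x, y) \<partial>lborel \<partial>lborel)"
    by (rule lborel_pair.integral_fst'[OF hi, symmetric])
  finally show "energy_form s \<phi> v = 2 * (\<integral>x. v x * frac_lap s \<phi> x \<partial>lborel)"
    by (simp add: inner)
  show "integrable lborel (\<lambda>x. v x * frac_lap s \<phi> x)"
    using lborel_pair.integrable_fst'[OF hi] by (simp add: inner)
qed

section \<open>The energy space and the comparison principle\<close>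

text \<open>For \<open>K = closure \<Omega>\<close> these are the Borel representatives of the elements of \<open>Hs_tilde s \<Omega>\<close>.\<close>

definition energy_space :: "real \<Rightarrow> (real ^ 'n) set \<Rightarrow> (real ^ 'n \<Rightarrow> real) set" where
  "energy_space s K = {v \<in> borel_measurable borel. integrable lborel (\<lambda>x. (v x)\<^sup>2) \<and>
     finite_energy s v \<and> (AE x in lborel. x \<notin> K \<longrightarrow> v x = 0)}"

lemma energy_spaceD:
  assumes "v \<in> energy_space s K"
  shows "v \<in> borel_measurable borel" "integrable lborel (\<lambda>x. (v x)\<^sup>2)" "finite_energy s v"
    "AE x in lborel. x \<notin> K \<longrightarrow> v x = 0"
  using assms by (auto simp: energy_space_def)

lemma energy_space_integrable:
  assumes v: "v \<in> energy_space s K" and K: "bounded K"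
  shows "integrable lborel v"
proof -
  note [measurable] = energy_spaceD(1)[OF v]
  obtain R where R: "\<And>x. x \<in> K \<Longrightarrow> norm x \<le> R" using K unfolding bounded_iff by blast
  show ?thesis
  proof (rule Bochner_Integration.integrable_bound)
    show "integrable lborel (\<lambda>x. indicator (cball 0 R) x + (v x)\<^sup>2 :: real)"
      using energy_spaceD(2)[OF v] emeasure_lborel_cball_finite[of "0" R]
      by (intro Bochner_Integration.integrable_add integrable_real_indicator) auto
    have *: "\<bar>t\<bar> \<le> 1 + t\<^sup>2" for t :: real
    proof -
      have "0 \<le> (\<bar>t\<bar> - 1)\<^sup>2" by simp
      moreover have "(\<bar>t\<bar> - 1)\<^sup>2 = t\<^sup>2 - 2 * \<bar>t\<bar> + 1" by (simp add: power2_diff)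
      ultimately show ?thesis using zero_le_power2[of t] by linarith
    qed
    show "AE x in lborel. norm (v x) \<le> norm (indicator (cball 0 R) x + (v x)\<^sup>2 :: real)"
    proof (rule AE_mp[OF energy_spaceD(4)[OF v]], rule AE_I2, rule impI)
      fix x assume x: "x \<notin> K \<longrightarrow> v x = 0"
      show "norm (v x) \<le> norm (indicator (cball 0 R) x + (v x)\<^sup>2 :: real)"
      proof (cases "x \<in> K")
        case True
        then have "indicator (cball 0 R) x = (1::real)" using R by (simp add: indicator_def)
        then show ?thesis using *[of "v x"] by simp
      qed (use x in simp)
    qed
  qed measurable
qed

lemma finite_energy_scale: "finite_energy s v \<Longrightarrow> finite_energy s (\<lambda>x. c * v x)"
proof -
  assume "finite_energy s v"
  then have "integrable (lborel \<Otimes>\<^sub>M lborel) (\<lambda>z. c\<^sup>2 * (\<lambda>(x, y). (v x - v y)\<^sup>2 * frac_kernel s (x - y)) z)"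
    unfolding finite_energy_def by (rule integrable_mult_right)
  moreover have "(\<lambda>z. c\<^sup>2 * (\<lambda>(x, y). (v x - v y)\<^sup>2 * frac_kernel s (x - y)) z)
     = (\<lambda>(x, y). (c * v x - c * v y)\<^sup>2 * frac_kernel s (x - y))"
    by (auto simp: fun_eq_iff power_mult_distrib right_diff_distrib[symmetric])
  ultimately show ?thesis unfolding finite_energy_def by simp
qed

lemma finite_energy_add:
  assumes [measurable]: "v \<in> borel_measurable borel" "w \<in> borel_measurable borel"
    and "finite_energy s v" "finite_energy s w"
  shows "finite_energy s (\<lambda>x. v x + w x)"
  unfolding finite_energy_def
proof (rule Bochner_Integration.integrable_bound)
  show "integrable (lborel \<Otimes>\<^sub>M lborel) (\<lambda>z. 2 * (\<lambda>(x, y). (v x - v y)\<^sup>2 * frac_kernel s (x - y)) z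
      + 2 * (\<lambda>(x, y). (w x - w y)\<^sup>2 * frac_kernel s (x - y)) z)"
    using assms unfolding finite_energy_def
    by (intro Bochner_Integration.integrable_add integrable_mult_right)
  have *: "(a + b)\<^sup>2 \<le> 2 * a\<^sup>2 + 2 * b\<^sup>2" for a b :: real
    using zero_le_power2[of "a - b"] by (simp add: power2_eq_square algebra_simps)
  have "(v x + w x - (v y + w y))\<^sup>2 * frac_kernel s (x - y) \<le> 2 * ((v x - v y)\<^sup>2 * frac_kernel s (x - y))
     + 2 * ((w x - w y)\<^sup>2 * frac_kernel s (x - y))" for x y
    using mult_right_mono[OF *, of "frac_kernel s (x - y)" "v x - v y" "w x - w y"] by (simp add: algebra_simps)
  then show "AE z in lborel \<Otimes>\<^sub>M lborel.
     norm ((\<lambda>(x, y). (v x + w x - (v y + w y))\<^sup>2 * frac_kernel s (x - y)) z)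
     \<le> norm (2 * (\<lambda>(x, y). (v x - v y)\<^sup>2 * frac_kernel s (x - y)) z
      + 2 * (\<lambda>(x, y). (w x - w y)\<^sup>2 * frac_kernel s (x - y)) z)"
    by (intro AE_I2) (auto simp: split_beta intro!: order_trans[OF _ abs_ge_self])
qed measurable

lemma energy_space_scale: "v \<in> energy_space s K \<Longrightarrow> (\<lambda>x. c * v x) \<in> energy_space s K"
  by (auto simp: energy_space_def power_mult_distrib intro!: finite_energy_scale)

lemma energy_space_add:
  assumes v: "v \<in> energy_space s K" and w: "w \<in> energy_space s K"
  shows "(\<lambda>x. v x + w x) \<in> energy_space s K"
proof -
  note [measurable] = energy_spaceD(1)[OF v] energy_spaceD(1)[OF w]
  have "integrable lborel (\<lambda>x. (v x + w x)\<^sup>2)"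
  proof (rule Bochner_Integration.integrable_bound)
    show "integrable lborel (\<lambda>x. 2 * (v x)\<^sup>2 + 2 * (w x)\<^sup>2)"
      using energy_spaceD(2)[OF v] energy_spaceD(2)[OF w] by simp
    have *: "(a + b)\<^sup>2 \<le> 2 * a\<^sup>2 + 2 * b\<^sup>2" for a b :: real
      using zero_le_power2[of "a - b"] by (simp add: power2_eq_square algebra_simps)
    show "AE x in lborel. norm ((v x + w x)\<^sup>2) \<le> norm (2 * (v x)\<^sup>2 + 2 * (w x)\<^sup>2)"
      using * by (intro AE_I2) simp
  qed measurable
  moreover have "AE x in lborel. x \<notin> K \<longrightarrow> v x + w x = 0"
    using energy_spaceD(4)[OF v] energy_spaceD(4)[OF w] by eventually_elim auto
  ultimately show ?thesis
    using finite_energy_add[OF energy_spaceD(1)[OF v] energy_spaceD(1)[OF w] energy_spaceD(3)[OF v] energy_spaceD(3)[OF w]]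
    by (auto simp: energy_space_def)
qed

lemma energy_space_diff:
  assumes "v \<in> energy_space s K" and "w \<in> energy_space s K"
  shows "(\<lambda>x. v x - w x) \<in> energy_space s K"
  using energy_space_add[OF assms(1) energy_space_scale[OF assms(2), of "-1"]] by simp

lemma energy_form_add:
  assumes "u \<in> energy_space s K" "v \<in> energy_space s K" "w \<in> energy_space s K"
  shows "energy_form s (\<lambda>x. u x + v x) w = energy_form s u w + energy_form s v w"
proof -
  have eq: "(\<lambda>(x, y). (u x + v x - (u y + v y)) * (w x - w y) * frac_kernel s (x - y)) =
    (\<lambda>z. (\<lambda>(x, y). (u x - u y) * (w x - w y) * frac_kernel s (x - y)) z +
         (\<lambda>(x, y). (v x - v y) * (w x - w y) * frac_kernel s (x - y)) z)"
    by (auto simp: fun_eq_iff algebra_simps)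
  show ?thesis
    unfolding energy_form_def eq
    by (intro Bochner_Integration.integral_add finite_energy_integrable energy_spaceD[OF assms(1)]
        energy_spaceD[OF assms(2)] energy_spaceD[OF assms(3)])
qed

lemma energy_form_scale: "energy_form s (\<lambda>x. c * v x) w = c * energy_form s v w"
proof -
  have eq: "(\<lambda>(x, y). (c * v x - c * v y) * (w x - w y) * frac_kernel s (x - y)) =
    (\<lambda>z. c * (\<lambda>(x, y). (v x - v y) * (w x - w y) * frac_kernel s (x - y)) z)"
    by (auto simp: fun_eq_iff algebra_simps)
  show ?thesis unfolding energy_form_def eq by (rule integral_mult_right_zero)
qed

lemma energy_form_diff:
  assumes "u \<in> energy_space s K" "v \<in> energy_space s K" "w \<in> energy_space s K"
  shows "energy_form s (\<lambda>x. u x - v x) w = energy_form s u w - energy_form s v w"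
  using energy_form_add[OF assms(1) energy_space_scale[OF assms(2), of "-1"] assms(3)]
    energy_form_scale[of s "-1" v w] by simp

lemma AE_lborel_pair:
  fixes P :: "'a::euclidean_space \<Rightarrow> bool"
  assumes "AE x in lborel. P x"
  shows "AE z in lborel \<Otimes>\<^sub>M (lborel :: 'b::euclidean_space measure). P (fst z)"
    and "AE z in (lborel :: 'b::euclidean_space measure) \<Otimes>\<^sub>M lborel. P (snd z)"
proof -
  obtain N where N': "\<And>x. x \<in> space lborel - N \<Longrightarrow> P x" "N \<in> null_sets lborel"
    using AE_E3[OF assms] by blast
  then have N: "{x. \<not> P x} \<subseteq> N" "N \<in> sets lborel" "emeasure lborel N = 0" by auto
  have "N \<times> UNIV \<in> null_sets (lborel \<Otimes>\<^sub>M (lborel :: 'b measure))"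
    using N by (intro null_setsI) (simp_all add: lborel.emeasure_pair_measure_Times)
  then show "AE z in lborel \<Otimes>\<^sub>M (lborel :: 'b measure). P (fst z)"
    using N by (intro AE_I'[of "N \<times> UNIV"]) auto
  have "UNIV \<times> N \<in> null_sets ((lborel :: 'b measure) \<Otimes>\<^sub>M lborel)"
    using N by (intro null_setsI) (simp_all add: lborel.emeasure_pair_measure_Times)
  then show "AE z in (lborel :: 'b measure) \<Otimes>\<^sub>M lborel. P (snd z)"
    using N by (intro AE_I'[of "UNIV \<times> N"]) auto
qed

text \<open>
  The test function is \<open>v = max 0 (u - \<phi>)\<close>. Since \<open>t \<mapsto> max 0 t\<close> is nondecreasing, the increments of
  \<open>u - \<phi>\<close> and of \<open>v\<close> have the same sign, hence the form of \<open>\<phi>\<close> with \<open>v\<close> is at most that of \<open>u\<close>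
  with \<open>v\<close>. The former equals \<open>2 \<integral> v * frac_lap s \<phi>\<close>, which is at least \<open>2 \<Lambda> \<integral> v\<close>, the latter is at
  most \<open>C \<integral> v\<close>, so \<open>\<integral> v = 0\<close>. The barrier \<open>\<phi>\<close> need not have finite energy; that \<open>v\<close> has is part of
  the proof, and is therefore available when the last hypothesis is to be verified.
\<close>

lemma energy_comparison:
  fixes u \<phi> :: "real ^ 'n \<Rightarrow> real"
  assumes u: "u \<in> energy_space s K" and K: "bounded K"
    and [measurable]: "\<phi> \<in> borel_measurable borel" and \<phi>0: "\<And>x. 0 \<le> \<phi> x"
    and B: "AE x in lborel. \<phi> x < u x \<longrightarrow> abs_lap s \<phi> x \<le> ennreal B"
    and L: "AE x in lborel. \<phi> x < u x \<longrightarrow> \<Lambda> \<le> frac_lap s \<phi> x"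
    and E: "(\<lambda>x. max 0 (u x - \<phi> x)) \<in> energy_space s K \<Longrightarrow>
       energy_form s u (\<lambda>x. max 0 (u x - \<phi> x)) \<le> C * (\<integral>x. max 0 (u x - \<phi> x) \<partial>lborel)"
    and C: "C < 2 * \<Lambda>"
  shows "AE x in lborel. u x \<le> \<phi> x"
proof -
  note [measurable] = energy_spaceD(1)[OF u]
  define v where "v = (\<lambda>x. max 0 (u x - \<phi> x))"
  have [measurable]: "v \<in> borel_measurable borel" unfolding v_def by measurable
  have v_le: "\<bar>v x\<bar> \<le> \<bar>u x\<bar>" "0 \<le> v x" for x using \<phi>0[of x] by (auto simp: v_def)
  have vi: "integrable lborel v"
    by (rule Bochner_Integration.integrable_bound[OF energy_space_integrable[OF u K]]) (use v_le in auto)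
  have vB: "AE x in lborel. v x \<noteq> 0 \<longrightarrow> abs_lap s \<phi> x \<le> ennreal B"
    using B by eventually_elim (auto simp: v_def)
  note parts = energy_form_by_parts[OF \<open>\<phi> \<in> _\<close> \<open>v \<in> _\<close> vi vB]
  \<comment> \<open>This pointwise bound gives \<open>v\<close> finite energy although \<open>\<phi>\<close> may have none.\<close>
  have key: "(v x - v y)\<^sup>2 * frac_kernel s (x - y) \<le>
      (u x - u y)\<^sup>2 * frac_kernel s (x - y) + 2 * \<bar>(\<phi> x - \<phi> y) * (v x - v y) * frac_kernel s (x - y)\<bar>" for x y
  proof -
    have a: "(v x - v y)\<^sup>2 \<le> ((u x - \<phi> x) - (u y - \<phi> y)) * (v x - v y)"
    proof -
      define p q where "p = u x - \<phi> x" and "q = u y - \<phi> y"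
      have "(max 0 p - max 0 q)\<^sup>2 \<le> (p - q) * (max 0 p - max 0 q)"
        by (cases "p \<le> 0"; cases "q \<le> 0")
          (auto simp: max_def power2_eq_square mult_le_0_iff algebra_simps mult_nonneg_nonpos mult_nonpos_nonneg)
      then show ?thesis by (simp add: v_def p_def q_def)
    qed
    have b: "2 * ((u x - u y) * (v x - v y)) \<le> (u x - u y)\<^sup>2 + (v x - v y)\<^sup>2"
      using zero_le_power2[of "(u x - u y) - (v x - v y)"] by (simp add: power2_eq_square algebra_simps)
    have "(v x - v y)\<^sup>2 \<le> (u x - u y)\<^sup>2 + 2 * \<bar>(\<phi> x - \<phi> y) * (v x - v y)\<bar>"
    proof -
      have "((u x - \<phi> x) - (u y - \<phi> y)) * (v x - v y) = (u x - u y) * (v x - v y) - (\<phi> x - \<phi> y) * (v x - v y)"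
        by (simp add: algebra_simps)
      then show ?thesis using a b abs_ge_minus_self[of "(\<phi> x - \<phi> y) * (v x - v y)"] by linarith
    qed
    from mult_right_mono[OF this frac_kernel_nonneg[of s "x - y"]]
    show ?thesis unfolding abs_mult[of _ "frac_kernel s (x - y)"] abs_of_nonneg[OF frac_kernel_nonneg]
      by (simp only: distrib_right mult.assoc)
  qed
  have fe: "finite_energy s v"
    unfolding finite_energy_def
  proof (rule Bochner_Integration.integrable_bound)
    show "integrable (lborel \<Otimes>\<^sub>M lborel) (\<lambda>z. (\<lambda>(x, y). (u x - u y)\<^sup>2 * frac_kernel s (x - y)) z +
       2 * \<bar>(\<lambda>(x, y). (\<phi> x - \<phi> y) * (v x - v y) * frac_kernel s (x - y)) z\<bar>)"
      using energy_spaceD(3)[OF u] parts(1) unfolding finite_energy_def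
      by (intro Bochner_Integration.integrable_add integrable_mult_right integrable_abs)
    show "AE z in lborel \<Otimes>\<^sub>M lborel. norm ((\<lambda>(x, y). (v x - v y)\<^sup>2 * frac_kernel s (x - y)) z)
      \<le> norm ((\<lambda>(x, y). (u x - u y)\<^sup>2 * frac_kernel s (x - y)) z +
       2 * \<bar>(\<lambda>(x, y). (\<phi> x - \<phi> y) * (v x - v y) * frac_kernel s (x - y)) z\<bar>)"
      using key by (intro AE_I2) (auto simp: split_beta intro!: order_trans[OF _ abs_ge_self])
  qed measurable
  have "integrable lborel (\<lambda>x. (v x)\<^sup>2)"
    by (rule Bochner_Integration.integrable_bound[OF energy_spaceD(2)[OF u]])
      (use v_le in \<open>auto simp: abs_le_square_iff[symmetric]\<close>)
  moreover have "AE x in lborel. x \<notin> K \<longrightarrow> v x = 0"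
    using energy_spaceD(4)[OF u]
  proof eventually_elim
    case (elim x)
    then show ?case using v_le(1)[of x] by auto
  qed
  ultimately have vX: "v \<in> energy_space s K" using fe by (auto simp: energy_space_def)
  have "2 * (\<integral>x. v x * frac_lap s \<phi> x \<partial>lborel) = energy_form s \<phi> v" using parts(2) by simp
  also have "\<dots> \<le> energy_form s u v"
    unfolding energy_form_def
  proof (rule integral_mono)
    show "integrable (lborel \<Otimes>\<^sub>M lborel) (\<lambda>(x, y). (u x - u y) * (v x - v y) * frac_kernel s (x - y))"
      using energy_spaceD[OF u] energy_spaceD[OF vX] by (intro finite_energy_integrable)
    fix z
    have "(a - b) * (max 0 (p - a) - max 0 (q - b)) \<le> (p - q) * (max 0 (p - a) - max 0 (q - b))" for a b p q :: real
    proof -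
      have "0 \<le> ((p - a) - (q - b)) * (max 0 (p - a) - max 0 (q - b))"
        by (cases "p - a \<le> q - b") (auto intro!: mult_nonneg_nonneg mult_nonpos_nonpos simp: max_def)
      then show ?thesis by (simp add: algebra_simps)
    qed
    then show "(case z of (x, y) \<Rightarrow> (\<phi> x - \<phi> y) * (v x - v y) * frac_kernel s (x - y))
      \<le> (case z of (x, y) \<Rightarrow> (u x - u y) * (v x - v y) * frac_kernel s (x - y))"
      unfolding v_def split_beta by (rule mult_right_mono) simp
  qed (use parts(1) in simp)
  also have "\<dots> \<le> C * (\<integral>x. v x \<partial>lborel)" using E vX unfolding v_def by blast
  finally have 1: "2 * (\<integral>x. v x * frac_lap s \<phi> x \<partial>lborel) \<le> C * (\<integral>x. v x \<partial>lborel)" .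
  have "(\<integral>x. \<Lambda> * v x \<partial>lborel) \<le> (\<integral>x. v x * frac_lap s \<phi> x \<partial>lborel)"
  proof (rule integral_mono_AE)
    show "AE x in lborel. \<Lambda> * v x \<le> v x * frac_lap s \<phi> x"
      using L
    proof eventually_elim
      case (elim x)
      show ?case
      proof (cases "v x = 0")
        case False
        then have "\<phi> x < u x" "0 \<le> v x" by (auto simp: v_def)
        then show ?thesis using elim mult_right_mono[of \<Lambda> "frac_lap s \<phi> x" "v x"] by (simp add: mult.commute)
      qed simp
    qed
  qed (use vi parts(3) in auto)
  then have 2: "\<Lambda> * (\<integral>x. v x \<partial>lborel) \<le> (\<integral>x. v x * frac_lap s \<phi> x \<partial>lborel)" by simp
  from 1 2 have "(2 * \<Lambda> - C) * (\<integral>x. v x \<partial>lborel) \<le> 0" by (simp add: algebra_simps)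
  then have "(\<integral>x. v x \<partial>lborel) \<le> 0" using C by (simp add: mult_le_0_iff)
  moreover have "0 \<le> (\<integral>x. v x \<partial>lborel)" using v_le(2) by simp
  ultimately have "(\<integral>x. v x \<partial>lborel) = 0" by simp
  then have "AE x in lborel. v x = 0"
    using integral_nonneg_eq_0_iff_AE[OF vi] v_le(2) by simp
  then show ?thesis by eventually_elim (auto simp: v_def)
qed

section \<open>Poincare inequality and supremum bounds\<close>

lemma abs_lap_le:
  fixes \<phi> :: "real ^ 'n \<Rightarrow> real"
  assumes "0 < a" "0 < b" "0 \<le> C"
    and le: "\<And>y. \<bar>\<phi> x - \<phi> y\<bar> * frac_kernel s (x - y) \<le> C * two_sided_powr a b (x - y)"
  shows "abs_lap s \<phi> x \<le> ennreal (C * (\<integral>z. two_sided_powr a b (z :: real ^ 'n) \<partial>lborel))"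
proof -
  have "abs_lap s \<phi> x \<le> (\<integral>\<^sup>+y. ennreal (C * two_sided_powr a b (x - y)) \<partial>lborel)"
    unfolding abs_lap_def by (intro nn_integral_mono ennreal_leI le)
  also have "\<dots> = (\<integral>\<^sup>+z. ennreal (C * two_sided_powr a b (z :: real ^ 'n)) \<partial>lborel)"
    by (rule nn_integral_reflect) measurable
  also have "\<dots> = ennreal (\<integral>z. C * two_sided_powr a b (z :: real ^ 'n) \<partial>lborel)"
    using assms integrable_two_sided_powr[OF assms(1,2), where 'a = "real ^ 'n"]
    by (intro nn_integral_eq_integral) auto
  finally show ?thesis by simp
qed

lemma frac_lap_integrable:
  fixes \<phi> :: "real ^ 'n \<Rightarrow> real"
  assumes [measurable]: "\<phi> \<in> borel_measurable borel" and "abs_lap s \<phi> x \<le> ennreal B"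
  shows "integrable lborel (\<lambda>y. (\<phi> x - \<phi> y) * frac_kernel s (x - y))"
proof (rule integrableI_bounded)
  have "(\<integral>\<^sup>+y. ennreal (norm ((\<phi> x - \<phi> y) * frac_kernel s (x - y))) \<partial>lborel) = abs_lap s \<phi> x"
    unfolding abs_lap_def by (simp add: abs_mult)
  also have "\<dots> < \<infinity>" using assms(2) by (rule order.strict_trans1) simp
  finally show "(\<integral>\<^sup>+y. ennreal (norm ((\<phi> x - \<phi> y) * frac_kernel s (x - y))) \<partial>lborel) < \<infinity>" .
qed measurable

lemma abs_lap_scale:
  assumes [measurable]: "\<phi> \<in> borel_measurable borel" and "0 \<le> M"
  shows "abs_lap s (\<lambda>x. M * \<phi> x) x = ennreal M * abs_lap s \<phi> x"
proof -
  have "abs_lap s (\<lambda>x. M * \<phi> x) x = (\<integral>\<^sup>+y. ennreal M * ennreal (\<bar>\<phi> x - \<phi> y\<bar> * frac_kernel s (x - y)) \<partial>lborel)"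
    unfolding abs_lap_def using assms(2)
    by (intro nn_integral_cong) (simp add: ennreal_mult[symmetric] right_diff_distrib[symmetric] abs_mult mult.assoc)
  also have "\<dots> = ennreal M * abs_lap s \<phi> x"
    unfolding abs_lap_def by (rule nn_integral_cmult) measurable
  finally show ?thesis .
qed

lemma frac_lap_scale: "frac_lap s (\<lambda>x. M * \<phi> x) x = M * frac_lap s \<phi> x"
  unfolding frac_lap_def by (simp add: right_diff_distrib[symmetric] mult.assoc)

text \<open>
  On \<open>K\<close> the indicator of a ball of larger radius attains its maximum and is constant nearby, so
  its fractional Laplacian is the integral of the kernel over the complement of the ball: there
  is no singularity, and a ball outside contributes a positive amount uniformly on \<open>K\<close>.
\<close>

lemma ball_indicator_supersolution:
  fixes K :: "(real ^ 'n) set"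
  assumes s: "0 < s" and K: "bounded K"
  obtains R B c where "0 < c" "K \<subseteq> cball 0 R"
    "\<And>x. x \<in> K \<Longrightarrow> abs_lap s (indicator (cball 0 R)) x \<le> ennreal B"
    "\<And>x. x \<in> K \<Longrightarrow> c \<le> frac_lap s (indicator (cball 0 R)) x"
proof -
  obtain R0 where R0: "\<And>x. x \<in> K \<Longrightarrow> norm x \<le> R0" "0 < R0"
    using K unfolding bounded_pos by blast
  define R where "R = R0 + 1"
  have R: "1 < R" using R0 by (simp add: R_def)
  define ch where "ch = (indicator (cball 0 R) :: real ^ 'n \<Rightarrow> real)"
  have [measurable]: "ch \<in> borel_measurable borel" unfolding ch_def by (rule borel_measurable_indicator) simp
  obtain p :: "real ^ 'n" where p: "norm p = 2 * R" using R vector_choose_size[of "2 * R"] by auto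
  define c where "c = (4 * R) powr (- 2 * s - real CARD('n)) * measure lborel (ball p R)"
  have c: "0 < c" using R content_ball_pos[of R p] by (simp add: c_def)
  have K1: "ch x = 1" if "x \<in> K" for x using R0(1)[OF that] by (simp add: ch_def R_def)
  have bd: "\<bar>ch x - ch y\<bar> * frac_kernel s (x - y) \<le> 1 * two_sided_powr 1 (2 * s) (x - y)" if x: "x \<in> K" for x y
  proof (cases "norm y \<le> R")
    case True
    then show ?thesis using K1[OF x] by (simp add: ch_def)
  next
    case False
    have "norm y \<le> norm x + norm (x - y)" by (metis add.commute norm_minus_commute norm_triangle_sub)
    then have "1 < norm (x - y)" using False R0(1)[OF x] unfolding R_def by simp
    then show ?thesis using K1[OF x] False by (simp add: ch_def two_sided_powr_def frac_kernel_powr)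
  qed
  show ?thesis
  proof (rule that[of c R "1 * (\<integral>z. two_sided_powr 1 (2 * s) (z :: real ^ 'n) \<partial>lborel)"])
    show "K \<subseteq> cball 0 R" using R0 by (force simp: R_def)
    fix x assume x: "x \<in> K"
    show ab: "abs_lap s (indicator (cball 0 R)) x \<le> ennreal (1 * (\<integral>z. two_sided_powr 1 (2 * s) (z :: real ^ 'n) \<partial>lborel))"
      using abs_lap_le[OF _ _ _ bd[OF x]] s unfolding ch_def by simp
    have int: "integrable lborel (\<lambda>y. (ch x - ch y) * frac_kernel s (x - y))"
      by (rule frac_lap_integrable[OF \<open>ch \<in> _\<close> ab[folded ch_def]])
    have "c = (\<integral>y. (4 * R) powr (- 2 * s - real CARD('n)) * indicator (ball p R) y \<partial>lborel)"
      by (simp add: c_def)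
    also have "\<dots> \<le> (\<integral>y. (ch x - ch y) * frac_kernel s (x - y) \<partial>lborel)"
    proof (rule integral_mono[OF _ int])
      show "integrable lborel (\<lambda>y. (4 * R) powr (- 2 * s - real CARD('n)) * indicator (ball p R) y :: real)"
        using emeasure_lborel_ball_finite[of p R] by (intro integrable_mult_right integrable_real_indicator) auto
      fix y
      show "(4 * R) powr (- 2 * s - real CARD('n)) * indicator (ball p R) y \<le> (ch x - ch y) * frac_kernel s (x - y)"
      proof (cases "y \<in> ball p R")
        case True
        then have d: "norm (p - y) < R" by (simp add: dist_norm)
        have n1: "R < norm y" using d p norm_triangle_sub[of p y] by simp
        have n2: "norm y < 3 * R" using d p norm_triangle_sub[of y p] by (simp add: norm_minus_commute)
        have n3: "norm (x - y) \<le> 4 * R"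
          using norm_triangle_ineq4[of x y] n2 R0(1)[OF x] by (simp add: R_def)
        have "x \<noteq> y" using n1 R0(1)[OF x] by (auto simp: R_def)
        then have "(4 * R) powr (- 2 * s - real CARD('n)) \<le> frac_kernel s (x - y)"
          using n3 s by (intro frac_kernel_antimono) auto
        then show ?thesis using True K1[OF x] n1 by (simp add: ch_def)
      next
        case False
        then show ?thesis using K1[OF x] by (simp add: ch_def indicator_def)
      qed
    qed
    finally show "c \<le> frac_lap s (indicator (cball 0 R)) x" unfolding frac_lap_def ch_def .
  qed (rule c)
qed

text \<open>
  Integration by parts with the test function \<open>v\<^sup>2\<close> and the indicator \<open>\<chi>\<close> of a large ball reduces the
  claim to \<open>(\<chi> x - \<chi> y) * (v\<^sup>2 x - v\<^sup>2 y) \<le> (v x - v y)\<^sup>2\<close>, which holds because \<open>\<chi>\<close> has values in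
  \<open>{0, 1}\<close> and \<open>v = 0\<close> where \<open>\<chi> = 0\<close>.
\<close>

lemma energy_poincare:
  fixes K :: "(real ^ 'n) set"
  assumes s: "0 < s" and K: "bounded K"
  obtains c where "0 < c" "\<And>v. v \<in> energy_space s K \<Longrightarrow> c * (\<integral>x. (v x)\<^sup>2 \<partial>lborel) \<le> energy_form s v v"
proof -
  obtain c R B where c: "0 < c" "K \<subseteq> cball 0 R"
    and B: "\<And>x. x \<in> K \<Longrightarrow> abs_lap s (indicator (cball 0 R)) x \<le> ennreal B"
    and L: "\<And>x. x \<in> K \<Longrightarrow> c \<le> frac_lap s (indicator (cball 0 R)) x"
    by (rule ball_indicator_supersolution[OF s K], rule that)
  define ch where "ch = (indicator (cball 0 R) :: real ^ 'n \<Rightarrow> real)"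
  have chim [measurable]: "ch \<in> borel_measurable borel" unfolding ch_def by (rule borel_measurable_indicator) simp
  show ?thesis
  proof (rule that[of "2 * c"])
    fix v assume v: "v \<in> energy_space s K"
    note [measurable] = energy_spaceD(1)[OF v]
    have vm: "(\<lambda>x. (v x)\<^sup>2) \<in> borel_measurable borel" by measurable
    have AEB: "AE x in lborel. (v x)\<^sup>2 \<noteq> 0 \<longrightarrow> abs_lap s ch x \<le> ennreal B"
      using energy_spaceD(4)[OF v] by eventually_elim (use B in \<open>auto simp: ch_def\<close>)
    note parts = energy_form_by_parts[OF chim vm energy_spaceD(2)[OF v] AEB]
    have "(\<integral>x. c * (v x)\<^sup>2 \<partial>lborel) \<le> (\<integral>x. (v x)\<^sup>2 * frac_lap s ch x \<partial>lborel)"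
    proof (rule integral_mono_AE)
      show "AE x in lborel. c * (v x)\<^sup>2 \<le> (v x)\<^sup>2 * frac_lap s ch x"
        using energy_spaceD(4)[OF v]
      proof eventually_elim
        case (elim x)
        show ?case
        proof (cases "x \<in> K")
          case True
          from mult_left_mono[OF L[OF this], of "(v x)\<^sup>2"] show ?thesis by (simp add: ch_def mult.commute)
        qed (use elim in simp)
      qed
    qed (use parts(3) energy_spaceD(2)[OF v] in auto)
    then have "2 * c * (\<integral>x. (v x)\<^sup>2 \<partial>lborel) \<le> energy_form s ch (\<lambda>x. (v x)\<^sup>2)"
      unfolding parts(2) by simp
    also have "\<dots> \<le> energy_form s v v"
      unfolding energy_form_def
    proof (rule integral_mono_AE)
      show "integrable (lborel \<Otimes>\<^sub>M lborel) (\<lambda>(x, y). (v x - v y) * (v x - v y) * frac_kernel s (x - y))"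
        using energy_spaceD(3)[OF v] by (simp add: finite_energy_def power2_eq_square)
      have AEx: "AE x in lborel. ch x = 0 \<longrightarrow> v x = 0"
        using energy_spaceD(4)[OF v] by eventually_elim (use c(2) in \<open>auto simp: ch_def indicator_def split: if_splits\<close>)
      show "AE z in lborel \<Otimes>\<^sub>M lborel. (case z of (x, y) \<Rightarrow> (ch x - ch y) * ((v x)\<^sup>2 - (v y)\<^sup>2) * frac_kernel s (x - y))
         \<le> (case z of (x, y) \<Rightarrow> (v x - v y) * (v x - v y) * frac_kernel s (x - y))"
        using AE_lborel_pair(1)[OF AEx] AE_lborel_pair(2)[OF AEx]
      proof eventually_elim
        case (elim z)
        have 01: "ch (fst z) = 0 \<or> ch (fst z) = 1" "ch (snd z) = 0 \<or> ch (snd z) = 1"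
          by (auto simp: ch_def indicator_def)
        then have "(ch (fst z) - ch (snd z)) * ((v (fst z))\<^sup>2 - (v (snd z))\<^sup>2) \<le> (v (fst z) - v (snd z)) * (v (fst z) - v (snd z))"
          using elim by (auto simp: power2_eq_square)
        then show ?case by (auto simp: split_beta intro!: mult_right_mono)
      qed
    qed (rule parts(1))
    finally show "2 * c * (\<integral>x. (v x)\<^sup>2 \<partial>lborel) \<le> energy_form s v v" .
  qed (use c in simp)
qed

text \<open>
  Comparison with a multiple of the indicator of a large ball. The differential inequality is only
  required for test functions supported where \<open>u > 0\<close>; there a monotone zero-order term has a
  favourable sign, so the bound also applies to semilinear equations.
\<close>

lemma energy_sup_bound:
  fixes K :: "(real ^ 'n) set"
  assumes s: "0 < s" and K: "bounded K"
  obtains c where "0 < c"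
    "\<And>u C. \<lbrakk>u \<in> energy_space s K; 0 < C;
       \<And>v. \<lbrakk>v \<in> energy_space s K; \<And>x. 0 \<le> v x; \<And>x. 0 < v x \<Longrightarrow> 0 < u x\<rbrakk> \<Longrightarrow>
          energy_form s u v \<le> C * (\<integral>x. v x \<partial>lborel)\<rbrakk> \<Longrightarrow> AE x in lborel. u x \<le> C * c"
proof -
  obtain c R B where c: "0 < c" "K \<subseteq> cball 0 R"
    and B: "\<And>x. x \<in> K \<Longrightarrow> abs_lap s (indicator (cball 0 R)) x \<le> ennreal B"
    and L: "\<And>x. x \<in> K \<Longrightarrow> c \<le> frac_lap s (indicator (cball 0 R)) x"
    by (rule ball_indicator_supersolution[OF s K], rule that)
  define ch where "ch = (indicator (cball 0 R) :: real ^ 'n \<Rightarrow> real)"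
  have chim [measurable]: "ch \<in> borel_measurable borel" unfolding ch_def by (rule borel_measurable_indicator) simp
  have chi01: "0 \<le> ch x" "ch x \<le> 1" for x by (auto simp: ch_def indicator_def)
  show ?thesis
  proof (rule that[of "1 / c"])
    fix u C assume u: "u \<in> energy_space s K" and C: "0 < C"
      and H: "\<And>v. \<lbrakk>v \<in> energy_space s K; \<And>x. 0 \<le> v x; \<And>x. 0 < v x \<Longrightarrow> 0 < u x\<rbrakk> \<Longrightarrow>
          energy_form s u v \<le> C * (\<integral>x. v x \<partial>lborel)"
    define M where "M = C / c"
    have M: "0 < M" using C c by (simp add: M_def)
    have "AE x in lborel. u x \<le> M * ch x"
    proof (rule energy_comparison[OF u K])
      show "(\<lambda>x. M * ch x) \<in> borel_measurable borel" by measurable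
      show "0 \<le> M * ch x" for x using M chi01 by simp
      have inK: "AE x in lborel. M * ch x < u x \<longrightarrow> x \<in> K"
        using energy_spaceD(4)[OF u]
      proof eventually_elim
        case (elim x)
        then show ?case using M chi01[of x] by (smt (verit) mult_nonneg_nonneg)
      qed
      show "AE x in lborel. M * ch x < u x \<longrightarrow> abs_lap s (\<lambda>x. M * ch x) x \<le> ennreal (M * B)"
        using inK
      proof eventually_elim
        case (elim x)
        show ?case
          using elim B[of x] M unfolding abs_lap_scale[OF chim less_imp_le[OF M]] ch_def[symmetric]
          by (auto simp: ennreal_mult' intro!: mult_left_mono)
      qed
      show "AE x in lborel. M * ch x < u x \<longrightarrow> C \<le> frac_lap s (\<lambda>x. M * ch x) x"
        using inK
      proof eventually_elim
        case (elim x)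
        show ?case
        proof
          assume "M * ch x < u x"
          then have "c \<le> frac_lap s ch x" using elim L by (simp add: ch_def)
          then have "M * c \<le> M * frac_lap s ch x" using M by (intro mult_left_mono) auto
          then show "C \<le> frac_lap s (\<lambda>x. M * ch x) x" using c unfolding frac_lap_scale by (simp add: M_def)
        qed
      qed
      show "C < 2 * C" using C by simp
      assume "(\<lambda>x. max 0 (u x - M * ch x)) \<in> energy_space s K"
      then show "energy_form s u (\<lambda>x. max 0 (u x - M * ch x)) \<le> C * (\<integral>x. max 0 (u x - M * ch x) \<partial>lborel)"
      proof (rule H)
        fix x assume "0 < max 0 (u x - M * ch x)"
        moreover have "0 \<le> M * ch x" using M chi01 by simp
        ultimately show "0 < u x" by (auto simp: max_def split: if_splits)
      qed simp
    qed
    then show "AE x in lborel. u x \<le> C * (1 / c)"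
    proof eventually_elim
      case (elim x)
      have "M * ch x \<le> M * 1" using M chi01 by (intro mult_left_mono) auto
      then show ?case using elim by (simp add: M_def)
    qed
  qed (use c in simp)
qed

section \<open>Half-spaces\<close>

text \<open>
  The mass of the kernel beyond the plane at distance one. It does not depend on the unit vector
  \<open>e\<close>, but the uniform bounds below replace rotation invariance.
\<close>

definition halfspace_mass :: "real \<Rightarrow> real ^ 'n \<Rightarrow> ennreal" where
  "halfspace_mass s e = (\<integral>\<^sup>+z. ennreal (frac_kernel s z) * indicator {z. 1 < z \<bullet> e} z \<partial>lborel)"

lemma frac_kernel_scaleR:
  assumes "0 < t"
  shows "frac_kernel s (t *\<^sub>R z :: real ^ 'n) = t powr (- 2 * s - real CARD('n)) * frac_kernel s z"
  using assms by (simp add: frac_kernel_powr powr_mult)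

text \<open>Homogeneity: the kernel scales like \<open>t powr (- n - 2 s)\<close> and the volume like \<open>t powr n\<close>.\<close>

lemma kernel_halfspace:
  fixes e :: "real ^ 'n"
  assumes "0 < t"
  shows "(\<integral>\<^sup>+z. ennreal (frac_kernel s z) * indicator {z. t < z \<bullet> e} z \<partial>lborel) =
    ennreal (t powr (- 2 * s)) * halfspace_mass s e"
proof -
  have "(\<integral>\<^sup>+z. ennreal (frac_kernel s z) * indicator {z. t < z \<bullet> e} z \<partial>lborel) =
      ennreal (t ^ CARD('n)) * (\<integral>\<^sup>+z. ennreal (frac_kernel s (t *\<^sub>R z)) * indicator {z. t < z \<bullet> e} (t *\<^sub>R z) \<partial>lborel)"
    using assms by (subst nn_integral_scale[of _ t]) auto
  also have "(\<integral>\<^sup>+z. ennreal (frac_kernel s (t *\<^sub>R z)) * indicator {z. t < z \<bullet> e} (t *\<^sub>R z) \<partial>lborel) =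
      (\<integral>\<^sup>+z. ennreal (t powr (- 2 * s - real CARD('n))) * (ennreal (frac_kernel s z) * indicator {z. 1 < z \<bullet> e} z) \<partial>lborel)"
    using assms by (intro nn_integral_cong) (auto simp: frac_kernel_scaleR ennreal_mult' mult.assoc indicator_def)
  also have "\<dots> = ennreal (t powr (- 2 * s - real CARD('n))) * halfspace_mass s e"
    unfolding halfspace_mass_def by (rule nn_integral_cmult) measurable
  also have "ennreal (t ^ CARD('n)) * (ennreal (t powr (- 2 * s - real CARD('n))) * halfspace_mass s e) =
      ennreal (t powr (- 2 * s)) * halfspace_mass s e"
  proof -
    have "t ^ CARD('n) * t powr (- 2 * s - real CARD('n)) = t powr (- 2 * s)"
      using assms by (simp add: powr_diff powr_realpow)
    then show ?thesis using assms by (simp add: mult.assoc[symmetric] ennreal_mult'[symmetric])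
  qed
  finally show ?thesis .
qed

lemma halfspace_mass_finite:
  fixes e :: "real ^ 'n"
  assumes "norm e = 1" "0 < s"
  shows "halfspace_mass s e < \<infinity>"
proof -
  have "halfspace_mass s e \<le> (\<integral>\<^sup>+z. ennreal (if norm z < 1 then 0 else norm z powr (- (2 * s) - real DIM(real ^ 'n))) \<partial>(lborel :: (real ^ 'n) measure))"
    unfolding halfspace_mass_def
  proof (intro nn_integral_mono)
    fix z :: "real ^ 'n"
    have "z \<bullet> e \<le> norm z" using norm_cauchy_schwarz[of z e] assms by simp
    then show "ennreal (frac_kernel s z) * indicator {z. 1 < z \<bullet> e} z
      \<le> ennreal (if norm z < 1 then 0 else norm z powr (- (2 * s) - real DIM(real ^ 'n)))"
      by (auto simp: indicator_def frac_kernel_powr)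
  qed
  also have "\<dots> < \<infinity>" using assms by (intro nn_integral_powr_at_infinity) simp
  finally show ?thesis .
qed

text \<open>The half-space contains the ball of radius \<open>1/2\<close> around \<open>2 e\<close>, on which \<open>\<bar>z\<bar> \<le> 5/2\<close>.\<close>

lemma halfspace_mass_lower_bound:
  assumes "0 < s"
  obtains c where "0 < c" "\<And>e :: real ^ 'n. norm e = 1 \<Longrightarrow> ennreal c \<le> halfspace_mass s e"
proof -
  define c where "c = (5/2) powr (- 2 * s - real CARD('n)) * measure lborel (ball (0 :: real ^ 'n) (1/2))"
  show ?thesis
  proof (rule that[of c])
    show "0 < c" using content_ball_pos[of "1/2" "0 :: real ^ 'n"] by (simp add: c_def)
    fix e :: "real ^ 'n" assume e: "norm e = 1"
    have "c = (5/2) powr (- 2 * s - real CARD('n)) * measure lborel (ball (2 *\<^sub>R e) (1/2))"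
      using content_ball_conv_unit_ball[of "1/2" "0 :: real ^ 'n"] content_ball_conv_unit_ball[of "1/2" "2 *\<^sub>R e"]
      by (simp add: c_def)
    then have "ennreal c = ennreal ((5/2) powr (- 2 * s - real CARD('n))) * emeasure lborel (ball (2 *\<^sub>R e) (1/2))"
      using emeasure_lborel_ball_finite[of "2 *\<^sub>R e" "1/2"] by (simp add: emeasure_eq_ennreal_measure ennreal_mult')
    also have "\<dots> = (\<integral>\<^sup>+z. ennreal ((5/2) powr (- 2 * s - real CARD('n))) * indicator (ball (2 *\<^sub>R e) (1/2)) z \<partial>lborel)"
      by (rule nn_integral_cmult_indicator[symmetric]) simp
    also have "\<dots> \<le> halfspace_mass s e"
      unfolding halfspace_mass_def
    proof (intro nn_integral_mono)
      fix z
      show "ennreal ((5/2) powr (- 2 * s - real CARD('n))) * indicator (ball (2 *\<^sub>R e) (1/2)) z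
        \<le> ennreal (frac_kernel s z) * indicator {z. 1 < z \<bullet> e} z"
      proof (cases "z \<in> ball (2 *\<^sub>R e) (1/2)")
        case True
        then have d: "norm (2 *\<^sub>R e - z) < 1/2" by (simp add: dist_norm)
        have "(2 *\<^sub>R e - z) \<bullet> e \<le> norm (2 *\<^sub>R e - z)" using norm_cauchy_schwarz[of "2 *\<^sub>R e - z" e] e by simp
        moreover have "e \<bullet> e = 1" using e by (simp add: dot_square_norm)
        ultimately have 1: "1 < z \<bullet> e" using d by (simp add: inner_diff_left)
        have "norm z \<le> norm (2 *\<^sub>R e) + norm (2 *\<^sub>R e - z)" by (metis norm_minus_commute norm_triangle_sub)
        then have "norm z \<le> 5/2" using d e by simp
        moreover have "z \<noteq> 0" using 1 by auto
        ultimately have "(5/2) powr (- 2 * s - real CARD('n)) \<le> frac_kernel s z"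
          using assms by (intro frac_kernel_antimono) auto
        then show ?thesis using True 1 by (simp add: ennreal_leI)
      qed simp
    qed
    finally show "ennreal c \<le> halfspace_mass s e" .
  qed
qed

section \<open>The half-space profile\<close>

text \<open>
  Integrals of the kernel against a function of \<open>z \<bullet> e\<close> reduce to one dimension: write the function
  as the primitive of \<open>h\<close>, exchange the integrals, and use that the kernel mass beyond distance
  \<open>t\<close> is proportional to \<open>t powr (- 2 s)\<close>.
\<close>

lemma kernel_layer_cake:
  fixes e :: "real ^ 'n" and h :: "real \<Rightarrow> ennreal"
  assumes [measurable]: "h \<in> borel_measurable borel"
  shows "(\<integral>\<^sup>+z. ennreal (frac_kernel s z) * (\<integral>\<^sup>+t. h t * indicator {0<..<z \<bullet> e} t \<partial>lborel) \<partial>lborel) =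
    halfspace_mass s e * (\<integral>\<^sup>+t. h t * ennreal (t powr (- 2 * s)) * indicator {0<..} t \<partial>lborel)"
proof -
  define F where "F = (\<lambda>(z :: real ^ 'n, t :: real). h t * indicator {0<..} t * (if t < z \<bullet> e then ennreal (frac_kernel s z) else 0))"
  have [measurable]: "F \<in> borel_measurable (lborel \<Otimes>\<^sub>M lborel)" unfolding F_def by measurable
  have "(\<integral>\<^sup>+z. ennreal (frac_kernel s z) * (\<integral>\<^sup>+t. h t * indicator {0<..<z \<bullet> e} t \<partial>lborel) \<partial>lborel) =
     (\<integral>\<^sup>+z. \<integral>\<^sup>+t. F (z, t) \<partial>lborel \<partial>lborel)"
  proof (rule nn_integral_cong)
    fix z :: "real ^ 'n"
    have "ennreal (frac_kernel s z) * (\<integral>\<^sup>+t. h t * indicator {0<..<z \<bullet> e} t \<partial>lborel) =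
       (\<integral>\<^sup>+t. ennreal (frac_kernel s z) * (h t * indicator {0<..<z \<bullet> e} t) \<partial>lborel)"
      by (rule nn_integral_cmult[symmetric]) measurable
    also have "\<dots> = (\<integral>\<^sup>+t. F (z, t) \<partial>lborel)"
      by (intro nn_integral_cong) (auto simp: F_def indicator_def mult.commute)
    finally show "ennreal (frac_kernel s z) * (\<integral>\<^sup>+t. h t * indicator {0<..<z \<bullet> e} t \<partial>lborel) = (\<integral>\<^sup>+t. F (z, t) \<partial>lborel)" .
  qed
  also have "\<dots> = (\<integral>\<^sup>+t. \<integral>\<^sup>+z. F (z, t) \<partial>lborel \<partial>lborel)"
    by (rule lborel_pair.Fubini'[symmetric]) measurable
  also have "\<dots> = (\<integral>\<^sup>+t. halfspace_mass s e * (h t * ennreal (t powr (- 2 * s)) * indicator {0<..} t) \<partial>lborel)"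
  proof (rule nn_integral_cong)
    fix t :: real
    show "(\<integral>\<^sup>+z. F (z, t) \<partial>lborel) = halfspace_mass s e * (h t * ennreal (t powr (- 2 * s)) * indicator {0<..} t)"
    proof (cases "0 < t")
      case True
      have "(\<integral>\<^sup>+z. F (z, t) \<partial>lborel) = (\<integral>\<^sup>+z. h t * (ennreal (frac_kernel s z) * indicator {z. t < z \<bullet> e} z) \<partial>lborel)"
        using True by (intro nn_integral_cong) (auto simp: F_def indicator_def)
      also have "\<dots> = h t * (\<integral>\<^sup>+z. ennreal (frac_kernel s z) * indicator {z. t < z \<bullet> e} z \<partial>lborel)"
        by (rule nn_integral_cmult) measurable
      finally show ?thesis using True by (simp add: kernel_halfspace mult_ac)
    qed (simp add: F_def)
  qed
  also have "\<dots> = halfspace_mass s e * (\<integral>\<^sup>+t. h t * ennreal (t powr (- 2 * s)) * indicator {0<..} t \<partial>lborel)"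
    by (rule nn_integral_cmult) measurable
  finally show ?thesis .
qed

lemma nn_integral_powr_interval:
  fixes s :: real
  assumes "0 < s" "0 \<le> p" "p \<le> q"
  shows "(\<integral>\<^sup>+t. ennreal (s * t powr (s - 1)) * indicator {p<..<q} t \<partial>lborel) = ennreal (q powr s - p powr s)"
proof -
  have hi: "((\<lambda>t. s * t powr (s - 1)) has_integral (q powr s - p powr s)) {p..q}"
  proof (rule fundamental_theorem_of_calculus_interior)
    show "continuous_on {p..q} (\<lambda>t. t powr s)"
      using assms by (intro continuous_on_powr' continuous_intros) auto
    fix x assume "x \<in> {p<..<q}"
    then show "((\<lambda>t. t powr s) has_vector_derivative s * x powr (s - 1)) (at x)"
      using assms unfolding has_real_derivative_iff_has_vector_derivative[symmetric]
      by (auto intro!: derivative_eq_intros)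
  qed (use assms in auto)
  have "(\<integral>\<^sup>+t. ennreal (s * t powr (s - 1)) * indicator {p<..<q} t \<partial>lborel) =
      (\<integral>\<^sup>+t. ennreal (indicator {p..q} t * (s * t powr (s - 1))) \<partial>lborel)"
  proof (rule nn_integral_cong_AE)
    have "AE t in lborel. t \<noteq> p \<and> t \<noteq> (q::real)" by (intro AE_conjI AE_lborel_singleton)
    then show "AE t in lborel. ennreal (s * t powr (s - 1)) * indicator {p<..<q} t = ennreal (indicator {p..q} t * (s * t powr (s - 1)))"
      by eventually_elim (auto simp: indicator_def)
  qed
  also have "\<dots> = ennreal (q powr s - p powr s)"
  proof (intro nn_integral_has_integral_lborel)
    have "((\<lambda>t. if t \<in> {p..q} then s * t powr (s - 1) else 0) has_integral (q powr s - p powr s)) UNIV"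
      using hi by (simp only: has_integral_restrict_UNIV)
    moreover have "(\<lambda>t. if t \<in> {p..q} then s * t powr (s - 1) else 0) = (\<lambda>t. indicator {p..q} t * (s * t powr (s - 1)))"
      by (auto simp: indicator_def)
    ultimately show "((\<lambda>t. indicator {p..q} t * (s * t powr (s - 1))) has_integral (q powr s - p powr s)) UNIV" by simp
  qed (use assms in auto)
  finally show ?thesis .
qed

text \<open>
  The substitution \<open>t = x / (1 - x)\<close> turns the integral over the half-line into the Beta integral
  with parameters \<open>1 - 2 s\<close> and \<open>s\<close>, which is the integral over \<open>(0, 1)\<close>. The exponents match
  because the power in the profile is exactly \<open>s\<close>: this is what distinguishes
  \<open>(max 0 t) powr s\<close> among all powers.
\<close>

lemma fractional_beta_identity:
  fixes s :: real
  assumes s: "0 < s" "s < 1/2"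
  shows "(\<integral>\<^sup>+t. ennreal (s * (1 + t) powr (s - 1)) * ennreal (t powr (- 2 * s)) * indicator {0<..} t \<partial>lborel)
       = (\<integral>\<^sup>+t. ennreal (s * (1 - t) powr (s - 1) * indicator {..<1} t) * ennreal (t powr (- 2 * s)) * indicator {0<..} t \<partial>lborel)" (is "?A = ?B")
    and "(\<integral>\<^sup>+t. ennreal (s * (1 + t) powr (s - 1)) * ennreal (t powr (- 2 * s)) * indicator {0<..} t \<partial>lborel) < \<infinity>"
proof -
  define f where "f = (\<lambda>t::real. s * (1 + t) powr (s - 1) * t powr (- 2 * s))"
  define g where "g = (\<lambda>x::real. x / (1 - x))"
  define g' where "g' = (\<lambda>x::real. 1 / (1 - x)\<^sup>2)"
  have fg: "f (g x) * g' x = s * (x powr (1 - 2 * s - 1) * (1 - x) powr (s - 1))" if "0 < x" "x < 1" for x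
  proof -
    \<comment> \<open>In logarithmic coordinates all powers become exponentials of linear expressions.\<close>
    define L M where "L = ln x" and "M = ln (1 - x)"
    have x: "x = exp L" "1 - x = exp M" using that by (simp_all add: L_def M_def)
    have "1 + g x = 1 / (1 - x)" using that by (simp add: g_def field_simps)
    then have 1: "1 + g x = exp (- M)" by (simp add: x(2) exp_minus field_simps)
    have 2: "g x = exp (L - M)" unfolding g_def x(2) by (subst x(1)) (simp add: exp_diff)
    have 3: "g' x = exp (- 2 * M)" unfolding g'_def x(2) by (simp add: exp_double[symmetric] exp_minus divide_inverse)
    have "f (g x) * g' x = s * (exp ((s - 1) * (- M)) * exp ((- 2 * s) * (L - M)) * exp (- 2 * M))"
      unfolding f_def 1 3 by (subst 2) (simp add: powr_def)
    also have "\<dots> = s * (exp ((- 2 * s) * L) * exp ((s - 1) * M))"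
      by (simp add: exp_add[symmetric] algebra_simps)
    also have "\<dots> = s * (x powr (1 - 2 * s - 1) * (1 - x) powr (s - 1))"
      using that by (simp add: powr_def L_def M_def)
    finally show ?thesis .
  qed
  have e01: "einterval 0 1 = {0<..<1::real}"
    by (auto simp: einterval_def zero_ereal_def one_ereal_def)
  have e0inf: "einterval 0 \<infinity> = ({0<..} :: real set)"
    by (auto simp: einterval_def zero_ereal_def)
  have int01: "set_integrable lborel {0<..<1} (\<lambda>x. f (g x) * g' x)"
  proof -
    have "set_integrable lborel {0..1} (\<lambda>t. t powr (1 - 2 * s - 1) * (1 - t) powr (s - 1))"
      using s by (intro integrable_Beta) auto
    then have "set_integrable lborel {0<..<1} (\<lambda>t. s * (t powr (1 - 2 * s - 1) * (1 - t) powr (s - 1)))"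
      by (intro set_integrable_mult_right) (rule set_integrable_subset, auto)
    then show ?thesis
      by (rule set_integrable_cong[THEN iffD1, rotated -1]) (auto simp: fg)
  qed
  have lim0: "((ereal \<circ> g \<circ> real_of_ereal) \<longlongrightarrow> 0) (at_right 0)"
  proof -
    have "(g \<longlongrightarrow> g 0) (at_right 0)"
      unfolding g_def by (intro tendsto_intros) auto
    then have "((ereal \<circ> g) \<longlongrightarrow> 0) (at_right 0)"
      by (simp add: o_def g_def zero_ereal_def)
    then show ?thesis unfolding zero_ereal_def by (simp add: ereal_tendsto_simps)
  qed
  have lim1: "((ereal \<circ> g \<circ> real_of_ereal) \<longlongrightarrow> \<infinity>) (at_left 1)"
  proof -
    have "filterlim (\<lambda>x::real. 1 - x) (at_right 0) (at_left 1)"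
      unfolding filterlim_at
      by (auto intro!: tendsto_eq_intros simp: eventually_at_filter)
    then have "filterlim (\<lambda>x::real. inverse (1 - x)) at_top (at_left 1)"
      by (rule filterlim_compose[OF filterlim_inverse_at_top_right])
    then have "filterlim (\<lambda>x::real. x * inverse (1 - x)) at_top (at_left 1)"
      by (intro filterlim_tendsto_pos_mult_at_top[of _ 1] tendsto_intros) auto
    then have "filterlim g at_top (at_left 1)" unfolding g_def by (simp add: divide_inverse)
    then have "((ereal \<circ> g) \<longlongrightarrow> \<infinity>) (at_left 1)"
      by (simp add: o_def tendsto_PInfty_eq_at_top)
    then show ?thesis unfolding one_ereal_def by (simp add: ereal_tendsto_simps)
  qed
  have sub: "set_integrable lborel (einterval 0 \<infinity>) f"
    "(LBINT x=0..\<infinity>. f x) = (LBINT x=0..1. f (g x) * g' x)"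
  proof -
    have d: "DERIV g x :> g' x" if "0 < ereal x" "ereal x < 1" for x
      using that unfolding g_def g'_def one_ereal_def
      by (auto intro!: derivative_eq_intros simp: power2_eq_square field_simps)
    have pos: "0 < g x" if "0 < ereal x" "ereal x < 1" for x
      using that by (simp add: g_def one_ereal_def zero_ereal_def)
    have c: "isCont f (g x)" if "0 < ereal x" "ereal x < 1" for x
      using pos[OF that] unfolding f_def by (intro continuous_intros) auto
    have c': "isCont g' x" if "0 < ereal x" "ereal x < 1" for x
      using that unfolding g'_def one_ereal_def by (intro continuous_intros) auto
    note S = interval_integral_substitution_nonneg[of 0 1 g g' f 0 \<infinity>, OF _ d c c' _ _ lim0 lim1]
    show "set_integrable lborel (einterval 0 \<infinity>) f"
      by (rule S(1)) (use s int01 in \<open>auto simp: e01 f_def g'_def\<close>)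
    show "(LBINT x=0..\<infinity>. f x) = (LBINT x=0..1. f (g x) * g' x)"
      by (rule S(2)) (use s int01 in \<open>auto simp: e01 f_def g'_def\<close>)
  qed
  have f0: "0 \<le> f t" for t using s by (simp add: f_def)
  have "?A = (\<integral>\<^sup>+t. ennreal (indicator {0<..} t * f t) \<partial>lborel)"
    using s by (intro nn_integral_cong) (auto simp: f_def indicator_def ennreal_mult')
  also have "\<dots> = ennreal (\<integral>t. indicator {0<..} t * f t \<partial>lborel)"
    using sub(1) f0 unfolding e0inf set_integrable_def by (intro nn_integral_eq_integral) auto
  finally have A: "?A = ennreal (\<integral>t. indicator {0<..} t * f t \<partial>lborel)" .
  then show "?A < \<infinity>" by simp
  have "?B = (\<integral>\<^sup>+t. ennreal (indicator {0<..<1} t * (f (g t) * g' t)) \<partial>lborel)"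
  proof (rule nn_integral_cong)
    fix t :: real
    show "ennreal (s * (1 - t) powr (s - 1) * indicator {..<1} t) * ennreal (t powr (- 2 * s)) * indicator {0<..} t =
        ennreal (indicator {0<..<1} t * (f (g t) * g' t))"
    proof (cases "0 < t \<and> t < 1")
      case True
      then have "ennreal (s * (1 - t) powr (s - 1)) * ennreal (t powr (- 2 * s)) = ennreal (f (g t) * g' t)"
        using s by (simp add: ennreal_mult'[symmetric] fg mult.assoc mult.commute[of "(1 - t) powr (s - 1)"])
      then show ?thesis using True by simp
    qed (auto simp: indicator_def)
  qed
  also have "\<dots> = ennreal (\<integral>t. indicator {0<..<1} t * (f (g t) * g' t) \<partial>lborel)"
    using int01 f0 unfolding set_integrable_def
    by (intro nn_integral_eq_integral) (auto simp: g'_def)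
  also have "(\<integral>t. indicator {0<..<1} t * (f (g t) * g' t) \<partial>lborel) = (\<integral>t. indicator {0<..} t * f t \<partial>lborel)"
    using sub(2) unfolding interval_lebesgue_integral_def set_lebesgue_integral_def e01 e0inf by simp
  finally show "?A = ?B" using A by simp
qed

text \<open>
  The profile \<open>(max 0 (x \<bullet> e)) powr s\<close> is \<open>s\<close>-harmonic in the half-space where it is positive. The
  increments with \<open>z \<bullet> e > 0\<close> and those with \<open>z \<bullet> e < 0\<close> are integrated separately. By scaling it
  suffices to treat \<open>d = 1\<close>, where \<open>kernel_layer_cake\<close> turns them into the two sides of
  \<open>fractional_beta_identity\<close>.
\<close>

lemma flat_profile:
  fixes e :: "real ^ 'n"
  assumes s: "0 < s" "s < 1/2" and e: "norm e = 1" and d: "0 < d"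
  shows "integrable lborel (\<lambda>z. (d powr s - (max 0 (d + z \<bullet> e)) powr s) * frac_kernel s z)" (is ?I)
    and "(\<integral>z. (d powr s - (max 0 (d + z \<bullet> e)) powr s) * frac_kernel s z \<partial>lborel) = 0" (is ?E)
proof -
  define f1 where "f1 = (\<lambda>d (z :: real ^ 'n). frac_kernel s z * ((d + max 0 (z \<bullet> e)) powr s - d powr s))"
  define f2 where "f2 = (\<lambda>d (z :: real ^ 'n). frac_kernel s z * (d powr s - (max 0 (d - max 0 (- (z \<bullet> e)))) powr s))"
  have m1 [measurable]: "f1 d \<in> borel_measurable borel" for d unfolding f1_def by measurable
  have m2 [measurable]: "f2 d \<in> borel_measurable borel" for d unfolding f2_def by measurable
  define I where "I = (\<integral>\<^sup>+t. ennreal (s * (1 + t) powr (s - 1)) * ennreal (t powr (- 2 * s)) * indicator {0<..} t \<partial>lborel)"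
  have I1: "(\<integral>\<^sup>+z. ennreal (f1 1 z) \<partial>lborel) = halfspace_mass s e * I"
  proof -
    have *: "ennreal (f1 1 z) = ennreal (frac_kernel s z) * (\<integral>\<^sup>+t. ennreal (s * (1 + t) powr (s - 1)) * indicator {0<..<z \<bullet> e} t \<partial>lborel)" for z
    proof -
      have "(\<integral>\<^sup>+t. ennreal (s * (1 + t) powr (s - 1)) * indicator {0<..<z \<bullet> e} t \<partial>lborel) =
         (\<integral>\<^sup>+t. ennreal (s * (1 + t) powr (s - 1)) * indicator {1<..<1 + max 0 (z \<bullet> e)} (1 + t) \<partial>lborel)"
        by (intro nn_integral_cong) (auto simp: indicator_def max_def)
      also have "\<dots> = (\<integral>\<^sup>+t. ennreal (s * t powr (s - 1)) * indicator {1<..<1 + max 0 (z \<bullet> e)} t \<partial>lborel)"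
        by (rule nn_integral_shift) measurable
      also have "\<dots> = ennreal ((1 + max 0 (z \<bullet> e)) powr s - 1 powr s)"
        using s by (intro nn_integral_powr_interval) auto
      finally show ?thesis
        unfolding f1_def using s by (simp add: ennreal_mult' powr_mono2 ge_one_powr_ge_zero)
    qed
    show ?thesis unfolding * I_def by (rule kernel_layer_cake) measurable
  qed
  have I2: "(\<integral>\<^sup>+z. ennreal (f2 1 z) \<partial>lborel) = halfspace_mass s e * I"
  proof -
    have *: "ennreal (f2 1 (0 - z)) = ennreal (frac_kernel s z) * (\<integral>\<^sup>+t. ennreal (s * (1 - t) powr (s - 1) * indicator {..<1} t) * indicator {0<..<z \<bullet> e} t \<partial>lborel)" for z
    proof -
      define p where "p = max 0 (1 - max 0 (z \<bullet> e))"
      have p: "0 \<le> p" "p \<le> 1" by (auto simp: p_def)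
      have "(\<integral>\<^sup>+t. ennreal (s * (1 - t) powr (s - 1) * indicator {..<1} t) * indicator {0<..<z \<bullet> e} t \<partial>lborel) =
         (\<integral>\<^sup>+t. ennreal (s * (1 - t) powr (s - 1)) * indicator {p<..<1} (1 - t) \<partial>lborel)"
        by (intro nn_integral_cong) (auto simp: indicator_def p_def max_def split: if_splits)
      also have "\<dots> = (\<integral>\<^sup>+t. ennreal (s * t powr (s - 1)) * indicator {p<..<1} t \<partial>lborel)"
        by (rule nn_integral_reflect) measurable
      also have "\<dots> = ennreal (1 powr s - p powr s)"
        using s p by (intro nn_integral_powr_interval) auto
      finally show ?thesis
        unfolding f2_def by (simp add: ennreal_mult' p_def)
    qed
    have "(\<integral>\<^sup>+z. ennreal (f2 1 z) \<partial>lborel) = (\<integral>\<^sup>+z. ennreal (f2 1 (0 - z)) \<partial>lborel)"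
      by (rule nn_integral_reflect[symmetric]) measurable
    also have "\<dots> = halfspace_mass s e * I"
      unfolding * I_def fractional_beta_identity(1)[OF s] by (rule kernel_layer_cake) measurable
    finally show ?thesis .
  qed
  define c where "c = d ^ CARD('n) * (d powr (- 2 * s - real CARD('n)) * d powr s)"
  have sc1: "(\<integral>\<^sup>+z. ennreal (f1 d z) \<partial>lborel) = ennreal c * (\<integral>\<^sup>+z. ennreal (f1 1 z) \<partial>lborel)"
  proof -
    have *: "f1 d (d *\<^sub>R z) = (d powr (- 2 * s - real CARD('n)) * d powr s) * f1 1 z" for z
    proof -
      have "d + max 0 (d * (z \<bullet> e)) = d * (1 + max 0 (z \<bullet> e))"
        using d by (simp add: max_def algebra_simps mult_le_0_iff zero_le_mult_iff)
      then have "(d + max 0 (d * (z \<bullet> e))) powr s = d powr s * (1 + max 0 (z \<bullet> e)) powr s"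
        using d by (simp only: powr_mult)
      then show ?thesis
        using d by (simp add: f1_def frac_kernel_scaleR algebra_simps)
    qed
    have "(\<integral>\<^sup>+z. ennreal (f1 d z) \<partial>lborel) = ennreal (d ^ CARD('n)) * (\<integral>\<^sup>+z. ennreal (f1 d (d *\<^sub>R z)) \<partial>lborel)"
      using d by (subst nn_integral_scale[of _ d]) auto
    then show ?thesis unfolding * c_def using d
      by (simp add: ennreal_mult' nn_integral_cmult mult.assoc)
  qed
  have sc2: "(\<integral>\<^sup>+z. ennreal (f2 d z) \<partial>lborel) = ennreal c * (\<integral>\<^sup>+z. ennreal (f2 1 z) \<partial>lborel)"
  proof -
    have *: "f2 d (d *\<^sub>R z) = (d powr (- 2 * s - real CARD('n)) * d powr s) * f2 1 z" for z
    proof -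
      have "max 0 (d - max 0 (- (d * (z \<bullet> e)))) = d * max 0 (1 - max 0 (- (z \<bullet> e)))"
        using d by (simp add: max_mult_distrib_left right_diff_distrib)
      then have "(max 0 (d - max 0 (- (d * (z \<bullet> e))))) powr s = d powr s * (max 0 (1 - max 0 (- (z \<bullet> e)))) powr s"
        using d by (simp only: powr_mult)
      then show ?thesis
        using d by (simp add: f2_def frac_kernel_scaleR algebra_simps)
    qed
    have "(\<integral>\<^sup>+z. ennreal (f2 d z) \<partial>lborel) = ennreal (d ^ CARD('n)) * (\<integral>\<^sup>+z. ennreal (f2 d (d *\<^sub>R z)) \<partial>lborel)"
      using d by (subst nn_integral_scale[of _ d]) auto
    then show ?thesis unfolding * c_def using d
      by (simp add: ennreal_mult' nn_integral_cmult mult.assoc)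
  qed
  have fin: "halfspace_mass s e * I < \<infinity>"
    using halfspace_mass_finite[OF e s(1)] fractional_beta_identity(2)[OF s]
    by (simp add: I_def ennreal_mult_less_top)
  have f10: "0 \<le> f1 d z" for z
    using s d by (auto simp: f1_def intro!: mult_nonneg_nonneg powr_mono2)
  have f20: "0 \<le> f2 d z" for z
    using s d by (auto simp: f2_def intro!: mult_nonneg_nonneg powr_mono2)
  have fin12: "ennreal c * (halfspace_mass s e * I) < \<infinity>" using fin by (simp add: ennreal_mult_less_top)
  have i1: "integrable lborel (f1 d)"
    by (rule integrableI_bounded) (use fin12 sc1 I1 f10 in simp_all)
  have i2: "integrable lborel (f2 d)"
    by (rule integrableI_bounded) (use fin12 sc2 I2 f20 in simp_all)
  have "integral\<^sup>L lborel (f1 d) = enn2real (\<integral>\<^sup>+z. ennreal (f1 d z) \<partial>lborel)"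
    using f10 by (intro integral_eq_nn_integral) auto
  also have "\<dots> = enn2real (\<integral>\<^sup>+z. ennreal (f2 d z) \<partial>lborel)" using sc1 sc2 I1 I2 by simp
  also have "\<dots> = integral\<^sup>L lborel (f2 d)"
    using f20 by (intro integral_eq_nn_integral[symmetric]) auto
  finally have eq: "integral\<^sup>L lborel (f1 d) = integral\<^sup>L lborel (f2 d)" .
  have dec: "(\<lambda>z. (d powr s - (max 0 (d + z \<bullet> e)) powr s) * frac_kernel s z) = (\<lambda>z. f2 d z - f1 d z)"
  proof
    fix z
    show "(d powr s - (max 0 (d + z \<bullet> e)) powr s) * frac_kernel s z = f2 d z - f1 d z"
      using d by (cases "0 \<le> z \<bullet> e") (simp_all add: f1_def f2_def max_def algebra_simps)
  qed
  show ?I unfolding dec by (intro Bochner_Integration.integrable_diff i1 i2)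
  show ?E unfolding dec using i1 i2 eq by simp
qed

section \<open>The barrier outside a ball\<close>

text \<open>The concave power lies above its chord over \<open>[0, a]\<close>.\<close>

lemma powr_diff_le_linear:
  fixes a b s :: real
  assumes "0 \<le> s" "s \<le> 1" "0 \<le> b" "b \<le> a" "0 < a"
  shows "a powr s - b powr s \<le> a powr (s - 1) * (a - b)"
proof -
  have "a powr (s - 1) * b \<le> b powr s"
  proof (cases "b = 0")
    case False
    then have "a powr (s - 1) * b \<le> b powr (s - 1) * b"
      using assms by (intro mult_right_mono powr_mono2') auto
    also have "\<dots> = b powr s" using False assms by (simp add: powr_diff)
    finally show ?thesis .
  qed simp
  moreover have "a powr (s - 1) * a = a powr s" using assms by (simp add: powr_diff)
  ultimately show ?thesis by (simp add: algebra_simps)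
qed

lemma powr_diff_le_powr:
  fixes a b s :: real
  assumes "0 \<le> s" "s \<le> 1" "0 \<le> b" "b \<le> a"
  shows "a powr s - b powr s \<le> (a - b) powr s"
proof (cases "a = b")
  case False
  then have ab: "b < a" "0 < a" using assms by auto
  have "a powr s - b powr s \<le> a powr (s - 1) * (a - b)"
    using assms ab by (intro powr_diff_le_linear) auto
  also have "\<dots> \<le> (a - b) powr (s - 1) * (a - b)"
    using assms ab by (intro mult_right_mono powr_mono2') auto
  also have "\<dots> = (a - b) powr s" using ab by (simp add: powr_diff)
  finally show ?thesis .
qed simp

text \<open>
  A strictly concave modification of the identity near \<open>0\<close>, nondecreasing, with values
  between \<open>min t 1 / 2\<close> and \<open>t\<close>. Any exponent strictly between \<open>1\<close> and \<open>2\<close> would serve: an exponent \<open>\<beta>\<close> produces the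
  gain \<open>d powr (- (2 - \<beta>) s)\<close> at distance \<open>d\<close> from the ball, which has to be unbounded as
  \<open>d\<close> tends to \<open>0\<close>. The value \<open>3/2\<close> allows polynomial identities in the square root.
\<close>

definition bend :: "real \<Rightarrow> real" where
  "bend t = t - (min t 1) powr (3/2) / 2"

text \<open>The bent half-space profile with the distance to a plane replaced by the distance to a ball.\<close>

definition ball_barrier :: "real \<Rightarrow> real ^ 'n \<Rightarrow> real \<Rightarrow> real ^ 'n \<Rightarrow> real" where
  "ball_barrier s c \<rho> x = bend ((max 0 (norm (x - c) - \<rho>)) powr s)"

lemma ball_barrier_measurable [measurable]: "ball_barrier s c \<rho> \<in> borel_measurable borel"
  unfolding ball_barrier_def bend_def by measurable

lemma powr_three_halves: "0 \<le> t \<Longrightarrow> t powr (3/2) = sqrt t ^ 3" for t :: real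
proof (cases "t = 0")
  assume "0 \<le> t" "t \<noteq> 0"
  then have "t powr (3/2) = t powr (1 + 1/2)" by simp
  also have "\<dots> = t * sqrt t" using \<open>0 \<le> t\<close> \<open>t \<noteq> 0\<close> by (subst powr_add) (simp add: powr_half_sqrt)
  also have "\<dots> = sqrt t ^ 3" using \<open>0 \<le> t\<close> by (simp add: power3_eq_cube)
  finally show ?thesis .
qed simp

lemma bend_bounds:
  assumes "0 \<le> t"
  shows "min t 1 / 2 \<le> bend t" "bend t \<le> t"
proof -
  have "(min t 1) powr (3/2) \<le> min t 1"
  proof (cases "t = 0")
    case False
    then have "(min t 1) powr (3/2) \<le> (min t 1) powr 1"
      using assms by (intro powr_mono') auto
    then show ?thesis using assms by simp
  qed simp
  then show "min t 1 / 2 \<le> bend t" unfolding bend_def by linarith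
  show "bend t \<le> t" unfolding bend_def by simp
qed

lemma bend_diff_le: "0 \<le> b \<Longrightarrow> b \<le> a \<Longrightarrow> bend a - bend b \<le> a - b"
  unfolding bend_def using powr_mono2[of "3/2" "min b 1" "min a 1"] by simp

lemma bend_lipschitz:
  assumes "0 \<le> a" "0 \<le> b"
  shows "\<bar>bend a - bend b\<bar> \<le> 2 * \<bar>a - b\<bar>"
proof -
  have *: "\<bar>bend a - bend b\<bar> \<le> 2 * (a - b)" if "0 \<le> b" "b \<le> a" for a b
  proof -
    define p q where "p = sqrt (min a 1)" and "q = sqrt (min b 1)"
    have pq: "0 \<le> q" "q \<le> p" "p \<le> 1" using that by (auto simp: p_def q_def)
    have "(min a 1) powr (3/2) - (min b 1) powr (3/2) = p ^ 3 - q ^ 3"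
      using that by (simp add: powr_three_halves p_def q_def)
    also have "\<dots> = (p - q) * (p * p + p * q + q * q)" by (simp add: power3_eq_cube algebra_simps)
    also have "\<dots> \<le> (p - q) * (2 * (p + q))"
    proof (rule mult_left_mono)
      have "p * p \<le> p" "p * q \<le> q" "q * q \<le> q"
        using pq mult_left_mono[of p 1 p] mult_right_mono[of p 1 q] mult_right_mono[of q 1 q] by simp_all
      then have "p * p + p * q + q * q \<le> p + q + q" by (intro add_mono)
      also have "\<dots> \<le> 2 * (p + q)" using pq by simp
      finally show "p * p + p * q + q * q \<le> 2 * (p + q)" .
    qed (use pq in simp)
    also have "\<dots> = 2 * (p\<^sup>2 - q\<^sup>2)" by (simp add: power2_eq_square algebra_simps)
    also have "p\<^sup>2 - q\<^sup>2 = min a 1 - min b 1" using that by (simp add: p_def q_def)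
    finally have 1: "(min a 1) powr (3/2) - (min b 1) powr (3/2) \<le> 2 * (a - b)"
      using that by (auto simp: min_def split: if_splits)
    have 2: "0 \<le> (min a 1) powr (3/2) - (min b 1) powr (3/2)"
      using powr_mono2[of "3/2" "min b 1" "min a 1"] that by simp
    from 1 2 that show ?thesis unfolding bend_def by (simp add: abs_le_iff)
  qed
  show ?thesis
  proof (cases "b \<le> a")
    case True then show ?thesis using *[of b a] assms by simp
  next
    case False then show ?thesis using *[of a b] assms by (simp add: abs_minus_commute)
  qed
qed

text \<open>
  By concavity \<open>bend\<close> lies below its tangent at \<open>t0\<close> on \<open>[0, 1]\<close>, and at \<open>0\<close> the gap is
  \<open>sqrt t0 ^ 3 / 4\<close>. Beyond \<open>1\<close>, where \<open>bend\<close> continues with slope one, the tangent may lie below it,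
  which is compensated by subtracting \<open>t\<close>.
\<close>

lemma bend_tangent:
  assumes t0: "0 < t0" "t0 \<le> 1" and t: "0 \<le> t"
  shows "(1 - 3/4 * sqrt t0) * (t0 - t) + (if t = 0 then sqrt t0 ^ 3 / 4 else 0)
      - (if 1 < t then t else 0) \<le> bend t0 - bend t"
proof -
  define q p where "q = sqrt t0" and "p = sqrt t"
  have q: "0 < q" "q \<le> 1" "t0 = q\<^sup>2" using t0 by (auto simp: q_def)
  have p: "0 \<le> p" "t = p\<^sup>2" using t by (auto simp: p_def)
  have b0: "bend t0 = q\<^sup>2 - q ^ 3 / 2"
    using t0 by (simp add: bend_def powr_three_halves q_def min_absorb1)
  show ?thesis
  proof (cases "t \<le> 1")
    case True
    then have b: "bend t = p\<^sup>2 - p ^ 3 / 2"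
      using t by (simp add: bend_def powr_three_halves p_def min_absorb1)
    \<comment> \<open>Twice the gap between \<open>bend\<close> and its tangent, as a polynomial in the square roots.\<close>
    have id: "p ^ 3 - q ^ 3 - 3/2 * q * (p\<^sup>2 - q\<^sup>2) = (p - q)\<^sup>2 * (p + q / 2)"
      by (simp add: power2_eq_square power3_eq_cube field_simps)
    have "(p - q)\<^sup>2 * (p + q / 2) \<ge> (if t = 0 then q ^ 3 / 2 else 0)"
      using p q by (auto simp: power3_eq_cube power2_eq_square)
    then have "(if t = 0 then q ^ 3 / 4 else 0) \<le> (p ^ 3 - q ^ 3 - 3/2 * q * (p\<^sup>2 - q\<^sup>2)) / 2"
      unfolding id by (auto split: if_splits)
    moreover have "(1 - 3/4 * q) * (q\<^sup>2 - p\<^sup>2) + (p ^ 3 - q ^ 3 - 3/2 * q * (p\<^sup>2 - q\<^sup>2)) / 2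
       = (q\<^sup>2 - q ^ 3 / 2) - (p\<^sup>2 - p ^ 3 / 2)"
      by (simp add: field_simps power2_eq_square power3_eq_cube)
    ultimately have "(1 - 3/4 * q) * (q\<^sup>2 - p\<^sup>2) + (if t = 0 then q ^ 3 / 4 else 0) - 0 \<le> (q\<^sup>2 - q ^ 3 / 2) - (p\<^sup>2 - p ^ 3 / 2)"
      by linarith
    then show ?thesis unfolding b b0 using True
      by (auto simp: q_def[symmetric] q(3)[symmetric] p(2)[symmetric] split: if_splits)
  next
    case False
    then have b: "bend t = t - 1/2" by (simp add: bend_def)
    have "(1 - 3/4 * q) * (t0 - t) - t \<le> t0 - q ^ 3 / 2 - (t - 1/2)"
    proof -
      have "3/4 * q * t \<le> 1 * t" using q False by (intro mult_right_mono) auto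
      moreover have "q ^ 3 \<le> 1" using q by (simp add: power_le_one)
      moreover have "0 \<le> q * t0" using q t0 by simp
      moreover have "(1 - 3/4 * q) * (t0 - t) = t0 - t - 3/4 * (q * t0) + 3/4 * q * t" by (simp add: field_simps)
      ultimately show ?thesis by linarith
    qed
    then show ?thesis unfolding b b0 q_def[symmetric] using False by (simp add: q(3))
  qed
qed

lemma frac_lap_shift:
  assumes [measurable]: "\<phi> \<in> borel_measurable borel"
  shows "frac_lap s \<phi> x = (\<integral>z. (\<phi> x - \<phi> (x + z)) * frac_kernel s z \<partial>lborel)"
    and "integrable lborel (\<lambda>y. (\<phi> x - \<phi> y) * frac_kernel s (x - y)) \<longleftrightarrow>
      integrable lborel (\<lambda>z. (\<phi> x - \<phi> (x + z)) * frac_kernel s z)"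
proof -
  have m: "(\<lambda>y. (\<phi> x - \<phi> y) * frac_kernel s (x - y)) \<in> borel_measurable borel" by measurable
  show "frac_lap s \<phi> x = (\<integral>z. (\<phi> x - \<phi> (x + z)) * frac_kernel s z \<partial>lborel)"
    using integral_shift(1)[OF m, of x] by (simp add: frac_lap_def)
  show "integrable lborel (\<lambda>y. (\<phi> x - \<phi> y) * frac_kernel s (x - y)) \<longleftrightarrow>
      integrable lborel (\<lambda>z. (\<phi> x - \<phi> (x + z)) * frac_kernel s z)"
    using integral_shift(2)[OF m, of x] by simp
qed

text \<open>
  Here \<open>a\<close> is the distance to the ball, \<open>b\<close> that to the half-space through the tangent plane, \<open>d\<close> the distance of the
  base point and \<open>r\<close> the length of the increment. The exponent \<open>s / 4\<close> is an arbitrary small one: it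
  makes the right-hand side integrable at the origin, and the price \<open>d powr (- (s / 4))\<close> is below
  the gain \<open>d powr (- (s / 2))\<close> of the barrier.
\<close>

lemma barrier_error:
  fixes a b d r Q s n :: real
  assumes s: "0 < s" "s < 1/2" and ab: "0 \<le> b" "b \<le> a" and q: "a - b \<le> Q * r\<^sup>2" "0 \<le> Q"
    and l: "a - b \<le> 2 * r" "d - r \<le> a" and d: "0 < d" "d \<le> 1" and r: "0 < r"
  shows "(a powr s - b powr s) * r powr (- 2 * s - n) \<le>
    4 * (1 + Q) * d powr (- (s / 4)) * (if r < 1 then r powr (s / 4 - n) else r powr (- s - n))"
proof -
  have d1: "1 \<le> d powr (- (s / 4))" using d s powr_mono2'[of "- (s/4)" d 1] by simp
  have two: "2 powr t \<le> (2::real)" if "t \<le> 1" for t using powr_mono[of t 1 "2::real"] that by simp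
  \<comment> \<open>Subadditivity of the power and the linear bound on \<open>a - b\<close> suffice for \<open>1 \<le> r\<close>, subadditivity
     and the quadratic bound for \<open>d / 2 \<le> r < 1\<close>; for smaller \<open>r\<close> the point stays at distance at
     least \<open>d / 2\<close> and the derivative of the power is bounded.\<close>
  consider "1 \<le> r" | "r < 1" "d \<le> 2 * r" | "r < 1" "2 * r < d" by linarith
  then show ?thesis
  proof cases
    case 1
    have "a powr s - b powr s \<le> (a - b) powr s" using s ab by (intro powr_diff_le_powr) auto
    also have "\<dots> \<le> (2 * r) powr s" using s ab l by (intro powr_mono2) auto
    also have "\<dots> \<le> 2 * r powr s" using r two[of s] s by (simp add: powr_mult)
    finally have "(a powr s - b powr s) * r powr (- 2 * s - n) \<le> (2 * r powr s) * r powr (- 2 * s - n)"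
      by (rule mult_right_mono) simp
    also have "\<dots> = 2 * r powr (- s - n)" by (simp add: powr_add[symmetric])
    also have "\<dots> \<le> 4 * (1 + Q) * d powr (- (s / 4)) * r powr (- s - n)"
    proof (rule mult_right_mono)
      have "2 * 1 \<le> 4 * (1 + Q) * d powr (- (s / 4))" using d1 q by (intro mult_mono) auto
      then show "2 \<le> 4 * (1 + Q) * d powr (- (s / 4))" by simp
    qed simp
    finally show ?thesis using 1 by simp
  next
    case 2
    have "a powr s - b powr s \<le> (a - b) powr s" using s ab by (intro powr_diff_le_powr) auto
    also have "\<dots> \<le> (Q * r\<^sup>2) powr s" using s ab q by (intro powr_mono2) auto
    also have "\<dots> = Q powr s * r powr (2 * s)"
      using r q by (simp add: powr_mult powr_powr flip: powr_numeral)
    also have "\<dots> \<le> (1 + Q) * r powr (2 * s)"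
    proof (rule mult_right_mono)
      show "Q powr s \<le> 1 + Q"
      proof (cases "Q \<le> 1")
        case True
        then have "Q powr s \<le> 1 powr s" using q s by (intro powr_mono2) auto
        then show ?thesis using q by simp
      next
        case False
        then have "Q powr s \<le> Q powr 1" using s by (intro powr_mono) auto
        then show ?thesis using False by simp
      qed
    qed simp
    finally have "(a powr s - b powr s) * r powr (- 2 * s - n) \<le> ((1 + Q) * r powr (2 * s)) * r powr (- 2 * s - n)"
      by (rule mult_right_mono) simp
    also have "\<dots> = (1 + Q) * (r powr (- (s / 4)) * r powr (s / 4 - n))" by (simp add: powr_add[symmetric])
    also have "\<dots> \<le> (1 + Q) * ((2 * d powr (- (s / 4))) * r powr (s / 4 - n))"
    proof (intro mult_left_mono mult_right_mono)
      have "r powr (- (s / 4)) \<le> (d / 2) powr (- (s / 4))" using 2 d s by (intro powr_mono2') auto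
      also have "\<dots> = 2 powr (s / 4) * d powr (- (s / 4))"
        using d by (simp add: powr_divide powr_minus field_simps)
      also have "\<dots> \<le> 2 * d powr (- (s / 4))" using s by (intro mult_right_mono two) auto
      finally show "r powr (- (s / 4)) \<le> 2 * d powr (- (s / 4))" .
    qed (use q in auto)
    also have "\<dots> \<le> 4 * (1 + Q) * d powr (- (s / 4)) * r powr (s / 4 - n)"
    proof -
      define P where "P = d powr (- (s / 4)) * r powr (s / 4 - n)"
      have "(1 + Q) * (2 * P) \<le> (1 + Q) * (4 * P)" using q by (intro mult_left_mono) (auto simp: P_def)
      then show ?thesis by (simp add: P_def algebra_simps)
    qed
    finally show ?thesis using 2 by simp
  next
    case 3
    have a: "d / 2 \<le> a" "0 < a" using 3 l d by auto
    have "a powr s - b powr s \<le> a powr (s - 1) * (a - b)" using s ab a by (intro powr_diff_le_linear) auto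
    also have "\<dots> \<le> (d / 2) powr (s - 1) * (Q * r\<^sup>2)"
      using s ab a d q by (intro mult_mono powr_mono2') auto
    also have "\<dots> = Q * (d / 2) powr (s - 1) * r powr 2" using r by (simp add: powr_numeral)
    finally have "(a powr s - b powr s) * r powr (- 2 * s - n) \<le> (Q * (d / 2) powr (s - 1) * r powr 2) * r powr (- 2 * s - n)"
      by (rule mult_right_mono) simp
    also have "\<dots> = Q * ((d / 2) powr (s - 1) * r powr (2 - 9 * s / 4)) * r powr (s / 4 - n)"
    proof -
      have "(d / 2) powr (s - 1) * r powr 2 * r powr (- 2 * s - n) = ((d / 2) powr (s - 1) * r powr (2 - 9 * s / 4)) * r powr (s / 4 - n)"
        by (simp add: powr_add[symmetric] mult.assoc algebra_simps)
      then show ?thesis by (simp only: mult.assoc)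
    qed
    also have "\<dots> \<le> Q * 1 * r powr (s / 4 - n)"
    proof (intro mult_left_mono mult_right_mono)
      have "(d / 2) powr (s - 1) * r powr (2 - 9 * s / 4) \<le> (d / 2) powr (s - 1) * (d / 2) powr (2 - 9 * s / 4)"
        using 3 r s by (intro mult_left_mono powr_mono2) auto
      also have "\<dots> = (d / 2) powr (1 - 5 * s / 4)" by (simp add: powr_add[symmetric])
      also have "\<dots> \<le> 1 powr (1 - 5 * s / 4)" using d s by (intro powr_mono2) auto
      finally show "(d / 2) powr (s - 1) * r powr (2 - 9 * s / 4) \<le> 1" by simp
    qed (use q in auto)
    also have "\<dots> \<le> 4 * (1 + Q) * d powr (- (s / 4)) * r powr (s / 4 - n)"
    proof (rule mult_right_mono)
      have "Q * 1 \<le> (4 * (1 + Q)) * d powr (- (s / 4))" using d1 q by (intro mult_mono) auto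
      then show "Q * 1 \<le> 4 * (1 + Q) * d powr (- (s / 4))" by simp
    qed simp
    finally show ?thesis using 3 by simp
  qed
qed

text \<open>
  The half-space beyond the tangent plane lies outside the ball, which gives \<open>b \<le> a\<close>. For the quadratic
  bound, \<open>N = \<bar>w + z\<bar>\<close> and its component \<open>P\<close> along \<open>e\<close> satisfy \<open>N\<^sup>2 - P\<^sup>2 \<le> \<bar>z\<bar>\<^sup>2\<close> by Pythagoras; the
  difference \<open>a - b\<close> is obtained after truncation at \<open>\<rho>\<close> and division by a sum that is at least \<open>2 \<rho>\<close>.
\<close>

lemma sphere_versus_tangent_plane:
  fixes w z e :: "'a::euclidean_space"
  assumes \<rho>: "0 < \<rho>" and d: "0 < d" and w: "w = (\<rho> + d) *\<^sub>R e" and e: "norm e = 1"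
  defines "a \<equiv> max 0 (norm (w + z) - \<rho>)" and "b \<equiv> max 0 (d + z \<bullet> e)"
  shows "b \<le> a" "a - b \<le> 2 * norm z" "d - norm z \<le> a" "a - b \<le> 2 / \<rho> * (norm z)\<^sup>2"
proof -
  define N P where "N = norm (w + z)" and "P = (w + z) \<bullet> e"
  have ee: "e \<bullet> e = 1" using e by (simp add: dot_square_norm)
  have P: "P = \<rho> + d + z \<bullet> e" by (simp add: P_def w inner_add_left ee)
  have PN: "P \<le> N" using norm_cauchy_schwarz[of "w + z" e] e by (simp add: P_def N_def)
  have ze: "\<bar>z \<bullet> e\<bar> \<le> norm z" using Cauchy_Schwarz_ineq2[of z e] e by simp
  have nw: "norm w = \<rho> + d" using \<rho> d e by (simp add: w)
  have N1: "N \<le> \<rho> + d + norm z" using norm_triangle_ineq[of w z] nw by (simp add: N_def)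
  have N2: "\<rho> + d - norm z \<le> N" using norm_diff_ineq[of w z] nw by (simp add: N_def)
  show "b \<le> a" using PN P by (auto simp: a_def b_def N_def[symmetric])
  show "a - b \<le> 2 * norm z" using N1 ze d by (auto simp: a_def b_def N_def[symmetric] max_def split: if_splits)
  show "d - norm z \<le> a" using N2 by (auto simp: a_def N_def[symmetric])
  have NP: "N\<^sup>2 - P\<^sup>2 \<le> (norm z)\<^sup>2"
  proof -
    have eq: "w + z - P *\<^sub>R e = z - (z \<bullet> e) *\<^sub>R e" unfolding P by (simp add: w algebra_simps)
    moreover have pyth: "(norm (X - (X \<bullet> e) *\<^sub>R e))\<^sup>2 = (norm X)\<^sup>2 - (X \<bullet> e)\<^sup>2" for X
    proof -
      have "(norm (X - (X \<bullet> e) *\<^sub>R e))\<^sup>2 = X \<bullet> X - (X \<bullet> e) * (X \<bullet> e) - (X \<bullet> e) * (e \<bullet> X) + (X \<bullet> e) * ((X \<bullet> e) * (e \<bullet> e))"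
        unfolding power2_norm_eq_inner by (simp add: inner_diff_left inner_diff_right right_diff_distrib)
      then show ?thesis by (simp add: ee inner_commute[of e X] power2_eq_square power2_norm_eq_inner[unfolded power2_eq_square])
    qed
    moreover have "(norm (w + z - P *\<^sub>R e))\<^sup>2 = N\<^sup>2 - P\<^sup>2" using pyth[of "w + z"] by (simp only: N_def P_def)
    moreover have "(norm (z - (z \<bullet> e) *\<^sub>R e))\<^sup>2 = (norm z)\<^sup>2 - (z \<bullet> e)\<^sup>2" by (rule pyth)
    ultimately have "N\<^sup>2 - P\<^sup>2 = (norm z)\<^sup>2 - (z \<bullet> e)\<^sup>2" by (simp only: eq)
    then show ?thesis using zero_le_power2[of "z \<bullet> e"] by linarith
  qed
  define A B where "A = max N \<rho>" and "B = max P \<rho>"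
  have aA: "a = A - \<rho>" "b = B - \<rho>" by (auto simp: a_def b_def A_def B_def N_def P)
  have AB2: "A\<^sup>2 - B\<^sup>2 \<le> 4 * (norm z)\<^sup>2"
  proof (cases "N \<le> \<rho>")
    case True
    then show ?thesis using PN by (simp add: A_def B_def max_def)
  next
    case False
    show ?thesis
    proof (cases "- \<rho> \<le> P")
      case True
      have "P\<^sup>2 \<le> B\<^sup>2" using True \<rho> by (intro power2_le_iff_abs_le[THEN iffD2]) (auto simp: B_def max_def)
      moreover have "A\<^sup>2 = N\<^sup>2" using False by (simp add: A_def)
      ultimately show ?thesis using NP zero_le_power2[of "norm z"] by linarith
    next
      case P2: False
      then have "\<rho> + d \<le> norm z" using P ze \<rho> by linarith
      then have "N \<le> 2 * norm z" using N1 by simp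
      then have "N\<^sup>2 \<le> (2 * norm z)\<^sup>2" by (intro power_mono) (auto simp: N_def)
      moreover have "(2 * norm z)\<^sup>2 = 4 * (norm z)\<^sup>2" by (simp add: power_mult_distrib)
      moreover have "A\<^sup>2 = N\<^sup>2" using False by (simp add: A_def)
      ultimately show ?thesis using zero_le_power2[of B] by linarith
    qed
  qed
  have "(a - b) * (2 * \<rho>) \<le> (a - b) * (A + B)"
    using \<open>b \<le> a\<close> by (intro mult_left_mono) (auto simp: A_def B_def)
  also have "\<dots> = A\<^sup>2 - B\<^sup>2" by (simp add: aA power2_eq_square algebra_simps)
  finally have "(a - b) * (2 * \<rho>) \<le> 4 * (norm z)\<^sup>2" using AB2 by linarith
  then show "a - b \<le> 2 / \<rho> * (norm z)\<^sup>2" using \<rho> by (simp add: field_simps)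
qed

text \<open>
  At distance at least \<open>\<tau>\<close> from the ball the barrier is Lipschitz with a constant of order
  \<open>\<tau> powr (s - 1)\<close>, and globally it grows at most like the \<open>s\<close>-th power of the increment. The bound
  degenerates as \<open>\<tau>\<close> tends to \<open>0\<close>, but is used only qualitatively.
\<close>

lemma abs_lap_ball_barrier:
  fixes x c :: "real ^ 'n"
  assumes s: "0 < s" "s < 1/2" and \<tau>: "0 < \<tau>" and x: "\<rho> + \<tau> \<le> norm (x - c)"
  shows "abs_lap s (ball_barrier s c \<rho>) x \<le>
    ennreal (2 * (1 + \<tau> powr (s - 1)) * (\<integral>z. two_sided_powr (1 - 2 * s) s (z :: real ^ 'n) \<partial>lborel))"
proof (rule abs_lap_le)
  fix y
  define d b r where "d = max 0 (norm (x - c) - \<rho>)" and "b = max 0 (norm (y - c) - \<rho>)" and "r = norm (x - y)"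
  have d: "\<tau> \<le> d" "0 < d" using x \<tau> by (auto simp: d_def)
  have b: "0 \<le> b" by (simp add: b_def)
  have r: "\<bar>d - b\<bar> \<le> r"
  proof -
    have "\<bar>norm (x - c) - norm (y - c)\<bar> \<le> norm (x - y)" using norm_triangle_ineq3[of "x - c" "y - c"] by simp
    then show ?thesis by (auto simp: d_def b_def r_def)
  qed
  have 1: "\<bar>d powr s - b powr s\<bar> \<le> \<tau> powr (s - 1) * r"
  proof (cases "b \<le> d")
    case True
    have "d powr s - b powr s \<le> d powr (s - 1) * (d - b)" using s d b True by (intro powr_diff_le_linear) auto
    also have "\<dots> \<le> \<tau> powr (s - 1) * r" using s d \<tau> r True by (intro mult_mono powr_mono2') auto
    finally show ?thesis using powr_mono2[of s b d] s b True by simp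
  next
    case False
    have "b powr s - d powr s \<le> b powr (s - 1) * (b - d)" using s d b False by (intro powr_diff_le_linear) auto
    also have "\<dots> \<le> \<tau> powr (s - 1) * r" using s d \<tau> r False by (intro mult_mono powr_mono2') auto
    finally show ?thesis using powr_mono2[of s d b] s d False by simp
  qed
  have 2: "\<bar>d powr s - b powr s\<bar> \<le> r powr s"
  proof (cases "b \<le> d")
    case True
    have "d powr s - b powr s \<le> (d - b) powr s" using s d b True by (intro powr_diff_le_powr) auto
    also have "\<dots> \<le> r powr s" using s r True by (intro powr_mono2) auto
    finally show ?thesis using powr_mono2[of s b d] s b True by simp
  next
    case False
    have "b powr s - d powr s \<le> (b - d) powr s" using s d b False by (intro powr_diff_le_powr) auto
    also have "\<dots> \<le> r powr s" using s r False by (intro powr_mono2) auto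
    finally show ?thesis using powr_mono2[of s d b] s d False by simp
  qed
  have 3: "\<bar>ball_barrier s c \<rho> x - ball_barrier s c \<rho> y\<bar> \<le> 2 * \<bar>d powr s - b powr s\<bar>"
    unfolding ball_barrier_def d_def b_def by (rule bend_lipschitz) auto
  show "\<bar>ball_barrier s c \<rho> x - ball_barrier s c \<rho> y\<bar> * frac_kernel s (x - y)
    \<le> 2 * (1 + \<tau> powr (s - 1)) * two_sided_powr (1 - 2 * s) s (x - y)"
  proof (cases "x = y")
    case False
    then have r0: "0 < r" by (simp add: r_def)
    show ?thesis
    proof (cases "r < 1")
      case True
      have "\<bar>ball_barrier s c \<rho> x - ball_barrier s c \<rho> y\<bar> * frac_kernel s (x - y)
         \<le> (2 * (\<tau> powr (s - 1) * r)) * r powr (- 2 * s - real CARD('n))"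
        using 3 1 unfolding frac_kernel_powr r_def[symmetric] by (intro mult_right_mono) auto
      also have "\<dots> = 2 * \<tau> powr (s - 1) * r powr (1 - 2 * s - real CARD('n))"
        using r0 by (simp add: powr_mult_base mult.assoc) (simp add: algebra_simps)
      also have "\<dots> \<le> 2 * (1 + \<tau> powr (s - 1)) * r powr (1 - 2 * s - real CARD('n))"
        by (intro mult_right_mono) auto
      finally show ?thesis using True by (simp add: two_sided_powr_def r_def)
    next
      case False
      have "\<bar>ball_barrier s c \<rho> x - ball_barrier s c \<rho> y\<bar> * frac_kernel s (x - y)
         \<le> (2 * r powr s) * r powr (- 2 * s - real CARD('n))"
        using 3 2 unfolding frac_kernel_powr r_def[symmetric] by (intro mult_right_mono) auto
      also have "\<dots> = 2 * r powr (- s - real CARD('n))" by (simp add: powr_add[symmetric])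
      also have "\<dots> \<le> 2 * (1 + \<tau> powr (s - 1)) * r powr (- s - real CARD('n))"
        by (intro mult_right_mono) auto
      finally show ?thesis using False by (simp add: two_sided_powr_def r_def)
    qed
  qed (simp add: two_sided_powr_nonneg)
qed (use s in auto)

lemma ball_barrier_bounds:
  assumes "0 < s" "s < 1"
  shows "0 \<le> ball_barrier s c \<rho> x"
    and "ball_barrier s c \<rho> x \<le> (max 0 (norm (x - c) - \<rho>)) powr s"
    and "\<rho> + r \<le> norm (x - c) \<Longrightarrow> 0 < r \<Longrightarrow> min (r powr s) 1 / 2 \<le> ball_barrier s c \<rho> x"
proof -
  note b = bend_bounds[of "(max 0 (norm (x - c) - \<rho>)) powr s", folded ball_barrier_def, OF powr_ge_zero]
  show "ball_barrier s c \<rho> x \<le> (max 0 (norm (x - c) - \<rho>)) powr s" by (rule b(2))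
  have "0 \<le> min ((max 0 (norm (x - c) - \<rho>)) powr s) 1 / 2" by simp
  then show "0 \<le> ball_barrier s c \<rho> x" using b(1) by linarith
  assume r: "\<rho> + r \<le> norm (x - c)" "0 < r"
  then have "r powr s \<le> (max 0 (norm (x - c) - \<rho>)) powr s" using assms by (intro powr_mono2) auto
  then have "min (r powr s) 1 / 2 \<le> min ((max 0 (norm (x - c) - \<rho>)) powr s) 1 / 2" by auto
  then show "min (r powr s) 1 / 2 \<le> ball_barrier s c \<rho> x" using b(1) by linarith
qed

text \<open>
  With \<open>b\<close> and \<open>a\<close> the distances to the tangent half-space and to the ball,
  the increment \<open>bend (d powr s) - bend (a powr s)\<close> is that of the flat profile minus the error
  \<open>bend (a powr s) - bend (b powr s)\<close>. By \<open>bend_tangent\<close> the former is a multiple of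
  the increment of the \<open>s\<close>-harmonic profile, whose integral vanishes, plus the concavity gap
  \<open>d powr (3/2 s) / 4\<close> on the half-space where the flat profile is zero; that half-space has mass
  of order \<open>d powr (- 2 s)\<close>. The error is integrated with \<open>barrier_error\<close>.
\<close>

lemma frac_lap_ball_barrier:
  fixes x c :: "real ^ 'n"
  assumes s: "0 < s" "s < 1/2" and \<rho>: "0 < \<rho>0" "\<rho>0 \<le> \<rho>"
    and x: "norm (x - c) = \<rho> + d" and d: "0 < d" "d \<le> 1/2"
    and \<kappa>: "0 \<le> \<kappa>" "\<And>e :: real ^ 'n. norm e = 1 \<Longrightarrow> ennreal \<kappa> \<le> halfspace_mass s e"
  defines "T \<equiv> \<integral>z. two_sided_powr (s / 4) s (z :: real ^ 'n) \<partial>lborel"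
  shows "\<kappa> / 4 * d powr (- (s / 2)) - (4 + 4 * (1 + 2 / \<rho>0) * d powr (- (s / 4))) * T
     \<le> frac_lap s (ball_barrier s c \<rho>) x"
proof -
  define e where "e = (1 / (\<rho> + d)) *\<^sub>R (x - c)"
  have e: "norm e = 1" using \<rho> d x by (simp add: e_def)
  have w: "x - c = (\<rho> + d) *\<^sub>R e" using \<rho> d by (simp add: e_def)
  define a b where "a = (\<lambda>z. max 0 (norm (x + z - c) - \<rho>))" and "b = (\<lambda>z. max 0 (d + z \<bullet> e))"
  have geo: "b z \<le> a z" "a z - b z \<le> 2 * norm z" "d - norm z \<le> a z" "a z - b z \<le> 2 / \<rho> * (norm z)\<^sup>2" for z
    using sphere_versus_tangent_plane[OF _ d(1) w e, of z] \<rho> by (auto simp: a_def b_def algebra_simps)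
  have b0: "0 \<le> b z" for z by (simp add: b_def)
  define t0 where "t0 = d powr s"
  have t0: "0 < t0" "t0 \<le> 1" using d s powr_mono2[of s d 1] by (auto simp: t0_def)
  define A where "A = 4 * (1 + 2 / \<rho>0) * d powr (- (s / 4))"
  have A: "0 \<le> A" using \<rho> by (simp add: A_def)
  define W where "W = (two_sided_powr (s / 4) s :: real ^ 'n \<Rightarrow> real)"
  have W: "integrable lborel W" unfolding W_def using s by (intro integrable_two_sided_powr) auto
  have W0: "0 \<le> W z" for z by (simp add: W_def)
  \<comment> \<open>The integrable minorant of the increments of the barrier: harmonic part, concavity gap,
     correction of \<open>bend_tangent\<close> for large \<open>b\<close>, curvature error.\<close>
  define g where "g = (\<lambda>z :: real ^ 'n. (1 - 3/4 * sqrt t0) * ((d powr s - (b z) powr s) * frac_kernel s z)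
      + sqrt t0 ^ 3 / 4 * (frac_kernel s z * indicator {z. d < z \<bullet> (- e)} z) - 4 * W z - A * W z)"
  have flat: "integrable lborel (\<lambda>z. (d powr s - (b z) powr s) * frac_kernel s z)"
    "(\<integral>z. (d powr s - (b z) powr s) * frac_kernel s z \<partial>lborel) = 0"
    using flat_profile[OF s e d(1)] by (simp_all add: b_def)
  have e': "norm (- e) = 1" using e by simp
  have H: "(\<integral>\<^sup>+z. ennreal (frac_kernel s z * indicator {z. d < z \<bullet> (- e)} z) \<partial>lborel)
     = ennreal (d powr (- 2 * s)) * halfspace_mass s (- e)"
    using kernel_halfspace[OF d(1), of s "- e"] by (simp add: ennreal_mult'' ennreal_indicator)
  have Hi: "integrable lborel (\<lambda>z. frac_kernel s z * indicator {z. d < z \<bullet> (- e)} z)"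
  proof (rule integrableI_bounded)
    have "(\<integral>\<^sup>+z. ennreal (norm (frac_kernel s z * indicator {z. d < z \<bullet> (- e)} z)) \<partial>lborel)
        = (\<integral>\<^sup>+z. ennreal (frac_kernel s z * indicator {z. d < z \<bullet> (- e)} z) \<partial>lborel)"
      by (intro nn_integral_cong) (simp add: abs_mult)
    also have "\<dots> < \<infinity>" unfolding H using halfspace_mass_finite[OF e' s(1)] by (simp add: ennreal_mult_less_top)
    finally show "(\<integral>\<^sup>+z. ennreal (norm (frac_kernel s z * indicator {z. d < z \<bullet> (- e)} z)) \<partial>lborel) < \<infinity>" .
  qed measurable
  have Hl: "d powr (- 2 * s) * \<kappa> \<le> (\<integral>z. frac_kernel s z * indicator {z. d < z \<bullet> (- e)} z \<partial>lborel)"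
  proof -
    have "ennreal (d powr (- 2 * s) * \<kappa>) \<le> ennreal (d powr (- 2 * s)) * halfspace_mass s (- e)"
      using \<kappa>(2)[OF e'] \<kappa>(1) by (simp add: ennreal_mult' mult_left_mono)
    also have "\<dots> = ennreal (\<integral>z. frac_kernel s z * indicator {z. d < z \<bullet> (- e)} z \<partial>lborel)"
      unfolding H[symmetric] by (intro nn_integral_eq_integral Hi) (auto intro!: AE_I2)
    finally show ?thesis
      by (subst (asm) ennreal_le_iff) (auto intro!: integral_nonneg_AE AE_I2)
  qed
  have gi: "integrable lborel g"
    unfolding g_def using flat(1) Hi W
    by (intro Bochner_Integration.integrable_diff Bochner_Integration.integrable_add integrable_mult_right)
  have "integral\<^sup>L lborel g = sqrt t0 ^ 3 / 4 * (\<integral>z. frac_kernel s z * indicator {z. d < z \<bullet> (- e)} z \<partial>lborel) - 4 * T - A * T"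
    unfolding g_def using flat Hi W by (simp add: T_def W_def)
  moreover have "\<kappa> / 4 * d powr (- (s / 2)) \<le> sqrt t0 ^ 3 / 4 * (\<integral>z. frac_kernel s z * indicator {z. d < z \<bullet> (- e)} z \<partial>lborel)"
  proof -
    have "sqrt t0 ^ 3 = t0 powr (3/2)" using t0 by (simp add: powr_three_halves)
    also have "\<dots> = d powr (3/2 * s)" by (simp add: t0_def powr_powr mult.commute)
    finally have t3: "sqrt t0 ^ 3 = d powr (3/2 * s)" .
    have "d powr (3/2 * s) * d powr (- 2 * s) = d powr (- (s / 2))" by (simp add: powr_add[symmetric])
    then have "\<kappa> / 4 * d powr (- (s / 2)) = sqrt t0 ^ 3 / 4 * (d powr (- 2 * s) * \<kappa>)"
      unfolding t3 by (simp add: algebra_simps)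
    also have "\<dots> \<le> sqrt t0 ^ 3 / 4 * (\<integral>z. frac_kernel s z * indicator {z. d < z \<bullet> (- e)} z \<partial>lborel)"
      using t0 by (intro mult_left_mono Hl) auto
    finally show ?thesis .
  qed
  ultimately have "\<kappa> / 4 * d powr (- (s / 2)) - (4 + A) * T \<le> integral\<^sup>L lborel g"
    by (simp add: algebra_simps)
  also have "\<dots> \<le> (\<integral>z. (ball_barrier s c \<rho> x - ball_barrier s c \<rho> (x + z)) * frac_kernel s z \<partial>lborel)"
  proof (rule integral_mono[OF gi])
    have "integrable lborel (\<lambda>y. (ball_barrier s c \<rho> x - ball_barrier s c \<rho> y) * frac_kernel s (x - y))"
      using abs_lap_ball_barrier[OF s d(1), of \<rho> x c] x
      by (intro frac_lap_integrable[OF ball_barrier_measurable]) simp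
    then show "integrable lborel (\<lambda>z. (ball_barrier s c \<rho> x - ball_barrier s c \<rho> (x + z)) * frac_kernel s z)"
      by (subst (asm) frac_lap_shift(2)) auto
    fix z
    show "g z \<le> (ball_barrier s c \<rho> x - ball_barrier s c \<rho> (x + z)) * frac_kernel s z"
    proof (cases "z = 0")
      case True
      then show ?thesis using mult_nonneg_nonneg[OF A W0[of 0]] W0[of 0] by (simp add: g_def frac_kernel_def)
    next
      case False
      define r where "r = norm z"
      have r: "0 < r" using False by (simp add: r_def)
      have Wr: "W z = (if r < 1 then r powr (s / 4 - real CARD('n)) else r powr (- s - real CARD('n)))"
        by (simp add: W_def two_sided_powr_def r_def)
      have k: "frac_kernel s z = r powr (- 2 * s - real CARD('n))" by (simp add: frac_kernel_powr r_def)
      have err: "((a z) powr s - (b z) powr s) * frac_kernel s z \<le> A * W z"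
        unfolding Wr k A_def
      proof (rule barrier_error[OF s b0 geo(1) _ _ geo(2)[of z, folded r_def] geo(3)[of z, folded r_def] d(1) _ r])
        have "2 / \<rho> \<le> 2 / \<rho>0" using \<rho> by (intro divide_left_mono) auto
        then show "a z - b z \<le> 2 / \<rho>0 * r\<^sup>2"
          using geo(4)[of z] mult_right_mono[of "2/\<rho>" "2/\<rho>0" "r\<^sup>2"] by (simp add: r_def)
      qed (use \<rho> d in auto)
      have far: "(if 1 < (b z) powr s then (b z) powr s else 0) * frac_kernel s z \<le> 4 * W z"
      proof (cases "1 < (b z) powr s")
        case True
        have "1 < b z"
        proof (rule ccontr)
          assume "\<not> 1 < b z"
          then have "(b z) powr s \<le> 1 powr s" using b0 s by (intro powr_mono2) auto
          then show False using True by simp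
        qed
        then have "1 < d + z \<bullet> e" by (simp add: b_def max_def split: if_splits)
        moreover have "z \<bullet> e \<le> r" using norm_cauchy_schwarz[of z e] e by (simp add: r_def)
        ultimately have r2: "1/2 < r" "b z \<le> 2 * r" using d by (auto simp: b_def)
        have two: "2 powr t \<le> (2::real)" if "t \<le> 1" for t using powr_mono[of t 1 "2::real"] that by simp
        have "(b z) powr s \<le> (2 * r) powr s" using b0 r2 s by (intro powr_mono2) auto
        also have "\<dots> \<le> 2 * r powr s" using r two[of s] s by (simp add: powr_mult)
        finally have "(b z) powr s * frac_kernel s z \<le> (2 * r powr s) * r powr (- 2 * s - real CARD('n))"
          unfolding k by (rule mult_right_mono) simp
        also have "\<dots> = 2 * r powr (- s - real CARD('n))" by (simp add: powr_add[symmetric])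
        also have "\<dots> \<le> 4 * W z"
        proof (cases "r < 1")
          case r1: True
          have "r powr (- (5 * s / 4)) \<le> (1/2) powr (- (5 * s / 4))" using r2 s by (intro powr_mono2') auto
          also have "\<dots> = 2 powr (5 * s / 4)" by (simp add: powr_divide powr_minus)
          also have "\<dots> \<le> 2" using s by (intro two) simp
          finally have "r powr (- (5 * s / 4)) * r powr (s / 4 - real CARD('n)) \<le> 2 * r powr (s / 4 - real CARD('n))"
            by (rule mult_right_mono) simp
          moreover have "r powr (- (5 * s / 4)) * r powr (s / 4 - real CARD('n)) = r powr (- s - real CARD('n))"
            by (simp add: powr_add[symmetric])
          ultimately show ?thesis using r1 by (simp add: Wr)
        qed (simp add: Wr)
        finally show ?thesis using True by simp
      qed (use W0 in simp)
      have "bend t0 - bend ((a z) powr s) =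
          (bend t0 - bend ((b z) powr s)) - (bend ((a z) powr s) - bend ((b z) powr s))" by simp
      moreover have "bend ((a z) powr s) - bend ((b z) powr s) \<le> (a z) powr s - (b z) powr s"
        using geo(1) b0 s by (intro bend_diff_le powr_mono2) auto
      moreover note bend_tangent[OF t0 powr_ge_zero, of "b z" s]
      moreover have "(if (b z) powr s = 0 then sqrt t0 ^ 3 / 4 else 0) \<ge> sqrt t0 ^ 3 / 4 * indicator {z. d < z \<bullet> (- e)} z"
        using t0 by (auto simp: b_def indicator_def)
      ultimately have lower: "(1 - 3/4 * sqrt t0) * (t0 - (b z) powr s) + sqrt t0 ^ 3 / 4 * indicator {z. d < z \<bullet> (- e)} z
          - (if 1 < (b z) powr s then (b z) powr s else 0) - ((a z) powr s - (b z) powr s) \<le> bend t0 - bend ((a z) powr s)"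
        by linarith
      have bb: "ball_barrier s c \<rho> x = bend t0" "ball_barrier s c \<rho> (x + z) = bend ((a z) powr s)"
        using x d by (simp_all add: ball_barrier_def t0_def a_def)
      have "g z = (1 - 3/4 * sqrt t0) * (t0 - (b z) powr s) * frac_kernel s z
          + sqrt t0 ^ 3 / 4 * indicator {z. d < z \<bullet> (- e)} z * frac_kernel s z - 4 * W z - A * W z"
        by (simp add: g_def t0_def)
      also have "\<dots> \<le> (1 - 3/4 * sqrt t0) * (t0 - (b z) powr s) * frac_kernel s z
          + sqrt t0 ^ 3 / 4 * indicator {z. d < z \<bullet> (- e)} z * frac_kernel s z
          - (if 1 < (b z) powr s then (b z) powr s else 0) * frac_kernel s z - ((a z) powr s - (b z) powr s) * frac_kernel s z"
        using err far by linarith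
      also have "\<dots> = ((1 - 3/4 * sqrt t0) * (t0 - (b z) powr s) + sqrt t0 ^ 3 / 4 * indicator {z. d < z \<bullet> (- e)} z
          - (if 1 < (b z) powr s then (b z) powr s else 0) - ((a z) powr s - (b z) powr s)) * frac_kernel s z"
        by (simp only: left_diff_distrib distrib_right)
      also have "\<dots> \<le> (bend t0 - bend ((a z) powr s)) * frac_kernel s z"
        using lower by (rule mult_right_mono) simp
      finally show ?thesis unfolding bb .
    qed
  qed
  also have "\<dots> = frac_lap s (ball_barrier s c \<rho>) x"
    by (rule frac_lap_shift(1)[symmetric]) measurable
  finally show ?thesis unfolding A_def .
qed

text \<open>
  In terms of \<open>X = d powr (- (s / 4))\<close>, which is large near the ball, the gain is quadratic and
  the error is linear.
\<close>

lemma ball_barrier_supersolution: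
  assumes s: "0 < s" "s < 1/2" and \<rho>: "0 < \<rho>0"
  obtains r where "0 < r"
    "\<And>(c :: real ^ 'n) \<rho> x. \<lbrakk>\<rho>0 \<le> \<rho>; \<rho> < norm (x - c); norm (x - c) < \<rho> + r\<rbrakk> \<Longrightarrow>
       1 \<le> frac_lap s (ball_barrier s c \<rho>) x"
proof -
  obtain \<kappa> where \<kappa>: "0 < \<kappa>" "\<And>e :: real ^ 'n. norm e = 1 \<Longrightarrow> ennreal \<kappa> \<le> halfspace_mass s e"
    using halfspace_mass_lower_bound[OF s(1)] by metis
  define T where "T = (\<integral>z. two_sided_powr (s / 4) s (z :: real ^ 'n) \<partial>lborel)"
  have T: "0 \<le> T" unfolding T_def by (intro integral_nonneg_AE AE_I2) simp
  define A where "A = 4 * (1 + 2 / \<rho>0)"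
  have A: "0 \<le> A" using \<rho> by (simp add: A_def)
  define Y where "Y = 4 * ((4 + A) * T + 1) / \<kappa>"
  have Y: "0 < Y" using \<kappa> T A by (auto simp: Y_def intro!: divide_pos_pos mult_pos_pos add_nonneg_pos mult_nonneg_nonneg)
  define r where "r = min (1/2) (Y powr (- (4 / s)))"
  show ?thesis
  proof (rule that[of r])
    show "0 < r" using Y by (simp add: r_def)
    fix c x :: "real ^ 'n" and \<rho>
    assume *: "\<rho>0 \<le> \<rho>" "\<rho> < norm (x - c)" "norm (x - c) < \<rho> + r"
    define d where "d = norm (x - c) - \<rho>"
    have d: "0 < d" "d \<le> 1/2" "d \<le> Y powr (- (4 / s))" using * by (auto simp: d_def r_def)
    define X where "X = d powr (- (s / 4))"
    have X1: "1 \<le> X" unfolding X_def using d s powr_mono2'[of "- (s/4)" d 1] by simp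
    have "Y = (Y powr (- (4 / s))) powr (- (s / 4))" using Y s by (simp add: powr_powr)
    also have "\<dots> \<le> X" unfolding X_def using d s by (intro powr_mono2') auto
    finally have XY: "Y \<le> X" .
    have X2: "d powr (- (s / 2)) = X * X" by (simp add: X_def powr_add[symmetric])
    have "1 \<le> \<kappa> / 4 * (X * X) - (4 + A * X) * T"
    proof -
      have "(4 + A * X) * T + 1 \<le> (4 * X + A * X) * T + X"
        using X1 T by (intro add_mono mult_right_mono) auto
      also have "\<dots> = X * ((4 + A) * T + 1)" by (simp add: algebra_simps)
      also have "\<dots> = X * (\<kappa> / 4 * Y)" using \<kappa> by (simp add: Y_def)
      also have "\<dots> \<le> X * (\<kappa> / 4 * X)" using X1 XY \<kappa> by (intro mult_left_mono) auto
      finally show ?thesis by (simp add: algebra_simps)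
    qed
    also have "\<dots> \<le> frac_lap s (ball_barrier s c \<rho>) x"
      using frac_lap_ball_barrier[OF s \<rho> *(1) _ d(1,2) less_imp_le[OF \<kappa>(1)] \<kappa>(2), of x c]
      by (simp add: d_def[symmetric] X2 X_def T_def A_def) (simp add: d_def)
    finally show "1 \<le> frac_lap s (ball_barrier s c \<rho>) x" .
  qed
qed

text \<open>
  Comparison with a large multiple of the barrier of an exterior ball. Beyond the annulus where the
  barrier is a supersolution the multiple already exceeds the bound \<open>B\<close>. At the boundary of the ball
  itself the fractional Laplacian of the barrier diverges, so concentric balls of radius \<open>\<rho> - \<tau>\<close>
  are used, from which \<open>K\<close> has distance \<open>\<tau>\<close>, and then \<open>\<tau>\<close> tends to \<open>0\<close>; the constant \<open>M\<close> does not
  depend on \<open>\<tau>\<close>.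
\<close>

lemma energy_boundary_decay:
  fixes K :: "(real ^ 'n) set"
  assumes s: "0 < s" "s < 1/2" and K: "bounded K" and \<rho>: "0 < \<rho>"
    and u: "u \<in> energy_space s K" and bd: "AE x in lborel. u x \<le> B" and C: "0 < C"
    and E: "\<And>v. \<lbrakk>v \<in> energy_space s K; \<And>x. 0 \<le> v x\<rbrakk> \<Longrightarrow> energy_form s u v \<le> C * (\<integral>x. v x \<partial>lborel)"
  obtains M where "0 < M" "\<And>c p. \<lbrakk>dist c p = \<rho>; ball c \<rho> \<inter> K = {}\<rbrakk> \<Longrightarrow>
       AE x in lborel. u x \<le> M * norm (x - p) powr s"
proof -
  obtain r where r: "0 < r" "\<And>(c :: real ^ 'n) \<rho>' x. \<lbrakk>\<rho> / 2 \<le> \<rho>'; \<rho>' < norm (x - c); norm (x - c) < \<rho>' + r\<rbrakk> \<Longrightarrow>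
       1 \<le> frac_lap s (ball_barrier s c \<rho>') x"
    by (rule ball_barrier_supersolution[OF s, of "\<rho> / 2"]) (use \<rho> in simp, rule that)
  define m where "m = min (r powr s) 1 / 2"
  have m: "0 < m" using r by (simp add: m_def)
  define M where "M = C + \<bar>B\<bar> / m"
  have M: "0 < M" "C < 2 * M" "B \<le> M * m"
    using C m mult_pos_pos[OF C m] by (auto simp: M_def algebra_simps add_nonneg_pos intro: add_pos_nonneg order_trans[OF abs_ge_self])
  show ?thesis
  proof (rule that[OF M(1)])
    fix c p assume cp: "dist c p = \<rho>" and disj: "ball c \<rho> \<inter> K = {}"
    have far: "\<rho> \<le> norm (x - c)" if "x \<in> K" for x
      using disj that by (force simp: dist_norm norm_minus_commute)
    have step: "AE x in lborel. u x \<le> M * ball_barrier s c (\<rho> - \<tau>) x" if \<tau>: "0 < \<tau>" "\<tau> \<le> \<rho> / 2" for \<tau>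
    proof -
      define B' where "B' = 2 * (1 + \<tau> powr (s - 1)) * (\<integral>z. two_sided_powr (1 - 2 * s) s (z :: real ^ 'n) \<partial>lborel)"
      have loc: "AE x in lborel. M * ball_barrier s c (\<rho> - \<tau>) x < u x \<longrightarrow> x \<in> K \<and> norm (x - c) < \<rho> - \<tau> + r"
        using energy_spaceD(4)[OF u] bd
      proof eventually_elim
        case (elim x)
        show ?case
        proof (intro impI conjI)
          assume less: "M * ball_barrier s c (\<rho> - \<tau>) x < u x"
          have "0 \<le> M * ball_barrier s c (\<rho> - \<tau>) x" using M s ball_barrier_bounds(1)[of s c "\<rho> - \<tau>" x] by simp
          then show "x \<in> K" using less elim by auto
          show "norm (x - c) < \<rho> - \<tau> + r"
          proof (rule ccontr)
            assume "\<not> ?thesis"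
            then have "m \<le> ball_barrier s c (\<rho> - \<tau>) x"
              unfolding m_def using s r by (intro ball_barrier_bounds(3)) auto
            then have "M * m \<le> M * ball_barrier s c (\<rho> - \<tau>) x" using M by (intro mult_left_mono) auto
            then show False using less elim M by linarith
          qed
        qed
      qed
      show ?thesis
      proof (rule energy_comparison[OF u K])
        show "(\<lambda>x. M * ball_barrier s c (\<rho> - \<tau>) x) \<in> borel_measurable borel" by measurable
        show "0 \<le> M * ball_barrier s c (\<rho> - \<tau>) x" for x using M s ball_barrier_bounds(1)[of s c "\<rho> - \<tau>" x] by simp
        show "AE x in lborel. M * ball_barrier s c (\<rho> - \<tau>) x < u x \<longrightarrow>
            abs_lap s (\<lambda>x. M * ball_barrier s c (\<rho> - \<tau>) x) x \<le> ennreal (M * B')"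
          using loc
        proof eventually_elim
          case (elim x)
          show ?case
          proof
            assume "M * ball_barrier s c (\<rho> - \<tau>) x < u x"
            then have "abs_lap s (ball_barrier s c (\<rho> - \<tau>)) x \<le> ennreal B'"
              unfolding B'_def using elim far by (intro abs_lap_ball_barrier s \<tau>) auto
            then have "ennreal M * abs_lap s (ball_barrier s c (\<rho> - \<tau>)) x \<le> ennreal M * ennreal B'"
              by (rule mult_left_mono) simp
            then show "abs_lap s (\<lambda>x. M * ball_barrier s c (\<rho> - \<tau>) x) x \<le> ennreal (M * B')"
              using M by (simp add: abs_lap_scale ennreal_mult')
          qed
        qed
        show "AE x in lborel. M * ball_barrier s c (\<rho> - \<tau>) x < u x \<longrightarrow>
            M \<le> frac_lap s (\<lambda>x. M * ball_barrier s c (\<rho> - \<tau>) x) x"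
          using loc
        proof eventually_elim
          case (elim x)
          show ?case
          proof
            assume "M * ball_barrier s c (\<rho> - \<tau>) x < u x"
            then have "1 \<le> frac_lap s (ball_barrier s c (\<rho> - \<tau>)) x"
              using elim far[of x] \<tau> by (intro r(2)) auto
            then have "M * 1 \<le> M * frac_lap s (ball_barrier s c (\<rho> - \<tau>)) x" using M by (intro mult_left_mono) auto
            then show "M \<le> frac_lap s (\<lambda>x. M * ball_barrier s c (\<rho> - \<tau>) x) x" unfolding frac_lap_scale by simp
          qed
        qed
        show "C < 2 * M" by (rule M)
        assume "(\<lambda>x. max 0 (u x - M * ball_barrier s c (\<rho> - \<tau>) x)) \<in> energy_space s K"
        then show "energy_form s u (\<lambda>x. max 0 (u x - M * ball_barrier s c (\<rho> - \<tau>) x))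
           \<le> C * (\<integral>x. max 0 (u x - M * ball_barrier s c (\<rho> - \<tau>) x) \<partial>lborel)"
          by (rule E) simp
      qed
    qed
    define \<tau> where "\<tau> = (\<lambda>k::nat. \<rho> / 2 / real (Suc k))"
    have \<tau>: "0 < \<tau> k" "\<tau> k \<le> \<rho> / 2" for k using \<rho> by (auto simp: \<tau>_def field_simps)
    have \<tau>0: "\<tau> \<longlonglongrightarrow> 0" 
    proof -
      have "(\<lambda>k. \<rho> / 2 * inverse (real (Suc k))) \<longlonglongrightarrow> \<rho> / 2 * 0"
        by (intro tendsto_mult tendsto_const LIMSEQ_inverse_real_of_nat)
      then show ?thesis by (simp only: \<tau>_def divide_inverse mult_zero_right)
    qed
    have "AE x in lborel. \<forall>k. u x \<le> M * ball_barrier s c (\<rho> - \<tau> k) x"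
      unfolding AE_all_countable using step \<tau> by blast
    then show "AE x in lborel. u x \<le> M * norm (x - p) powr s"
    proof eventually_elim
      case (elim x)
      have le: "u x \<le> M * (norm (x - p) + \<tau> k) powr s" for k
      proof -
        have "norm (x - c) \<le> norm (x - p) + \<rho>"
          using norm_triangle_ineq[of "x - p" "p - c"] cp by (simp add: dist_norm norm_minus_commute)
        then have "(max 0 (norm (x - c) - (\<rho> - \<tau> k))) powr s \<le> (norm (x - p) + \<tau> k) powr s"
          using s \<tau>[of k] by (intro powr_mono2) auto
        then have "ball_barrier s c (\<rho> - \<tau> k) x \<le> (norm (x - p) + \<tau> k) powr s"
          using ball_barrier_bounds(2)[of s c "\<rho> - \<tau> k" x] s by simp
        then have "M * ball_barrier s c (\<rho> - \<tau> k) x \<le> M * (norm (x - p) + \<tau> k) powr s"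
          using M by (intro mult_left_mono) auto
        then show ?thesis using elim by (meson order_trans)
      qed
      have "(\<lambda>k. M * (norm (x - p) + \<tau> k) powr s) \<longlonglongrightarrow> M * (norm (x - p) + 0) powr s"
        using s \<tau> \<tau>0 by (intro tendsto_mult tendsto_const tendsto_powr' tendsto_add)
          (auto intro!: always_eventually add_nonneg_nonneg less_imp_le)
      then show ?case using le by (intro LIMSEQ_le_const[where X = "\<lambda>k. M * (norm (x - p) + \<tau> k) powr s"]) auto
    qed
  qed
qed

section \<open>The doubling argument\<close>

text \<open>At \<open>\<epsilon> = 0\<close> the left-hand side is \<open>2 powr s < 2\<close>.\<close>

lemma powr_split_constant:
  assumes "0 < s" "s < (1/2::real)"
  obtains \<epsilon> \<kappa> where "0 < \<epsilon>" "\<epsilon> < 1" "0 < \<kappa>" "(2 + \<epsilon>) powr s + \<epsilon> powr s \<le> 2 - (\<kappa> :: real)"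
proof -
  define \<kappa> where "\<kappa> = (2 - 2 powr s) / 2"
  have "2 powr s < 2 powr (1::real)" using assms by (intro powr_less_mono) auto
  then have \<kappa>: "0 < \<kappa>" by (simp add: \<kappa>_def)
  have "((\<lambda>\<epsilon>. (2 + \<epsilon>) powr s + \<epsilon> powr s) \<longlongrightarrow> (2 + 0) powr s + 0 powr s) (at_right 0)"
    using assms by (intro tendsto_add tendsto_powr' tendsto_intros) (auto simp: eventually_at_filter)
  moreover have "(2 + 0) powr s + 0 powr s < 2 - \<kappa>" using \<open>2 powr s < 2 powr 1\<close> by (simp add: \<kappa>_def field_simps)
  ultimately have "eventually (\<lambda>\<epsilon>. (2 + \<epsilon>) powr s + \<epsilon> powr s < 2 - \<kappa>) (at_right 0)"
    by (rule order_tendstoD(2))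
  moreover have "eventually (\<lambda>\<epsilon>::real. 0 < \<epsilon> \<and> \<epsilon> < 1) (at_right 0)"
    unfolding eventually_at_right_field by (intro exI[of _ 1]) auto
  ultimately have "eventually (\<lambda>\<epsilon>. (0 < \<epsilon> \<and> \<epsilon> < 1) \<and> (2 + \<epsilon>) powr s + \<epsilon> powr s < 2 - \<kappa>) (at_right 0)"
    by (simp add: eventually_conj_iff)
  then obtain \<epsilon> where "0 < \<epsilon>" "\<epsilon> < 1" "(2 + \<epsilon>) powr s + \<epsilon> powr s < 2 - \<kappa>"
    using eventually_happens[of _ "at_right (0::real)"] by (auto simp: trivial_limit_at_right_real)
  then show ?thesis using that \<kappa> by (meson less_imp_le)
qed

text \<open>
  At a maximum of \<open>\<phi> x' - \<phi> y' - M * \<bar>x' - y'\<bar> powr s\<close>, moving \<open>x\<close> and \<open>y\<close> by the same \<open>z\<close> shows that the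
  increments of \<open>\<phi>\<close> at \<open>x\<close> dominate those at \<open>y\<close>. On a set symmetric about \<open>0\<close> one may instead
  move \<open>x\<close> by \<open>z\<close> and \<open>y\<close> by \<open>- z\<close>. With \<open>\<xi> = x - y\<close> the bounds for \<open>z\<close> and \<open>- z\<close> then add up to \<open>M\<close> times
  \<open>2 \<bar>\<xi>\<bar> powr s - \<bar>\<xi> + 2 z\<bar> powr s - \<bar>\<xi> - 2 z\<bar> powr s\<close>, which is at least \<open>\<kappa> * \<bar>\<xi>\<bar> powr s\<close> when \<open>z\<close> is
  close to \<open>\<xi> / 2\<close>. The admissible \<open>z\<close> fill a ball of radius proportional to \<open>\<bar>\<xi>\<bar>\<close>, on which the kernel
  is at least \<open>\<bar>\<xi>\<bar> powr (- n - 2 s)\<close>.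
\<close>

lemma reflected_coupling_gain:
  assumes s: "0 < s" "s < 1/2"
  obtains q where "0 < q"
    "\<And>(\<phi> :: real ^ 'n \<Rightarrow> real) x y M. \<lbrakk>\<phi> \<in> borel_measurable borel; x \<noteq> y; 0 \<le> M;
       integrable lborel (\<lambda>z. (\<phi> x - \<phi> (x + z)) * frac_kernel s z);
       integrable lborel (\<lambda>z. (\<phi> y - \<phi> (y + z)) * frac_kernel s z);
       \<And>x' y'. \<phi> x' - \<phi> y' - M * norm (x' - y') powr s \<le> \<phi> x - \<phi> y - M * norm (x - y) powr s\<rbrakk>
     \<Longrightarrow> M * q * norm (x - y) powr (- s) \<le> frac_lap s \<phi> x - frac_lap s \<phi> y"
proof -
  obtain \<epsilon> \<kappa> where ek: "0 < \<epsilon>" "\<epsilon> < 1" "0 < \<kappa>" "(2 + \<epsilon>) powr s + \<epsilon> powr s \<le> 2 - \<kappa>"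
    using powr_split_constant[OF s] by metis
  define \<omega> where "\<omega> = measure lborel (ball (0 :: real ^ 'n) 1)"
  have \<omega>: "0 < \<omega>" unfolding \<omega>_def by (rule content_ball_pos) simp
  define q where "q = \<kappa> * ((\<epsilon> / 2) ^ CARD('n) * \<omega>) / 2"
  show ?thesis
  proof (rule that[of q])
    show "0 < q" using ek \<omega> by (simp add: q_def)
    fix \<phi> :: "real ^ 'n \<Rightarrow> real" and x y M
    assume m [measurable]: "\<phi> \<in> borel_measurable borel" and xy: "x \<noteq> y" and M: "0 \<le> M"
      and ix: "integrable lborel (\<lambda>z. (\<phi> x - \<phi> (x + z)) * frac_kernel s z)"
      and iy: "integrable lborel (\<lambda>z. (\<phi> y - \<phi> (y + z)) * frac_kernel s z)"
      and max: "\<And>x' y'. \<phi> x' - \<phi> y' - M * norm (x' - y') powr s \<le> \<phi> x - \<phi> y - M * norm (x - y) powr s"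
    define \<xi> where "\<xi> = x - y"
    define R where "R = norm \<xi>"
    have R: "0 < R" using xy by (simp add: R_def \<xi>_def)
    define S where "S = ball ((1/2) *\<^sub>R \<xi>) (\<epsilon> * R / 2)"
    \<comment> \<open>The increments on \<open>D\<close> are paired with their reflections, all others with themselves.\<close>
    define D where "D = {z. z \<in> S \<or> - z \<in> S}"
    have Sm [measurable]: "S \<in> sets borel" unfolding S_def by simp
    have Dm [measurable]: "D \<in> sets borel" unfolding D_def by measurable
    have Dsym: "- z \<in> D \<longleftrightarrow> z \<in> D" for z by (auto simp: D_def)
    have S1: "norm (\<xi> - 2 *\<^sub>R z) \<le> \<epsilon> * R" "norm (\<xi> + 2 *\<^sub>R z) \<le> (2 + \<epsilon>) * R"
      "(1 - \<epsilon>) / 2 * R \<le> norm z" "norm z \<le> R" if "z \<in> S" for z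
    proof -
      have "norm ((1/2) *\<^sub>R \<xi> - z) < \<epsilon> * R / 2" using that by (simp add: S_def dist_norm)
      moreover have "\<xi> - 2 *\<^sub>R z = 2 *\<^sub>R ((1/2) *\<^sub>R \<xi> - z)" by (simp add: algebra_simps)
      ultimately show 1: "norm (\<xi> - 2 *\<^sub>R z) \<le> \<epsilon> * R" by simp
      have "\<xi> + 2 *\<^sub>R z = 2 *\<^sub>R \<xi> - (\<xi> - 2 *\<^sub>R z)" by (simp add: algebra_simps scaleR_2)
      then have "norm (\<xi> + 2 *\<^sub>R z) \<le> norm (2 *\<^sub>R \<xi>) + norm (\<xi> - 2 *\<^sub>R z)"
        by (simp only: norm_triangle_ineq4)
      then show "norm (\<xi> + 2 *\<^sub>R z) \<le> (2 + \<epsilon>) * R"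
        using 1 by (simp add: R_def distrib_right)
      have "R - norm (2 *\<^sub>R z) \<le> \<epsilon> * R" using 1 norm_triangle_ineq2[of \<xi> "2 *\<^sub>R z"] by (simp add: R_def)
      then show "(1 - \<epsilon>) / 2 * R \<le> norm z" by (simp add: algebra_simps)
      have "norm (2 *\<^sub>R z) - R \<le> \<epsilon> * R"
        using 1 norm_triangle_ineq2[of "2 *\<^sub>R z" \<xi>] by (simp add: R_def norm_minus_commute)
      moreover have "\<epsilon> * R \<le> 1 * R" using ek R by (intro mult_right_mono) auto
      ultimately show "norm z \<le> R" by simp
    qed
    have D1: "(1 - \<epsilon>) / 2 * R \<le> norm z" "norm z \<le> R" "norm (\<xi> + 2 *\<^sub>R z) \<le> (2 + \<epsilon>) * R"
      "\<kappa> * R powr s \<le> 2 * R powr s - norm (\<xi> + 2 *\<^sub>R z) powr s - norm (\<xi> - 2 *\<^sub>R z) powr s" if "z \<in> D" for z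
    proof -
      have *: "\<kappa> * R powr s \<le> 2 * R powr s - norm (\<xi> + 2 *\<^sub>R z) powr s - norm (\<xi> - 2 *\<^sub>R z) powr s" if "z \<in> S" for z
      proof -
        have "norm (\<xi> + 2 *\<^sub>R z) powr s \<le> ((2 + \<epsilon>) * R) powr s" using S1[OF that] s by (intro powr_mono2) auto
        moreover have "norm (\<xi> - 2 *\<^sub>R z) powr s \<le> (\<epsilon> * R) powr s" using S1[OF that] s by (intro powr_mono2) auto
        moreover have "((2 + \<epsilon>) * R) powr s + (\<epsilon> * R) powr s = ((2 + \<epsilon>) powr s + \<epsilon> powr s) * R powr s"
          using ek R by (simp only: powr_mult distrib_right[of "(2 + \<epsilon>) powr s" "\<epsilon> powr s"])
        moreover have "((2 + \<epsilon>) powr s + \<epsilon> powr s) * R powr s \<le> (2 - \<kappa>) * R powr s"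
          using ek by (intro mult_right_mono) auto
        ultimately show ?thesis by (simp add: algebra_simps)
      qed
      show "\<kappa> * R powr s \<le> 2 * R powr s - norm (\<xi> + 2 *\<^sub>R z) powr s - norm (\<xi> - 2 *\<^sub>R z) powr s"
        using that *[of z] *[of "- z"] by (auto simp: D_def)
      have "\<epsilon> * R \<le> (2 + \<epsilon>) * R" using R by (intro mult_right_mono) auto
      then show "(1 - \<epsilon>) / 2 * R \<le> norm z" "norm z \<le> R" "norm (\<xi> + 2 *\<^sub>R z) \<le> (2 + \<epsilon>) * R"
        using that S1[of z] S1[of "- z"] by (auto simp: D_def)
    qed
    define g where "g = (\<lambda>z. (R powr s - norm (\<xi> + 2 *\<^sub>R z) powr s) * frac_kernel s z * indicator D z)"
    have [measurable]: "g \<in> borel_measurable borel" unfolding g_def by measurable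
    have Dfin: "emeasure lborel D < \<infinity>"
    proof -
      have "D \<subseteq> cball 0 R" using D1(2) by auto
      then have "emeasure lborel D \<le> emeasure lborel (cball (0 :: real ^ 'n) R)" by (intro emeasure_mono) auto
      then show ?thesis using emeasure_lborel_cball_finite[of "0 :: real ^ 'n" R] by (rule order.strict_trans1)
    qed
    define G where "G = 4 * R powr s * ((1 - \<epsilon>) / 2 * R) powr (- 2 * s - real CARD('n))"
    have gi: "integrable lborel g"
    proof (rule Bochner_Integration.integrable_bound)
      show "integrable lborel (\<lambda>z. G * indicator D z :: real)"
        using Dfin by (intro integrable_mult_right integrable_real_indicator) auto
      show "AE z in lborel. norm (g z) \<le> norm (G * indicator D z)"
      proof (rule AE_I2)
        fix z
        show "norm (g z) \<le> norm (G * indicator D z)"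
        proof (cases "z \<in> D")
          case True
          have "norm (\<xi> + 2 *\<^sub>R z) powr s \<le> (3 * R) powr s"
            using D1(3)[OF True] ek R s by (intro powr_mono2) (auto intro: order_trans)
          also have "\<dots> \<le> 3 * R powr s"
            using R s powr_mono[of s 1 "3::real"] by (simp add: powr_mult)
          finally have "\<bar>R powr s - norm (\<xi> + 2 *\<^sub>R z) powr s\<bar> \<le> 4 * R powr s"
            using powr_ge_zero[of "norm (\<xi> + 2 *\<^sub>R z)" s] powr_ge_zero[of R s] by linarith
          moreover have "frac_kernel s z \<le> ((1 - \<epsilon>) / 2 * R) powr (- 2 * s - real CARD('n))"
            unfolding frac_kernel_powr using D1(1)[OF True] ek R s by (intro powr_mono2') auto
          ultimately have "\<bar>R powr s - norm (\<xi> + 2 *\<^sub>R z) powr s\<bar> * frac_kernel s z \<le> G"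
            unfolding G_def by (intro mult_mono) auto
          then show ?thesis using True by (simp add: g_def abs_mult)
        qed (simp add: g_def)
      qed
    qed measurable
    have g': "integrable lborel (\<lambda>z. g (0 - z))" "(\<integral>z. g (0 - z) \<partial>lborel) = integral\<^sup>L lborel g"
      using integral_reflect[of g 0] gi by auto
    have lower: "\<kappa> * R powr s * R powr (- 2 * s - real CARD('n)) * measure lborel S \<le> 2 * integral\<^sup>L lborel g"
    proof -
      have Sfin: "emeasure lborel S < \<infinity>" unfolding S_def by (rule emeasure_lborel_ball_finite)
      have "\<kappa> * R powr s * R powr (- 2 * s - real CARD('n)) * measure lborel S =
         (\<integral>z. \<kappa> * R powr s * R powr (- 2 * s - real CARD('n)) * indicator S z \<partial>lborel)" by simp
      also have "\<dots> \<le> (\<integral>z. g z + g (0 - z) \<partial>lborel)"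
      proof (rule integral_mono)
        show "integrable lborel (\<lambda>z. \<kappa> * R powr s * R powr (- 2 * s - real CARD('n)) * indicator S z :: real)"
          using Sfin by (intro integrable_mult_right integrable_real_indicator) auto
        show "integrable lborel (\<lambda>z. g z + g (0 - z))" using gi g' by simp
        fix z
        show "\<kappa> * R powr s * R powr (- 2 * s - real CARD('n)) * indicator S z \<le> g z + g (0 - z)"
        proof (cases "z \<in> D")
          case True
          have "z \<noteq> 0" using D1(1)[OF True] ek R by (auto simp: mult_le_0_iff)
          have k: "R powr (- 2 * s - real CARD('n)) \<le> frac_kernel s z"
            using s D1(2)[OF True] \<open>z \<noteq> 0\<close> by (intro frac_kernel_antimono) auto
          have "\<kappa> * R powr s * R powr (- 2 * s - real CARD('n)) * indicator S z \<le> \<kappa> * R powr s * R powr (- 2 * s - real CARD('n))"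
            using ek by (auto simp: indicator_def)
          also have "\<dots> \<le> (2 * R powr s - norm (\<xi> + 2 *\<^sub>R z) powr s - norm (\<xi> - 2 *\<^sub>R z) powr s) * frac_kernel s z"
          proof (rule mult_mono)
            have "0 \<le> \<kappa> * R powr s" using ek by simp
            then show "0 \<le> 2 * R powr s - norm (\<xi> + 2 *\<^sub>R z) powr s - norm (\<xi> - 2 *\<^sub>R z) powr s"
              using D1(4)[OF True] by linarith
          qed (use D1(4)[OF True] k in auto)
          also have "\<dots> = g z + g (0 - z)"
            using True Dsym[of z] by (simp add: g_def algebra_simps)
          finally show ?thesis .
        next
          case False
          then have "z \<notin> S" by (auto simp: D_def)
          then show ?thesis using False Dsym[of z] by (simp add: g_def)
        qed
      qed
      also have "\<dots> = 2 * integral\<^sup>L lborel g" using gi g' by simp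
      finally show ?thesis .
    qed
    define P Q where "P = (\<lambda>z. (\<phi> x - \<phi> (x + z)) * frac_kernel s z)" and "Q = (\<lambda>z. (\<phi> y - \<phi> (y + z)) * frac_kernel s z)"
    have Pi: "integrable lborel P" and Qi: "integrable lborel Q" using ix iy by (simp_all add: P_def Q_def)
    have [measurable]: "Q \<in> borel_measurable borel" unfolding Q_def by measurable
    have Q1: "integrable lborel (\<lambda>z. Q z * indicator D z)" "integrable lborel (\<lambda>z. Q z * indicator (- D) z)"
      using integrable_mult_indicator[OF _ Qi, of D] integrable_mult_indicator[OF _ Qi, of "- D"] by (auto simp: mult.commute)
    have Q2: "integrable lborel (\<lambda>z. Q (0 - z) * indicator D z)"
      "(\<integral>z. Q (0 - z) * indicator D z \<partial>lborel) = (\<integral>z. Q z * indicator D z \<partial>lborel)"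
    proof -
      have eq: "(\<lambda>z. Q (0 - z) * indicator D z) = (\<lambda>z. (\<lambda>z. Q z * indicator D z) (0 - z))"
        using Dsym by (auto simp: fun_eq_iff indicator_def)
      show "integrable lborel (\<lambda>z. Q (0 - z) * indicator D z)"
        unfolding eq using Q1(1) by (subst integral_reflect(2)) auto
      show "(\<integral>z. Q (0 - z) * indicator D z \<partial>lborel) = (\<integral>z. Q z * indicator D z \<partial>lborel)"
        unfolding eq by (rule integral_reflect(1)) measurable
    qed
    have "integral\<^sup>L lborel Q = (\<integral>z. Q z * indicator D z + Q z * indicator (- D) z \<partial>lborel)"
      by (intro Bochner_Integration.integral_cong refl) (auto simp: indicator_def)
    also have "\<dots> = (\<integral>z. Q (0 - z) * indicator D z + Q z * indicator (- D) z \<partial>lborel)"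
      using Q1 Q2 by simp
    finally have QQ: "integral\<^sup>L lborel Q = (\<integral>z. Q (0 - z) * indicator D z + Q z * indicator (- D) z \<partial>lborel)" .
    have "(\<integral>z. M * g z \<partial>lborel) \<le> (\<integral>z. P z - (Q (0 - z) * indicator D z + Q z * indicator (- D) z) \<partial>lborel)"
    proof (rule integral_mono)
      show "integrable lborel (\<lambda>z. M * g z)" using gi by simp
      show "integrable lborel (\<lambda>z. P z - (Q (0 - z) * indicator D z + Q z * indicator (- D) z))"
        using Pi Q1 Q2 by simp
      fix z
      show "M * g z \<le> P z - (Q (0 - z) * indicator D z + Q z * indicator (- D) z)"
      proof (cases "z \<in> D")
        case True
        have "M * (norm \<xi> powr s - norm (\<xi> + 2 *\<^sub>R z) powr s) \<le> (\<phi> x - \<phi> (x + z)) - (\<phi> y - \<phi> (y - z))"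
          using max[of "x + z" "y - z"] by (simp add: \<xi>_def algebra_simps scaleR_2)
        from mult_right_mono[OF this frac_kernel_nonneg[of s z]]
        show ?thesis using True by (simp add: P_def Q_def g_def R_def algebra_simps)
      next
        case False
        have "0 \<le> (\<phi> x - \<phi> (x + z)) - (\<phi> y - \<phi> (y + z))"
          using max[of "x + z" "y + z"] by simp
        from mult_right_mono[OF this frac_kernel_nonneg[of s z]]
        show ?thesis using False by (simp add: P_def Q_def g_def algebra_simps)
      qed
    qed
    also have "\<dots> = integral\<^sup>L lborel P - integral\<^sup>L lborel Q"
      unfolding QQ using Pi Q1 Q2 by (intro Bochner_Integration.integral_diff) auto
    also have "\<dots> = frac_lap s \<phi> x - frac_lap s \<phi> y"
      unfolding frac_lap_shift(1)[OF m] P_def Q_def ..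
    finally have "M * integral\<^sup>L lborel g \<le> frac_lap s \<phi> x - frac_lap s \<phi> y" by simp
    moreover have "M * q * norm (x - y) powr (- s) \<le> M * integral\<^sup>L lborel g"
    proof -
      have "measure lborel S = (\<epsilon> * R / 2) ^ CARD('n) * \<omega>"
        using content_ball_conv_unit_ball[of "\<epsilon> * R / 2" "(1/2) *\<^sub>R \<xi>"] ek R by (simp add: S_def \<omega>_def)
      also have "\<dots> = (\<epsilon> / 2) ^ CARD('n) * \<omega> * R powr (real CARD('n))"
        using R by (simp add: powr_realpow power_mult_distrib power_divide)
      finally have "\<kappa> * R powr s * R powr (- 2 * s - real CARD('n)) * measure lborel S =
          2 * q * (R powr s * R powr (- 2 * s - real CARD('n)) * R powr (real CARD('n)))"
        by (simp add: q_def)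
      also have "R powr s * R powr (- 2 * s - real CARD('n)) * R powr (real CARD('n)) = R powr (- s)"
        by (simp add: powr_add[symmetric])
      finally have "q * R powr (- s) \<le> integral\<^sup>L lborel g" using lower by simp
      then show ?thesis using M by (simp add: R_def \<xi>_def mult.assoc mult_left_mono)
    qed
    ultimately show "M * q * norm (x - y) powr (- s) \<le> frac_lap s \<phi> x - frac_lap s \<phi> y" by simp
  qed
qed

text \<open>
  If the bound failed somewhere, then \<open>\<phi> x - \<phi> y - M * \<bar>x - y\<bar> powr s\<close> would attain a maximum above
  \<open>A\<close>, at two distinct points of \<open>U\<close>. There the difference of the fractional Laplacians is at most
  \<open>2 C\<close>, whereas \<open>reflected_coupling_gain\<close> makes it larger, since \<open>\<bar>x - y\<bar> \<le> 2 R\<close> and \<open>M\<close> is large. The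
  additive slack \<open>A\<close> absorbs the layer near the boundary lost by mollification.
\<close>

lemma doubling_holder_estimate:
  fixes R C :: real
  assumes s: "0 < s" "s < 1/2" and R: "0 < R" and C: "0 \<le> C"
  obtains M0 where "0 < M0"
    "\<And>(\<phi> :: real ^ 'n \<Rightarrow> real) U A M x y. \<lbrakk>continuous_on UNIV \<phi>; U \<subseteq> cball 0 R;
       \<And>x. x \<in> U \<Longrightarrow> integrable lborel (\<lambda>z. (\<phi> x - \<phi> (x + z)) * frac_kernel s z);
       \<And>x. x \<in> U \<Longrightarrow> \<bar>frac_lap s \<phi> x\<bar> \<le> C;
       \<And>x y. x \<notin> U \<or> y \<notin> U \<Longrightarrow> \<phi> x - \<phi> y \<le> M * norm (x - y) powr s + A; 0 \<le> A; M0 \<le> M\<rbrakk>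
     \<Longrightarrow> \<phi> x - \<phi> y \<le> M * norm (x - y) powr s + A"
proof -
  obtain q where q: "0 < q"
    "\<And>(\<phi> :: real ^ 'n \<Rightarrow> real) x y M. \<lbrakk>\<phi> \<in> borel_measurable borel; x \<noteq> y; 0 \<le> M;
       integrable lborel (\<lambda>z. (\<phi> x - \<phi> (x + z)) * frac_kernel s z);
       integrable lborel (\<lambda>z. (\<phi> y - \<phi> (y + z)) * frac_kernel s z);
       \<And>x' y'. \<phi> x' - \<phi> y' - M * norm (x' - y') powr s \<le> \<phi> x - \<phi> y - M * norm (x - y) powr s\<rbrakk>
     \<Longrightarrow> M * q * norm (x - y) powr (- s) \<le> frac_lap s \<phi> x - frac_lap s \<phi> y"
    by (rule reflected_coupling_gain[OF s]) (rule that, assumption, blast)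
  define M0 where "M0 = (2 * C + 1) / (q * (2 * R) powr (- s))"
  have M0: "0 < M0" using q R C by (simp add: M0_def)
  show ?thesis
  proof (rule that[OF M0])
    fix \<phi> :: "real ^ 'n \<Rightarrow> real" and U A M x y
    assume cont: "continuous_on UNIV \<phi>" and U: "U \<subseteq> cball 0 R"
      and int: "\<And>x. x \<in> U \<Longrightarrow> integrable lborel (\<lambda>z. (\<phi> x - \<phi> (x + z)) * frac_kernel s z)"
      and bd: "\<And>x. x \<in> U \<Longrightarrow> \<bar>frac_lap s \<phi> x\<bar> \<le> C"
      and out: "\<And>x y. x \<notin> U \<or> y \<notin> U \<Longrightarrow> \<phi> x - \<phi> y \<le> M * norm (x - y) powr s + A"
      and A: "0 \<le> A" and M: "M0 \<le> M"
    have m: "\<phi> \<in> borel_measurable borel" using cont by (rule borel_measurable_continuous_onI)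
    define F where "F = (\<lambda>z. \<phi> (fst z) - \<phi> (snd z) - M * norm (fst z - snd z) powr s)"
    have Fc: "continuous_on (cball 0 R \<times> cball 0 R) F"
      unfolding F_def using s cont
      by (intro continuous_intros continuous_on_powr' continuous_on_compose2[OF cont]) auto
    have "F (x, y) \<le> A"
    proof (rule ccontr)
      assume "\<not> F (x, y) \<le> A"
      then have Fxy: "A < F (x, y)" by simp
      have inU: "a \<in> U \<and> b \<in> U" if "A < F (a, b)" for a b
        using out[of a b] that by (force simp: F_def)
      have "(x, y) \<in> cball 0 R \<times> cball 0 R" using inU[OF Fxy] U by auto
      then obtain z0 where z0: "z0 \<in> cball 0 R \<times> cball 0 R" "\<And>z. z \<in> cball 0 R \<times> cball 0 R \<Longrightarrow> F z \<le> F z0"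
        using continuous_attains_sup[OF compact_Times[OF compact_cball compact_cball] _ Fc] by blast
      obtain a b where ab: "z0 = (a, b)" by (cases z0)
      have Fab: "A < F (a, b)" using Fxy z0(2)[OF \<open>(x, y) \<in> _\<close>] ab by simp
      have abU: "a \<in> U" "b \<in> U" using inU[OF Fab] by auto
      have glob: "F (a', b') \<le> F (a, b)" for a' b'
      proof (cases "A < F (a', b')")
        case True
        then have "(a', b') \<in> cball 0 R \<times> cball 0 R" using inU[OF True] U by auto
        then show ?thesis using z0(2) ab by simp
      qed (use Fab in simp)
      have "a \<noteq> b" using Fab A by (auto simp: F_def)
      have "M * q * norm (a - b) powr (- s) \<le> frac_lap s \<phi> a - frac_lap s \<phi> b"
        using glob M M0 by (intro q(2) m \<open>a \<noteq> b\<close> int abU) (auto simp: F_def)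
      also have "\<dots> \<le> 2 * C" using bd[OF abU(1)] bd[OF abU(2)] by linarith
      finally have 1: "M * q * norm (a - b) powr (- s) \<le> 2 * C" .
      have "norm a \<le> R" "norm b \<le> R" using abU U by auto
      then have "norm (a - b) \<le> 2 * R" using norm_triangle_ineq4[of a b] by simp
      then have "(2 * R) powr (- s) \<le> norm (a - b) powr (- s)" using \<open>a \<noteq> b\<close> s by (intro powr_mono2') auto
      then have "M0 * q * (2 * R) powr (- s) \<le> M * q * norm (a - b) powr (- s)"
        using M M0 q by (intro mult_mono mult_nonneg_nonneg) auto
      then have "M0 * (q * (2 * R) powr (- s)) \<le> 2 * C" using 1 by (simp add: mult.assoc)
      then show False using q R by (simp add: M0_def)
    qed
    then show "\<phi> x - \<phi> y \<le> M * norm (x - y) powr s + A" by (simp add: F_def)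
  qed
qed

section \<open>Mollification\<close>

text \<open>Lipschitz regularity of the mollifier is enough, because \<open>2 s < 1\<close>.\<close>

definition tent :: "real \<Rightarrow> 'a::euclidean_space \<Rightarrow> real" where
  "tent \<epsilon> z = max 0 (1 - norm z / \<epsilon>)"

definition mollify :: "real \<Rightarrow> ('a::euclidean_space \<Rightarrow> real) \<Rightarrow> 'a \<Rightarrow> real" where
  "mollify \<epsilon> u x = (\<integral>y. u y * tent \<epsilon> (x - y) \<partial>lborel) / (\<integral>z. tent \<epsilon> (z :: 'a) \<partial>lborel)"

lemma tent_measurable [measurable]: "tent \<epsilon> \<in> borel_measurable borel"
  unfolding tent_def by measurable

lemma tent_bounds: "0 < \<epsilon> \<Longrightarrow> 0 \<le> tent \<epsilon> z" "0 < \<epsilon> \<Longrightarrow> tent \<epsilon> z \<le> 1"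
  by (auto simp: tent_def)

lemma tent_abs_le: "0 < \<epsilon> \<Longrightarrow> \<bar>tent \<epsilon> z\<bar> \<le> 1"
  using tent_bounds[of \<epsilon> z] by simp

lemma tent_minus: "tent \<epsilon> (- z) = tent \<epsilon> z"
  by (simp add: tent_def)

lemma tent_eq_0: "0 < \<epsilon> \<Longrightarrow> \<epsilon> \<le> norm z \<Longrightarrow> tent \<epsilon> z = 0"
  by (simp add: tent_def)

lemma tent_lipschitz:
  assumes "0 < \<epsilon>" shows "\<bar>tent \<epsilon> z - tent \<epsilon> w\<bar> \<le> norm (z - w) / \<epsilon>"
proof -
  have "\<bar>tent \<epsilon> z - tent \<epsilon> w\<bar> \<le> \<bar>norm z / \<epsilon> - norm w / \<epsilon>\<bar>" by (auto simp: tent_def max_def)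
  also have "\<dots> = \<bar>norm z - norm w\<bar> / \<epsilon>" using assms by (simp add: diff_divide_distrib[symmetric])
  also have "\<dots> \<le> norm (z - w) / \<epsilon>" using assms norm_triangle_ineq3[of z w] by (intro divide_right_mono) auto
  finally show ?thesis .
qed

lemma tent_integrable:
  assumes "0 < \<epsilon>" shows "integrable lborel (tent \<epsilon> :: 'a::euclidean_space \<Rightarrow> real)"
proof (rule Bochner_Integration.integrable_bound)
  show "integrable lborel (indicator (ball (0::'a) \<epsilon>) :: 'a \<Rightarrow> real)"
    using emeasure_lborel_ball_finite[of "0::'a" \<epsilon>] by (intro integrable_real_indicator) auto
  show "AE z::'a in lborel. norm (tent \<epsilon> z) \<le> norm (indicator (ball 0 \<epsilon>) z :: real)"
    using assms by (intro AE_I2) (auto simp: indicator_def tent_bounds tent_eq_0)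
qed measurable

lemma tent_mass_pos:
  assumes "0 < \<epsilon>" shows "0 < (\<integral>z. tent \<epsilon> (z :: 'a::euclidean_space) \<partial>lborel)"
proof -
  have "0 < measure lborel (ball (0::'a) (\<epsilon> / 2)) * (1/2)" using assms content_ball_pos[of "\<epsilon>/2" "0::'a"] by simp
  also have "\<dots> = (\<integral>z. (1/2) * indicator (ball (0::'a) (\<epsilon> / 2)) z \<partial>lborel)" by simp
  also have "\<dots> \<le> (\<integral>z. tent \<epsilon> (z :: 'a) \<partial>lborel)"
  proof (rule integral_mono)
    show "integrable lborel (\<lambda>z. (1/2) * indicator (ball (0::'a) (\<epsilon> / 2)) z :: real)"
      using emeasure_lborel_ball_finite[of "0::'a" "\<epsilon> / 2"] by (intro integrable_mult_right integrable_real_indicator) auto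
    fix z :: 'a
    show "(1/2) * indicator (ball (0::'a) (\<epsilon> / 2)) z \<le> tent \<epsilon> z"
      using assms by (auto simp: indicator_def tent_def field_simps)
  qed (rule tent_integrable[OF assms])
  finally show ?thesis .
qed

lemma tent_shift_integral: "(\<integral>y. tent \<epsilon> (x - y :: 'a) \<partial>lborel) = (\<integral>z. tent \<epsilon> (z :: 'a::euclidean_space) \<partial>lborel)"
  by (rule integral_reflect(1)) measurable

lemma tent_shift_integrable: "0 < \<epsilon> \<Longrightarrow> integrable lborel (\<lambda>y. tent \<epsilon> (x - y :: 'a::euclidean_space))"
  using integral_reflect(2)[of "tent \<epsilon>" x] tent_integrable[of \<epsilon>, where 'a='a] by simp

lemma mult_tent_integrable:
  assumes "integrable lborel u" "0 < \<epsilon>"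
  shows "integrable lborel (\<lambda>y. u y * tent \<epsilon> (x - y))"
proof (rule Bochner_Integration.integrable_bound[OF assms(1)])
  have [measurable]: "u \<in> borel_measurable borel" using assms(1) by (simp add: borel_measurable_integrable)
  show "(\<lambda>y. u y * tent \<epsilon> (x - y)) \<in> borel_measurable lborel" by measurable
  show "AE y in lborel. norm (u y * tent \<epsilon> (x - y)) \<le> norm (u y)"
    by (intro AE_I2) (simp add: abs_mult tent_abs_le[OF assms(2)] mult_left_le)
qed

lemma mollify_le:
  assumes u: "integrable lborel u" and \<epsilon>: "0 < \<epsilon>" and le: "AE y in lborel. norm (x - y) < \<epsilon> \<longrightarrow> u y \<le> h"
  shows "mollify \<epsilon> u x \<le> h"
proof -
  have "(\<integral>y. u y * tent \<epsilon> (x - y) \<partial>lborel) \<le> (\<integral>y. h * tent \<epsilon> (x - y) \<partial>lborel)"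
  proof (rule integral_mono_AE)
    show "AE y in lborel. u y * tent \<epsilon> (x - y) \<le> h * tent \<epsilon> (x - y)"
      using le
    proof eventually_elim
      case (elim y)
      show ?case
        using elim \<epsilon> tent_bounds(1)[OF \<epsilon>, of "x - y"] tent_eq_0[OF \<epsilon>, of "x - y"]
        by (cases "norm (x - y) < \<epsilon>") (auto intro: mult_right_mono)
    qed
  qed (use u \<epsilon> in \<open>auto intro: mult_tent_integrable tent_shift_integrable\<close>)
  then show ?thesis
    using tent_mass_pos[OF \<epsilon>, where 'a='a] by (simp add: mollify_def tent_shift_integral divide_le_eq)
qed

lemma mollify_uminus: "mollify \<epsilon> (\<lambda>y. - u y) x = - mollify \<epsilon> u x"
  by (simp add: mollify_def)

lemma mollify_ge:
  assumes u: "integrable lborel u" and \<epsilon>: "0 < \<epsilon>" and le: "AE y in lborel. norm (x - y) < \<epsilon> \<longrightarrow> h \<le> u y"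
  shows "h \<le> mollify \<epsilon> u x"
  using mollify_le[of "\<lambda>y. - u y" \<epsilon> x "- h"] assms by (simp add: mollify_uminus)

lemma mollify_abs_le:
  assumes u: "integrable lborel u" and \<epsilon>: "0 < \<epsilon>" and le: "AE y in lborel. norm (x - y) < \<epsilon> \<longrightarrow> \<bar>u y\<bar> \<le> h"
  shows "\<bar>mollify \<epsilon> u x\<bar> \<le> h"
proof -
  have "AE y in lborel. norm (x - y) < \<epsilon> \<longrightarrow> u y \<le> h" "AE y in lborel. norm (x - y) < \<epsilon> \<longrightarrow> - h \<le> u y"
    using le by (eventually_elim, force)+
  then have "mollify \<epsilon> u x \<le> h" "- h \<le> mollify \<epsilon> u x" using u \<epsilon> by (auto intro: mollify_le mollify_ge)
  then show ?thesis by simp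
qed

lemma mollify_lipschitz:
  fixes u :: "'a::euclidean_space \<Rightarrow> real"
  assumes u: "integrable lborel u" and \<epsilon>: "0 < \<epsilon>"
  defines "L \<equiv> (\<integral>y. \<bar>u y\<bar> \<partial>lborel) / (\<epsilon> * (\<integral>z. tent \<epsilon> (z :: 'a) \<partial>lborel))"
  shows "\<bar>mollify \<epsilon> u x - mollify \<epsilon> u x'\<bar> \<le> L * norm (x - x')"
proof -
  let ?N = "\<integral>z. tent \<epsilon> (z :: 'a) \<partial>lborel"
  have N: "0 < ?N" by (rule tent_mass_pos[OF \<epsilon>])
  have "\<bar>(\<integral>y. u y * tent \<epsilon> (x - y) \<partial>lborel) - (\<integral>y. u y * tent \<epsilon> (x' - y) \<partial>lborel)\<bar>
      = \<bar>\<integral>y. u y * tent \<epsilon> (x - y) - u y * tent \<epsilon> (x' - y) \<partial>lborel\<bar>"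
    using u \<epsilon> by (subst Bochner_Integration.integral_diff) (auto intro: mult_tent_integrable)
  also have "\<dots> \<le> (\<integral>y. \<bar>u y * tent \<epsilon> (x - y) - u y * tent \<epsilon> (x' - y)\<bar> \<partial>lborel)" by simp
  also have "\<dots> \<le> (\<integral>y. \<bar>u y\<bar> * (norm (x - x') / \<epsilon>) \<partial>lborel)"
  proof (rule integral_mono)
    show "integrable lborel (\<lambda>y. \<bar>u y * tent \<epsilon> (x - y) - u y * tent \<epsilon> (x' - y)\<bar>)"
      using u \<epsilon> by (intro integrable_abs Bochner_Integration.integrable_diff mult_tent_integrable)
    fix y
    show "\<bar>u y * tent \<epsilon> (x - y) - u y * tent \<epsilon> (x' - y)\<bar> \<le> \<bar>u y\<bar> * (norm (x - x') / \<epsilon>)"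
      using tent_lipschitz[OF \<epsilon>, of "x - y" "x' - y"]
      unfolding right_diff_distrib[symmetric] abs_mult by (intro mult_left_mono) (simp_all add: algebra_simps)
  qed (use u in auto)
  also have "\<dots> = (\<integral>y. \<bar>u y\<bar> \<partial>lborel) * (norm (x - x') / \<epsilon>)" by simp
  finally have "\<bar>(\<integral>y. u y * tent \<epsilon> (x - y) \<partial>lborel) - (\<integral>y. u y * tent \<epsilon> (x' - y) \<partial>lborel)\<bar> / ?N
     \<le> (\<integral>y. \<bar>u y\<bar> \<partial>lborel) * (norm (x - x') / \<epsilon>) / ?N"
    using N by (intro divide_right_mono) auto
  then show ?thesis using N \<epsilon> by (simp add: mollify_def L_def diff_divide_distrib[symmetric] field_simps)
qed

lemma mollify_continuous:
  fixes u :: "'a::euclidean_space \<Rightarrow> real"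
  assumes u: "integrable lborel u" and \<epsilon>: "0 < \<epsilon>"
  shows "continuous_on UNIV (mollify \<epsilon> u)"
proof -
  have "((\<integral>y. \<bar>u y\<bar> \<partial>lborel) / (\<epsilon> * (\<integral>z. tent \<epsilon> (z :: 'a) \<partial>lborel)))-lipschitz_on UNIV (mollify \<epsilon> u)"
    using mollify_lipschitz[OF u \<epsilon>] tent_mass_pos[OF \<epsilon>, where 'a='a] \<epsilon>
    by (intro lipschitz_onI) (auto simp: dist_norm intro!: divide_nonneg_pos)
  then show ?thesis by (rule lipschitz_on_continuous_on)
qed

lemma frac_lap_bound_lipschitz:
  fixes \<phi> :: "real ^ 'n \<Rightarrow> real"
  assumes s: "0 < s" and L: "\<And>y. \<bar>\<phi> x - \<phi> y\<bar> \<le> L * norm (x - y)" and B: "\<And>y. \<bar>\<phi> x - \<phi> y\<bar> \<le> B"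
  shows "\<bar>\<phi> x - \<phi> y\<bar> * frac_kernel s (x - y) \<le> (L + B) * two_sided_powr (1 - 2 * s) (2 * s) (x - y)"
proof (cases "x = y")
  case False
  define r where "r = norm (x - y)"
  have r: "0 < r" using False by (simp add: r_def)
  have "0 \<le> L * r" using L[of y] by (simp add: r_def order_trans[OF abs_ge_zero])
  then have L0: "0 \<le> L" using r by (simp add: zero_le_mult_iff)
  have B0: "0 \<le> B" using B[of y] by (simp add: order_trans[OF abs_ge_zero])
  show ?thesis
  proof (cases "r < 1")
    case True
    have "\<bar>\<phi> x - \<phi> y\<bar> * frac_kernel s (x - y) \<le> (L * r) * r powr (- 2 * s - real CARD('n))"
      using L[of y] unfolding frac_kernel_powr r_def[symmetric] by (intro mult_right_mono) auto
    also have "\<dots> = L * r powr (1 - 2 * s - real CARD('n))"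
      using r powr_mult_base[of r "- 2 * s - real CARD('n)"] by (simp add: mult.assoc algebra_simps)
    also have "\<dots> \<le> (L + B) * r powr (1 - 2 * s - real CARD('n))" using B0 by (intro mult_right_mono) auto
    finally show ?thesis using True by (simp add: two_sided_powr_def r_def)
  next
    case False
    have "\<bar>\<phi> x - \<phi> y\<bar> * frac_kernel s (x - y) \<le> B * r powr (- 2 * s - real CARD('n))"
      using B[of y] unfolding frac_kernel_powr r_def[symmetric] by (intro mult_right_mono) auto
    also have "\<dots> \<le> (L + B) * r powr (- 2 * s - real CARD('n))" using L0 by (intro mult_right_mono) auto
    finally show ?thesis using False by (simp add: two_sided_powr_def r_def)
  qed
next
  case True
  have "0 \<le> B" using B[of x] by simp
  then show ?thesis using True by (simp add: two_sided_powr_def)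
qed

lemma tent_abs_lap:
  assumes s: "0 < s" "s < 1/2" and \<epsilon>: "0 < \<epsilon>"
  shows "abs_lap s (\<lambda>y :: real ^ 'n. tent \<epsilon> (x - y)) a \<le>
    ennreal ((1 / \<epsilon> + 1) * (\<integral>z. two_sided_powr (1 - 2 * s) (2 * s) (z :: real ^ 'n) \<partial>lborel))"
proof (rule abs_lap_le)
  fix y :: "real ^ 'n"
  show "\<bar>tent \<epsilon> (x - a) - tent \<epsilon> (x - y)\<bar> * frac_kernel s (a - y) \<le> (1 / \<epsilon> + 1) * two_sided_powr (1 - 2 * s) (2 * s) (a - y)"
  proof (rule frac_lap_bound_lipschitz[OF s(1), of "\<lambda>y. tent \<epsilon> (x - y)"])
    fix y
    show "\<bar>tent \<epsilon> (x - a) - tent \<epsilon> (x - y)\<bar> \<le> 1 / \<epsilon> * norm (a - y)"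
      using tent_lipschitz[OF \<epsilon>, of "x - a" "x - y"] by (simp add: norm_minus_commute)
    show "\<bar>tent \<epsilon> (x - a) - tent \<epsilon> (x - y)\<bar> \<le> 1"
      using tent_bounds[OF \<epsilon>, of "x - a"] tent_bounds[OF \<epsilon>, of "x - y"] by linarith
  qed
qed (use s \<epsilon> in auto)

lemma tent_in_energy_space:
  fixes x :: "real ^ 'n"
  assumes s: "0 < s" "s < 1/2" and \<epsilon>: "0 < \<epsilon>" and K: "cball x \<epsilon> \<subseteq> K"
  shows "(\<lambda>y. tent \<epsilon> (x - y)) \<in> energy_space s K"
proof -
  have m: "(\<lambda>y. tent \<epsilon> (x - y)) \<in> borel_measurable borel" by measurable
  have "integrable (lborel \<Otimes>\<^sub>M lborel)
      (\<lambda>(a, y). (tent \<epsilon> (x - a) - tent \<epsilon> (x - y)) * (tent \<epsilon> (x - a) - tent \<epsilon> (x - y)) * frac_kernel s (a - y))"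
    using tent_abs_lap[OF s \<epsilon>, of x]
    by (intro energy_form_by_parts(1)[OF m m tent_shift_integrable[OF \<epsilon>]] AE_I2 impI)
  moreover have "integrable lborel (\<lambda>y. (tent \<epsilon> (x - y))\<^sup>2)"
  proof (rule Bochner_Integration.integrable_bound[OF tent_shift_integrable[OF \<epsilon>, of x]])
    show "AE y in lborel. norm ((tent \<epsilon> (x - y))\<^sup>2) \<le> norm (tent \<epsilon> (x - y))"
    proof (rule AE_I2)
      fix y
      have "\<bar>tent \<epsilon> (x - y)\<bar> * \<bar>tent \<epsilon> (x - y)\<bar> \<le> \<bar>tent \<epsilon> (x - y)\<bar> * 1"
        using tent_abs_le[OF \<epsilon>, of "x - y"] by (intro mult_left_mono) auto
      then show "norm ((tent \<epsilon> (x - y))\<^sup>2) \<le> norm (tent \<epsilon> (x - y))"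
        by (simp add: power2_eq_square abs_mult)
    qed
  qed measurable
  moreover have "tent \<epsilon> (x - y) = 0" if "y \<notin> K" for y
  proof (rule tent_eq_0[OF \<epsilon>])
    show "\<epsilon> \<le> norm (x - y)" using K that by (force simp: dist_norm)
  qed
  ultimately show ?thesis using m by (auto simp: energy_space_def finite_energy_def power2_eq_square)
qed

lemma mollify_frac_lap_integrable:
  fixes u :: "real ^ 'n \<Rightarrow> real"
  assumes s: "0 < s" "s < 1/2" and \<epsilon>: "0 < \<epsilon>" and u: "integrable lborel u" and B: "AE x in lborel. \<bar>u x\<bar> \<le> B"
  shows "integrable lborel (\<lambda>z. (mollify \<epsilon> u x - mollify \<epsilon> u (x + z)) * frac_kernel s z)"
proof -
  define L where "L = (\<integral>y. \<bar>u y\<bar> \<partial>lborel) / (\<epsilon> * (\<integral>z. tent \<epsilon> (z :: real ^ 'n) \<partial>lborel))"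
  have m: "mollify \<epsilon> u \<in> borel_measurable borel"
    by (intro borel_measurable_continuous_onI mollify_continuous u \<epsilon>)
  have bd: "\<bar>mollify \<epsilon> u x\<bar> \<le> B" for x
    using B by (intro mollify_abs_le[OF u \<epsilon>]) auto
  have "\<bar>mollify \<epsilon> u x - mollify \<epsilon> u y\<bar> * frac_kernel s (x - y) \<le> (L + 2 * B) * two_sided_powr (1 - 2 * s) (2 * s) (x - y)" for y
  proof (rule frac_lap_bound_lipschitz[OF s(1)])
    fix y
    show "\<bar>mollify \<epsilon> u x - mollify \<epsilon> u y\<bar> \<le> L * norm (x - y)" unfolding L_def by (rule mollify_lipschitz[OF u \<epsilon>])
    show "\<bar>mollify \<epsilon> u x - mollify \<epsilon> u y\<bar> \<le> 2 * B" using bd[of x] bd[of y] by linarith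
  qed
  moreover have "0 \<le> L + 2 * B"
    using bd[of x] tent_mass_pos[OF \<epsilon>, where 'a = "real ^ 'n"] \<epsilon>
    by (auto simp: L_def intro!: add_nonneg_nonneg divide_nonneg_pos)
  ultimately have "abs_lap s (mollify \<epsilon> u) x \<le> ennreal ((L + 2 * B) * (\<integral>z. two_sided_powr (1 - 2 * s) (2 * s) (z :: real ^ 'n) \<partial>lborel))"
    using s by (intro abs_lap_le) auto
  from frac_lap_integrable[OF m this] show ?thesis by (simp add: frac_lap_shift(2)[OF m])
qed

text \<open>
  Convolution commutes with the fractional Laplacian: by translation invariance and Fubini's
  theorem the operator is moved onto the tent centred at \<open>x\<close>. Hence a weak inequality for \<open>u\<close>,
  tested with tents, is a pointwise inequality for its mollification.
\<close>

lemma frac_lap_mollify: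
  fixes u :: "real ^ 'n \<Rightarrow> real"
  assumes s: "0 < s" "s < 1/2" and \<epsilon>: "0 < \<epsilon>" and u: "integrable lborel u"
  shows "2 * (\<integral>z. tent \<epsilon> (z :: real ^ 'n) \<partial>lborel) * frac_lap s (mollify \<epsilon> u) x =
    energy_form s (\<lambda>y. tent \<epsilon> (x - y)) u"
proof -
  let ?N = "\<integral>z. tent \<epsilon> (z :: real ^ 'n) \<partial>lborel"
  have N: "0 < ?N" by (rule tent_mass_pos[OF \<epsilon>])
  have um [measurable]: "u \<in> borel_measurable borel" using borel_measurable_integrable[OF u] by simp
  have mm: "mollify \<epsilon> u \<in> borel_measurable borel"
    by (intro borel_measurable_continuous_onI mollify_continuous u \<epsilon>)
  define \<eta> where "\<eta> = (\<lambda>y. tent \<epsilon> (x - y))"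
  have em [measurable]: "\<eta> \<in> borel_measurable borel" unfolding \<eta>_def by measurable
  define B where "B = (1 / \<epsilon> + 1) * (\<integral>z. two_sided_powr (1 - 2 * s) (2 * s) (z :: real ^ 'n) \<partial>lborel)"
  have B: "abs_lap s \<eta> a \<le> ennreal B" for a unfolding \<eta>_def B_def by (rule tent_abs_lap[OF s \<epsilon>])
  define G where "G = (\<lambda>a z. u a * ((tent \<epsilon> (x - a) - tent \<epsilon> (x + z - a)) * frac_kernel s z))"
  have [measurable]: "case_prod G \<in> borel_measurable (lborel \<Otimes>\<^sub>M lborel)"
    unfolding G_def by measurable
  have abs: "(\<integral>\<^sup>+z. ennreal (norm (G a z)) \<partial>lborel) = ennreal \<bar>u a\<bar> * abs_lap s \<eta> a" for a
  proof -
    have m: "(\<lambda>z. ennreal (norm (G a z))) \<in> borel_measurable borel" unfolding G_def by measurable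
    have "(\<integral>\<^sup>+z. ennreal (norm (G a z)) \<partial>lborel) = (\<integral>\<^sup>+b. ennreal (norm (G a (a - b))) \<partial>lborel)"
      by (rule nn_integral_reflect[OF m, symmetric])
    also have "\<dots> = (\<integral>\<^sup>+b. ennreal \<bar>u a\<bar> * ennreal (\<bar>\<eta> a - \<eta> b\<bar> * frac_kernel s (a - b)) \<partial>lborel)"
      by (intro nn_integral_cong) (simp add: G_def \<eta>_def abs_mult ennreal_mult[symmetric])
    also have "\<dots> = ennreal \<bar>u a\<bar> * abs_lap s \<eta> a" unfolding abs_lap_def by (rule nn_integral_cmult) measurable
    finally show ?thesis .
  qed
  have inner: "(\<integral>z. G a z \<partial>lborel) = u a * frac_lap s \<eta> a" for a
  proof -
    have m: "G a \<in> borel_measurable borel" unfolding G_def by measurable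
    have "(\<integral>z. G a z \<partial>lborel) = (\<integral>b. G a (a - b) \<partial>lborel)" by (rule integral_reflect(1)[OF m, symmetric])
    also have "\<dots> = (\<integral>b. u a * ((\<eta> a - \<eta> b) * frac_kernel s (a - b)) \<partial>lborel)"
      by (intro Bochner_Integration.integral_cong refl) (simp add: G_def \<eta>_def)
    also have "\<dots> = u a * frac_lap s \<eta> a" by (simp add: frac_lap_def)
    finally show ?thesis .
  qed
  have Gi: "integrable (lborel \<Otimes>\<^sub>M lborel) (case_prod G)"
  proof (rule integrableI_bounded)
    have "(\<integral>\<^sup>+w. ennreal (norm (case_prod G w)) \<partial>(lborel \<Otimes>\<^sub>M lborel)) =
        (\<integral>\<^sup>+a. \<integral>\<^sup>+z. ennreal (norm (case_prod G (a, z))) \<partial>lborel \<partial>lborel)"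
      by (rule lborel.nn_integral_fst[symmetric]) measurable
    also have "\<dots> = (\<integral>\<^sup>+a. ennreal \<bar>u a\<bar> * abs_lap s \<eta> a \<partial>lborel)" by (simp only: abs prod.case)
    also have "\<dots> \<le> (\<integral>\<^sup>+a. ennreal B * ennreal (norm (u a)) \<partial>lborel)"
    proof (rule nn_integral_mono)
      fix a
      show "ennreal \<bar>u a\<bar> * abs_lap s \<eta> a \<le> ennreal B * ennreal (norm (u a))"
        using mult_left_mono[OF B, of "ennreal \<bar>u a\<bar>" a] by (simp add: mult.commute[of "ennreal B"])
    qed
    also have "\<dots> = ennreal B * (\<integral>\<^sup>+a. ennreal (norm (u a)) \<partial>lborel)"
      by (rule nn_integral_cmult) measurable
    also have "\<dots> < \<infinity>" using u by (simp add: integrable_iff_bounded ennreal_mult_less_top)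
    finally show "(\<integral>\<^sup>+w. ennreal (norm (case_prod G w)) \<partial>(lborel \<Otimes>\<^sub>M lborel)) < \<infinity>" .
  qed measurable
  have "?N * frac_lap s (mollify \<epsilon> u) x = (\<integral>z. ?N * ((mollify \<epsilon> u x - mollify \<epsilon> u (x + z)) * frac_kernel s z) \<partial>lborel)"
    unfolding frac_lap_shift(1)[OF mm] by simp
  also have "\<dots> = (\<integral>z. \<integral>a. G a z \<partial>lborel \<partial>lborel)"
  proof (intro Bochner_Integration.integral_cong refl)
    fix z
    have "?N * (mollify \<epsilon> u x - mollify \<epsilon> u (x + z)) = (\<integral>a. u a * tent \<epsilon> (x - a) \<partial>lborel) - (\<integral>a. u a * tent \<epsilon> (x + z - a) \<partial>lborel)"
      using N by (simp add: mollify_def right_diff_distrib)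
    also have "\<dots> = (\<integral>a. u a * tent \<epsilon> (x - a) - u a * tent \<epsilon> (x + z - a) \<partial>lborel)"
      using u \<epsilon> by (intro Bochner_Integration.integral_diff[symmetric] mult_tent_integrable)
    finally have "?N * ((mollify \<epsilon> u x - mollify \<epsilon> u (x + z)) * frac_kernel s z) =
        (\<integral>a. u a * tent \<epsilon> (x - a) - u a * tent \<epsilon> (x + z - a) \<partial>lborel) * frac_kernel s z" by simp
    also have "\<dots> = (\<integral>a. G a z \<partial>lborel)"
      by (subst integral_mult_left_zero[symmetric], intro Bochner_Integration.integral_cong refl) (simp add: G_def algebra_simps)
    finally show "?N * ((mollify \<epsilon> u x - mollify \<epsilon> u (x + z)) * frac_kernel s z) = (\<integral>a. G a z \<partial>lborel)" .
  qed
  also have "\<dots> = (\<integral>a. \<integral>z. G a z \<partial>lborel \<partial>lborel)" by (rule lborel_pair.Fubini_integral[OF Gi])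
  also have "\<dots> = (\<integral>a. u a * frac_lap s \<eta> a \<partial>lborel)" by (simp only: inner)
  finally have "2 * ?N * frac_lap s (mollify \<epsilon> u) x = 2 * (\<integral>a. u a * frac_lap s \<eta> a \<partial>lborel)" by simp
  also have "\<dots> = energy_form s \<eta> u"
    using B by (intro energy_form_by_parts(2)[OF em um u, symmetric] AE_I2) auto
  finally show ?thesis unfolding \<eta>_def .
qed

text \<open>Mollification is symmetric because the tent is even.\<close>

lemma integral_mollify_set:
  fixes u :: "'a::euclidean_space \<Rightarrow> real"
  assumes u: "integrable lborel u" and \<epsilon>: "0 < \<epsilon>" and V: "V \<in> sets borel" "emeasure lborel V < \<infinity>"
  shows "integrable lborel (\<lambda>x. mollify \<epsilon> u x * indicator V x)"
    and "(\<integral>x. mollify \<epsilon> u x * indicator V x \<partial>lborel) = (\<integral>y. u y * mollify \<epsilon> (indicator V) y \<partial>lborel)"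
proof -
  let ?N = "\<integral>z. tent \<epsilon> (z :: 'a) \<partial>lborel"
  have N: "0 < ?N" by (rule tent_mass_pos[OF \<epsilon>])
  note [measurable] = V(1)
  have um [measurable]: "u \<in> borel_measurable borel" using borel_measurable_integrable[OF u] by simp
  define G where "G = (\<lambda>x y. (u y * tent \<epsilon> (x - y)) * indicator V x :: real)"
  have [measurable]: "case_prod G \<in> borel_measurable (lborel \<Otimes>\<^sub>M lborel)" unfolding G_def by measurable
  have Gi: "integrable (lborel \<Otimes>\<^sub>M lborel) (case_prod G)"
  proof (rule Bochner_Integration.integrable_bound)
    define H where "H = (\<lambda>(x, y). indicator V x * u y :: real)"
    have [measurable]: "H \<in> borel_measurable (lborel \<Otimes>\<^sub>M lborel)" unfolding H_def by measurable
    show "integrable (lborel \<Otimes>\<^sub>M lborel) H"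
    proof (rule integrableI_bounded)
      have "(\<integral>\<^sup>+w. ennreal (norm (H w)) \<partial>(lborel \<Otimes>\<^sub>M lborel)) = (\<integral>\<^sup>+x. \<integral>\<^sup>+y. ennreal (norm (H (x, y))) \<partial>lborel \<partial>lborel)"
        by (rule lborel.nn_integral_fst[symmetric]) measurable
      also have "\<dots> = (\<integral>\<^sup>+x. (\<integral>\<^sup>+y. ennreal (norm (u y)) \<partial>lborel) * indicator V x \<partial>lborel)"
        by (intro nn_integral_cong) (auto simp: H_def indicator_def)
      also have "\<dots> = (\<integral>\<^sup>+y. ennreal (norm (u y)) \<partial>lborel) * emeasure lborel V"
        by (rule nn_integral_cmult_indicator) simp
      also have "\<dots> < \<infinity>" using u V by (simp add: integrable_iff_bounded ennreal_mult_less_top)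
      finally show "(\<integral>\<^sup>+w. ennreal (norm (H w)) \<partial>(lborel \<Otimes>\<^sub>M lborel)) < \<infinity>" .
    qed measurable
    show "AE w in lborel \<Otimes>\<^sub>M lborel. norm (case_prod G w) \<le> norm (H w)"
      by (intro AE_I2) (auto simp: G_def H_def abs_mult indicator_def tent_abs_le[OF \<epsilon>] intro!: mult_left_le)
  qed measurable
  have inner1: "(\<integral>y. G x y \<partial>lborel) = ?N * (mollify \<epsilon> u x * indicator V x)" for x
    using N by (simp add: G_def mollify_def)
  have inner2: "(\<integral>x. G x y \<partial>lborel) = ?N * (u y * mollify \<epsilon> (indicator V) y)" for y
  proof -
    have "(\<integral>x. G x y \<partial>lborel) = (\<integral>x. u y * (indicator V x * tent \<epsilon> (y - x)) \<partial>lborel)"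
    proof (intro Bochner_Integration.integral_cong refl)
      fix x
      have "tent \<epsilon> (x - y) = tent \<epsilon> (y - x)" using tent_minus[of \<epsilon> "y - x"] by simp
      then show "G x y = u y * (indicator V x * tent \<epsilon> (y - x))" by (simp add: G_def)
    qed
    also have "\<dots> = u y * (\<integral>x. indicator V x * tent \<epsilon> (y - x) \<partial>lborel)" by simp
    finally show ?thesis using N by (simp add: mollify_def)
  qed
  have "integrable lborel (\<lambda>x. ?N * (mollify \<epsilon> u x * indicator V x))"
    using lborel_pair.integrable_fst'[OF Gi] by (simp add: inner1)
  then show "integrable lborel (\<lambda>x. mollify \<epsilon> u x * indicator V x)" using N by simp
  have "?N * (\<integral>x. mollify \<epsilon> u x * indicator V x \<partial>lborel) = (\<integral>x. \<integral>y. G x y \<partial>lborel \<partial>lborel)"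
    by (simp only: inner1 integral_mult_right_zero)
  also have "\<dots> = (\<integral>y. \<integral>x. G x y \<partial>lborel \<partial>lborel)"
    by (rule lborel_pair.Fubini_integral[OF Gi, symmetric])
  also have "\<dots> = ?N * (\<integral>y. u y * mollify \<epsilon> (indicator V) y \<partial>lborel)"
    by (simp only: inner2 integral_mult_right_zero)
  finally show "(\<integral>x. mollify \<epsilon> u x * indicator V x \<partial>lborel) = (\<integral>y. u y * mollify \<epsilon> (indicator V) y \<partial>lborel)"
    using N by simp
qed

lemma mollify_indicator_tendsto:
  fixes V :: "'a::euclidean_space set"
  assumes \<epsilon>: "\<And>k. 0 < \<epsilon> k" "\<epsilon> \<longlonglongrightarrow> 0" and V: "V \<in> sets borel" "emeasure lborel V < \<infinity>" and y: "y \<notin> frontier V"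
  shows "(\<lambda>k. mollify (\<epsilon> k) (indicator V) y) \<longlonglongrightarrow> indicator V y"
proof -
  have Vi: "integrable lborel (indicator V :: 'a \<Rightarrow> real)" using V by (intro integrable_real_indicator) auto
  have "y \<in> interior V \<or> y \<in> interior (- V)"
    using y by (auto simp: frontier_def interior_complement)
  then obtain r where r: "0 < r" "ball y r \<subseteq> V \<or> ball y r \<subseteq> - V"
    using mem_interior[of y V] mem_interior[of y "- V"] by blast
  have "eventually (\<lambda>k. \<epsilon> k < r) sequentially" using order_tendstoD(2)[OF \<epsilon>(2) r(1)] .
  then have "eventually (\<lambda>k. mollify (\<epsilon> k) (indicator V) y = indicator V y) sequentially"
  proof eventually_elim
    case (elim k)
    have "indicator V z = (indicator V y :: real)" if "norm (y - z) < \<epsilon> k" for z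
    proof -
      have "z \<in> ball y r" "y \<in> ball y r" using that elim r by (auto simp: dist_norm)
      then have "z \<in> V \<longleftrightarrow> y \<in> V" using r(2) by blast
      then show ?thesis by (simp add: indicator_def)
    qed
    then have "mollify (\<epsilon> k) (indicator V) y \<le> indicator V y" "indicator V y \<le> mollify (\<epsilon> k) (indicator V) y"
      using mollify_le[OF Vi \<epsilon>(1)[of k], of y "indicator V y"] mollify_ge[OF Vi \<epsilon>(1)[of k], of y "indicator V y"] by auto
    then show ?case by simp
  qed
  then show ?thesis by (rule tendsto_eventually)
qed

text \<open>
  Mollification is moved onto the indicator of \<open>V\<close>, which converges outside the frontier of \<open>V\<close>. The
  frontier of a convex set is negligible.
\<close>

lemma mollify_weak_limit:
  fixes u :: "'a::euclidean_space \<Rightarrow> real"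
  assumes u: "integrable lborel u" and \<epsilon>: "\<And>k. 0 < \<epsilon> k" "\<epsilon> \<longlonglongrightarrow> 0" and V: "bounded V" "V \<in> sets borel" "convex V"
  shows "(\<lambda>k. \<integral>x. mollify (\<epsilon> k) u x * indicator V x \<partial>lborel) \<longlonglongrightarrow> (\<integral>y. u y * indicator V y \<partial>lborel)"
proof -
  have fin: "emeasure lborel V < \<infinity>" using V(1) by (rule emeasure_bounded_finite)
  note [measurable] = V(2)
  have um [measurable]: "u \<in> borel_measurable borel" using borel_measurable_integrable[OF u] by simp
  have Vi: "integrable lborel (indicator V :: 'a \<Rightarrow> real)" using V fin by (intro integrable_real_indicator) auto
  have [measurable]: "mollify (\<epsilon> k) (indicator V) \<in> borel_measurable borel" for k
    by (intro borel_measurable_continuous_onI mollify_continuous Vi \<epsilon>)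
  have fr: "AE y in lborel. y \<notin> frontier V"
  proof -
    have "frontier V \<in> null_sets lebesgue"
      using negligible_convex_frontier[OF V(3)] by (simp add: negligible_iff_null_sets)
    then have "AE y in lebesgue. y \<notin> frontier V" by (rule AE_not_in)
    then show ?thesis by (simp add: AE_completion_iff)
  qed
  have "(\<lambda>k. \<integral>y. u y * mollify (\<epsilon> k) (indicator V) y \<partial>lborel) \<longlonglongrightarrow> (\<integral>y. u y * indicator V y \<partial>lborel)"
  proof (rule integral_dominated_convergence)
    show "integrable lborel (\<lambda>y. \<bar>u y\<bar>)" using u by simp
    show "AE y in lborel. (\<lambda>k. u y * mollify (\<epsilon> k) (indicator V) y) \<longlonglongrightarrow> u y * indicator V y"
      using fr
    proof eventually_elim
      case (elim y)
      then show ?case by (intro tendsto_mult tendsto_const mollify_indicator_tendsto \<epsilon> V fin)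
    qed
    fix k
    show "AE y in lborel. norm (u y * mollify (\<epsilon> k) (indicator V) y) \<le> \<bar>u y\<bar>"
    proof (rule AE_I2)
      fix y
      have "\<bar>mollify (\<epsilon> k) (indicator V) y\<bar> \<le> 1"
        using Vi \<epsilon>(1)[of k] by (intro mollify_abs_le) (auto simp: indicator_def)
      then show "norm (u y * mollify (\<epsilon> k) (indicator V) y) \<le> \<bar>u y\<bar>"
        by (simp add: abs_mult mult_left_le)
    qed
  qed measurable
  then show ?thesis unfolding integral_mollify_set(2)[OF u \<epsilon>(1) V(2) fin] .
qed

text \<open>
  Adding the constant \<open>B\<close> makes both functions densities of measures, which agree on the
  intersection-stable generator of boxes.
\<close>

lemma AE_eq_if_box_integrals_eq:
  fixes u g :: "'a::euclidean_space \<Rightarrow> real"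
  assumes [measurable]: "u \<in> borel_measurable borel" "g \<in> borel_measurable borel"
    and B: "AE x in lborel. \<bar>u x\<bar> \<le> B" "AE x in lborel. \<bar>g x\<bar> \<le> B"
    and eq: "\<And>a b. (\<integral>x. u x * indicator (box a b) x \<partial>lborel) = (\<integral>x. g x * indicator (box a b) x \<partial>lborel)"
  shows "AE x in lborel. u x = g x"
proof -
  have em: "emeasure (density lborel (\<lambda>x. ennreal (f x + B))) (box a b) =
      ennreal ((\<integral>x. f x * indicator (box a b) x \<partial>lborel) + B * measure lborel (box a b))"
    if [measurable]: "f \<in> borel_measurable borel" and f: "AE x in lborel. \<bar>f x\<bar> \<le> B" for f a b
  proof -
    have fin: "emeasure lborel (box a b) < \<infinity>" by (rule emeasure_lborel_box_finite)
    have Ii: "integrable lborel (\<lambda>x. B * indicator (box a b) x :: real)"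
      using fin by (intro integrable_mult_right integrable_real_indicator) auto
    have fi: "integrable lborel (\<lambda>x. f x * indicator (box a b) x)"
    proof (rule Bochner_Integration.integrable_bound[OF Ii])
      show "AE x in lborel. norm (f x * indicator (box a b) x) \<le> norm (B * indicator (box a b) x :: real)"
        using f by eventually_elim (auto simp: indicator_def)
    qed measurable
    have "emeasure (density lborel (\<lambda>x. ennreal (f x + B))) (box a b) = (\<integral>\<^sup>+x. ennreal (f x + B) * indicator (box a b) x \<partial>lborel)"
      by (subst emeasure_density) auto
    also have "\<dots> = (\<integral>\<^sup>+x. ennreal (f x * indicator (box a b) x + B * indicator (box a b) x) \<partial>lborel)"
      by (intro nn_integral_cong) (auto simp: indicator_def)
    also have "\<dots> = ennreal (\<integral>x. f x * indicator (box a b) x + B * indicator (box a b) x \<partial>lborel)"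
    proof (rule nn_integral_eq_integral)
      show "AE x in lborel. 0 \<le> f x * indicator (box a b) x + B * indicator (box a b) x"
        using f by eventually_elim (auto simp: indicator_def)
    qed (use fi Ii in simp)
    also have "(\<integral>x. f x * indicator (box a b) x + B * indicator (box a b) x \<partial>lborel)
       = (\<integral>x. f x * indicator (box a b) x \<partial>lborel) + B * measure lborel (box a b)"
      using fi Ii by simp
    finally show ?thesis .
  qed
  have "density lborel (\<lambda>x. ennreal (u x + B)) = density lborel (\<lambda>x. ennreal (g x + B))"
  proof (rule measure_eqI_generator_eq[where E = "range (\<lambda>(a, b). box a b :: 'a set)" and \<Omega> = UNIV
        and A = "\<lambda>k. box (- (real k *\<^sub>R One)) (real k *\<^sub>R One)"])
    show "Int_stable (range (\<lambda>(a, b). box a b :: 'a set))"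
    proof (rule Int_stableI_image)
      fix i j :: "'a \<times> 'a"
      show "\<exists>k\<in>UNIV. (case i of (a, b) \<Rightarrow> box a b) \<inter> (case j of (a, b) \<Rightarrow> box a b) = (case k of (a, b) \<Rightarrow> box a b)"
        by (cases i; cases j) (auto simp: box_Int_box)
    qed
    show "sets (density lborel (\<lambda>x. ennreal (u x + B))) = sigma_sets UNIV (range (\<lambda>(a, b). box a b :: 'a set))"
      "sets (density lborel (\<lambda>x. ennreal (g x + B))) = sigma_sets UNIV (range (\<lambda>(a, b). box a b :: 'a set))"
      by (simp_all add: borel_eq_box)
    show "(\<Union>k. box (- (real k *\<^sub>R One)) (real k *\<^sub>R One)) = (UNIV :: 'a set)" by (rule UN_box_eq_UNIV)
    show "emeasure (density lborel (\<lambda>x. ennreal (u x + B))) X = emeasure (density lborel (\<lambda>x. ennreal (g x + B))) X"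
      if "X \<in> range (\<lambda>(a, b). box a b :: 'a set)" for X
      using that eq B by (auto simp: em)
    show "emeasure (density lborel (\<lambda>x. ennreal (u x + B))) (box (- (real k *\<^sub>R One)) (real k *\<^sub>R One)) \<noteq> \<infinity>" for k
      using B by (simp add: em)
  qed auto
  then have "AE x in lborel. ennreal (u x + B) = ennreal (g x + B)"
    by (subst (asm) sigma_finite_measure.density_unique_iff[OF sigma_finite_lborel]) auto
  with B show ?thesis by eventually_elim (simp add: abs_le_iff)
qed

text \<open>
  The mollifications converge at every point, not only almost everywhere: up to the vanishing term
  \<open>A * \<epsilon> powr s\<close> they are equicontinuous, so the value at \<open>x\<close> is close to the average over a small
  ball, and such averages converge by \<open>mollify_weak_limit\<close>. The limit inherits the Hoelder bound
  and has the same integrals over boxes as \<open>u\<close>.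
\<close>

lemma holder_representative_of_mollified:
  fixes u :: "real ^ 'n \<Rightarrow> real"
  assumes s: "0 < s" and u: "integrable lborel u" and B: "AE x in lborel. \<bar>u x\<bar> \<le> B" and M: "0 \<le> M" and A: "0 \<le> A"
    and est: "\<And>\<epsilon> x y. 0 < \<epsilon> \<Longrightarrow> mollify \<epsilon> u x - mollify \<epsilon> u y \<le> M * norm (x - y) powr s + A * \<epsilon> powr s"
  shows "\<exists>g\<in>holder_space s UNIV. AE x in lborel. u x = g x"
proof -
  have um [measurable]: "u \<in> borel_measurable borel" using borel_measurable_integrable[OF u] by simp
  define \<epsilon> where "\<epsilon> = (\<lambda>k::nat. inverse (real (Suc k)))"
  have \<epsilon>: "\<And>k. 0 < \<epsilon> k" "\<epsilon> \<longlonglongrightarrow> 0" unfolding \<epsilon>_def by (simp, rule LIMSEQ_inverse_real_of_nat)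
  define F where "F = (\<lambda>k. mollify (\<epsilon> k) u)"
  have Fc: "continuous_on UNIV (F k)" for k unfolding F_def by (rule mollify_continuous[OF u \<epsilon>(1)])
  have [measurable]: "F k \<in> borel_measurable borel" for k using Fc by (rule borel_measurable_continuous_onI)
  have Fb: "\<bar>F k x\<bar> \<le> B" for k x unfolding F_def using B by (intro mollify_abs_le u \<epsilon>) auto
  have ek: "(\<lambda>k. A * \<epsilon> k powr s) \<longlonglongrightarrow> 0"
  proof -
    have "(\<lambda>k. A * \<epsilon> k powr s) \<longlonglongrightarrow> A * 0 powr s"
      using s \<epsilon> by (intro tendsto_mult tendsto_const tendsto_powr') (auto intro!: always_eventually less_imp_le)
    then show ?thesis by simp
  qed
  have conv: "convergent (\<lambda>k. F k x)" for x
  proof (rule Cauchy_convergent, rule metric_CauchyI)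
    fix e :: real assume e: "0 < e"
    obtain \<delta> where \<delta>: "0 < \<delta>" "M * \<delta> powr s < e / 4"
    proof -
      have "((\<lambda>\<delta>. M * \<delta> powr s) \<longlongrightarrow> M * 0 powr s) (at_right 0)"
        using s by (intro tendsto_mult tendsto_const tendsto_powr' tendsto_intros) (auto simp: eventually_at_filter)
      then have "eventually (\<lambda>\<delta>. M * \<delta> powr s < e / 4) (at_right 0)"
        using e by (intro order_tendstoD(2)) auto
      then have "eventually (\<lambda>\<delta>. 0 < \<delta> \<and> M * \<delta> powr s < e / 4) (at_right 0)"
        by (simp add: eventually_conj_iff eventually_at_right_less)
      then show ?thesis using that eventually_happens[of _ "at_right (0::real)"] by (auto simp: trivial_limit_at_right_real)
    qed
    define V where "V = ball x \<delta>"
    define v where "v = measure lborel V"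
    have v: "0 < v" unfolding v_def V_def using \<delta>(1) by (rule content_ball_pos)
    have Vfin: "emeasure lborel V < \<infinity>" unfolding V_def by (rule emeasure_lborel_ball_finite)
    have Vm [measurable]: "V \<in> sets borel" unfolding V_def by simp
    define a where "a = (\<lambda>k. (\<integral>y. F k y * indicator V y \<partial>lborel) / v)"
    have "(\<lambda>k. \<integral>y. F k y * indicator V y \<partial>lborel) \<longlonglongrightarrow> (\<integral>y. u y * indicator V y \<partial>lborel)"
      unfolding F_def using u \<epsilon> Vm by (intro mollify_weak_limit) (auto simp: V_def)
    then have "a \<longlonglongrightarrow> (\<integral>y. u y * indicator V y \<partial>lborel) / v" unfolding a_def using v by (intro tendsto_divide) auto
    then have "Cauchy a" by (rule LIMSEQ_imp_Cauchy)
    then obtain N1 where N1: "\<And>m k. N1 \<le> m \<Longrightarrow> N1 \<le> k \<Longrightarrow> dist (a m) (a k) < e / 4"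
      using e unfolding Cauchy_def by (metis divide_pos_pos zero_less_numeral)
    obtain N2 where N2: "\<And>k. N2 \<le> k \<Longrightarrow> A * \<epsilon> k powr s < e / 8"
      using order_tendstoD(2)[OF ek, of "e / 8"] e unfolding eventually_sequentially by auto
    have Fa: "\<bar>F k x - a k\<bar> \<le> M * \<delta> powr s + A * \<epsilon> k powr s" for k
    proof -
      let ?c = "M * \<delta> powr s + A * \<epsilon> k powr s"
      have pt: "F k x - ?c \<le> F k y" "F k y \<le> F k x + ?c" if "y \<in> V" for y
      proof -
        have n: "norm (x - y) powr s \<le> \<delta> powr s" "norm (y - x) powr s \<le> \<delta> powr s"
          using that s by (auto simp: V_def dist_norm norm_minus_commute intro!: powr_mono2)
        have "M * norm (x - y) powr s \<le> M * \<delta> powr s" "M * norm (y - x) powr s \<le> M * \<delta> powr s"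
          using M n by (auto intro: mult_left_mono)
        then show "F k x - ?c \<le> F k y" "F k y \<le> F k x + ?c"
          using est[OF \<epsilon>(1)[of k], of x y] est[OF \<epsilon>(1)[of k], of y x] by (auto simp: F_def)
      qed
      have Fi: "integrable lborel (\<lambda>y. F k y * indicator V y)"
        unfolding F_def by (rule integral_mollify_set(1)[OF u \<epsilon>(1) Vm Vfin])
      have ci: "integrable lborel (\<lambda>y. c * indicator V y :: real)" for c
        using Vfin by (intro integrable_mult_right integrable_real_indicator) auto
      have "(\<integral>y. (F k x - ?c) * indicator V y \<partial>lborel) \<le> (\<integral>y. F k y * indicator V y \<partial>lborel)"
        using pt by (intro integral_mono Fi ci) (auto simp: indicator_def)
      moreover have "(\<integral>y. F k y * indicator V y \<partial>lborel) \<le> (\<integral>y. (F k x + ?c) * indicator V y \<partial>lborel)"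
        using pt by (intro integral_mono Fi ci) (auto simp: indicator_def)
      ultimately have "(F k x - ?c) * v \<le> a k * v" "a k * v \<le> (F k x + ?c) * v"
        using v by (simp_all add: a_def v_def)
      then have "F k x - ?c \<le> a k" "a k \<le> F k x + ?c" using v by (simp_all only: mult_le_cancel_right_pos)
      then show ?thesis by (simp add: abs_le_iff)
    qed
    show "\<exists>N. \<forall>m\<ge>N. \<forall>k\<ge>N. dist (F m x) (F k x) < e"
    proof (intro exI allI impI)
      fix m k assume "max N1 N2 \<le> m" "max N1 N2 \<le> k"
      then have mk: "N1 \<le> m" "N1 \<le> k" "N2 \<le> m" "N2 \<le> k" by auto
      have "\<bar>a m - a k\<bar> < e / 4" using N1[OF mk(1,2)] by (simp add: dist_real_def)
      then show "dist (F m x) (F k x) < e"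
        using Fa[of m] Fa[of k] N2[OF mk(3)] N2[OF mk(4)] \<delta>(2) unfolding dist_real_def by linarith
    qed
  qed
  define g where "g = (\<lambda>x. lim (\<lambda>k. F k x))"
  have lim: "(\<lambda>k. F k x) \<longlonglongrightarrow> g x" for x
    using conv[of x] unfolding g_def by (simp add: convergent_LIMSEQ_iff)
  have gm [measurable]: "g \<in> borel_measurable borel" unfolding g_def by measurable
  have gb: "\<bar>g x\<bar> \<le> B" for x
    using Fb by (intro LIMSEQ_le_const2[OF tendsto_rabs[OF lim]]) auto
  have gh: "g x - g y \<le> M * norm (x - y) powr s" for x y
  proof (rule LIMSEQ_le)
    show "(\<lambda>k. F k x - F k y) \<longlonglongrightarrow> g x - g y" by (intro tendsto_diff lim)
    show "(\<lambda>k. M * norm (x - y) powr s + A * \<epsilon> k powr s) \<longlonglongrightarrow> M * norm (x - y) powr s"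
      using tendsto_add[OF tendsto_const ek] by simp
    show "\<exists>N. \<forall>k\<ge>N. F k x - F k y \<le> M * norm (x - y) powr s + A * \<epsilon> k powr s"
      using est \<epsilon>(1) by (auto simp: F_def)
  qed
  have "AE x in lborel. u x = g x"
  proof (rule AE_eq_if_box_integrals_eq[OF um gm B])
    show "AE x in lborel. \<bar>g x\<bar> \<le> B" using gb by simp
    fix a b :: "real ^ 'n"
    have 1: "(\<lambda>k. \<integral>x. F k x * indicator (box a b) x \<partial>lborel) \<longlonglongrightarrow> (\<integral>x. u x * indicator (box a b) x \<partial>lborel)"
      unfolding F_def using u \<epsilon> by (intro mollify_weak_limit) (auto simp: bounded_box)
    have bi: "integrable lborel (\<lambda>x. B * indicator (box a b) x :: real)"
      using emeasure_lborel_box_finite[of a b] by (intro integrable_mult_right integrable_real_indicator) auto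
    have 2: "(\<lambda>k. \<integral>x. F k x * indicator (box a b) x \<partial>lborel) \<longlonglongrightarrow> (\<integral>x. g x * indicator (box a b) x \<partial>lborel)"
    proof (rule integral_dominated_convergence[OF _ _ bi])
      show "AE x in lborel. (\<lambda>k. F k x * indicator (box a b) x) \<longlonglongrightarrow> g x * indicator (box a b) x"
        using lim by (intro AE_I2 tendsto_mult tendsto_const)
      show "AE x in lborel. norm (F k x * indicator (box a b) x) \<le> B * indicator (box a b) x" for k
        using Fb by (intro AE_I2) (auto simp: indicator_def)
    qed measurable
    show "(\<integral>x. u x * indicator (box a b) x \<partial>lborel) = (\<integral>x. g x * indicator (box a b) x \<partial>lborel)"
      using 1 2 by (rule LIMSEQ_unique)
  qed
  moreover have "g \<in> holder_space s UNIV"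
    unfolding holder_space_def
  proof (intro CollectI conjI exI ballI)
    show "bounded (range g)" unfolding bounded_iff using gb by (intro exI[of _ B]) auto
    fix x y
    show "\<bar>g x - g y\<bar> \<le> M * norm (x - y) powr s"
      using gh[of x y] gh[of y x] by (simp add: abs_le_iff norm_minus_commute)
  qed
  ultimately show ?thesis by blast
qed

section \<open>Regularity up to the boundary\<close>

text \<open>
  Barriers give the decay \<open>\<bar>u x\<bar> \<le> m * \<bar>x - p\<bar> powr s\<close> for boundary points \<open>p\<close>. The mollification of \<open>u\<close> at
  scale \<open>\<epsilon>\<close> satisfies the equation in the set \<open>U\<close> of points at distance more than \<open>\<epsilon>\<close> from the complement
  of \<open>\<Omega>\<close>; for pairs with a member outside \<open>U\<close> the decay gives the Hoelder bound up to a multiple of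
  \<open>\<epsilon> powr s\<close>. The doubling argument extends it to all pairs.
\<close>

theorem bounded_rhs_holder_regularity:
  fixes \<Omega> :: "(real ^ 'n) set"
  assumes s: "0 < s" "s < 1/2" and \<Omega>: "open \<Omega>" "bounded \<Omega>" and ext: "exterior_ball_condition \<Omega>"
    and u: "u \<in> energy_space s (closure \<Omega>)"
    and E: "\<And>v. \<lbrakk>v \<in> energy_space s (closure \<Omega>); \<And>x. 0 \<le> v x\<rbrakk> \<Longrightarrow> \<bar>energy_form s u v\<bar> \<le> C * (\<integral>x. v x \<partial>lborel)"
    and C: "0 < C"
  shows "\<exists>g\<in>holder_space s UNIV. AE x in lborel. u x = g x"
proof -
  define K where "K = closure \<Omega>"
  have K: "bounded K" using \<Omega> by (simp add: K_def bounded_closure)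
  note uK = u[folded K_def] and EK = E[folded K_def]
  have um [measurable]: "u \<in> borel_measurable borel" by (rule energy_spaceD(1)[OF uK])
  have ui: "integrable lborel u" by (rule energy_space_integrable[OF uK K])
  define u' where "u' = (\<lambda>x. - u x)"
  have u'K: "u' \<in> energy_space s K" using energy_space_scale[OF uK, of "-1"] by (simp add: u'_def)
  have E': "energy_form s u' v = - energy_form s u v" for v
    using energy_form_scale[of s "-1" u v] by (simp add: u'_def)
  obtain B where B: "0 \<le> B" "AE x in lborel. u x \<le> B" "AE x in lborel. u' x \<le> B"
  proof -
    obtain c where c: "0 < c" "\<And>u C. \<lbrakk>u \<in> energy_space s K; 0 < C;
       \<And>v. \<lbrakk>v \<in> energy_space s K; \<And>x. 0 \<le> v x; \<And>x. 0 < v x \<Longrightarrow> 0 < u x\<rbrakk> \<Longrightarrow>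
          energy_form s u v \<le> C * (\<integral>x. v x \<partial>lborel)\<rbrakk> \<Longrightarrow> AE x in lborel. u x \<le> C * c"
      by (rule energy_sup_bound[OF s(1) K]) (rule that, assumption, blast)
    have "AE x in lborel. u x \<le> C * c" using EK by (intro c(2)[OF uK C]) (smt (verit))
    moreover have "AE x in lborel. u' x \<le> C * c" using EK by (intro c(2)[OF u'K C]) (smt (verit) E')
    moreover have "0 \<le> C * c" using C c by simp
    ultimately show ?thesis using that by blast
  qed
  have uB: "AE x in lborel. \<bar>u x\<bar> \<le> B" using B(2,3) by eventually_elim (auto simp: u'_def)
  obtain \<rho> where \<rho>: "0 < \<rho>" "\<And>p. p \<in> frontier \<Omega> \<Longrightarrow> \<exists>c. dist c p = \<rho> \<and> ball c \<rho> \<inter> \<Omega> = {}"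
    using ext unfolding exterior_ball_condition_def by blast
  obtain M1 where M1: "0 < M1" "\<And>c p. \<lbrakk>dist c p = \<rho>; ball c \<rho> \<inter> K = {}\<rbrakk> \<Longrightarrow>
       AE x in lborel. u x \<le> M1 * norm (x - p) powr s"
  proof (rule energy_boundary_decay[OF s K \<rho>(1) uK B(2) C])
    show "energy_form s u v \<le> C * (\<integral>x. v x \<partial>lborel)" if "v \<in> energy_space s K" "\<And>x. 0 \<le> v x" for v
      using EK[OF that] by simp
  qed (rule that, assumption, blast)
  obtain M2 where M2: "0 < M2" "\<And>c p. \<lbrakk>dist c p = \<rho>; ball c \<rho> \<inter> K = {}\<rbrakk> \<Longrightarrow>
       AE x in lborel. u' x \<le> M2 * norm (x - p) powr s"
  proof (rule energy_boundary_decay[OF s K \<rho>(1) u'K B(3) C])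
    show "energy_form s u' v \<le> C * (\<integral>x. v x \<partial>lborel)" if "v \<in> energy_space s K" "\<And>x. 0 \<le> v x" for v
      using EK[OF that] unfolding E' by simp
  qed (rule that, assumption, blast)
  define m where "m = max M1 M2"
  have m: "0 < m" using M1 by (simp add: m_def)
  have decay: "AE x in lborel. \<bar>u x\<bar> \<le> m * norm (x - p) powr s" if p: "p \<in> frontier \<Omega>" for p
  proof -
    obtain c where c: "dist c p = \<rho>" "ball c \<rho> \<inter> \<Omega> = {}" using \<rho>(2)[OF p] by blast
    have "ball c \<rho> \<inter> K = {}" using c(2) by (simp add: K_def open_Int_closure_eq_empty)
    from M1(2)[OF c(1) this] M2(2)[OF c(1) this] show ?thesis
    proof eventually_elim
      case (elim x)
      have "M1 * norm (x - p) powr s \<le> m * norm (x - p) powr s" "M2 * norm (x - p) powr s \<le> m * norm (x - p) powr s"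
        by (intro mult_right_mono; simp add: m_def)+
      then show ?case using elim by (auto simp: u'_def)
    qed
  qed
  obtain R where R: "0 < R" "\<And>x. x \<in> \<Omega> \<Longrightarrow> norm x \<le> R" using \<Omega>(2) unfolding bounded_pos by blast
  obtain M0 where M0: "0 < M0"
    "\<And>(\<phi> :: real ^ 'n \<Rightarrow> real) U A M x y. \<lbrakk>continuous_on UNIV \<phi>; U \<subseteq> cball 0 R;
       \<And>x. x \<in> U \<Longrightarrow> integrable lborel (\<lambda>z. (\<phi> x - \<phi> (x + z)) * frac_kernel s z);
       \<And>x. x \<in> U \<Longrightarrow> \<bar>frac_lap s \<phi> x\<bar> \<le> C;
       \<And>x y. x \<notin> U \<or> y \<notin> U \<Longrightarrow> \<phi> x - \<phi> y \<le> M * norm (x - y) powr s + A; 0 \<le> A; M0 \<le> M\<rbrakk>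
     \<Longrightarrow> \<phi> x - \<phi> y \<le> M * norm (x - y) powr s + A"
    by (rule doubling_holder_estimate[OF s R(1), of C]) (use C in simp, rule that, assumption, blast)
  define M where "M = max M0 m"
  have M: "0 < M" "m \<le> M" "M0 \<le> M" using m by (auto simp: M_def)
  define A where "A = 2 * m * 2 powr s"
  have A: "0 \<le> A" using m by (simp add: A_def)
  have "mollify \<epsilon> u x - mollify \<epsilon> u y \<le> M * norm (x - y) powr s + A * \<epsilon> powr s" if \<epsilon>: "0 < \<epsilon>" for \<epsilon> x y
  proof -
    define F where "F = mollify \<epsilon> u"
    define U where "U = {x \<in> \<Omega>. cball x \<epsilon> \<subseteq> \<Omega>}"
    have Fdec: "\<bar>F x\<bar> \<le> m * (norm (x - p) + \<epsilon>) powr s" if p: "p \<in> frontier \<Omega>" for x p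
      unfolding F_def
    proof (rule mollify_abs_le[OF ui \<epsilon>])
      show "AE y in lborel. norm (x - y) < \<epsilon> \<longrightarrow> \<bar>u y\<bar> \<le> m * (norm (x - p) + \<epsilon>) powr s"
        using decay[OF p]
      proof eventually_elim
        case (elim y)
        show ?case
        proof
          assume "norm (x - y) < \<epsilon>"
          then have "norm (y - p) \<le> norm (x - p) + \<epsilon>"
            using norm_triangle_ineq[of "y - x" "x - p"] by (simp add: norm_minus_commute)
          then have "norm (y - p) powr s \<le> (norm (x - p) + \<epsilon>) powr s" using s by (intro powr_mono2) auto
          then have "m * norm (y - p) powr s \<le> m * (norm (x - p) + \<epsilon>) powr s" using m by (intro mult_left_mono) auto
          then show "\<bar>u y\<bar> \<le> m * (norm (x - p) + \<epsilon>) powr s" using elim by linarith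
        qed
      qed
    qed
    have F0: "F x = 0" if x: "cball x \<epsilon> \<inter> K = {}" for x
    proof -
      have "AE y in lborel. norm (x - y) < \<epsilon> \<longrightarrow> \<bar>u y\<bar> \<le> 0"
        using energy_spaceD(4)[OF uK]
      proof eventually_elim
        case (elim y)
        show ?case
        proof
          assume "norm (x - y) < \<epsilon>"
          then have "y \<in> cball x \<epsilon>" by (simp add: dist_norm)
          then have "y \<notin> K" using x by blast
          then show "\<bar>u y\<bar> \<le> 0" using elim by simp
        qed
      qed
      from mollify_abs_le[OF ui \<epsilon> this] show ?thesis by (simp add: F_def)
    qed
    \<comment> \<open>Outside \<open>U\<close> a point is either within \<open>\<epsilon>\<close> of the boundary, or so far outside that the
       mollification vanishes.\<close>
    have alt: "(\<exists>p\<in>frontier \<Omega>. norm (x - p) \<le> \<epsilon>) \<or> x \<notin> \<Omega> \<and> cball x \<epsilon> \<inter> K = {}" if x: "x \<notin> U" for x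
    proof (cases "cball x \<epsilon> \<inter> frontier \<Omega> = {}")
      case False
      then show ?thesis by (auto simp: dist_norm)
    next
      case True
      have conn: "connected (cball x \<epsilon>)" by simp
      have xin: "x \<in> cball x \<epsilon>" using \<epsilon> by simp
      have "cball x \<epsilon> \<inter> \<Omega> = {}"
      proof (rule ccontr)
        assume ne: "cball x \<epsilon> \<inter> \<Omega> \<noteq> {}"
        have "cball x \<epsilon> - \<Omega> \<noteq> {}" using x xin unfolding U_def by blast
        from connected_Int_frontier[OF conn ne this] True show False by simp
      qed
      moreover have "K = \<Omega> \<union> frontier \<Omega>" unfolding K_def by (simp add: closure_Un_frontier)
      ultimately show ?thesis using True xin by blast
    qed
    have two: "(2 * \<epsilon>) powr s = 2 powr s * \<epsilon> powr s" using \<epsilon> by (simp add: powr_mult)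
    have near: "\<bar>F x\<bar> + \<bar>F y\<bar> \<le> M * norm (x - y) powr s + A * \<epsilon> powr s"
      if p: "p \<in> frontier \<Omega>" "norm (x - p) \<le> \<epsilon>" for x y p
    proof -
      have sub: "(norm (x - y) + 2 * \<epsilon>) powr s \<le> norm (x - y) powr s + (2 * \<epsilon>) powr s"
        using powr_diff_le_powr[of s "norm (x - y)" "norm (x - y) + 2 * \<epsilon>"] s \<epsilon> by simp
      have "\<bar>F x\<bar> \<le> m * (norm (x - p) + \<epsilon>) powr s" by (rule Fdec[OF p(1)])
      also have "\<dots> \<le> m * (2 * \<epsilon>) powr s" using p s m \<epsilon> by (intro mult_left_mono powr_mono2) auto
      finally have 1: "\<bar>F x\<bar> \<le> m * (2 * \<epsilon>) powr s" .
      have "norm (y - p) \<le> norm (x - y) + \<epsilon>"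
        using norm_triangle_ineq[of "y - x" "x - p"] p(2) by (simp add: norm_minus_commute)
      then have "m * (norm (y - p) + \<epsilon>) powr s \<le> m * (norm (x - y) + 2 * \<epsilon>) powr s"
        using s m \<epsilon> by (intro mult_left_mono powr_mono2) auto
      also have "\<dots> \<le> m * (norm (x - y) powr s + (2 * \<epsilon>) powr s)" using sub m by (intro mult_left_mono) auto
      finally have 2: "\<bar>F y\<bar> \<le> m * norm (x - y) powr s + m * (2 * \<epsilon>) powr s"
        using Fdec[OF p(1), of y] by (simp add: distrib_left)
      have "m * norm (x - y) powr s \<le> M * norm (x - y) powr s" using M by (intro mult_right_mono) auto
      then show ?thesis using 1 2 unfolding A_def two by (simp add: algebra_simps)
    qed
    have far: "\<bar>F x\<bar> + \<bar>F y\<bar> \<le> M * norm (x - y) powr s + A * \<epsilon> powr s"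
      if x: "x \<notin> \<Omega>" "cball x \<epsilon> \<inter> K = {}" for x y
    proof (cases "y \<in> U")
      case False
      from alt[OF False] show ?thesis
      proof
        assume "\<exists>p\<in>frontier \<Omega>. norm (y - p) \<le> \<epsilon>"
        then obtain p where "p \<in> frontier \<Omega>" "norm (y - p) \<le> \<epsilon>" by blast
        from near[OF this, of x] show ?thesis by (simp add: norm_minus_commute)
      next
        assume "y \<notin> \<Omega> \<and> cball y \<epsilon> \<inter> K = {}"
        then have "F y = 0" "F x = 0" using F0 x by auto
        then show ?thesis using M A by simp
      qed
    next
      case True
      then have y: "y \<in> \<Omega>" by (simp add: U_def)
      \<comment> \<open>The segment from the exterior point \<open>x\<close> to \<open>y\<close> crosses the boundary no further from \<open>y\<close> than \<open>x\<close> is.\<close>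
      have "closed_segment x y \<inter> frontier \<Omega> \<noteq> {}"
        using x(1) y by (intro connected_Int_frontier) auto
      then obtain p where p: "p \<in> closed_segment x y" "p \<in> frontier \<Omega>" by blast
      have yp: "norm (y - p) \<le> norm (x - y)"
        using segment_bound(2)[OF p(1)] by (simp add: norm_minus_commute)
      have "\<bar>F y\<bar> \<le> m * (norm (y - p) + \<epsilon>) powr s" by (rule Fdec[OF p(2)])
      also have "\<dots> \<le> m * (norm (x - y) + 2 * \<epsilon>) powr s" using yp s m \<epsilon> by (intro mult_left_mono powr_mono2) auto
      also have "\<dots> \<le> m * (norm (x - y) powr s + (2 * \<epsilon>) powr s)"
        using powr_diff_le_powr[of s "norm (x - y)" "norm (x - y) + 2 * \<epsilon>"] s \<epsilon> m by (intro mult_left_mono) auto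
      finally have 2: "\<bar>F y\<bar> \<le> m * norm (x - y) powr s + m * (2 * \<epsilon>) powr s" by (simp add: distrib_left)
      have "m * norm (x - y) powr s \<le> M * norm (x - y) powr s" using M by (intro mult_right_mono) auto
      moreover have "0 \<le> m * (2 * \<epsilon>) powr s" using m by simp
      ultimately show ?thesis using 2 F0[OF x(2)] unfolding A_def two by (simp add: algebra_simps)
    qed
    have out: "F x - F y \<le> M * norm (x - y) powr s + A * \<epsilon> powr s" if "x \<notin> U \<or> y \<notin> U" for x y
    proof -
      have *: "\<bar>F x\<bar> + \<bar>F y\<bar> \<le> M * norm (x - y) powr s + A * \<epsilon> powr s" if "x \<notin> U" for x y
        using alt[OF that] near far by blast
      from that show ?thesis
      proof
        assume "x \<notin> U" from *[OF this, of y] show ?thesis by linarith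
      next
        assume "y \<notin> U" from *[OF this, of x] show ?thesis by (simp add: norm_minus_commute)
      qed
    qed
    have "F x - F y \<le> M * norm (x - y) powr s + A * \<epsilon> powr s"
    proof (rule M0(2)[OF _ _ _ _ out _ M(3)])
      show "continuous_on UNIV F" unfolding F_def by (rule mollify_continuous[OF ui \<epsilon>])
      show "U \<subseteq> cball 0 R" using R by (auto simp: U_def)
      show "0 \<le> A * \<epsilon> powr s" using A by simp
      show "integrable lborel (\<lambda>z. (F x - F (x + z)) * frac_kernel s z)" for x
        unfolding F_def by (rule mollify_frac_lap_integrable[OF s \<epsilon> ui uB])
      fix x assume x: "x \<in> U"
      have "cball x \<epsilon> \<subseteq> K" using x closure_subset by (auto simp: U_def K_def)
      then have "(\<lambda>y. tent \<epsilon> (x - y)) \<in> energy_space s K" by (rule tent_in_energy_space[OF s \<epsilon>])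
      from EK[OF this tent_bounds(1)[OF \<epsilon>]] have "\<bar>energy_form s u (\<lambda>y. tent \<epsilon> (x - y))\<bar> \<le> C * (\<integral>z. tent \<epsilon> (z :: real ^ 'n) \<partial>lborel)"
        by (simp add: tent_shift_integral)
      then have *: "\<bar>2 * (\<integral>z. tent \<epsilon> (z :: real ^ 'n) \<partial>lborel) * frac_lap s F x\<bar> \<le> C * (\<integral>z. tent \<epsilon> (z :: real ^ 'n) \<partial>lborel)"
        unfolding F_def frac_lap_mollify[OF s \<epsilon> ui] by (simp add: energy_form_commute)
      define N where "N = (\<integral>z. tent \<epsilon> (z :: real ^ 'n) \<partial>lborel)"
      have N: "0 < N" unfolding N_def by (rule tent_mass_pos[OF \<epsilon>])
      have "(2 * \<bar>frac_lap s F x\<bar>) * N \<le> C * N" using * N unfolding N_def[symmetric] by (simp add: abs_mult mult_ac)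
      then have "2 * \<bar>frac_lap s F x\<bar> \<le> C" using N by (simp only: mult_le_cancel_right_pos)
      then show "\<bar>frac_lap s F x\<bar> \<le> C" by simp
    qed
    then show ?thesis by (simp add: F_def)
  qed
  then show ?thesis
    by (rule holder_representative_of_mollified[OF s(1) ui uB less_imp_le[OF M(1)] A])
qed

section \<open>Existence of solutions by minimization\<close>

lemma fatou_bound:
  fixes f :: "nat \<Rightarrow> 'a \<Rightarrow> real" and g :: "'a \<Rightarrow> real"
  assumes [measurable]: "\<And>k. f k \<in> borel_measurable M"
    and lim: "AE x in M. (\<lambda>k. f k x) \<longlonglongrightarrow> g x"
    and le: "eventually (\<lambda>k. (\<integral>\<^sup>+x. ennreal (f k x) \<partial>M) \<le> C) sequentially"
  shows "(\<integral>\<^sup>+x. ennreal (g x) \<partial>M) \<le> C"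
proof -
  have "(\<integral>\<^sup>+x. ennreal (g x) \<partial>M) = (\<integral>\<^sup>+x. liminf (\<lambda>k. ennreal (f k x)) \<partial>M)"
  proof (rule nn_integral_cong_AE)
    show "AE x in M. ennreal (g x) = liminf (\<lambda>k. ennreal (f k x))"
      using lim
    proof eventually_elim
      case (elim x)
      from tendsto_ennrealI[OF elim] show ?case by (simp add: lim_imp_Liminf)
    qed
  qed
  also have "\<dots> \<le> liminf (\<lambda>k. \<integral>\<^sup>+x. ennreal (f k x) \<partial>M)" by (rule nn_integral_liminf) measurable
  also have "\<dots> \<le> limsup (\<lambda>k. \<integral>\<^sup>+x. ennreal (f k x) \<partial>M)" by (rule Liminf_le_Limsup) simp
  also have "\<dots> \<le> C" using le by (rule Limsup_bounded)
  finally show ?thesis .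
qed

lemma energy_form_self: "energy_form s v v = (\<integral>(x, y). (v x - v y)\<^sup>2 * frac_kernel s (x - y) \<partial>(lborel \<Otimes>\<^sub>M lborel))"
  by (simp add: energy_form_def power2_eq_square)

lemma energy_form_self_nonneg: "0 \<le> energy_form s v v"
  unfolding energy_form_self by (intro integral_nonneg_AE AE_I2) (auto simp: split_beta)

lemma energy_form_self_nn:
  assumes "v \<in> energy_space s K"
  shows "(\<integral>\<^sup>+z. ennreal ((\<lambda>(x, y). (v x - v y)\<^sup>2 * frac_kernel s (x - y)) z) \<partial>(lborel \<Otimes>\<^sub>M lborel)) = ennreal (energy_form s v v)"
  unfolding energy_form_self
  using energy_spaceD(3)[OF assms] by (intro nn_integral_eq_integral) (auto simp: finite_energy_def intro!: AE_I2)

lemma energy_form_expand: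
  assumes v: "v \<in> energy_space s K" and w: "w \<in> energy_space s K"
  shows "energy_form s (\<lambda>x. v x + t * w x) (\<lambda>x. v x + t * w x) =
    energy_form s v v + 2 * t * energy_form s v w + t\<^sup>2 * energy_form s w w"
proof -
  have tw: "(\<lambda>x. t * w x) \<in> energy_space s K" by (rule energy_space_scale[OF w])
  have vt: "(\<lambda>x. v x + t * w x) \<in> energy_space s K" by (rule energy_space_add[OF v tw])
  have 1: "energy_form s a (\<lambda>x. v x + t * w x) = energy_form s a v + t * energy_form s a w"
    if "a \<in> energy_space s K" for a
    using energy_form_add[OF v tw that] energy_form_scale[of s t w a] by (simp add: energy_form_commute[of s a])
  show ?thesis
    unfolding energy_form_add[OF v tw vt] energy_form_scale 1[OF v] 1[OF w]
    using energy_form_commute[of s w v] by (simp add: algebra_simps power2_eq_square)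
qed

lemma energy_space_zero: "(\<lambda>x. 0) \<in> energy_space s K"
  by (simp add: energy_space_def finite_energy_def split_beta')

text \<open>
  Young's inequality \<open>\<bar>v\<bar> \<le> \<theta> + v\<^sup>2 / \<theta>\<close> on a ball containing \<open>K\<close>. The free parameter \<open>\<theta>\<close> serves
  two purposes: coercivity of the energy, and the decay rate of a minimizing sequence.
\<close>

lemma energy_space_L1:
  fixes K :: "(real ^ 'n) set"
  assumes K: "bounded K"
  obtains V where "0 \<le> V" "\<And>v \<theta>. \<lbrakk>v \<in> energy_space s K; 0 < \<theta>\<rbrakk> \<Longrightarrow>
     (\<integral>x. \<bar>v x\<bar> \<partial>lborel) \<le> \<theta> * V + (\<integral>x. (v x)\<^sup>2 \<partial>lborel) / \<theta>"
proof -
  obtain R where R: "\<And>x. x \<in> K \<Longrightarrow> norm x \<le> R" using K unfolding bounded_iff by blast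
  define V where "V = measure lborel (cball (0 :: real ^ 'n) R)"
  show ?thesis
  proof (rule that[of V])
    show "0 \<le> V" by (simp add: V_def)
    fix v \<theta> assume v: "v \<in> energy_space s K" and \<theta>: "0 < (\<theta> :: real)"
    have Vi: "integrable lborel (\<lambda>x. \<theta> * indicator (cball (0 :: real ^ 'n) R) x :: real)"
      using emeasure_lborel_cball_finite[of "0 :: real ^ 'n" R]
      by (intro integrable_mult_right integrable_real_indicator) auto
    have "(\<integral>x. \<bar>v x\<bar> \<partial>lborel) \<le> (\<integral>x. \<theta> * indicator (cball 0 R) x + (v x)\<^sup>2 / \<theta> \<partial>lborel)"
    proof (rule integral_mono_AE)
      show "integrable lborel (\<lambda>x. \<bar>v x\<bar>)" using energy_space_integrable[OF v K] by simp
      show "integrable lborel (\<lambda>x. \<theta> * indicator (cball 0 R) x + (v x)\<^sup>2 / \<theta>)"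
        using Vi energy_spaceD(2)[OF v] by simp
      show "AE x in lborel. \<bar>v x\<bar> \<le> \<theta> * indicator (cball 0 R) x + (v x)\<^sup>2 / \<theta>"
        using energy_spaceD(4)[OF v]
      proof eventually_elim
        case (elim x)
        have "0 \<le> (\<bar>v x\<bar> - \<theta>)\<^sup>2" by simp
        moreover have "(\<bar>v x\<bar> - \<theta>)\<^sup>2 = (v x)\<^sup>2 - 2 * \<bar>v x\<bar> * \<theta> + \<theta>\<^sup>2" by (simp add: power2_diff)
        moreover have "0 \<le> \<bar>v x\<bar> * \<theta>" using \<theta> by simp
        ultimately have "\<bar>v x\<bar> * \<theta> \<le> \<theta>\<^sup>2 + (v x)\<^sup>2" by linarith
        then have "\<bar>v x\<bar> \<le> (\<theta>\<^sup>2 + (v x)\<^sup>2) / \<theta>" using \<theta> by (simp add: pos_le_divide_eq)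
        then have *: "\<bar>v x\<bar> \<le> \<theta> + (v x)\<^sup>2 / \<theta>" using \<theta> by (simp add: add_divide_distrib power2_eq_square)
        show ?case
        proof (cases "x \<in> K")
          case True
          then show ?thesis using * R by simp
        qed (use elim \<theta> in simp)
      qed
    qed
    also have "\<dots> = \<theta> * V + (\<integral>x. (v x)\<^sup>2 \<partial>lborel) / \<theta>"
      using Vi energy_spaceD(2)[OF v] by (simp add: V_def)
    finally show "(\<integral>x. \<bar>v x\<bar> \<partial>lborel) \<le> \<theta> * V + (\<integral>x. (v x)\<^sup>2 \<partial>lborel) / \<theta>" .
  qed
qed

text \<open>
  The geometric rate makes the sum of the increments finite almost everywhere, so the sequence
  itself converges pointwise and no subsequence has to be extracted.
\<close>

lemma geometric_L1_cauchy_limit: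
  fixes v :: "nat \<Rightarrow> 'a::euclidean_space \<Rightarrow> real"
  assumes int: "\<And>k. integrable lborel (v k)"
    and d: "\<And>k. (\<integral>x. \<bar>v (Suc k) x - v k x\<bar> \<partial>lborel) \<le> D * (1/2) ^ k" and D: "0 \<le> D"
  obtains u where "u \<in> borel_measurable borel" "AE x in lborel. (\<lambda>k. v k x) \<longlonglongrightarrow> u x"
    "integrable lborel u" "\<And>k. (\<integral>x. \<bar>v k x - u x\<bar> \<partial>lborel) \<le> 2 * D * (1/2) ^ k"
proof -
  have vm [measurable]: "v k \<in> borel_measurable borel" for k using borel_measurable_integrable[OF int[of k]] by simp
  have nn: "(\<integral>\<^sup>+x. ennreal \<bar>v (Suc k) x - v k x\<bar> \<partial>lborel) \<le> ennreal (D * (1/2) ^ k)" for k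
    using d[of k] int by (subst nn_integral_eq_integral) (auto intro: ennreal_leI)
  have "(\<integral>\<^sup>+x. (\<Sum>k. ennreal \<bar>v (Suc k) x - v k x\<bar>) \<partial>lborel) = (\<Sum>k. \<integral>\<^sup>+x. ennreal \<bar>v (Suc k) x - v k x\<bar> \<partial>lborel)"
    by (rule nn_integral_suminf) measurable
  also have "\<dots> \<le> (\<Sum>k. ennreal (D * (1/2) ^ k))" by (intro suminf_le nn) auto
  also have "\<dots> < \<infinity>"
    using D by (subst suminf_ennreal2) (auto intro!: summable_mult summable_geometric)
  finally have "(\<integral>\<^sup>+x. (\<Sum>k. ennreal \<bar>v (Suc k) x - v k x\<bar>) \<partial>lborel) \<noteq> \<infinity>" by simp
  then have "AE x in lborel. (\<Sum>k. ennreal \<bar>v (Suc k) x - v k x\<bar>) \<noteq> \<infinity>"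
    by (intro nn_integral_PInf_AE) auto
  then have conv: "AE x in lborel. convergent (\<lambda>k. v k x)"
  proof eventually_elim
    case (elim x)
    then have "summable (\<lambda>k. \<bar>v (Suc k) x - v k x\<bar>)" by (intro summable_suminf_not_top) auto
    then have "summable (\<lambda>k. v (Suc k) x - v k x)" by (rule summable_rabs_cancel)
    then have "convergent (\<lambda>n. \<Sum>k<n. v (Suc k) x - v k x)" by (simp add: summable_iff_convergent)
    then have "convergent (\<lambda>n. v n x - v 0 x)" by (simp only: sum_lessThan_telescope[of "\<lambda>k. v k x"])
    then have "convergent (\<lambda>n. v 0 x + (v n x - v 0 x))" by (intro convergent_add convergent_const)
    then show ?case by simp
  qed
  define u where "u = (\<lambda>x. lim (\<lambda>k. v k x))"
  have um [measurable]: "u \<in> borel_measurable borel" unfolding u_def by measurable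
  have lim: "AE x in lborel. (\<lambda>k. v k x) \<longlonglongrightarrow> u x"
    using conv by eventually_elim (simp add: u_def convergent_LIMSEQ_iff)
  have dist: "(\<integral>x. \<bar>v (k + i) x - v k x\<bar> \<partial>lborel) \<le> 2 * D * (1/2) ^ k * (1 - (1/2) ^ i)" for k i
  proof (induction i)
    case (Suc i)
    have "(\<integral>x. \<bar>v (k + Suc i) x - v k x\<bar> \<partial>lborel) \<le>
       (\<integral>x. \<bar>v (Suc (k + i)) x - v (k + i) x\<bar> + \<bar>v (k + i) x - v k x\<bar> \<partial>lborel)"
      using int by (intro integral_mono) auto
    also have "\<dots> = (\<integral>x. \<bar>v (Suc (k + i)) x - v (k + i) x\<bar> \<partial>lborel) + (\<integral>x. \<bar>v (k + i) x - v k x\<bar> \<partial>lborel)"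
      using int by (intro Bochner_Integration.integral_add) auto
    also have "\<dots> \<le> D * (1/2) ^ (k + i) + 2 * D * (1/2) ^ k * (1 - (1/2) ^ i)"
      by (intro add_mono d Suc)
    also have "\<dots> = 2 * D * (1/2) ^ k * (1 - (1/2) ^ Suc i)" by (simp add: power_add algebra_simps)
    finally show ?case .
  qed simp
  have tail: "(\<integral>\<^sup>+x. ennreal \<bar>v k x - u x\<bar> \<partial>lborel) \<le> ennreal (2 * D * (1/2) ^ k)" for k
  proof (rule fatou_bound[where f = "\<lambda>j x. \<bar>v k x - v j x\<bar>"])
    show "AE x in lborel. (\<lambda>j. \<bar>v k x - v j x\<bar>) \<longlonglongrightarrow> \<bar>v k x - u x\<bar>"
      using lim by eventually_elim (intro tendsto_intros)
    show "eventually (\<lambda>j. (\<integral>\<^sup>+x. ennreal \<bar>v k x - v j x\<bar> \<partial>lborel) \<le> ennreal (2 * D * (1/2) ^ k)) sequentially"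
      using eventually_ge_at_top[of k]
    proof eventually_elim
      case (elim j)
      have "(\<integral>x. \<bar>v j x - v k x\<bar> \<partial>lborel) \<le> 2 * D * (1/2) ^ k * (1 - (1/2) ^ (j - k))"
        using dist[of k "j - k"] elim by simp
      also have "\<dots> \<le> 2 * D * (1/2) ^ k * 1" using D by (intro mult_left_mono) auto
      finally have "(\<integral>x. \<bar>v k x - v j x\<bar> \<partial>lborel) \<le> 2 * D * (1/2) ^ k" by (simp add: abs_minus_commute)
      then show ?case using int by (subst nn_integral_eq_integral) (auto intro: ennreal_leI)
    qed
  qed measurable
  have ki: "integrable lborel (\<lambda>x. v k x - u x)" for k
  proof (rule integrableI_bounded)
    show "(\<integral>\<^sup>+x. ennreal (norm (v k x - u x)) \<partial>lborel) < \<infinity>"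
      using tail[of k] by (simp add: le_less_trans)
  qed measurable
  have ui: "integrable lborel u"
    using Bochner_Integration.integrable_diff[OF int[of 0] ki[of 0]] by simp
  show ?thesis
  proof (rule that[OF um lim ui])
    fix k
    have "ennreal (\<integral>x. \<bar>v k x - u x\<bar> \<partial>lborel) \<le> ennreal (2 * D * (1/2) ^ k)"
      using tail[of k] ki[of k] by (subst nn_integral_eq_integral[symmetric]) auto
    then show "(\<integral>x. \<bar>v k x - u x\<bar> \<partial>lborel) \<le> 2 * D * (1/2) ^ k"
      using D by (simp add: ennreal_le_iff)
  qed
qed

text \<open>
  The direct method without weak compactness. By the parallelogram identity and midpoint convexity of
  \<open>N\<close>, two almost minimizers are close in energy, hence in \<open>L\<^sup>1\<close> by the Poincare inequality; a minimizing
  sequence with excess at most \<open>4\<^sup>-\<^sup>k\<close> therefore converges almost everywhere, and Fatou's lemma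
  gives lower semicontinuity of the quadratic part. \<open>N\<close> is continuous in \<open>L\<^sup>1\<close> by hypothesis.
\<close>

lemma energy_minimizer_exists:
  fixes K :: "(real ^ 'n) set" and N :: "(real ^ 'n \<Rightarrow> real) \<Rightarrow> real"
  assumes s: "0 < s" and K: "bounded K" and Q: "0 < Q" and C: "0 \<le> C"
    and lip: "\<And>v w. \<lbrakk>v \<in> energy_space s K; w \<in> energy_space s K\<rbrakk> \<Longrightarrow> \<bar>N v - N w\<bar> \<le> C * (\<integral>x. \<bar>v x - w x\<bar> \<partial>lborel)"
    and conv: "\<And>v w. \<lbrakk>v \<in> energy_space s K; w \<in> energy_space s K\<rbrakk> \<Longrightarrow> N (\<lambda>x. (v x + w x) / 2) \<le> (N v + N w) / 2"
  obtains u where "u \<in> energy_space s K"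
    "\<And>v. v \<in> energy_space s K \<Longrightarrow> Q / 2 * energy_form s u u + N u \<le> Q / 2 * energy_form s v v + N v"
proof -
  define X where "X = energy_space s K"
  define J where "J = (\<lambda>v. Q / 2 * energy_form s v v + N v)"
  obtain c where c: "0 < c" "\<And>v. v \<in> energy_space s K \<Longrightarrow> c * (\<integral>x. (v x)\<^sup>2 \<partial>lborel) \<le> energy_form s v v"
    using energy_poincare[OF s K] by metis
  obtain V where V: "0 \<le> V" "\<And>v \<theta>. \<lbrakk>v \<in> energy_space s K; 0 < \<theta>\<rbrakk> \<Longrightarrow>
     (\<integral>x. \<bar>v x\<bar> \<partial>lborel) \<le> \<theta> * V + (\<integral>x. (v x)\<^sup>2 \<partial>lborel) / \<theta>"
    by (rule energy_space_L1[OF K]) (rule that, assumption, blast)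
  have zX: "(\<lambda>x. 0) \<in> X" unfolding X_def by (rule energy_space_zero)
  have N0: "\<bar>N v\<bar> \<le> \<bar>N (\<lambda>x. 0)\<bar> + C * (\<integral>x. \<bar>v x\<bar> \<partial>lborel)" if "v \<in> X" for v
    using lip[of v "\<lambda>x. 0"] that zX by (simp add: X_def)
  \<comment> \<open>With this \<open>\<theta>\<close> the linear growth of \<open>N\<close> is absorbed by the quadratic energy.\<close>
  define \<theta> where "\<theta> = 2 * (C + 1) / (Q * c)"
  have \<theta>: "0 < \<theta>" using C Q c by (simp add: \<theta>_def)
  have lower: "- \<bar>N (\<lambda>x. 0)\<bar> - C * \<theta> * V \<le> J v" if v: "v \<in> X" for v
  proof -
    define I where "I = (\<integral>x. (v x)\<^sup>2 \<partial>lborel)"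
    have I: "0 \<le> I" by (simp add: I_def)
    have "C * (\<integral>x. \<bar>v x\<bar> \<partial>lborel) \<le> C * (\<theta> * V + I / \<theta>)"
      using V(2)[of v \<theta>] v \<theta> C by (intro mult_left_mono) (auto simp: X_def I_def)
    moreover have "C * (I / \<theta>) \<le> Q / 2 * (c * I)"
    proof -
      have "C * (I / \<theta>) \<le> (C + 1) * (I / \<theta>)" using I \<theta> by (intro mult_right_mono) auto
      also have "\<dots> = Q / 2 * (c * I)" using C Q c by (simp add: \<theta>_def field_simps)
      finally show ?thesis .
    qed
    moreover have "Q / 2 * (c * I) \<le> Q / 2 * energy_form s v v"
      using c(2)[of v] v Q by (intro mult_left_mono) (auto simp: X_def I_def)
    moreover have "C * (\<theta> * V + I / \<theta>) = C * \<theta> * V + C * (I / \<theta>)" by (simp add: distrib_left)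
    ultimately show ?thesis using N0[OF v] unfolding J_def by linarith
  qed
  define m where "m = (INF v\<in>X. J v)"
  have bdd: "bdd_below (J ` X)" using lower by (intro bdd_belowI2) auto
  have mle: "m \<le> J v" if "v \<in> X" for v unfolding m_def using bdd that by (rule cINF_lower)
  have "\<exists>v\<in>X. J v < m + (1/4) ^ k" for k :: nat
  proof (rule ccontr)
    assume "\<not> ?thesis"
    then have "m + (1/4) ^ k \<le> m"
      unfolding m_def using zX by (intro cINF_greatest) (auto simp: not_less m_def)
    moreover have "0 < (1/4 :: real) ^ k" by simp
    ultimately show False by linarith
  qed
  then obtain v where v: "\<And>k. v k \<in> X" "\<And>k. J (v k) < m + (1/4) ^ k" by metis
  \<comment> \<open>The midpoint of \<open>a\<close> and \<open>b\<close> has value at least \<open>m\<close>, and the parallelogram identity measures the defect.\<close>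
  have par: "Q / 8 * energy_form s (\<lambda>x. a x - b x) (\<lambda>x. a x - b x) \<le> (J a + J b) / 2 - m" if ab: "a \<in> X" "b \<in> X" for a b
  proof -
    have ab': "a \<in> energy_space s K" "b \<in> energy_space s K" using ab by (auto simp: X_def)
    have h: "(\<lambda>x. (a x + b x) / 2) \<in> X"
      using energy_space_scale[OF energy_space_add[OF ab'], of "1/2"] by (simp add: X_def)
    have "energy_form s (\<lambda>x. (1/2) * (a x + 1 * b x)) (\<lambda>x. (1/2) * (a x + 1 * b x)) =
       1/4 * energy_form s (\<lambda>x. a x + 1 * b x) (\<lambda>x. a x + 1 * b x)"
      unfolding energy_form_scale energy_form_commute[of s "\<lambda>x. a x + 1 * b x" "\<lambda>x. (1/2) * (a x + 1 * b x)"] by simp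
    then have 1: "energy_form s (\<lambda>x. (a x + b x) / 2) (\<lambda>x. (a x + b x) / 2) =
       (energy_form s a a + 2 * energy_form s a b + energy_form s b b) / 4"
      using energy_form_expand[OF ab', of 1] by simp
    have 2: "energy_form s (\<lambda>x. a x - b x) (\<lambda>x. a x - b x) = energy_form s a a - 2 * energy_form s a b + energy_form s b b"
      using energy_form_expand[OF ab', of "-1"] by simp
    have "m \<le> Q / 2 * ((energy_form s a a + 2 * energy_form s a b + energy_form s b b) / 4) + (N a + N b) / 2"
      using mle[OF h] conv[OF ab'] unfolding J_def 1 by linarith
    then show ?thesis unfolding 2 J_def by (simp add: field_simps)
  qed
  define D where "D = V + 8 / (Q * c)"
  have D: "0 \<le> D" using V Q c by (simp add: D_def)
  have vi: "integrable lborel (v k)" for k by (rule energy_space_integrable[OF v(1)[unfolded X_def] K])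
  have step: "(\<integral>x. \<bar>v (Suc k) x - v k x\<bar> \<partial>lborel) \<le> D * (1/2) ^ k" for k
  proof -
    define d where "d = (\<lambda>x. v (Suc k) x - v k x)"
    have dX: "d \<in> energy_space s K" unfolding d_def using v(1) by (intro energy_space_diff) (auto simp: X_def)
    have "Q / 8 * energy_form s d d \<le> (1/4) ^ k"
    proof -
      define q q' where "q = (1/4 :: real) ^ k" and "q' = (1/4 :: real) ^ Suc k"
      have "q' \<le> q" unfolding q_def q'_def by (intro power_decreasing) auto
      then have "(J (v (Suc k)) + J (v k)) / 2 - m \<le> q"
        using v(2)[of k, folded q_def] v(2)[of "Suc k", folded q'_def] by (simp add: field_simps)
      then show ?thesis
        using par[OF v(1)[of "Suc k"] v(1)[of k]] unfolding d_def q_def[symmetric] by (rule order_trans[rotated])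
    qed
    moreover have "Q / 8 * (c * (\<integral>x. (d x)\<^sup>2 \<partial>lborel)) \<le> Q / 8 * energy_form s d d"
      using c(2)[OF dX] Q by (intro mult_left_mono) auto
    ultimately have "Q / 8 * (c * (\<integral>x. (d x)\<^sup>2 \<partial>lborel)) \<le> (1/4) ^ k" by (rule order_trans[rotated])
    then have I: "(\<integral>x. (d x)\<^sup>2 \<partial>lborel) \<le> 8 / (Q * c) * (1/4) ^ k"
      using Q c(1) by (simp add: pos_le_divide_eq mult.commute mult.left_commute del: power_one_over)
    \<comment> \<open>The choice \<open>\<theta> = 2\<^sup>-\<^sup>k\<close> balances \<open>\<theta> * V\<close> and the squared norm of order \<open>4\<^sup>-\<^sup>k\<close> divided by \<open>\<theta>\<close>.\<close>
    have "(\<integral>x. \<bar>d x\<bar> \<partial>lborel) \<le> (1/2) ^ k * V + (\<integral>x. (d x)\<^sup>2 \<partial>lborel) / (1/2) ^ k"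
      by (rule V(2)[OF dX]) simp
    also have "\<dots> \<le> (1/2) ^ k * V + (8 / (Q * c) * (1/4) ^ k) / (1/2) ^ k"
      using I by (intro add_left_mono divide_right_mono) auto
    also have "\<dots> = D * (1/2) ^ k"
    proof -
      have "(1/4 :: real) ^ k = (1/2) ^ k * (1/2) ^ k" by (simp add: power_mult_distrib[symmetric])
      then show ?thesis by (simp add: D_def algebra_simps)
    qed
    finally show ?thesis by (simp add: d_def)
  qed
  obtain u where um [measurable]: "u \<in> borel_measurable borel" and lim: "AE x in lborel. (\<lambda>k. v k x) \<longlonglongrightarrow> u x"
    and ui: "integrable lborel u" and tail: "\<And>k. (\<integral>x. \<bar>v k x - u x\<bar> \<partial>lborel) \<le> 2 * D * (1/2) ^ k"
    by (rule geometric_L1_cauchy_limit[of v D, OF vi step D]) (rule that)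
  have vm [measurable]: "v k \<in> borel_measurable borel" for k using v(1)[of k] by (simp add: X_def energy_space_def)
  have vE: "Q / 2 * energy_form s (v k) (v k) \<le> m + 1 + \<bar>N (\<lambda>x. 0)\<bar> + C * ((\<integral>x. \<bar>u x\<bar> \<partial>lborel) + 2 * D)" for k
  proof -
    have "(\<integral>x. \<bar>v k x\<bar> \<partial>lborel) \<le> (\<integral>x. \<bar>v k x - u x\<bar> + \<bar>u x\<bar> \<partial>lborel)"
      using vi ui by (intro integral_mono) auto
    also have "\<dots> = (\<integral>x. \<bar>v k x - u x\<bar> \<partial>lborel) + (\<integral>x. \<bar>u x\<bar> \<partial>lborel)"
      using vi ui by (intro Bochner_Integration.integral_add) auto
    also have "\<dots> \<le> (\<integral>x. \<bar>u x\<bar> \<partial>lborel) + 2 * D"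
    proof -
      have "2 * D * (1/2) ^ k \<le> 2 * D * 1" using D by (intro mult_left_mono) (auto simp: power_le_one)
      then show ?thesis using tail[of k] by simp
    qed
    finally have "C * (\<integral>x. \<bar>v k x\<bar> \<partial>lborel) \<le> C * ((\<integral>x. \<bar>u x\<bar> \<partial>lborel) + 2 * D)" using C by (intro mult_left_mono)
    moreover have "(1/4 :: real) ^ k \<le> 1" by (simp add: power_le_one)
    ultimately show ?thesis using N0[OF v(1)[of k]] v(2)[of k] unfolding J_def by linarith
  qed
  define E0 where "E0 = (m + 1 + \<bar>N (\<lambda>x. 0)\<bar> + C * ((\<integral>x. \<bar>u x\<bar> \<partial>lborel) + 2 * D)) * 2 / Q"
  have vE0: "energy_form s (v k) (v k) \<le> E0" for k using vE[of k] Q by (simp add: E0_def field_simps)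
  have limp: "AE z in lborel \<Otimes>\<^sub>M lborel. (\<lambda>k. (\<lambda>(x, y). (v k x - v k y)\<^sup>2 * frac_kernel s (x - y)) z)
      \<longlonglongrightarrow> (\<lambda>(x, y). (u x - u y)\<^sup>2 * frac_kernel s (x - y)) z"
    using AE_lborel_pair(1)[OF lim] AE_lborel_pair(2)[OF lim]
    by eventually_elim (auto simp: split_beta intro!: tendsto_intros)
  have fat: "(\<integral>\<^sup>+z. ennreal ((\<lambda>(x, y). (u x - u y)\<^sup>2 * frac_kernel s (x - y)) z) \<partial>(lborel \<Otimes>\<^sub>M lborel)) \<le> ennreal E"
    if "eventually (\<lambda>k. energy_form s (v k) (v k) \<le> E) sequentially" for E
  proof (rule fatou_bound[OF _ limp])
    show "eventually (\<lambda>k. (\<integral>\<^sup>+z. ennreal ((\<lambda>(x, y). (v k x - v k y)\<^sup>2 * frac_kernel s (x - y)) z) \<partial>(lborel \<Otimes>\<^sub>M lborel)) \<le> ennreal E) sequentially"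
      using that
    proof eventually_elim
      case (elim k)
      show ?case unfolding energy_form_self_nn[OF v(1)[of k, unfolded X_def]] using elim by (rule ennreal_leI)
    qed
  qed measurable
  have fu: "finite_energy s u"
    unfolding finite_energy_def
  proof (rule integrableI_bounded)
    have "(\<integral>\<^sup>+z. ennreal (norm ((\<lambda>(x, y). (u x - u y)\<^sup>2 * frac_kernel s (x - y)) z)) \<partial>(lborel \<Otimes>\<^sub>M lborel)) \<le> ennreal E0"
      using fat[of E0] vE0 by (simp add: split_beta abs_mult)
    then show "(\<integral>\<^sup>+z. ennreal (norm ((\<lambda>(x, y). (u x - u y)\<^sup>2 * frac_kernel s (x - y)) z)) \<partial>(lborel \<Otimes>\<^sub>M lborel)) < \<infinity>"
      by (rule order.strict_trans1) simp
  qed measurable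
  have u2: "integrable lborel (\<lambda>x. (u x)\<^sup>2)"
  proof (rule integrableI_bounded)
    have "(\<integral>\<^sup>+x. ennreal ((u x)\<^sup>2) \<partial>lborel) \<le> ennreal (E0 / c)"
    proof (rule fatou_bound[where f = "\<lambda>k x. (v k x)\<^sup>2"])
      show "AE x in lborel. (\<lambda>k. (v k x)\<^sup>2) \<longlonglongrightarrow> (u x)\<^sup>2" using lim by eventually_elim (intro tendsto_intros)
      have "(\<integral>\<^sup>+x. ennreal ((v k x)\<^sup>2) \<partial>lborel) \<le> ennreal (E0 / c)" for k
      proof -
        have "c * (\<integral>x. (v k x)\<^sup>2 \<partial>lborel) \<le> E0" using c(2)[of "v k"] v(1)[of k] vE0[of k] by (simp add: X_def)
        then have "(\<integral>x. (v k x)\<^sup>2 \<partial>lborel) \<le> E0 / c" using c by (simp add: field_simps)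
        then show ?thesis using v(1)[of k] by (subst nn_integral_eq_integral) (auto simp: X_def energy_space_def intro: ennreal_leI)
      qed
      then show "eventually (\<lambda>k. (\<integral>\<^sup>+x. ennreal ((v k x)\<^sup>2) \<partial>lborel) \<le> ennreal (E0 / c)) sequentially" by simp
    qed measurable
    then show "(\<integral>\<^sup>+x. ennreal (norm ((u x)\<^sup>2)) \<partial>lborel) < \<infinity>" by (simp add: le_less_trans)
  qed measurable
  have "AE x in lborel. \<forall>k. x \<notin> K \<longrightarrow> v k x = 0"
    unfolding AE_all_countable using v(1) by (simp add: X_def energy_space_def)
  then have "AE x in lborel. x \<notin> K \<longrightarrow> u x = 0"
    using lim
  proof eventually_elim
    case (elim x)
    then show ?case using LIMSEQ_unique[of "\<lambda>k. v k x" "u x" 0] by auto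
  qed
  then have uX: "u \<in> energy_space s K" using um u2 fu by (simp add: energy_space_def)
  have "(\<lambda>k. N (v k)) \<longlonglongrightarrow> N u"
  proof (rule Lim_transform2[OF tendsto_const])
    have "(\<lambda>k. N u - N (v k)) \<longlonglongrightarrow> 0"
    proof (rule Lim_null_comparison)
      show "eventually (\<lambda>k. norm (N u - N (v k)) \<le> C * (2 * D * (1/2) ^ k)) sequentially"
      proof (intro always_eventually allI)
        fix k
        have "\<bar>N (v k) - N u\<bar> \<le> C * (\<integral>x. \<bar>v k x - u x\<bar> \<partial>lborel)" using v(1)[of k] uX by (intro lip) (auto simp: X_def)
        also have "\<dots> \<le> C * (2 * D * (1/2) ^ k)" using C by (intro mult_left_mono tail)
        finally show "norm (N u - N (v k)) \<le> C * (2 * D * (1/2) ^ k)" by (simp add: abs_minus_commute)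
      qed
      have "(\<lambda>k. C * (2 * D * (1/2) ^ k)) \<longlonglongrightarrow> C * (2 * D * 0)"
        by (intro tendsto_mult tendsto_const LIMSEQ_power_zero) simp
      then show "(\<lambda>k. C * (2 * D * (1/2) ^ k)) \<longlonglongrightarrow> 0" by simp
    qed
    then show "(\<lambda>k. N u - N (v k)) \<longlonglongrightarrow> 0" .
  qed
  then have limE: "(\<lambda>k. (m + (1/4) ^ k - N (v k)) * 2 / Q) \<longlonglongrightarrow> (m + 0 - N u) * 2 / Q"
    using Q by (intro tendsto_divide tendsto_mult tendsto_diff tendsto_add tendsto_const LIMSEQ_power_zero) auto
  have "energy_form s u u \<le> (m - N u) * 2 / Q"
  proof (rule field_le_epsilon)
    fix e :: real assume e: "0 < e"
    have ev: "eventually (\<lambda>k. energy_form s (v k) (v k) \<le> (m - N u) * 2 / Q + e) sequentially"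
    proof -
      have "(m + 0 - N u) * 2 / Q < (m - N u) * 2 / Q + e" using e by simp
      from order_tendstoD(2)[OF limE this] show ?thesis
      proof eventually_elim
        case (elim k)
        have "Q / 2 * energy_form s (v k) (v k) \<le> m + (1/4) ^ k - N (v k)"
          using less_imp_le[OF v(2)[of k]] unfolding J_def by (simp only: le_diff_eq)
        then have "energy_form s (v k) (v k) \<le> (m + (1/4) ^ k - N (v k)) * 2 / Q"
          using Q by (simp add: pos_le_divide_eq mult.commute)
        then show ?case using elim by linarith
      qed
    qed
    have nonneg: "0 \<le> (m - N u) * 2 / Q + e"
      using eventually_happens[OF ev] energy_form_self_nonneg by (auto intro: order_trans)
    have "ennreal (energy_form s u u) \<le> ennreal ((m - N u) * 2 / Q + e)"
      using fat[OF ev] unfolding energy_form_self_nn[OF uX] .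
    then show "energy_form s u u \<le> (m - N u) * 2 / Q + e" using nonneg by (simp add: ennreal_le_iff)
  qed
  then have "J u \<le> m" using Q by (simp add: J_def field_simps)
  then show ?thesis using that[OF uX] mle unfolding J_def X_def by (meson order_trans)
qed

lemma linear_coefficient_zero:
  fixes a b :: real
  assumes "\<And>t. 0 \<le> t * a + t\<^sup>2 * b"
  shows "a = 0"
proof (rule ccontr)
  assume a: "a \<noteq> 0"
  define q where "q = \<bar>b\<bar> + 1"
  have q: "0 < q" by (simp add: q_def)
  have "0 \<le> (- a / q) * a + (- a / q)\<^sup>2 * b" by (rule assms)
  also have "\<dots> = a\<^sup>2 / q\<^sup>2 * (b - q)" using q by (simp add: field_simps power2_eq_square)
  also have "\<dots> < 0" using a q by (intro mult_pos_neg) (auto simp: q_def)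
  finally show False by simp
qed

text \<open>
  The Euler equation, from a quadratic upper expansion of \<open>N\<close> along one line; no
  differentiability of \<open>N\<close> on the whole space is involved.
\<close>

lemma energy_minimizer_equation:
  assumes u: "u \<in> energy_space s K"
    and min: "\<And>v. v \<in> energy_space s K \<Longrightarrow> Q / 2 * energy_form s u u + N u \<le> Q / 2 * energy_form s v v + N v"
    and w: "w \<in> energy_space s K" and N: "\<And>t. N (\<lambda>x. u x + t * w x) \<le> N u + t * G + t\<^sup>2 * A"
  shows "Q * energy_form s u w + G = 0"
proof (rule linear_coefficient_zero)
  fix t
  have "Q / 2 * energy_form s u u + N u \<le> Q / 2 * (energy_form s u u + 2 * t * energy_form s u w + t\<^sup>2 * energy_form s w w) + (N u + t * G + t\<^sup>2 * A)"
    using min[OF energy_space_add[OF u energy_space_scale[OF w]], of t] N[of t] unfolding energy_form_expand[OF u w] by linarith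
  then show "0 \<le> t * (Q * energy_form s u w + G) + t\<^sup>2 * (Q / 2 * energy_form s w w + A)"
    by (simp add: algebra_simps)
qed

section \<open>Superposition operators and the semilinear equation\<close>

text \<open>
  The inner function is approximated by functions with countably many values, for which only the
  measurability of sections of \<open>f\<close> enters.
\<close>

lemma measurable_superposition:
  fixes f :: "'a \<Rightarrow> real \<Rightarrow> real"
  assumes f: "\<And>t. (\<lambda>x. f x t) \<in> borel_measurable M" and c: "\<And>x. x \<in> space M \<Longrightarrow> continuous_on UNIV (f x)"
    and u: "u \<in> borel_measurable M"
  shows "(\<lambda>x. f x (u x)) \<in> borel_measurable M"
proof (rule borel_measurable_LIMSEQ_real[where u = "\<lambda>k x. f x (real_of_int \<lfloor>real (Suc k) * u x\<rfloor> / real (Suc k))"])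
  fix k :: nat
  have "(\<lambda>x. \<lfloor>real (Suc k) * u x\<rfloor>) \<in> measurable M (count_space UNIV)" using u by measurable
  then show "(\<lambda>x. f x (real_of_int \<lfloor>real (Suc k) * u x\<rfloor> / real (Suc k))) \<in> borel_measurable M"
    using measurable_compose_countable[of "\<lambda>i x. f x (real_of_int i / real (Suc k))" M borel "\<lambda>x. \<lfloor>real (Suc k) * u x\<rfloor>"] f
    by simp
next
  fix x assume x: "x \<in> space M"
  have "(\<lambda>k. real_of_int \<lfloor>real (Suc k) * u x\<rfloor> / real (Suc k)) \<longlonglongrightarrow> u x"
  proof (rule tendsto_sandwich)
    show "eventually (\<lambda>k. u x - inverse (real (Suc k)) \<le> real_of_int \<lfloor>real (Suc k) * u x\<rfloor> / real (Suc k)) sequentially"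
    proof (intro always_eventually allI)
      fix k
      define n where "n = real (Suc k)"
      have n: "0 < n" by (simp add: n_def)
      have "n * u x - 1 \<le> real_of_int \<lfloor>n * u x\<rfloor>" by linarith
      then have "(n * u x - 1) / n \<le> real_of_int \<lfloor>n * u x\<rfloor> / n" using n by (intro divide_right_mono) auto
      then show "u x - inverse (real (Suc k)) \<le> real_of_int \<lfloor>real (Suc k) * u x\<rfloor> / real (Suc k)"
        using n unfolding n_def[symmetric] by (simp add: diff_divide_distrib inverse_eq_divide)
    qed
    show "eventually (\<lambda>k. real_of_int \<lfloor>real (Suc k) * u x\<rfloor> / real (Suc k) \<le> u x) sequentially"
    proof (intro always_eventually allI)
      fix k
      define n where "n = real (Suc k)"
      have n: "0 < n" by (simp add: n_def)
      have "real_of_int \<lfloor>n * u x\<rfloor> / n \<le> n * u x / n" using n by (intro divide_right_mono) auto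
      then show "real_of_int \<lfloor>real (Suc k) * u x\<rfloor> / real (Suc k) \<le> u x"
        using n unfolding n_def[symmetric] by simp
    qed
    show "(\<lambda>k. u x - inverse (real (Suc k))) \<longlonglongrightarrow> u x"
      using tendsto_diff[OF tendsto_const[of "u x"] LIMSEQ_inverse_real_of_nat] by simp
  qed simp
  moreover have "isCont (f x) (u x)" using c[OF x] by (simp add: continuous_on_eq_continuous_at)
  ultimately show "(\<lambda>k. f x (real_of_int \<lfloor>real (Suc k) * u x\<rfloor> / real (Suc k))) \<longlonglongrightarrow> f x (u x)"
    by (rule isCont_tendsto_compose[rotated])
qed

lemma antiderivative_exists:
  fixes f :: "real \<Rightarrow> real"
  assumes "continuous_on UNIV f"
  shows "\<exists>F. F 0 = 0 \<and> (\<forall>t. (F has_real_derivative f t) (at t))"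
proof -
  have "\<exists>F. \<forall>x. - \<infinity> < ereal x \<longrightarrow> ereal x < \<infinity> \<longrightarrow> (F has_vector_derivative f x) (at x)"
    using assms by (intro einterval_antiderivative) (auto simp: continuous_on_eq_continuous_at)
  then obtain F where F: "\<And>t. (F has_real_derivative f t) (at t)"
    by (auto simp: has_real_derivative_iff_has_vector_derivative)
  show ?thesis
    by (intro exI[of _ "\<lambda>t. F t - F 0"] conjI allI) (auto intro!: derivative_eq_intros F)
qed

lemma primitive_taylor:
  fixes F f :: "real \<Rightarrow> real"
  assumes F: "\<And>t. (F has_real_derivative f t) (at t)" and lip: "\<And>t t'. \<bar>f t - f t'\<bar> \<le> \<Lambda> * \<bar>t - t'\<bar>"
  shows "\<bar>F (t + h) - F t - h * f t\<bar> \<le> \<Lambda> * h\<^sup>2"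
proof -
  have \<Lambda>: "0 \<le> \<Lambda>" using lip[of 1 0] by simp
  obtain \<xi> where \<xi>: "\<bar>\<xi> - t\<bar> \<le> \<bar>h\<bar>" "F (t + h) - F t = h * f \<xi>"
  proof (cases "h = 0")
    case True then show ?thesis using that[of t] by simp
  next
    case False
    show ?thesis
    proof (cases "0 < h")
      case True
      obtain z where "t < z" "z < t + h" "F (t + h) - F t = (t + h - t) * f z"
        using MVT2[of t "t + h" F f] True F by auto
      then show ?thesis using that[of z] by simp
    next
      case neg: False
      obtain z where "t + h < z" "z < t" "F t - F (t + h) = (t - (t + h)) * f z"
        using MVT2[of "t + h" t F f] neg False F by auto
      then show ?thesis using that[of z] by (simp add: algebra_simps)
    qed
  qed
  have "\<bar>F (t + h) - F t - h * f t\<bar> = \<bar>h\<bar> * \<bar>f \<xi> - f t\<bar>"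
    by (simp add: \<xi>(2) abs_mult[symmetric] right_diff_distrib)
  also have "\<dots> \<le> \<bar>h\<bar> * (\<Lambda> * \<bar>h\<bar>)"
    using lip[of \<xi> t] \<xi>(1) \<Lambda> by (intro mult_left_mono) (auto intro: order_trans mult_left_mono)
  also have "\<dots> = \<Lambda> * h\<^sup>2" by (simp add: power2_eq_square)
  finally show ?thesis .
qed

text \<open>The primitive is a limit of Riemann sums, with an error controlled by \<open>primitive_taylor\<close>.\<close>

lemma measurable_primitive:
  fixes F f :: "'a \<Rightarrow> real \<Rightarrow> real"
  assumes f: "\<And>t. (\<lambda>x. f x t) \<in> borel_measurable M"
    and F: "\<And>x t. (F x has_real_derivative f x t) (at t)" "\<And>x. F x 0 = 0"
    and lip: "\<And>x t t'. \<bar>f x t - f x t'\<bar> \<le> \<Lambda> * \<bar>t - t'\<bar>"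
  shows "(\<lambda>x. F x t) \<in> borel_measurable M"
proof -
  define R where "R = (\<lambda>(n::nat) x. \<Sum>i<Suc n. t / real (Suc n) * f x (real i * (t / real (Suc n))))"
  have Rm: "R n \<in> borel_measurable M" for n unfolding R_def using f by measurable
  have lim: "(\<lambda>n. R n x) \<longlonglongrightarrow> F x t" for x
  proof -
  have "\<bar>F x t - R n x\<bar> \<le> \<Lambda> * t\<^sup>2 / real (Suc n)" for n
  proof -
    define h where "h = t / real (Suc n)"
    have h: "real (Suc n) * h = t" by (simp add: h_def)
    have "F x t = (\<Sum>i<Suc n. F x (real (Suc i) * h) - F x (real i * h))"
      unfolding sum_lessThan_telescope[of "\<lambda>i. F x (real i * h)"] h by (simp add: F)
    then have "F x t - R n x = (\<Sum>i<Suc n. (F x (real i * h + h) - F x (real i * h)) - h * f x (real i * h))"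
      unfolding R_def h_def[symmetric] sum_subtractf by (simp add: algebra_simps)
    also have "\<bar>\<dots>\<bar> \<le> (\<Sum>i<Suc n. \<bar>F x (real i * h + h) - F x (real i * h) - h * f x (real i * h)\<bar>)"
      by (rule sum_abs)
    also have "\<dots> \<le> (\<Sum>i<Suc n. \<Lambda> * h\<^sup>2)"
      by (intro sum_mono primitive_taylor[OF F(1) lip])
    also have "\<dots> = \<Lambda> * t\<^sup>2 / real (Suc n)" by (simp add: h_def power2_eq_square)
    finally show ?thesis .
  qed
  moreover have "(\<lambda>n. \<Lambda> * t\<^sup>2 / real (Suc n)) \<longlonglongrightarrow> 0"
    using tendsto_mult[OF tendsto_const[of "\<Lambda> * t\<^sup>2"] LIMSEQ_inverse_real_of_nat] by (simp add: divide_inverse)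
  ultimately have "(\<lambda>n. R n x - F x t) \<longlonglongrightarrow> 0"
    by (intro Lim_null_comparison[of "\<lambda>n. R n x - F x t" "\<lambda>n. \<Lambda> * t\<^sup>2 / real (Suc n)"])
      (auto intro!: always_eventually simp: abs_minus_commute)
  then show ?thesis by (rule LIM_zero_cancel)
  qed
  show ?thesis by (rule borel_measurable_LIMSEQ_real[where u = R, OF lim Rm])
qed

lemma integrable_lebesgue_on_if_lborel:
  fixes v :: "'a::euclidean_space \<Rightarrow> real"
  assumes v: "integrable lborel v" and \<Omega>: "\<Omega> \<in> sets lebesgue"
  shows "integrable (lebesgue_on \<Omega>) v"
    and "(\<And>x. 0 \<le> v x) \<Longrightarrow> (\<integral>x. v x \<partial>lebesgue_on \<Omega>) \<le> (\<integral>x. v x \<partial>lborel)"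
proof -
  have vl: "integrable lebesgue v" using v by (simp add: integrable_completion)
  then have vi: "integrable lebesgue (\<lambda>x. indicator \<Omega> x *\<^sub>R v x)"
    using \<Omega> by (rule integrable_mult_indicator[rotated])
  then show "integrable (lebesgue_on \<Omega>) v"
    using \<Omega> by (subst integrable_restrict_space) auto
  assume pos: "\<And>x. 0 \<le> v x"
  have "(\<integral>x. v x \<partial>lebesgue_on \<Omega>) = (\<integral>x. indicator \<Omega> x *\<^sub>R v x \<partial>lebesgue)"
    using \<Omega> by (subst integral_restrict_space) auto
  also have "\<dots> \<le> (\<integral>x. v x \<partial>lebesgue)"
    using vi vl pos by (intro integral_mono) (auto simp: indicator_def)
  also have "\<dots> = (\<integral>x. v x \<partial>lborel)" using v by (intro integral_completion) auto
  finally show "(\<integral>x. v x \<partial>lebesgue_on \<Omega>) \<le> (\<integral>x. v x \<partial>lborel)" .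
qed

lemma borel_measurable_lebesgue_on:
  fixes v :: "'a::euclidean_space \<Rightarrow> real"
  assumes "v \<in> borel_measurable borel"
  shows "v \<in> borel_measurable (lebesgue_on \<Omega>)"
  using assms by (intro measurable_restrict_space1) (simp add: measurable_completion)

lemma integrable_bounded_mult:
  fixes f v :: "'a \<Rightarrow> real"
  assumes [measurable]: "f \<in> borel_measurable M" and v: "integrable M v" and C: "AE x in M. \<bar>f x\<bar> \<le> C"
  shows "integrable M (\<lambda>x. f x * v x)"
proof (rule Bochner_Integration.integrable_bound)
  show "integrable M (\<lambda>x. C * v x)" using v by simp
  have [measurable]: "v \<in> borel_measurable M" using v by auto
  show "(\<lambda>x. f x * v x) \<in> borel_measurable M" by measurable
  show "AE x in M. norm (f x * v x) \<le> norm (C * v x)"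
    using C
  proof eventually_elim
    case (elim x)
    then have "\<bar>f x\<bar> * \<bar>v x\<bar> \<le> \<bar>C\<bar> * \<bar>v x\<bar>" by (intro mult_right_mono) auto
    then show ?case by (simp add: abs_mult)
  qed
qed

text \<open>
  The equation is the Euler equation of the energy plus the integral of a primitive \<open>F\<close> of \<open>f\<close>.
  Monotonicity of \<open>f\<close> makes \<open>F\<close> convex, boundedness makes it Lipschitz, and the
  Lipschitz bound on \<open>f\<close> gives the quadratic expansion.
\<close>

theorem semilinear_solution_exists:
  fixes K \<Omega> :: "(real ^ 'n) set" and f :: "real ^ 'n \<Rightarrow> real \<Rightarrow> real"
  assumes s: "0 < s" and K: "bounded K" and Q: "0 < Q" and \<Omega>: "\<Omega> \<in> sets lebesgue"
    and f: "\<And>t. (\<lambda>x. f x t) \<in> borel_measurable (lebesgue_on \<Omega>)"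
    and mono: "\<And>x t t'. t \<le> t' \<Longrightarrow> f x t \<le> f x t'"
    and lip: "\<And>x t t'. \<bar>f x t - f x t'\<bar> \<le> \<Lambda> * \<bar>t - t'\<bar>"
    and bd: "\<And>x t. \<bar>f x t\<bar> \<le> C"
  obtains u where "u \<in> energy_space s K"
    "\<And>v. v \<in> energy_space s K \<Longrightarrow> Q * energy_form s u v + (\<integral>x. f x (u x) * v x \<partial>lebesgue_on \<Omega>) = 0"
proof -
  let ?M = "lebesgue_on \<Omega>"
  have C: "0 \<le> C" using bd[of undefined 0] by (rule order_trans[OF abs_ge_zero])
  have cont: "continuous_on UNIV (f x)" for x
  proof -
    have "(max \<Lambda> 0)-lipschitz_on UNIV (f x)"
    proof (rule lipschitz_onI)
      fix t t'
      have "\<Lambda> * \<bar>t - t'\<bar> \<le> max \<Lambda> 0 * \<bar>t - t'\<bar>" by (intro mult_right_mono) auto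
      then show "dist (f x t) (f x t') \<le> max \<Lambda> 0 * dist t t'"
        using lip[of x t t'] by (simp add: dist_real_def)
    qed simp
    then show ?thesis by (rule lipschitz_on_continuous_on)
  qed
  have "\<forall>x. \<exists>F. F 0 = 0 \<and> (\<forall>t. (F has_real_derivative f x t) (at t))" using antiderivative_exists[OF cont] by blast
  then obtain F where F0: "\<And>x. F x 0 = 0" and F: "\<And>x t. (F x has_real_derivative f x t) (at t)" by metis
  have Fc: "continuous_on UNIV (F x)" for x
    using F by (intro continuous_at_imp_continuous_on ballI) (auto intro: DERIV_isCont)
  have Fm: "(\<lambda>x. F x t) \<in> borel_measurable ?M" for t by (rule measurable_primitive[OF f F F0 lip])
  have Flip: "\<bar>F x t - F x t'\<bar> \<le> C * \<bar>t - t'\<bar>" for x t t'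
    using field_differentiable_bound[of UNIV "F x" "f x" C t t'] F bd by (simp add: has_field_derivative_at_within)
  have Fconv: "convex_on UNIV (F x)" for x
    by (rule convex_on_realI[of UNIV "F x" "f x"]) (use F mono in auto)
  define N where "N = (\<lambda>v. \<integral>x. F x (v x) \<partial>?M)"
  have Fi: "integrable ?M (\<lambda>x. F x (v x))" if v: "v \<in> energy_space s K" for v
  proof (rule Bochner_Integration.integrable_bound)
    show "integrable ?M (\<lambda>x. C * v x)"
      using integrable_lebesgue_on_if_lborel(1)[OF energy_space_integrable[OF v K] \<Omega>] by simp
    show "(\<lambda>x. F x (v x)) \<in> borel_measurable ?M"
      by (rule measurable_superposition[OF Fm Fc borel_measurable_lebesgue_on[OF energy_spaceD(1)[OF v]]])
    show "AE x in ?M. norm (F x (v x)) \<le> norm (C * v x)"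
      using Flip[of _ _ 0] F0 C by (intro AE_I2) (simp add: abs_mult)
  qed
  have vi: "integrable ?M v" if "v \<in> energy_space s K" for v
    by (rule integrable_lebesgue_on_if_lborel(1)[OF energy_space_integrable[OF that K] \<Omega>])
  obtain u where u: "u \<in> energy_space s K"
    "\<And>v. v \<in> energy_space s K \<Longrightarrow> Q / 2 * energy_form s u u + N u \<le> Q / 2 * energy_form s v v + N v"
  proof (rule energy_minimizer_exists[OF s K Q C])
    fix v w assume v: "v \<in> energy_space s K" and w: "w \<in> energy_space s K"
    have vw: "(\<lambda>x. v x - w x) \<in> energy_space s K" by (rule energy_space_diff[OF v w])
    have "\<bar>N v - N w\<bar> = \<bar>\<integral>x. F x (v x) - F x (w x) \<partial>?M\<bar>"
      unfolding N_def using Fi[OF v] Fi[OF w] by (subst Bochner_Integration.integral_diff) auto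
    also have "\<dots> \<le> (\<integral>x. \<bar>F x (v x) - F x (w x)\<bar> \<partial>?M)" by simp
    also have "\<dots> \<le> (\<integral>x. C * \<bar>v x - w x\<bar> \<partial>?M)"
      using Fi[OF v] Fi[OF w] vi[OF vw] Flip by (intro integral_mono) auto
    also have "\<dots> = C * (\<integral>x. \<bar>v x - w x\<bar> \<partial>?M)" by simp
    also have "\<dots> \<le> C * (\<integral>x. \<bar>v x - w x\<bar> \<partial>lborel)"
      using energy_space_integrable[OF vw K] \<Omega> C
      by (intro mult_left_mono integrable_lebesgue_on_if_lborel(2)) auto
    finally show "\<bar>N v - N w\<bar> \<le> C * (\<integral>x. \<bar>v x - w x\<bar> \<partial>lborel)" .
    have h: "(\<lambda>x. (v x + w x) / 2) \<in> energy_space s K"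
      using energy_space_scale[OF energy_space_add[OF v w], of "1/2"] by simp
    have "N (\<lambda>x. (v x + w x) / 2) \<le> (\<integral>x. (F x (v x) + F x (w x)) / 2 \<partial>?M)"
      unfolding N_def
    proof (rule integral_mono)
      show "integrable ?M (\<lambda>x. F x ((v x + w x) / 2))" by (rule Fi[OF h])
      show "integrable ?M (\<lambda>x. (F x (v x) + F x (w x)) / 2)" using Fi[OF v] Fi[OF w] by simp
      fix x
      show "F x ((v x + w x) / 2) \<le> (F x (v x) + F x (w x)) / 2"
        using convex_onD[OF Fconv[of x], of "1/2" "v x" "w x"] by (simp add: add_divide_distrib)
    qed
    also have "\<dots> = (N v + N w) / 2" unfolding N_def using Fi[OF v] Fi[OF w] by simp
    finally show "N (\<lambda>x. (v x + w x) / 2) \<le> (N v + N w) / 2" .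
  qed (rule that, assumption, blast)
  show ?thesis
  proof (rule that[OF u(1)])
    fix v assume v: "v \<in> energy_space s K"
    have v2: "integrable ?M (\<lambda>x. (v x)\<^sup>2)" by (rule integrable_lebesgue_on_if_lborel(1)[OF energy_spaceD(2)[OF v] \<Omega>])
    have fm: "(\<lambda>x. f x (u x)) \<in> borel_measurable ?M"
      by (rule measurable_superposition[OF f cont borel_measurable_lebesgue_on[OF energy_spaceD(1)[OF u(1)]]])
    have fv: "integrable ?M (\<lambda>x. f x (u x) * v x)"
      by (rule integrable_bounded_mult[OF fm vi[OF v]]) (use bd in auto)
    show "Q * energy_form s u v + (\<integral>x. f x (u x) * v x \<partial>?M) = 0"
    proof (rule energy_minimizer_equation[OF u v])
      fix t
      have tv: "(\<lambda>x. u x + t * v x) \<in> energy_space s K" by (rule energy_space_add[OF u(1) energy_space_scale[OF v]])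
      have "N (\<lambda>x. u x + t * v x) \<le> (\<integral>x. F x (u x) + t * (f x (u x) * v x) + t\<^sup>2 * (\<Lambda> * (v x)\<^sup>2) \<partial>?M)"
        unfolding N_def
      proof (rule integral_mono)
        show "integrable ?M (\<lambda>x. F x (u x + t * v x))" by (rule Fi[OF tv])
        show "integrable ?M (\<lambda>x. F x (u x) + t * (f x (u x) * v x) + t\<^sup>2 * (\<Lambda> * (v x)\<^sup>2))"
          using Fi[OF u(1)] fv v2 by simp
        fix x
        have "F x (u x + t * v x) - F x (u x) - t * v x * f x (u x) \<le> \<Lambda> * (t * v x)\<^sup>2"
          using primitive_taylor[OF F lip, of x "u x" "t * v x"] by (simp add: abs_le_iff)
        then show "F x (u x + t * v x) \<le> F x (u x) + t * (f x (u x) * v x) + t\<^sup>2 * (\<Lambda> * (v x)\<^sup>2)"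
          by (simp add: power_mult_distrib algebra_simps)
      qed
      also have "\<dots> = N u + t * (\<integral>x. f x (u x) * v x \<partial>?M) + t\<^sup>2 * (\<Lambda> * (\<integral>x. (v x)\<^sup>2 \<partial>?M))"
        unfolding N_def using Fi[OF u(1)] fv v2 by simp
      finally show "N (\<lambda>x. u x + t * v x) \<le> N u + t * (\<integral>x. f x (u x) * v x \<partial>?M) + t\<^sup>2 * (\<Lambda> * (\<integral>x. (v x)\<^sup>2 \<partial>?M))" .
    qed
  qed
qed

section \<open>From Lebesgue measurable representatives to Borel representatives\<close>

lemma sigma_finite_lebesgue: "sigma_finite_measure (lebesgue :: 'a::euclidean_space measure)"
proof
  show "\<exists>A. countable A \<and> A \<subseteq> sets (lebesgue :: 'a measure) \<and> \<Union>A = space lebesgue \<and> (\<forall>a\<in>A. emeasure lebesgue a \<noteq> \<infinity>)"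
  proof (intro exI[of _ "range (\<lambda>n::nat. cball (0::'a) (real n))"] conjI)
    show "\<Union>(range (\<lambda>n::nat. cball (0::'a) (real n))) = space lebesgue"
    proof -
      have "\<exists>n::nat. norm x \<le> real n" for x :: 'a by (rule real_arch_simple)
      then show ?thesis by auto
    qed
    show "\<forall>a\<in>range (\<lambda>n::nat. cball (0::'a) (real n)). emeasure lebesgue a \<noteq> \<infinity>"
      using emeasure_lborel_cball_finite[of "0::'a"] by (auto simp: less_top)
  qed auto
qed

interpretation lebesgue_pair: pair_sigma_finite "lebesgue :: 'a::euclidean_space measure" "lebesgue :: 'b::euclidean_space measure"
  by (simp add: pair_sigma_finite_def sigma_finite_lebesgue)

lemma id_lebesgue_lborel [measurable]: "(\<lambda>x. x) \<in> measurable lebesgue (lborel :: 'a::euclidean_space measure)"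
  by (rule measurable_completion) (simp add: measurable_ident_sets)

lemma id_lebesgue_pair [measurable]:
  "(\<lambda>z. z) \<in> measurable (lebesgue \<Otimes>\<^sub>M lebesgue) (lborel \<Otimes>\<^sub>M lborel :: ('a::euclidean_space \<times> 'b::euclidean_space) measure)"
proof -
  have "(\<lambda>z. (fst z, snd z)) \<in> measurable (lebesgue \<Otimes>\<^sub>M lebesgue) (lborel \<Otimes>\<^sub>M lborel :: ('a \<times> 'b) measure)"
    by (intro measurable_Pair measurable_compose[OF measurable_fst id_lebesgue_lborel] measurable_compose[OF measurable_snd id_lebesgue_lborel])
  then show ?thesis by simp
qed

text \<open>
  The product of two completed measures is not the completion of the product, nor the Borel
  product. The identity map between the two product spaces is measure preserving, which suffices
  to transfer integrals of Borel functions.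
\<close>

lemma distr_lebesgue_pair:
  "distr (lebesgue \<Otimes>\<^sub>M lebesgue) (lborel \<Otimes>\<^sub>M lborel) (\<lambda>z. z) = (lborel \<Otimes>\<^sub>M lborel :: ('a::euclidean_space \<times> 'b::euclidean_space) measure)"
proof (rule pair_measure_eqI[symmetric])
  fix A :: "'a set" and B :: "'b set" assume AB: "A \<in> sets lborel" "B \<in> sets lborel"
  then have "emeasure (distr (lebesgue \<Otimes>\<^sub>M lebesgue) (lborel \<Otimes>\<^sub>M lborel) (\<lambda>z. z)) (A \<times> B) = emeasure (lebesgue \<Otimes>\<^sub>M lebesgue) (A \<times> B)"
    by (subst emeasure_distr) (auto simp: space_pair_measure)
  also have "\<dots> = emeasure lebesgue A * emeasure lebesgue B"
    using AB by (intro sigma_finite_measure.emeasure_pair_measure_Times[OF sigma_finite_lebesgue]) auto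
  finally show "emeasure lborel A * emeasure lborel B = emeasure (distr (lebesgue \<Otimes>\<^sub>M lebesgue) (lborel \<Otimes>\<^sub>M lborel) (\<lambda>z. z)) (A \<times> B)"
    using AB by simp
qed (auto intro: sigma_finite_lborel)

lemma integral_lebesgue_pair:
  fixes h :: "'a::euclidean_space \<times> 'b::euclidean_space \<Rightarrow> real"
  assumes [measurable]: "h \<in> borel_measurable (lborel \<Otimes>\<^sub>M lborel)"
  shows "integral\<^sup>L (lebesgue \<Otimes>\<^sub>M lebesgue) h = integral\<^sup>L (lborel \<Otimes>\<^sub>M lborel) h"
    and "integrable (lebesgue \<Otimes>\<^sub>M lebesgue) h \<longleftrightarrow> integrable (lborel \<Otimes>\<^sub>M lborel) h"
proof -
  have "integral\<^sup>L (lborel \<Otimes>\<^sub>M lborel) h = integral\<^sup>L (distr (lebesgue \<Otimes>\<^sub>M lebesgue) (lborel \<Otimes>\<^sub>M lborel) (\<lambda>z. z)) h"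
    by (simp only: distr_lebesgue_pair)
  also have "\<dots> = integral\<^sup>L (lebesgue \<Otimes>\<^sub>M lebesgue) h" by (rule integral_distr) measurable
  finally show "integral\<^sup>L (lebesgue \<Otimes>\<^sub>M lebesgue) h = integral\<^sup>L (lborel \<Otimes>\<^sub>M lborel) h" ..
  have "integrable (lborel \<Otimes>\<^sub>M lborel) h \<longleftrightarrow> integrable (distr (lebesgue \<Otimes>\<^sub>M lebesgue) (lborel \<Otimes>\<^sub>M lborel) (\<lambda>z. z)) h"
    by (simp only: distr_lebesgue_pair)
  also have "\<dots> \<longleftrightarrow> integrable (lebesgue \<Otimes>\<^sub>M lebesgue) h" by (rule integrable_distr_eq) measurable
  finally show "integrable (lebesgue \<Otimes>\<^sub>M lebesgue) h \<longleftrightarrow> integrable (lborel \<Otimes>\<^sub>M lborel) h" ..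
qed

lemma AE_lebesgue_pair:
  fixes P :: "'a::euclidean_space \<Rightarrow> bool"
  assumes "AE x in lborel. P x"
  shows "AE z in lebesgue \<Otimes>\<^sub>M (lebesgue :: 'b::euclidean_space measure). P (fst z)"
    and "AE z in (lebesgue :: 'b::euclidean_space measure) \<Otimes>\<^sub>M lebesgue. P (snd z)"
proof -
  obtain N where N': "\<And>x. x \<in> space lborel - N \<Longrightarrow> P x" "N \<in> null_sets lborel"
    using AE_E3[OF assms] by blast
  then have N: "{x. \<not> P x} \<subseteq> N" "N \<in> sets lborel" "emeasure lborel N = 0" by auto
  have "N \<times> UNIV \<in> null_sets (lebesgue \<Otimes>\<^sub>M (lebesgue :: 'b measure))"
    using N by (intro null_setsI) (simp_all add: sigma_finite_measure.emeasure_pair_measure_Times[OF sigma_finite_lebesgue])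
  then show "AE z in lebesgue \<Otimes>\<^sub>M (lebesgue :: 'b measure). P (fst z)"
    using N by (intro AE_I'[of "N \<times> UNIV"]) auto
  have "UNIV \<times> N \<in> null_sets ((lebesgue :: 'b measure) \<Otimes>\<^sub>M lebesgue)"
    using N by (intro null_setsI) (simp_all add: sigma_finite_measure.emeasure_pair_measure_Times[OF sigma_finite_lebesgue])
  then show "AE z in (lebesgue :: 'b measure) \<Otimes>\<^sub>M lebesgue. P (snd z)"
    using N by (intro AE_I'[of "UNIV \<times> N"]) auto
qed

text \<open>
  The integrand may be changed on the null sets \<open>N \<times> UNIV\<close> and \<open>UNIV \<times> N\<close>, so \<open>v\<close> and \<open>w\<close> may be
  replaced by their Borel representatives.
\<close>

lemma lebesgue_pair_form:
  fixes v w v' w' :: "real ^ 'n \<Rightarrow> real"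
  assumes [measurable]: "v \<in> borel_measurable lebesgue" "w \<in> borel_measurable lebesgue"
      "v' \<in> borel_measurable borel" "w' \<in> borel_measurable borel"
    and v: "AE x in lborel. v x = v' x" and w: "AE x in lborel. w x = w' x"
  shows "(\<integral>(x, y). (v x - v y) * (w x - w y) / norm (x - y) powr (real CARD('n) + 2 * s) \<partial>(lebesgue \<Otimes>\<^sub>M lebesgue)) = energy_form s v' w'"
    and "integrable (lebesgue \<Otimes>\<^sub>M lebesgue) (\<lambda>(x, y). (v x - v y) * (w x - w y) / norm (x - y) powr (real CARD('n) + 2 * s))
      \<longleftrightarrow> integrable (lborel \<Otimes>\<^sub>M lborel) (\<lambda>(x, y). (v' x - v' y) * (w' x - w' y) * frac_kernel s (x - y))"
proof -
  let ?h = "\<lambda>(x, y). (v' x - v' y) * (w' x - w' y) * frac_kernel s (x - y)"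
  let ?g = "\<lambda>(x, y). (v x - v y) * (w x - w y) / norm (x - y) powr (real CARD('n) + 2 * s)"
  have hm [measurable]: "?h \<in> borel_measurable (lborel \<Otimes>\<^sub>M lborel)" by measurable
  have hl: "?h \<in> borel_measurable (lebesgue \<Otimes>\<^sub>M lebesgue)"
    using measurable_compose[OF id_lebesgue_pair hm] by simp
  have km: "(\<lambda>z :: (real ^ 'n) \<times> (real ^ 'n). norm (fst z - snd z) powr (real CARD('n) + 2 * s)) \<in> borel_measurable (lebesgue \<Otimes>\<^sub>M lebesgue)"
    by (rule measurable_compose[OF id_lebesgue_pair]) measurable
  have vm: "(\<lambda>z :: (real ^ 'n) \<times> (real ^ 'n). (v (fst z) - v (snd z)) * (w (fst z) - w (snd z))) \<in> borel_measurable (lebesgue \<Otimes>\<^sub>M lebesgue)"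
    by measurable
  have gm: "?g \<in> borel_measurable (lebesgue \<Otimes>\<^sub>M lebesgue)"
    using borel_measurable_divide[OF vm km] by (simp add: split_beta')
  have ae: "AE z in lebesgue \<Otimes>\<^sub>M lebesgue. ?g z = ?h z"
    using AE_lebesgue_pair(1)[OF v] AE_lebesgue_pair(2)[OF v] AE_lebesgue_pair(1)[OF w] AE_lebesgue_pair(2)[OF w]
    by eventually_elim (simp add: split_beta frac_kernel_def)
  have "integral\<^sup>L (lebesgue \<Otimes>\<^sub>M lebesgue) ?g = integral\<^sup>L (lebesgue \<Otimes>\<^sub>M lebesgue) ?h"
    by (rule integral_cong_AE[OF gm hl ae])
  then show "integral\<^sup>L (lebesgue \<Otimes>\<^sub>M lebesgue) ?g = energy_form s v' w'"
    unfolding energy_form_def integral_lebesgue_pair(1)[OF hm] .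
  have "integrable (lebesgue \<Otimes>\<^sub>M lebesgue) ?g \<longleftrightarrow> integrable (lebesgue \<Otimes>\<^sub>M lebesgue) ?h"
    by (rule integrable_cong_AE[OF gm hl ae])
  then show "integrable (lebesgue \<Otimes>\<^sub>M lebesgue) ?g \<longleftrightarrow> integrable (lborel \<Otimes>\<^sub>M lborel) ?h"
    unfolding integral_lebesgue_pair(2)[OF hm] .
qed

lemma borel_representative:
  fixes v :: "'a::euclidean_space \<Rightarrow> real"
  assumes "v \<in> borel_measurable lebesgue"
  obtains v' where "v' \<in> borel_measurable borel" "AE x in lborel. v x = v' x"
  using completion_ex_borel_measurable_real[OF assms] by auto

lemma integrable_square_representative:
  fixes v v' :: "'a::euclidean_space \<Rightarrow> real"
  assumes [measurable]: "v \<in> borel_measurable lebesgue" "v' \<in> borel_measurable borel"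
    and ae: "AE x in lborel. v x = v' x"
  shows "integrable lebesgue (\<lambda>x. \<bar>v x\<bar> powr 2) \<longleftrightarrow> integrable lborel (\<lambda>x. (v' x)\<^sup>2)"
proof -
  have m: "(\<lambda>x. (v' x)\<^sup>2) \<in> borel_measurable lborel" by measurable
  have "integrable lebesgue (\<lambda>x. \<bar>v x\<bar> powr 2) \<longleftrightarrow> integrable lebesgue (\<lambda>x. (v' x)\<^sup>2)"
  proof (rule integrable_cong_AE)
    show "AE x in lebesgue. \<bar>v x\<bar> powr 2 = (v' x)\<^sup>2"
      using AE_completion[OF ae] by eventually_elim simp
    show "(\<lambda>x. (v' x)\<^sup>2) \<in> borel_measurable lebesgue" using m by (rule measurable_completion)
  qed measurable
  then show ?thesis using m by (simp add: integrable_completion)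
qed

text \<open>
  The complement of the essential support is a union of arbitrarily many open sets on which \<open>v\<close>
  vanishes almost everywhere; by Lindeloef's theorem countably many of them suffice.
\<close>

lemma ess_support_subset_iff:
  assumes "closed K"
  shows "ess_support v \<subseteq> K \<longleftrightarrow> (AE x in lborel. x \<notin> K \<longrightarrow> v x = 0)"
proof
  assume sub: "ess_support v \<subseteq> K"
  define \<F> where "\<F> = {U. open U \<and> (AE x in lebesgue_on U. v x = 0)}"
  obtain \<F>' where F': "\<F>' \<subseteq> \<F>" "countable \<F>'" "\<Union>\<F>' = \<Union>\<F>"
    using Lindelof[of \<F>] by (auto simp: \<F>_def)
  have "AE x in lebesgue. \<forall>U\<in>\<F>'. x \<in> U \<longrightarrow> v x = 0"
    unfolding AE_ball_countable[OF F'(2)]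
  proof
    fix U assume "U \<in> \<F>'"
    then have U: "open U" "AE x in lebesgue_on U. v x = 0" using F'(1) by (auto simp: \<F>_def)
    then show "AE x in lebesgue. x \<in> U \<longrightarrow> v x = 0" by (subst (asm) AE_restrict_space_iff) auto
  qed
  then have "AE x in lebesgue. x \<notin> K \<longrightarrow> v x = 0"
  proof eventually_elim
    case (elim x)
    show ?case
    proof
      assume "x \<notin> K"
      then have "x \<in> \<Union>\<F>" using sub unfolding ess_support_def \<F>_def by blast
      then show "v x = 0" using elim F'(3) by auto
    qed
  qed
  then show "AE x in lborel. x \<notin> K \<longrightarrow> v x = 0" by (simp add: AE_completion_iff)
next
  assume "AE x in lborel. x \<notin> K \<longrightarrow> v x = 0"
  then have "AE x in lebesgue. x \<in> - K \<longrightarrow> v x = 0" by (simp add: AE_completion_iff)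
  then have "AE x in lebesgue_on (- K). v x = 0"
    using assms by (subst AE_restrict_space_iff) auto
  then have "- K \<subseteq> \<Union>{U. open U \<and> (AE x in lebesgue_on U. v x = 0)}" using assms by blast
  then show "ess_support v \<subseteq> K" unfolding ess_support_def by blast
qed

lemma Hs_tilde_measurable: "v \<in> Hs_tilde s \<Omega> \<Longrightarrow> v \<in> borel_measurable lebesgue"
  by (simp add: Hs_tilde_def Hs_space_def Lp_space_def lebesgue_on_UNIV_eq)

lemma Hs_tilde_iff_energy_space:
  fixes v v' :: "real ^ 'n \<Rightarrow> real"
  assumes v: "v \<in> borel_measurable lebesgue" and v': "v' \<in> borel_measurable borel"
    and ae: "AE x in lborel. v x = v' x"
  shows "v \<in> Hs_tilde s \<Omega> \<longleftrightarrow> v' \<in> energy_space s (closure \<Omega>)"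
proof -
  have "(AE x in lborel. x \<notin> closure \<Omega> \<longrightarrow> v x = 0) \<longleftrightarrow> (AE x in lborel. x \<notin> closure \<Omega> \<longrightarrow> v' x = 0)"
  proof
    assume "AE x in lborel. x \<notin> closure \<Omega> \<longrightarrow> v x = 0"
    with ae show "AE x in lborel. x \<notin> closure \<Omega> \<longrightarrow> v' x = 0" by eventually_elim simp
  next
    assume "AE x in lborel. x \<notin> closure \<Omega> \<longrightarrow> v' x = 0"
    with ae show "AE x in lborel. x \<notin> closure \<Omega> \<longrightarrow> v x = 0" by eventually_elim simp
  qed
  then show ?thesis
    using integrable_square_representative[OF v v' ae] lebesgue_pair_form(2)[OF v v v' v' ae ae, of s] v v'
    unfolding Hs_tilde_def Hs_space_def Lp_space_def energy_space_def finite_energy_def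
    by (simp add: lebesgue_on_UNIV_eq ess_support_subset_iff power2_eq_square)
qed

lemma Hs_tilde_representative:
  fixes v :: "real ^ 'n \<Rightarrow> real"
  assumes "v \<in> Hs_tilde s \<Omega>"
  obtains v' where "v' \<in> energy_space s (closure \<Omega>)" "AE x in lborel. v x = v' x"
proof -
  obtain v' where v': "v' \<in> borel_measurable borel" "AE x in lborel. v x = v' x"
    using borel_representative[OF Hs_tilde_measurable[OF assms]] by blast
  then show ?thesis
    using that[of v'] assms Hs_tilde_iff_energy_space[OF Hs_tilde_measurable[OF assms] v'] by blast
qed

lemma energy_space_subset_Hs_tilde:
  assumes "v \<in> energy_space s (closure \<Omega>)"
  shows "v \<in> Hs_tilde s \<Omega>"
proof -
  have m: "v \<in> borel_measurable borel" by (rule energy_spaceD(1)[OF assms])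
  then have "v \<in> borel_measurable lebesgue" by (simp add: measurable_completion)
  then show ?thesis using Hs_tilde_iff_energy_space[of v v s \<Omega>] m assms by simp
qed

lemma frac_form_representative:
  fixes v w v' w' :: "real ^ 'n \<Rightarrow> real"
  assumes "v \<in> borel_measurable lebesgue" "w \<in> borel_measurable lebesgue"
      "v' \<in> borel_measurable borel" "w' \<in> borel_measurable borel"
    and "AE x in lborel. v x = v' x" and "AE x in lborel. w x = w' x"
  shows "frac_form s v w = frac_const CARD('n) s / 2 * energy_form s v' w'"
  unfolding frac_form_def lebesgue_pair_form(1)[OF assms] ..

lemma frac_const_pos: "0 < s \<Longrightarrow> s < 1 \<Longrightarrow> 0 < frac_const n s"
  unfolding frac_const_def by (intro divide_pos_pos mult_pos_pos Gamma_real_pos) (auto intro: add_pos_nonneg)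

lemma AE_lebesgue_on_lborel:
  assumes "AE x in lborel. P x" and "\<Omega> \<in> sets lebesgue"
  shows "AE x in lebesgue_on \<Omega>. P x"
  using AE_completion[OF assms(1)] assms(2) by (subst AE_restrict_space_iff) auto

lemma borel_measurable_lebesgue_on_AE:
  fixes f g :: "'a::euclidean_space \<Rightarrow> real"
  assumes \<Omega>: "\<Omega> \<in> sets lebesgue" and f: "f \<in> borel_measurable (lebesgue_on \<Omega>)"
    and ae: "AE x in lebesgue_on \<Omega>. f x = g x"
  shows "g \<in> borel_measurable (lebesgue_on \<Omega>)"
proof -
  have "(\<lambda>x. if x \<in> \<Omega> then f x else 0) \<in> borel_measurable lebesgue"
    using f \<Omega> by (simp add: borel_measurable_if)
  moreover have "AE x in lebesgue. (if x \<in> \<Omega> then f x else 0) = (if x \<in> \<Omega> then g x else 0)"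
  proof -
    have "AE x in lebesgue. x \<in> \<Omega> \<longrightarrow> f x = g x" using ae \<Omega> by (subst (asm) AE_restrict_space_iff) auto
    then show ?thesis by eventually_elim auto
  qed
  ultimately have "(\<lambda>x. if x \<in> \<Omega> then g x else 0) \<in> borel_measurable lebesgue"
    by (rule borel_measurable_AE)
  then show ?thesis using \<Omega> by (simp add: borel_measurable_if)
qed

lemma borel_measurable_lebesgue_on_AE_limit:
  fixes f :: "nat \<Rightarrow> 'a::euclidean_space \<Rightarrow> real"
  assumes \<Omega>: "\<Omega> \<in> sets lebesgue" and f [measurable]: "\<And>k. f k \<in> borel_measurable (lebesgue_on \<Omega>)"
    and lim: "AE x in lebesgue_on \<Omega>. (\<lambda>k. f k x) \<longlonglongrightarrow> g x"
  shows "g \<in> borel_measurable (lebesgue_on \<Omega>)"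
proof (rule borel_measurable_lebesgue_on_AE[OF \<Omega>])
  show "(\<lambda>x. lim (\<lambda>k. f k x)) \<in> borel_measurable (lebesgue_on \<Omega>)" by measurable
  show "AE x in lebesgue_on \<Omega>. lim (\<lambda>k. f k x) = g x" using lim by eventually_elim (rule limI)
qed

text \<open>
  The nonlinearity is replaced by zero at the points \<open>x\<close> where it fails to be continuous. Changes on
  null sets preserve measurability because the measure is complete.
\<close>

lemma superposition_measurable_AE:
  fixes f :: "'a::euclidean_space \<Rightarrow> real \<Rightarrow> real"
  assumes \<Omega>: "\<Omega> \<in> sets lebesgue" and f: "\<And>t. (\<lambda>x. f x t) \<in> borel_measurable (lebesgue_on \<Omega>)"
    and c: "AE x in lebesgue_on \<Omega>. continuous_on UNIV (f x)" and u: "u \<in> borel_measurable (lebesgue_on \<Omega>)"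
  shows "(\<lambda>x. f x (u x)) \<in> borel_measurable (lebesgue_on \<Omega>)"
proof -
  define f' where "f' = (\<lambda>x. if continuous_on UNIV (f x) then f x else (\<lambda>t. 0))"
  have ff: "AE x in lebesgue_on \<Omega>. \<forall>t. f x t = f' x t" using c by eventually_elim (simp add: f'_def)
  have f'm: "(\<lambda>x. f' x t) \<in> borel_measurable (lebesgue_on \<Omega>)" for t
    by (rule borel_measurable_lebesgue_on_AE[OF \<Omega> f[of t]]) (use ff in eventually_elim, simp)
  have "(\<lambda>x. f' x (u x)) \<in> borel_measurable (lebesgue_on \<Omega>)"
    by (rule measurable_superposition[OF f'm _ u]) (simp add: f'_def)
  then show ?thesis
    by (rule borel_measurable_lebesgue_on_AE[OF \<Omega>]) (use ff in eventually_elim, simp)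
qed

text \<open>The derivative is the limit of difference quotients, which are superpositions.\<close>

lemma superposition_deriv_measurable:
  fixes f :: "'a::euclidean_space \<Rightarrow> real \<Rightarrow> real"
  assumes \<Omega>: "\<Omega> \<in> sets lebesgue" and f: "\<And>t. (\<lambda>x. f x t) \<in> borel_measurable (lebesgue_on \<Omega>)"
    and d: "AE x in lebesgue_on \<Omega>. \<forall>t. f x field_differentiable at t" and u: "u \<in> borel_measurable (lebesgue_on \<Omega>)"
  shows "(\<lambda>x. deriv (f x) (u x)) \<in> borel_measurable (lebesgue_on \<Omega>)"
proof (rule borel_measurable_lebesgue_on_AE_limit[OF \<Omega>])
  define h where "h = (\<lambda>k::nat. inverse (real (Suc k)))"
  have c: "AE x in lebesgue_on \<Omega>. continuous_on UNIV (f x)"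
    using d by eventually_elim (auto intro!: continuous_at_imp_continuous_on field_differentiable_imp_continuous_at)
  show "(\<lambda>x. (f x (u x + h k) - f x (u x)) / h k) \<in> borel_measurable (lebesgue_on \<Omega>)" for k
    using u by (intro borel_measurable_divide borel_measurable_diff superposition_measurable_AE[OF \<Omega> f c] borel_measurable_add) auto
  show "AE x in lebesgue_on \<Omega>. (\<lambda>k. (f x (u x + h k) - f x (u x)) / h k) \<longlonglongrightarrow> deriv (f x) (u x)"
    using d
  proof eventually_elim
    case (elim x)
    have "DERIV (f x) (u x) :> deriv (f x) (u x)" using elim by (simp add: DERIV_deriv_iff_field_differentiable)
    then have *: "((\<lambda>t. (f x (u x + t) - f x (u x)) / t) \<longlongrightarrow> deriv (f x) (u x)) (at 0)" by (simp add: DERIV_def)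
    have "filterlim h (at 0) sequentially"
      unfolding filterlim_at h_def using LIMSEQ_inverse_real_of_nat by auto
    from filterlim_compose[OF * this] show ?case .
  qed
qed

section \<open>The state equation\<close>

lemma C2_functionD:
  assumes "C2_function f"
  shows "(f has_real_derivative deriv f t) (at t)"
    and "(deriv f has_real_derivative (deriv ^^ 2) f t) (at t)"
  using assms by (auto simp: C2_function_def DERIV_deriv_iff_field_differentiable numeral_2_eq_2)

lemma C2_function_continuous: "C2_function f \<Longrightarrow> continuous_on UNIV f"
  using C2_functionD(1) by (intro continuous_at_imp_continuous_on) (auto intro: DERIV_isCont)

lemma C2_function_mono:
  assumes "C2_function f" "\<And>t. 0 \<le> deriv f t" "t \<le> t'"
  shows "f t \<le> f t'"
  using assms C2_functionD(1)[OF assms(1)] by (intro DERIV_nonneg_imp_nondecreasing[of t t' f]) auto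

text \<open>The mean value inequality, applied to the derivative and then to \<open>f\<close> minus its tangent.\<close>

lemma C2_function_taylor:
  assumes f: "C2_function f" and C: "\<And>t. t \<in> {-m..m} \<Longrightarrow> \<bar>(deriv ^^ 2) f t\<bar> \<le> C" and t: "t \<in> {-m..m}" "t' \<in> {-m..m}"
  shows "\<bar>f t' - f t - deriv f t * (t' - t)\<bar> \<le> C * (t' - t)\<^sup>2"
proof -
  have C0: "0 \<le> C" using C[OF t(1)] by (rule order_trans[OF abs_ge_zero])
  have seg: "\<tau> \<in> {-m..m}" "\<bar>\<tau> - t\<bar> \<le> \<bar>t' - t\<bar>" if "\<tau> \<in> closed_segment t t'" for \<tau>
    using that t by (auto simp: closed_segment_eq_real_ivl split: if_splits)
  have d: "\<bar>deriv f \<tau> - deriv f t\<bar> \<le> C * \<bar>t' - t\<bar>" if "\<tau> \<in> closed_segment t t'" for \<tau>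
  proof -
    have "norm (deriv f \<tau> - deriv f t) \<le> C * norm (\<tau> - t)"
    proof (rule field_differentiable_bound[of "{-m..m}" "deriv f" "(deriv ^^ 2) f"])
      show "(deriv f has_real_derivative (deriv ^^ 2) f x) (at x within {-m..m})" for x
        by (rule has_field_derivative_at_within[OF C2_functionD(2)[OF f]])
      show "norm ((deriv ^^ 2) f x) \<le> C" if "x \<in> {-m..m}" for x using C[OF that] by simp
    qed (use seg(1)[OF \<open>\<tau> \<in> closed_segment t t'\<close>] t in auto)
    also have "\<dots> \<le> C * \<bar>t' - t\<bar>" using seg(2)[OF that] C0 by (intro mult_left_mono) auto
    finally show ?thesis by simp
  qed
  have "norm ((f t' - t' * deriv f t) - (f t - t * deriv f t)) \<le> (C * \<bar>t' - t\<bar>) * norm (t' - t)"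
  proof (rule field_differentiable_bound[of "closed_segment t t'" "\<lambda>\<tau>. f \<tau> - \<tau> * deriv f t" "\<lambda>\<tau>. deriv f \<tau> - deriv f t"])
    show "((\<lambda>\<tau>. f \<tau> - \<tau> * deriv f t) has_field_derivative deriv f \<tau> - deriv f t) (at \<tau> within closed_segment t t')" for \<tau>
    proof (rule has_field_derivative_at_within)
      have "((\<lambda>\<tau>. f \<tau> - \<tau> * deriv f t) has_real_derivative deriv f \<tau> - 1 * deriv f t) (at \<tau>)"
        by (intro DERIV_diff C2_functionD(1)[OF f] DERIV_cmult_right DERIV_ident)
      then show "((\<lambda>\<tau>. f \<tau> - \<tau> * deriv f t) has_real_derivative deriv f \<tau> - deriv f t) (at \<tau>)" by simp
    qed
  qed (use d in auto)
  moreover have "(f t' - t' * deriv f t) - (f t - t * deriv f t) = f t' - f t - deriv f t * (t' - t)"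
    by (simp add: algebra_simps)
  moreover have "(C * \<bar>t' - t\<bar>) * norm (t' - t) = C * (t' - t)\<^sup>2"
    by (simp add: mult.assoc power2_eq_square)
  ultimately show ?thesis by (simp only: real_norm_def)
qed

text \<open>The normalising constant of the form is a parameter, since only its sign matters in the proofs.\<close>

locale state_equation =
  fixes s :: real and \<Omega> :: "(real ^ 'n) set" and a :: "real ^ 'n \<Rightarrow> real \<Rightarrow> real" and Q :: real
  assumes Q_def: "Q = frac_const CARD('n) s / 2" and s: "0 < s" "s < 1/2"
    and \<Omega>: "open \<Omega>" "bounded \<Omega>"
    and a_meas: "\<And>t. (\<lambda>x. a x t) \<in> borel_measurable (lebesgue_on \<Omega>)"
    and a_C2: "AE x in lebesgue_on \<Omega>. C2_function (a x)"
    and a_mono: "AE x in lebesgue_on \<Omega>. \<forall>t. 0 \<le> deriv (a x) t"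
    and a_bd: "\<And>m. 0 < m \<Longrightarrow> \<exists>C>0. AE x in lebesgue_on \<Omega>. \<forall>t\<in>{-m..m}.
      \<bar>a x t\<bar> \<le> C \<and> \<bar>deriv (a x) t\<bar> \<le> C \<and> \<bar>(deriv ^^ 2) (a x) t\<bar> \<le> C"
begin

abbreviation "M \<equiv> lebesgue_on \<Omega>"
abbreviation "X \<equiv> energy_space s (closure \<Omega>)"

lemma Q_pos: "0 < Q" using frac_const_pos[of s "CARD('n)"] s by (simp add: Q_def)

lemma K_bounded: "bounded (closure \<Omega>)" using \<Omega>(2) by (rule bounded_closure)

lemma \<Omega>_sets [simp]: "\<Omega> \<in> sets lebesgue" using \<Omega>(1) by simp

lemma M_finite: "finite_measure M"
  using \<Omega> by (intro finite_measure_lebesgue_on lmeasurable_open)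

lemma integrable_bounded:
  assumes "f \<in> borel_measurable M" "AE x in M. \<bar>f x\<bar> \<le> (C :: real)"
  shows "integrable M f"
  using finite_measure.integrable_const_bound[OF M_finite, of f C] assms by simp

lemma X_measurable: "v \<in> X \<Longrightarrow> v \<in> borel_measurable M"
  by (rule borel_measurable_lebesgue_on[OF energy_spaceD(1)])

lemma X_integrable: "v \<in> X \<Longrightarrow> integrable M v"
  by (rule integrable_lebesgue_on_if_lborel(1)[OF energy_space_integrable[OF _ K_bounded] \<Omega>_sets])

lemma X_integral_le: "v \<in> X \<Longrightarrow> (\<And>x. 0 \<le> v x) \<Longrightarrow> (\<integral>x. v x \<partial>M) \<le> (\<integral>x. v x \<partial>lborel)"
  by (rule integrable_lebesgue_on_if_lborel(2)[OF energy_space_integrable[OF _ K_bounded] \<Omega>_sets])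

lemma a_continuous: "AE x in M. continuous_on UNIV (a x)"
  using a_C2 by eventually_elim (rule C2_function_continuous)

lemma a_nondecreasing: "AE x in M. \<forall>t t'. t \<le> t' \<longrightarrow> a x t \<le> a x t'"
  using a_C2 a_mono by eventually_elim (auto intro: C2_function_mono)

lemma a_superposition: "u \<in> borel_measurable M \<Longrightarrow> (\<lambda>x. a x (u x)) \<in> borel_measurable M"
  by (rule superposition_measurable_AE[OF \<Omega>_sets a_meas a_continuous])

lemma a_deriv_superposition: "u \<in> borel_measurable M \<Longrightarrow> (\<lambda>x. deriv (a x) (u x)) \<in> borel_measurable M"
proof (rule superposition_deriv_measurable[OF \<Omega>_sets a_meas])
  show "AE x in M. \<forall>t. a x field_differentiable at t" using a_C2 by eventually_elim (simp add: C2_function_def)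
qed

lemma integral_mult_cong:
  fixes f g v w :: "real ^ 'n \<Rightarrow> real"
  assumes f: "f \<in> borel_measurable M" and fg: "AE x in M. f x = g x"
    and v: "v \<in> borel_measurable M" and vw: "AE x in M. v x = w x"
  shows "(\<integral>x. f x * v x \<partial>M) = (\<integral>x. g x * w x \<partial>M)"
proof (rule integral_cong_AE)
  have [measurable]: "g \<in> borel_measurable M" "w \<in> borel_measurable M"
    using borel_measurable_lebesgue_on_AE[OF \<Omega>_sets f fg] borel_measurable_lebesgue_on_AE[OF \<Omega>_sets v vw] by auto
  show "(\<lambda>x. f x * v x) \<in> borel_measurable M" using f v by measurable
  show "(\<lambda>x. g x * w x) \<in> borel_measurable M" by measurable
  show "AE x in M. f x * v x = g x * w x" using fg vw by eventually_elim simp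
qed

text \<open>
  The state equation for Borel representatives, tested with Borel functions. Every state has such a
  representative, and conversely every weak state is a state.
\<close>

definition weak_state :: "(real ^ 'n \<Rightarrow> real) \<Rightarrow> (real ^ 'n \<Rightarrow> real) \<Rightarrow> bool" where
  "weak_state z u \<longleftrightarrow> u \<in> X \<and> (\<exists>m>0. AE x in M. \<bar>u x\<bar> \<le> m) \<and>
     (\<forall>v\<in>X. Q * energy_form s u v + (\<integral>x. a x (u x) * v x \<partial>M) = (\<integral>x. z x * v x \<partial>M))"

lemma weak_state_representative:
  assumes st: "is_state s \<Omega> a z u" and z: "z \<in> borel_measurable M"
  obtains u' where "weak_state z u'" "AE x in lborel. u x = u' x"
proof -
  have uH: "u \<in> Hs_tilde s \<Omega>" and uL: "u \<in> Linf_space \<Omega>" using st by (auto simp: is_state_def)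
  obtain u' where u': "u' \<in> X" "AE x in lborel. u x = u' x" using Hs_tilde_representative[OF uH] by blast
  have uu: "AE x in M. u' x = u x" using AE_lebesgue_on_lborel[OF u'(2) \<Omega>_sets] by eventually_elim simp
  obtain C where C: "AE x in M. \<bar>u x\<bar> \<le> C" using uL by (auto simp: Linf_space_def)
  have "AE x in M. \<bar>u' x\<bar> \<le> \<bar>C\<bar> + 1" using C uu by eventually_elim auto
  then have "\<exists>m>0. AE x in M. \<bar>u' x\<bar> \<le> m" by (intro exI[of _ "\<bar>C\<bar> + 1"]) auto
  moreover have "Q * energy_form s u' v + (\<integral>x. a x (u' x) * v x \<partial>M) = (\<integral>x. z x * v x \<partial>M)" if v: "v \<in> X" for v
  proof -
    have "frac_form s u v = Q * energy_form s u' v"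
      using Hs_tilde_measurable[OF uH] Hs_tilde_measurable[OF energy_space_subset_Hs_tilde[OF v]] energy_spaceD(1)[OF u'(1)] energy_spaceD(1)[OF v] u'(2)
      unfolding Q_def by (intro frac_form_representative) auto
    moreover have "(\<integral>x. a x (u' x) * v x \<partial>M) = (\<integral>x. a x (u x) * v x \<partial>M)"
    proof (rule integral_mult_cong[OF a_superposition[OF X_measurable[OF u'(1)]] _ X_measurable[OF v]])
      show "AE x in M. a x (u' x) = a x (u x)" using uu by eventually_elim simp
    qed simp
    ultimately show ?thesis
      using st energy_space_subset_Hs_tilde[OF v] by (auto simp: is_state_def L2_inner_def)
  qed
  ultimately show ?thesis using that[of u'] u' by (auto simp: weak_state_def)
qed

lemma is_state_if_weak_state:
  assumes st: "weak_state z u" and z: "z \<in> borel_measurable M"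
  shows "is_state s \<Omega> a z u"
proof -
  have u: "u \<in> X" and bd: "\<exists>m>0. AE x in M. \<bar>u x\<bar> \<le> m" using st by (auto simp: weak_state_def)
  have uH: "u \<in> Hs_tilde s \<Omega>" by (rule energy_space_subset_Hs_tilde[OF u])
  have "u \<in> Linf_space \<Omega>" using X_measurable[OF u] bd by (auto simp: Linf_space_def)
  moreover have "frac_form s u v + L2_inner \<Omega> (\<lambda>x. a x (u x)) v = L2_inner \<Omega> z v" if v: "v \<in> Hs_tilde s \<Omega>" for v
  proof -
    obtain v' where v': "v' \<in> X" "AE x in lborel. v x = v' x" using Hs_tilde_representative[OF v] by blast
    have vv: "AE x in M. v' x = v x" using AE_lebesgue_on_lborel[OF v'(2) \<Omega>_sets] by eventually_elim simp
    have "frac_form s u v = Q * energy_form s u v'"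
      using Hs_tilde_measurable[OF uH] Hs_tilde_measurable[OF v] energy_spaceD(1)[OF u] energy_spaceD(1)[OF v'(1)] v'(2)
      unfolding Q_def by (intro frac_form_representative) auto
    moreover have "(\<integral>x. a x (u x) * v' x \<partial>M) = (\<integral>x. a x (u x) * v x \<partial>M)"
      by (rule integral_mult_cong[OF a_superposition[OF X_measurable[OF u]] _ X_measurable[OF v'(1)] vv]) simp
    moreover have "(\<integral>x. z x * v' x \<partial>M) = (\<integral>x. z x * v x \<partial>M)"
      by (rule integral_mult_cong[OF z _ X_measurable[OF v'(1)] vv]) simp
    ultimately show ?thesis using st v'(1) by (auto simp: weak_state_def L2_inner_def)
  qed
  ultimately show ?thesis using uH by (simp add: is_state_def)
qed

text \<open>The bound of \<open>energy_sup_bound\<close>, with the normalising constant and the integral over \<open>\<Omega>\<close>.\<close>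

lemma sup_bound:
  obtains c where "0 < c"
    "\<And>w T. \<lbrakk>w \<in> X; 0 < T; \<And>v. \<lbrakk>v \<in> X; \<And>x. 0 \<le> v x; \<And>x. 0 < v x \<Longrightarrow> 0 < w x\<rbrakk> \<Longrightarrow> Q * energy_form s w v \<le> T * (\<integral>x. v x \<partial>M)\<rbrakk>
      \<Longrightarrow> AE x in lborel. w x \<le> T * c"
proof -
  obtain c where c: "0 < c" "\<And>u C. \<lbrakk>u \<in> X; 0 < C;
       \<And>v. \<lbrakk>v \<in> X; \<And>x. 0 \<le> v x; \<And>x. 0 < v x \<Longrightarrow> 0 < u x\<rbrakk> \<Longrightarrow>
          energy_form s u v \<le> C * (\<integral>x. v x \<partial>lborel)\<rbrakk> \<Longrightarrow> AE x in lborel. u x \<le> C * c"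
    by (rule energy_sup_bound[OF s(1) K_bounded]) (rule that, assumption, blast)
  show ?thesis
  proof (rule that[of "c / Q"])
    show "0 < c / Q" using c Q_pos by (intro divide_pos_pos)
    fix w T assume w: "w \<in> X" and T: "0 < T"
      and H: "\<And>v. \<lbrakk>v \<in> X; \<And>x. 0 \<le> v x; \<And>x. 0 < v x \<Longrightarrow> 0 < w x\<rbrakk> \<Longrightarrow> Q * energy_form s w v \<le> T * (\<integral>x. v x \<partial>M)"
    have "AE x in lborel. w x \<le> T / Q * c"
    proof (rule c(2)[OF w])
      show "0 < T / Q" using T Q_pos by (intro divide_pos_pos)
      fix v assume v: "v \<in> X" "\<And>x. 0 \<le> v x" "\<And>x. 0 < v x \<Longrightarrow> 0 < w x"
      have "Q * energy_form s w v \<le> T * (\<integral>x. v x \<partial>M)" by (rule H[OF v])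
      also have "\<dots> \<le> T * (\<integral>x. v x \<partial>lborel)" using X_integral_le[OF v(1,2)] T by (intro mult_left_mono) auto
      finally show "energy_form s w v \<le> T / Q * (\<integral>x. v x \<partial>lborel)" using Q_pos by (simp add: pos_le_divide_eq mult.commute)
    qed
    then show "AE x in lborel. w x \<le> T * (c / Q)" by simp
  qed
qed

text \<open>
  Where \<open>u1 > u2\<close>, the monotone term \<open>a x (u1 x) - a x (u2 x)\<close> is nonnegative and may be dropped. So the
  difference of two states satisfies a differential inequality with right-hand side \<open>T\<close>, on the set that
  \<open>sup_bound\<close> asks for.
\<close>

lemma weak_state_stability:
  obtains c where "0 < c"
    "\<And>z1 z2 u1 u2 T B. \<lbrakk>weak_state z1 u1; weak_state z2 u2; z1 \<in> borel_measurable M; z2 \<in> borel_measurable M;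
       AE x in M. \<bar>z1 x\<bar> \<le> B; AE x in M. \<bar>z2 x\<bar> \<le> B; 0 < T; AE x in M. \<bar>z1 x - z2 x\<bar> \<le> T\<rbrakk>
      \<Longrightarrow> AE x in lborel. \<bar>u1 x - u2 x\<bar> \<le> T * c"
proof -
  obtain c where c: "0 < c"
    "\<And>w T. \<lbrakk>w \<in> X; 0 < T; \<And>v. \<lbrakk>v \<in> X; \<And>x. 0 \<le> v x; \<And>x. 0 < v x \<Longrightarrow> 0 < w x\<rbrakk> \<Longrightarrow> Q * energy_form s w v \<le> T * (\<integral>x. v x \<partial>M)\<rbrakk>
      \<Longrightarrow> AE x in lborel. w x \<le> T * c"
    by (rule sup_bound) (rule that, assumption, blast)
  have one: "AE x in lborel. u1 x - u2 x \<le> T * c"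
    if st: "weak_state z1 u1" "weak_state z2 u2" and zm: "z1 \<in> borel_measurable M" "z2 \<in> borel_measurable M"
      and zb: "AE x in M. \<bar>z1 x\<bar> \<le> B" "AE x in M. \<bar>z2 x\<bar> \<le> B" and T: "0 < T" and zT: "AE x in M. \<bar>z1 x - z2 x\<bar> \<le> T"
    for z1 z2 u1 u2 T B
  proof (rule c(2))
    have u: "u1 \<in> X" "u2 \<in> X" using st by (auto simp: weak_state_def)
    show "(\<lambda>x. u1 x - u2 x) \<in> X" by (rule energy_space_diff[OF u])
    fix v assume v: "v \<in> X" "\<And>x. 0 \<le> v x" "\<And>x. 0 < v x \<Longrightarrow> 0 < u1 x - u2 x"
    have ai: "integrable M (\<lambda>x. a x (u x) * v x)" if "weak_state z u" for z u
    proof -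
      have "\<exists>m>0. AE x in M. \<bar>u x\<bar> \<le> m" using that by (simp add: weak_state_def)
      then obtain m where m: "0 < m" "AE x in M. \<bar>u x\<bar> \<le> m" by (elim exE conjE)
      obtain C where "0 < C" and C: "AE x in M. \<forall>t\<in>{-m..m}. \<bar>a x t\<bar> \<le> C \<and> \<bar>deriv (a x) t\<bar> \<le> C \<and> \<bar>(deriv ^^ 2) (a x) t\<bar> \<le> C"
        using a_bd[OF m(1)] by blast
      have "AE x in M. \<bar>a x (u x)\<bar> \<le> C" using C m(2) by eventually_elim (auto simp: abs_le_iff)
      moreover have "u \<in> X" using that by (simp add: weak_state_def)
      ultimately show ?thesis
        by (intro integrable_bounded_mult[OF a_superposition[OF X_measurable] X_integrable[OF v(1)]])
    qed
    have zi: "integrable M (\<lambda>x. z1 x * v x)" "integrable M (\<lambda>x. z2 x * v x)"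
      by (rule integrable_bounded_mult[OF zm(1) X_integrable[OF v(1)] zb(1)],
          rule integrable_bounded_mult[OF zm(2) X_integrable[OF v(1)] zb(2)])
    have "Q * energy_form s u1 v + (\<integral>x. a x (u1 x) * v x \<partial>M) = (\<integral>x. z1 x * v x \<partial>M)"
      "Q * energy_form s u2 v + (\<integral>x. a x (u2 x) * v x \<partial>M) = (\<integral>x. z2 x * v x \<partial>M)"
      using st v(1) unfolding weak_state_def by blast+
    note eqs = this
    have "Q * energy_form s (\<lambda>x. u1 x - u2 x) v = Q * energy_form s u1 v - Q * energy_form s u2 v"
      unfolding energy_form_diff[OF u v(1)] by (simp add: right_diff_distrib)
    also have "\<dots> = ((\<integral>x. z1 x * v x \<partial>M) - (\<integral>x. a x (u1 x) * v x \<partial>M)) - ((\<integral>x. z2 x * v x \<partial>M) - (\<integral>x. a x (u2 x) * v x \<partial>M))"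
      using eqs by linarith
    also have "\<dots> = (\<integral>x. (z1 x * v x - a x (u1 x) * v x) - (z2 x * v x - a x (u2 x) * v x) \<partial>M)"
      using zi ai[OF st(1)] ai[OF st(2)] by simp
    also have "\<dots> \<le> (\<integral>x. T * v x \<partial>M)"
    proof (rule integral_mono_AE)
      show "integrable M (\<lambda>x. (z1 x * v x - a x (u1 x) * v x) - (z2 x * v x - a x (u2 x) * v x))"
        using zi ai[OF st(1)] ai[OF st(2)] by simp
      show "integrable M (\<lambda>x. T * v x)" using X_integrable[OF v(1)] by simp
      show "AE x in M. (z1 x * v x - a x (u1 x) * v x) - (z2 x * v x - a x (u2 x) * v x) \<le> T * v x"
        using zT a_nondecreasing
      proof eventually_elim
        case (elim x)
        show ?case
        proof (cases "v x = 0")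
          case False
          then have "0 < v x" using v(2)[of x] by simp
          then have "u2 x \<le> u1 x" using v(3)[of x] by simp
          then have "a x (u2 x) \<le> a x (u1 x)" using elim(2) by blast
          then have "(z1 x - a x (u1 x)) - (z2 x - a x (u2 x)) \<le> T" using elim(1) by (simp add: abs_le_iff)
          from mult_right_mono[OF this v(2)[of x]] show ?thesis by (simp add: algebra_simps)
        qed simp
      qed
    qed
    finally show "Q * energy_form s (\<lambda>x. u1 x - u2 x) v \<le> T * (\<integral>x. v x \<partial>M)" by simp
  qed (use T in simp)
  show ?thesis
  proof (rule that[OF c(1)])
    fix z1 z2 u1 u2 T B
    assume st: "weak_state z1 u1" "weak_state z2 u2" and zm: "z1 \<in> borel_measurable M" "z2 \<in> borel_measurable M"
      and zb: "AE x in M. \<bar>z1 x\<bar> \<le> B" "AE x in M. \<bar>z2 x\<bar> \<le> B" and T: "0 < T" and zT: "AE x in M. \<bar>z1 x - z2 x\<bar> \<le> T"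
    have zT': "AE x in M. \<bar>z2 x - z1 x\<bar> \<le> T" using zT by eventually_elim simp
    show "AE x in lborel. \<bar>u1 x - u2 x\<bar> \<le> T * c"
      using one[OF st zm zb T zT] one[OF st(2,1) zm(2,1) zb(2,1) T zT'] by eventually_elim (simp add: abs_le_iff)
  qed
qed

text \<open>
  The nonlinearity is truncated by applying it to the projection of \<open>u\<close> onto \<open>[- m, m]\<close>. On the set
  where \<open>u > 0\<close> monotonicity gives \<open>a x (cl (u x)) \<ge> a x 0\<close>, so the supremum bound for the truncated
  solution only involves \<open>a x 0\<close> and the control. Hence the level \<open>m\<close> can be fixed in advance so that the
  truncation is inactive.
\<close>

lemma weak_state_exists:
  assumes z: "z \<in> borel_measurable M" and Z: "AE x in M. \<bar>z x\<bar> \<le> Z"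
  obtains u where "weak_state z u"
proof -
  obtain c where c: "0 < c"
    "\<And>w T. \<lbrakk>w \<in> X; 0 < T; \<And>v. \<lbrakk>v \<in> X; \<And>x. 0 \<le> v x; \<And>x. 0 < v x \<Longrightarrow> 0 < w x\<rbrakk> \<Longrightarrow> Q * energy_form s w v \<le> T * (\<integral>x. v x \<partial>M)\<rbrakk>
      \<Longrightarrow> AE x in lborel. w x \<le> T * c"
    by (rule sup_bound) (rule that, assumption, blast)
  obtain C0 where C0: "0 < C0" "AE x in M. \<forall>t\<in>{-1..1}. \<bar>a x t\<bar> \<le> C0 \<and> \<bar>deriv (a x) t\<bar> \<le> C0 \<and> \<bar>(deriv ^^ 2) (a x) t\<bar> \<le> C0"
    using a_bd[of 1] by auto
  define T where "T = C0 + \<bar>Z\<bar>"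
  have T: "0 < T" using C0 by (simp add: T_def)
  define m where "m = T * c"
  have m: "0 < m" using T c by (simp add: m_def)
  obtain C where C: "0 < C" "AE x in M. \<forall>t\<in>{-m..m}. \<bar>a x t\<bar> \<le> C \<and> \<bar>deriv (a x) t\<bar> \<le> C \<and> \<bar>(deriv ^^ 2) (a x) t\<bar> \<le> C"
    using a_bd[OF m] by blast
  define cl where "cl = (\<lambda>t. max (- m) (min m t))"
  have cl: "cl t \<in> {-m..m}" "\<bar>cl t - cl t'\<bar> \<le> \<bar>t - t'\<bar>" "t \<le> t' \<Longrightarrow> cl t \<le> cl t'" for t t'
    using m by (auto simp: cl_def max_def min_def)
  \<comment> \<open>The properties of \<open>a x\<close> hold for almost every \<open>x\<close>; redefining the source by zero elsewhere
     makes them hold everywhere.\<close>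
  define good where "good = (\<lambda>x. \<bar>z x\<bar> \<le> \<bar>Z\<bar> \<and> \<bar>a x 0\<bar> \<le> C0 \<and> (\<forall>t t'. t \<le> t' \<longrightarrow> a x t \<le> a x t') \<and>
     (\<forall>t\<in>{-m..m}. \<bar>a x t\<bar> \<le> C) \<and> (\<forall>t\<in>{-m..m}. \<forall>t'\<in>{-m..m}. \<bar>a x t - a x t'\<bar> \<le> C * \<bar>t - t'\<bar>))"
  have good: "AE x in M. good x"
    using Z C0(2) a_nondecreasing C(2) a_C2
  proof eventually_elim
    case (elim x)
    have "\<bar>a x t - a x t'\<bar> \<le> C * \<bar>t - t'\<bar>" if "t \<in> {-m..m}" "t' \<in> {-m..m}" for t t'
      using C2_functionD(1)[OF elim(5)] elim(4) that
        field_differentiable_bound[of "{-m..m}" "a x" "deriv (a x)" C t t'] by (auto intro: has_field_derivative_at_within)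
    then show ?case using elim unfolding good_def by force
  qed
  define f where "f = (\<lambda>x t. if good x then a x (cl t) - z x else 0)"
  have fa: "AE x in M. \<forall>t. f x t = a x (cl t) - z x" using good by eventually_elim (simp add: f_def)
  obtain u where u: "u \<in> X" "\<And>v. v \<in> X \<Longrightarrow> Q * energy_form s u v + (\<integral>x. f x (u x) * v x \<partial>M) = 0"
  proof (rule semilinear_solution_exists[OF s(1) K_bounded Q_pos \<Omega>_sets, of f])
    fix t
    have "(\<lambda>x. a x (cl t) - z x) \<in> borel_measurable M" using a_meas z by (intro borel_measurable_diff)
    then show "(\<lambda>x. f x t) \<in> borel_measurable M"
      by (rule borel_measurable_lebesgue_on_AE[OF \<Omega>_sets]) (use fa in eventually_elim, simp)
  next
    show "f x t \<le> f x t'" if "t \<le> t'" for x t t'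
      using cl(3)[OF that] by (auto simp: f_def good_def)
    show "\<bar>f x t - f x t'\<bar> \<le> C * \<bar>t - t'\<bar>" for x t t'
    proof (cases "good x")
      case True
      then have "\<bar>a x (cl t) - a x (cl t')\<bar> \<le> C * \<bar>cl t - cl t'\<bar>" using cl(1) unfolding good_def by blast
      also have "\<dots> \<le> C * \<bar>t - t'\<bar>" using cl(2) C by (intro mult_left_mono) auto
      finally show ?thesis using True by (simp add: f_def)
    qed (use C in \<open>simp add: f_def\<close>)
    show "\<bar>f x t\<bar> \<le> C + \<bar>Z\<bar>" for x t
    proof (cases "good x")
      case True
      then have "\<bar>a x (cl t)\<bar> \<le> C" "\<bar>z x\<bar> \<le> \<bar>Z\<bar>" using cl(1)[of t] unfolding good_def by blast+
      then show ?thesis using True unfolding f_def by (simp add: abs_le_iff)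
    qed (use C in \<open>simp add: f_def\<close>)
  qed (rule that, assumption, blast)
  have fm: "(\<lambda>x. f x (u x)) \<in> borel_measurable M"
  proof (rule borel_measurable_lebesgue_on_AE[OF \<Omega>_sets])
    have [measurable]: "u \<in> borel_measurable M" by (rule X_measurable[OF u(1)])
    have "(\<lambda>x. cl (u x)) \<in> borel_measurable M" unfolding cl_def by measurable
    then show "(\<lambda>x. a x (cl (u x)) - z x) \<in> borel_measurable M"
      using z by (intro borel_measurable_diff a_superposition)
    show "AE x in M. a x (cl (u x)) - z x = f x (u x)" using fa by eventually_elim simp
  qed
  have fb: "AE x in M. \<bar>f x (u x)\<bar> \<le> C + \<bar>Z\<bar>"
    using good
  proof eventually_elim
    case (elim x)
    then have "\<bar>a x (cl (u x))\<bar> \<le> C" "\<bar>z x\<bar> \<le> \<bar>Z\<bar>" using cl(1)[of "u x"] unfolding good_def by blast+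
    then show ?case using elim unfolding f_def by (simp add: abs_le_iff)
  qed
  have fi: "integrable M (\<lambda>x. f x (u x) * v x)" if "v \<in> X" for v
    by (rule integrable_bounded_mult[OF fm X_integrable[OF that] fb])
  have cl0: "0 < t \<Longrightarrow> 0 \<le> cl t" "t < 0 \<Longrightarrow> cl t \<le> 0" for t using m by (auto simp: cl_def)
  have up: "AE x in lborel. u x \<le> m"
    unfolding m_def
  proof (rule c(2)[OF u(1) T])
    fix v assume v: "v \<in> X" "\<And>x. 0 \<le> v x" "\<And>x. 0 < v x \<Longrightarrow> 0 < u x"
    have "Q * energy_form s u v = (\<integral>x. - (f x (u x) * v x) \<partial>M)" using u(2)[OF v(1)] by simp
    also have "\<dots> \<le> (\<integral>x. T * v x \<partial>M)"
    proof (rule integral_mono_AE)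
      show "AE x in M. - (f x (u x) * v x) \<le> T * v x"
        using good
      proof eventually_elim
        case (elim x)
        show ?case
        proof (cases "v x = 0")
          case False
          then have "0 < u x" using v(2)[of x] v(3)[of x] by simp
          then have "a x 0 \<le> a x (cl (u x))" using cl0(1) elim unfolding good_def by blast
          moreover have "\<bar>a x 0\<bar> \<le> C0" "\<bar>z x\<bar> \<le> \<bar>Z\<bar>" using elim unfolding good_def by auto
          ultimately have "- f x (u x) \<le> T" using elim unfolding f_def T_def by simp
          from mult_right_mono[OF this v(2)[of x]] show ?thesis by simp
        qed simp
      qed
    qed (use fi[OF v(1)] X_integrable[OF v(1)] in auto)
    finally show "Q * energy_form s u v \<le> T * (\<integral>x. v x \<partial>M)" by simp
  qed
  have down: "AE x in lborel. (-1) * u x \<le> m"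
    unfolding m_def
  proof (rule c(2)[OF energy_space_scale[OF u(1), of "-1"] T])
    fix v assume v: "v \<in> X" "\<And>x. 0 \<le> v x" "\<And>x. 0 < v x \<Longrightarrow> 0 < (-1) * u x"
    have "Q * energy_form s (\<lambda>x. (-1) * u x) v = (\<integral>x. f x (u x) * v x \<partial>M)"
      using u(2)[OF v(1)] unfolding energy_form_scale by simp
    also have "\<dots> \<le> (\<integral>x. T * v x \<partial>M)"
    proof (rule integral_mono_AE)
      show "AE x in M. f x (u x) * v x \<le> T * v x"
        using good
      proof eventually_elim
        case (elim x)
        show ?case
        proof (cases "v x = 0")
          case False
          then have "u x < 0" using v(2)[of x] v(3)[of x] by simp
          then have "a x (cl (u x)) \<le> a x 0" using cl0(2) elim unfolding good_def by blast
          moreover have "\<bar>a x 0\<bar> \<le> C0" "\<bar>z x\<bar> \<le> \<bar>Z\<bar>" using elim unfolding good_def by auto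
          ultimately have "f x (u x) \<le> T" using elim unfolding f_def T_def by simp
          from mult_right_mono[OF this v(2)[of x]] show ?thesis by simp
        qed simp
      qed
    qed (use fi[OF v(1)] X_integrable[OF v(1)] in auto)
    finally show "Q * energy_form s (\<lambda>x. (-1) * u x) v \<le> T * (\<integral>x. v x \<partial>M)" by simp
  qed
  have ub: "AE x in lborel. \<bar>u x\<bar> \<le> m" using up down by eventually_elim (simp add: abs_le_iff)
  have ubM: "AE x in M. \<bar>u x\<bar> \<le> m" by (rule AE_lebesgue_on_lborel[OF ub \<Omega>_sets])
  have eq: "AE x in M. f x (u x) = a x (u x) - z x"
    using ubM fa by eventually_elim (auto simp: cl_def abs_le_iff min_def max_def)
  have "Q * energy_form s u v + (\<integral>x. a x (u x) * v x \<partial>M) = (\<integral>x. z x * v x \<partial>M)" if v: "v \<in> X" for v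
  proof -
    have "AE x in M. \<bar>a x (u x)\<bar> \<le> C" using C(2) ubM by eventually_elim (auto simp: abs_le_iff)
    then have ai: "integrable M (\<lambda>x. a x (u x) * v x)"
      by (rule integrable_bounded_mult[OF a_superposition[OF X_measurable[OF u(1)]] X_integrable[OF v]])
    have zi: "integrable M (\<lambda>x. z x * v x)" by (rule integrable_bounded_mult[OF z X_integrable[OF v] Z])
    have "(\<integral>x. f x (u x) * v x \<partial>M) = (\<integral>x. (a x (u x) - z x) * v x \<partial>M)"
      by (rule integral_mult_cong[OF fm eq X_measurable[OF v]]) simp
    also have "\<dots> = (\<integral>x. a x (u x) * v x \<partial>M) - (\<integral>x. z x * v x \<partial>M)"
      using ai zi by (simp add: left_diff_distrib)
    finally show ?thesis using u(2)[OF v] by linarith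
  qed
  then have "weak_state z u" using u(1) m ubM by (auto simp: weak_state_def)
  then show ?thesis by (rule that)
qed

lemma holder_if_bounded_source:
  assumes ext: "exterior_ball_condition \<Omega>" and u: "u \<in> X" and f: "AE x in M. \<bar>f x\<bar> \<le> C"
    and eq: "\<And>v. v \<in> X \<Longrightarrow> Q * energy_form s u v = (\<integral>x. f x * v x \<partial>M)"
  shows "\<exists>g\<in>holder_space s UNIV. AE x in lborel. u x = g x"
proof (rule bounded_rhs_holder_regularity[OF s \<Omega> ext u])
  show "0 < (\<bar>C\<bar> + 1) / Q" using Q_pos by (intro divide_pos_pos) auto
  fix v assume v: "v \<in> X" "\<And>x. 0 \<le> v x"
  have pos: "0 \<le> (\<integral>x. v x \<partial>M)" using v(2) by simp
  have "\<bar>\<integral>x. f x * v x \<partial>M\<bar> \<le> (\<bar>C\<bar> + 1) * (\<integral>x. v x \<partial>M)"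
  proof (cases "integrable M (\<lambda>x. f x * v x)")
    case True
    have "\<bar>\<integral>x. f x * v x \<partial>M\<bar> \<le> (\<integral>x. \<bar>f x * v x\<bar> \<partial>M)" by simp
    also have "\<dots> \<le> (\<integral>x. (\<bar>C\<bar> + 1) * v x \<partial>M)"
    proof (rule integral_mono_AE)
      show "AE x in M. \<bar>f x * v x\<bar> \<le> (\<bar>C\<bar> + 1) * v x"
        using f
      proof eventually_elim
        case (elim x)
        then have "\<bar>f x\<bar> * v x \<le> (\<bar>C\<bar> + 1) * v x" using v(2)[of x] by (intro mult_right_mono) auto
        then show ?case using v(2)[of x] by (simp add: abs_mult)
      qed
    qed (use True X_integrable[OF v(1)] in auto)
    finally show ?thesis by simp
  next
    case False
    \<comment> \<open>The integral of a nonintegrable function is \<open>0\<close> by convention.\<close>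
    then have "(\<integral>x. f x * v x \<partial>M) = 0" by (rule not_integrable_integral_eq)
    then show ?thesis using pos by simp
  qed
  also have "\<dots> \<le> (\<bar>C\<bar> + 1) * (\<integral>x. v x \<partial>lborel)" using X_integral_le[OF v] by (intro mult_left_mono) auto
  finally have "Q * \<bar>energy_form s u v\<bar> \<le> (\<bar>C\<bar> + 1) * (\<integral>x. v x \<partial>lborel)"
    unfolding eq[OF v(1), symmetric] using Q_pos by (simp add: abs_mult)
  then show "\<bar>energy_form s u v\<bar> \<le> (\<bar>C\<bar> + 1) / Q * (\<integral>x. v x \<partial>lborel)"
    using Q_pos by (simp add: pos_le_divide_eq mult.commute)
qed

text \<open>
  The cost is expanded along \<open>z + t * g\<close> with \<open>g = \<zeta> - z\<close>. Stability makes the difference \<open>d\<close> of the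
  states \<open>O(t)\<close>, so replacing the increments of \<open>a\<close> and \<open>L\<close> by their linearisations costs \<open>O(t\<^sup>2)\<close>. The
  linear term \<open>\<integral> deriv (L x) (u x) * d\<close> is eliminated by testing the adjoint equation with \<open>d\<close> and the
  difference of the state equations with \<open>p\<close>. What remains is \<open>t * J' + t\<^sup>2 * W\<close>, which is
  nonnegative for small \<open>t > 0\<close>; hence \<open>J' \<ge> 0\<close>.
\<close>

lemma first_order_condition:
  assumes L_meas: "\<And>t. (\<lambda>x. L x t) \<in> borel_measurable M" and L_C2: "AE x in M. C2_function (L x)"
    and L0: "integrable M (\<lambda>x. L x 0)"
    and L_bd: "\<And>m. 0 < m \<Longrightarrow> \<exists>C>0. AE x in M. \<forall>t\<in>{-m..m}. \<bar>deriv (L x) t\<bar> \<le> C"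
    and L_bd2: "\<And>m. 0 < m \<Longrightarrow> \<exists>\<phi>. integrable M \<phi> \<and> (AE x in M. \<forall>t\<in>{-m..m}. \<bar>(deriv ^^ 2) (L x) t\<bar> \<le> \<phi> x)"
    and loc: "locally_optimal_control s \<Omega> a L \<alpha> lo hi z"
    and st: "weak_state z u"
    and p: "p \<in> X" "AE x in M. \<bar>p x\<bar> \<le> P"
    and adj: "\<And>v. v \<in> X \<Longrightarrow> Q * energy_form s v p + (\<integral>x. deriv (a x) (u x) * p x * v x \<partial>M) = (\<integral>x. deriv (L x) (u x) * v x \<partial>M)"
    and \<zeta>: "\<zeta> \<in> borel_measurable M" "\<And>x. lo \<le> \<zeta> x" "\<And>x. \<zeta> x \<le> hi"
  shows "0 \<le> (\<integral>x. (p x + \<alpha> * z x) * (\<zeta> x - z x) \<partial>M)"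
proof -
  have zm [measurable]: "z \<in> borel_measurable M" and zlh: "AE x in M. lo \<le> z x \<and> z x \<le> hi"
    using loc by (auto simp: locally_optimal_control_def Z_ad_def Lp_space_def)
  note [measurable] = \<zeta>(1)
  define B where "B = \<bar>lo\<bar> + \<bar>hi\<bar> + 1"
  have B: "0 < B" by (simp add: B_def)
  define g where "g = (\<lambda>x. \<zeta> x - z x)"
  have gm [measurable]: "g \<in> borel_measurable M" unfolding g_def by measurable
  have gB: "AE x in M. \<bar>g x\<bar> \<le> B"
    using zlh
  proof eventually_elim
    case (elim x)
    then show ?case using \<zeta>(2)[of x] \<zeta>(3)[of x] by (auto simp: g_def B_def abs_le_iff)
  qed
  have zB: "AE x in M. \<bar>z x\<bar> \<le> B" using zlh by eventually_elim (auto simp: B_def)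
  define zt where "zt = (\<lambda>t x. z x + t * g x)"
  have ztm [measurable]: "zt t \<in> borel_measurable M" for t unfolding zt_def by measurable
  have ztlh: "AE x in M. lo \<le> zt t x \<and> zt t x \<le> hi" if "0 \<le> t" "t \<le> 1" for t
    using zlh
  proof eventually_elim
    case (elim x)
    have e: "zt t x = (1 - t) * z x + t * \<zeta> x" by (simp add: zt_def g_def algebra_simps)
    have "(1 - t) * lo + t * lo \<le> (1 - t) * z x + t * \<zeta> x" "(1 - t) * z x + t * \<zeta> x \<le> (1 - t) * hi + t * hi"
      using elim that \<zeta>(2)[of x] \<zeta>(3)[of x] by (intro add_mono mult_left_mono; simp)+
    then show ?case unfolding e by (simp add: algebra_simps)
  qed
  have ztB: "AE x in M. \<bar>zt t x\<bar> \<le> B" if "0 \<le> t" "t \<le> 1" for t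
    using ztlh[OF that] by eventually_elim (auto simp: B_def)
  have ztZ: "zt t \<in> Z_ad lo hi \<Omega>" if t: "0 \<le> t" "t \<le> 1" for t
  proof -
    have "integrable M (\<lambda>x. \<bar>zt t x\<bar> powr 2)"
    proof (rule integrable_bounded)
      show "AE x in M. \<bar>\<bar>zt t x\<bar> powr 2\<bar> \<le> B\<^sup>2"
        using ztB[OF t] by eventually_elim (simp add: power2_le_iff_abs_le B less_imp_le)
    qed measurable
    then show ?thesis using ztlh[OF t] by (simp add: Z_ad_def Lp_space_def)
  qed
  define u0 where "u0 = control_to_state s \<Omega> a z"
  define ut where "ut = (\<lambda>t. control_to_state s \<Omega> a (zt t))"
  have "is_state s \<Omega> a z u0"
    unfolding u0_def control_to_state_def by (rule someI[of "is_state s \<Omega> a z" u, OF is_state_if_weak_state[OF st zm]])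
  then obtain u0' where u0': "weak_state z u0'" "AE x in lborel. u0 x = u0' x"
    by (rule weak_state_representative[OF _ zm])
  have "\<exists>u'. weak_state (zt t) u' \<and> (AE x in lborel. ut t x = u' x)" if t: "0 \<le> t" "t \<le> 1" for t
  proof -
    obtain w where "weak_state (zt t) w" by (rule weak_state_exists[OF ztm ztB[OF t]])
    then have "is_state s \<Omega> a (zt t) w" by (rule is_state_if_weak_state) simp
    then have "is_state s \<Omega> a (zt t) (ut t)"
      unfolding ut_def control_to_state_def by (rule someI[of "is_state s \<Omega> a (zt t)" w])
    then show ?thesis by (rule weak_state_representative[OF _ ztm]) blast
  qed
  then obtain U where U: "\<And>t. 0 \<le> t \<Longrightarrow> t \<le> 1 \<Longrightarrow> weak_state (zt t) (U t)"
    "\<And>t. 0 \<le> t \<Longrightarrow> t \<le> 1 \<Longrightarrow> AE x in lborel. ut t x = U t x" by metis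
  obtain c where c: "0 < c"
    "\<And>z1 z2 u1 u2 T B. \<lbrakk>weak_state z1 u1; weak_state z2 u2; z1 \<in> borel_measurable M; z2 \<in> borel_measurable M;
       AE x in M. \<bar>z1 x\<bar> \<le> B; AE x in M. \<bar>z2 x\<bar> \<le> B; 0 < T; AE x in M. \<bar>z1 x - z2 x\<bar> \<le> T\<rbrakk>
      \<Longrightarrow> AE x in lborel. \<bar>u1 x - u2 x\<bar> \<le> T * c"
    by (rule weak_state_stability) (rule that, assumption, blast)
  have uX: "u \<in> X" and ueq: "\<And>v. v \<in> X \<Longrightarrow> Q * energy_form s u v + (\<integral>x. a x (u x) * v x \<partial>M) = (\<integral>x. z x * v x \<partial>M)"
    using st by (auto simp: weak_state_def)
  have um [measurable]: "u \<in> borel_measurable M" by (rule X_measurable[OF uX])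
  have u0u: "AE x in M. u0 x = u x"
  proof -
    have "AE x in lborel. \<forall>k. \<bar>u0' x - u x\<bar> \<le> inverse (real (Suc k)) * c"
      unfolding AE_all_countable using c(2)[OF u0'(1) st zm zm zB zB] by auto
    with u0'(2) have "AE x in lborel. u0 x = u x"
    proof eventually_elim
      case (elim x)
      have "(\<lambda>k. inverse (real (Suc k)) * c) \<longlonglongrightarrow> 0 * c"
        by (intro tendsto_mult tendsto_const LIMSEQ_inverse_real_of_nat)
      then have "\<bar>u0' x - u x\<bar> \<le> 0 * c"
        using elim(2) by (intro LIMSEQ_le_const[where X = "\<lambda>k. inverse (real (Suc k)) * c"]) auto
      then show ?case using elim(1) by simp
    qed
    then show ?thesis by (rule AE_lebesgue_on_lborel) simp
  qed
  obtain m0 where m0: "0 < m0" "AE x in M. \<bar>u x\<bar> \<le> m0" using st unfolding weak_state_def by blast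
  define m where "m = m0 + B * c"
  have m: "0 < m" "m0 \<le> m" using m0(1) mult_pos_pos[OF B c(1)] by (auto simp: m_def)
  have delta: "AE x in M. \<bar>U t x - u x\<bar> \<le> t * (B * c)" if t: "0 < t" "t \<le> 1" for t
  proof -
    have "AE x in M. \<bar>zt t x - z x\<bar> \<le> t * B"
      using gB by eventually_elim (use t in \<open>simp add: zt_def abs_mult\<close>)
    then have "AE x in lborel. \<bar>U t x - u x\<bar> \<le> t * B * c"
      using t B by (intro c(2)[OF U(1) st ztm zm ztB zB]) auto
    then show ?thesis by (intro AE_lebesgue_on_lborel) (simp_all add: mult.assoc)
  qed
  obtain Ca where Ca: "0 < Ca" "AE x in M. \<forall>t\<in>{-m..m}. \<bar>a x t\<bar> \<le> Ca \<and> \<bar>deriv (a x) t\<bar> \<le> Ca \<and> \<bar>(deriv ^^ 2) (a x) t\<bar> \<le> Ca"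
    using a_bd[OF m(1)] by blast
  obtain CL where CL: "0 < CL" "AE x in M. \<forall>t\<in>{-m..m}. \<bar>deriv (L x) t\<bar> \<le> CL" using L_bd[OF m(1)] by blast
  obtain \<phi> where \<phi>: "integrable M \<phi>" "AE x in M. \<forall>t\<in>{-m..m}. \<bar>(deriv ^^ 2) (L x) t\<bar> \<le> \<phi> x" using L_bd2[OF m(1)] by blast
  have L_cont: "AE x in M. continuous_on UNIV (L x)" using L_C2 by eventually_elim (rule C2_function_continuous)
  have Lm: "(\<lambda>x. L x (w x)) \<in> borel_measurable M" if "w \<in> borel_measurable M" for w
    by (rule superposition_measurable_AE[OF \<Omega>_sets L_meas L_cont that])
  have Ldm: "(\<lambda>x. deriv (L x) (u x)) \<in> borel_measurable M"
  proof (rule superposition_deriv_measurable[OF \<Omega>_sets L_meas _ um])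
    show "AE x in M. \<forall>t. L x field_differentiable at t" using L_C2 by eventually_elim (simp add: C2_function_def)
  qed
  have LDb: "AE x in M. \<bar>deriv (L x) (u x)\<bar> \<le> CL"
    using CL(2) m0(2) by eventually_elim (use m in \<open>auto simp: abs_le_iff\<close>)
  have adm: "(\<lambda>x. deriv (a x) (u x)) \<in> borel_measurable M" by (rule a_deriv_superposition[OF um])
  have adb: "AE x in M. \<bar>deriv (a x) (u x)\<bar> \<le> Ca"
    using Ca(2) m0(2) by eventually_elim (use m in \<open>auto simp: abs_le_iff\<close>)
  have aub: "AE x in M. \<bar>a x (u x)\<bar> \<le> Ca"
    using Ca(2) m0(2) by eventually_elim (use m in \<open>auto simp: abs_le_iff\<close>)
  have pm [measurable]: "p \<in> borel_measurable M" by (rule X_measurable[OF p(1)])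
  have pi: "integrable M p" by (rule X_integrable[OF p(1)])
  have Li: "integrable M (\<lambda>x. L x (w x))" if w: "w \<in> borel_measurable M" "AE x in M. \<bar>w x\<bar> \<le> m" for w
  proof (rule Bochner_Integration.integrable_bound)
    show "integrable M (\<lambda>x. \<bar>L x 0\<bar> + CL * m)"
      by (rule Bochner_Integration.integrable_add[OF integrable_abs[OF L0] finite_measure.integrable_const[OF M_finite]])
    show "AE x in M. norm (L x (w x)) \<le> norm (\<bar>L x 0\<bar> + CL * m)"
      using L_C2 CL(2) w(2)
    proof eventually_elim
      case (elim x)
      have "norm (L x (w x) - L x 0) \<le> CL * norm (w x - 0)"
        using C2_functionD(1)[OF elim(1)] elim(2,3) m
        by (intro field_differentiable_bound[of "{-m..m}" "L x" "deriv (L x)"]) (auto intro: has_field_derivative_at_within simp: abs_le_iff)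
      moreover have "CL * \<bar>w x\<bar> \<le> CL * m" using elim(3) CL by (intro mult_left_mono) auto
      ultimately show ?case unfolding real_norm_def diff_0_right by linarith
    qed
  qed (rule Lm[OF w(1)])
  define J' where "J' = (\<integral>x. (p x + \<alpha> * z x) * g x \<partial>M)"
  define W where "W = (B * c)\<^sup>2 * (Ca * (\<integral>x. \<bar>p x\<bar> \<partial>M) + (\<integral>x. \<phi> x \<partial>M)) + \<alpha> / 2 * (\<integral>x. (g x)\<^sup>2 \<partial>M)"
  have gi: "integrable M (\<lambda>x. (g x)\<^sup>2)"
    by (rule integrable_bounded[where C = "B\<^sup>2"]) (measurable, use gB in eventually_elim, simp add: power2_le_iff_abs_le B less_imp_le)
  have zi: "integrable M z" by (rule integrable_bounded[OF zm zB])
  have z2i: "integrable M (\<lambda>x. (z x)\<^sup>2)"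
    by (rule integrable_bounded[where C = "B\<^sup>2"]) (measurable, use zB in eventually_elim, simp add: power2_le_iff_abs_le B less_imp_le)
  have gpi: "integrable M (\<lambda>x. g x * p x)" by (rule integrable_bounded_mult[OF gm pi gB])
  have gzi: "integrable M (\<lambda>x. g x * z x)" by (rule integrable_bounded_mult[OF gm zi gB])
  have J'_eq: "J' = (\<integral>x. g x * p x \<partial>M) + \<alpha> * (\<integral>x. g x * z x \<partial>M)"
  proof -
    have "J' = (\<integral>x. g x * p x + \<alpha> * (g x * z x) \<partial>M)" unfolding J'_def by (simp add: algebra_simps)
    then show ?thesis using gpi gzi by simp
  qed
  have diff: "cost \<Omega> L \<alpha> (ut t) (zt t) - cost \<Omega> L \<alpha> u0 z \<le> t * J' + t\<^sup>2 * W" if t: "0 < t" "t \<le> 1" for t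
  proof -
    have t': "0 \<le> t" using t by simp
    define w where "w = U t"
    have stw: "weak_state (zt t) w" unfolding w_def by (rule U(1)[OF t' t(2)])
    have wX: "w \<in> X" and weq: "\<And>v. v \<in> X \<Longrightarrow> Q * energy_form s w v + (\<integral>x. a x (w x) * v x \<partial>M) = (\<integral>x. zt t x * v x \<partial>M)"
      using stw by (auto simp: weak_state_def)
    have wm [measurable]: "w \<in> borel_measurable M" by (rule X_measurable[OF wX])
    define d where "d = (\<lambda>x. w x - u x)"
    have dX: "d \<in> X" unfolding d_def by (rule energy_space_diff[OF wX uX])
    have dm [measurable]: "d \<in> borel_measurable M" by (rule X_measurable[OF dX])
    have di: "integrable M d" by (rule X_integrable[OF dX])
    have db: "AE x in M. \<bar>d x\<bar> \<le> t * (B * c)" using delta[OF t] by (simp add: d_def w_def)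
    have wb: "AE x in M. \<bar>w x\<bar> \<le> m"
      using db m0(2)
    proof eventually_elim
      case (elim x)
      have "t * (B * c) \<le> 1 * (B * c)" using t B c by (intro mult_right_mono) auto
      then show ?case using elim unfolding d_def m_def by (simp add: abs_le_iff)
    qed
    have uwm: "AE x in M. u x \<in> {-m..m} \<and> w x \<in> {-m..m}"
      using wb m0(2) by eventually_elim (use m in \<open>auto simp: abs_le_iff\<close>)
    have awb: "AE x in M. \<bar>a x (w x)\<bar> \<le> Ca" using Ca(2) uwm by eventually_elim auto
    have aup: "integrable M (\<lambda>x. a x (u x) * p x)" by (rule integrable_bounded_mult[OF a_superposition[OF um] pi aub])
    have awp: "integrable M (\<lambda>x. a x (w x) * p x)" by (rule integrable_bounded_mult[OF a_superposition[OF wm] pi awb])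
    have zp: "integrable M (\<lambda>x. z x * p x)" by (rule integrable_bounded_mult[OF zm pi zB])
    have adp: "integrable M (\<lambda>x. deriv (a x) (u x) * p x * d x)"
    proof -
      have "integrable M (\<lambda>x. deriv (a x) (u x) * p x)" by (rule integrable_bounded_mult[OF adm pi adb])
      from integrable_bounded_mult[OF dm this db] show ?thesis by (simp add: mult.commute)
    qed
    have LDi: "integrable M (\<lambda>x. deriv (L x) (u x) * d x)" by (rule integrable_bounded_mult[OF Ldm di LDb])
    \<comment> \<open>The difference of the two state equations, tested with \<open>p\<close>.\<close>
    have e1: "Q * energy_form s d p = t * (\<integral>x. g x * p x \<partial>M) - ((\<integral>x. a x (w x) * p x \<partial>M) - (\<integral>x. a x (u x) * p x \<partial>M))"
    proof -
      have "(\<integral>x. zt t x * p x \<partial>M) = (\<integral>x. z x * p x + t * (g x * p x) \<partial>M)" by (simp add: zt_def algebra_simps)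
      also have "\<dots> = (\<integral>x. z x * p x \<partial>M) + t * (\<integral>x. g x * p x \<partial>M)" using zp gpi by simp
      finally have zz: "(\<integral>x. zt t x * p x \<partial>M) = (\<integral>x. z x * p x \<partial>M) + t * (\<integral>x. g x * p x \<partial>M)" .
      have "Q * energy_form s d p = Q * energy_form s w p - Q * energy_form s u p"
        unfolding d_def energy_form_diff[OF wX uX p(1)] by (simp add: right_diff_distrib)
      then show ?thesis using weq[OF p(1)] ueq[OF p(1)] zz by linarith
    qed
    \<comment> \<open>The adjoint equation, tested with \<open>d\<close>.\<close>
    have e2: "(\<integral>x. deriv (L x) (u x) * d x \<partial>M) = Q * energy_form s d p + (\<integral>x. deriv (a x) (u x) * p x * d x \<partial>M)"
      using adj[OF dX] by simp
    \<comment> \<open>The linearisation error of \<open>a\<close>, weighted with the adjoint state.\<close>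
    define R where "R = (\<lambda>x. a x (w x) * p x - a x (u x) * p x - deriv (a x) (u x) * p x * d x)"
    have Ri: "integrable M R" unfolding R_def using aup awp adp by simp
    have "(\<integral>x. R x \<partial>M) = (\<integral>x. a x (w x) * p x \<partial>M) - (\<integral>x. a x (u x) * p x \<partial>M) - (\<integral>x. deriv (a x) (u x) * p x * d x \<partial>M)"
      unfolding R_def using aup awp adp by simp
    moreover have "(\<integral>x. - R x \<partial>M) = - (\<integral>x. R x \<partial>M)" by simp
    moreover have "(\<integral>x. - R x \<partial>M) \<le> Ca * (t * (B * c))\<^sup>2 * (\<integral>x. \<bar>p x\<bar> \<partial>M)"
    proof -
      have "(\<integral>x. - R x \<partial>M) \<le> (\<integral>x. Ca * (t * (B * c))\<^sup>2 * \<bar>p x\<bar> \<partial>M)"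
      proof (rule integral_mono_AE)
        show "AE x in M. - R x \<le> Ca * (t * (B * c))\<^sup>2 * \<bar>p x\<bar>"
          using a_C2 Ca(2) uwm db
        proof eventually_elim
          case (elim x)
          have "\<bar>a x (w x) - a x (u x) - deriv (a x) (u x) * (w x - u x)\<bar> \<le> Ca * (w x - u x)\<^sup>2"
            using elim by (intro C2_function_taylor[of "a x" m]) auto
          also have "\<dots> \<le> Ca * (t * (B * c))\<^sup>2"
            using elim(4) Ca t B c by (intro mult_left_mono power2_le_iff_abs_le[THEN iffD2]) (auto simp: d_def)
          finally have "\<bar>a x (w x) - a x (u x) - deriv (a x) (u x) * (w x - u x)\<bar> * \<bar>p x\<bar> \<le> Ca * (t * (B * c))\<^sup>2 * \<bar>p x\<bar>"
            by (rule mult_right_mono) simp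
          moreover have "R x =
            (a x (w x) - a x (u x) - deriv (a x) (u x) * (w x - u x)) * p x"
            by (simp add: R_def d_def algebra_simps)
          ultimately show ?case unfolding abs_mult[symmetric] by (metis abs_ge_minus_self order_trans)
        qed
      qed (use Ri pi in auto)
      then show ?thesis by simp
    qed
    ultimately have 1: "(\<integral>x. deriv (L x) (u x) * d x \<partial>M) \<le> t * (\<integral>x. g x * p x \<partial>M) + Ca * (t * (B * c))\<^sup>2 * (\<integral>x. \<bar>p x\<bar> \<partial>M)"
      using e1 e2 by linarith
    have um': "AE x in M. \<bar>u x\<bar> \<le> m" using m0(2) by eventually_elim (use m in simp)
    have "(\<integral>x. L x (w x) \<partial>M) - (\<integral>x. L x (u x) \<partial>M) = (\<integral>x. L x (w x) - L x (u x) \<partial>M)"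
      using Li[OF wm wb] Li[OF um um'] by simp
    also have "\<dots> \<le> (\<integral>x. deriv (L x) (u x) * d x + (t * (B * c))\<^sup>2 * \<phi> x \<partial>M)"
    proof (rule integral_mono_AE)
      show "AE x in M. L x (w x) - L x (u x) \<le> deriv (L x) (u x) * d x + (t * (B * c))\<^sup>2 * \<phi> x"
        using L_C2 \<phi>(2) uwm db
      proof eventually_elim
        case (elim x)
        have "\<bar>L x (w x) - L x (u x) - deriv (L x) (u x) * (w x - u x)\<bar> \<le> \<phi> x * (w x - u x)\<^sup>2"
          using elim by (intro C2_function_taylor[of "L x" m]) auto
        also have "\<dots> \<le> \<phi> x * (t * (B * c))\<^sup>2"
        proof (rule mult_left_mono)
          show "(w x - u x)\<^sup>2 \<le> (t * (B * c))\<^sup>2"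
            using elim(4) t B c by (intro power2_le_iff_abs_le[THEN iffD2]) (auto simp: d_def)
          show "0 \<le> \<phi> x" using elim(2,3) by (meson abs_ge_zero order_trans)
        qed
        finally show ?case unfolding d_def by (simp add: abs_le_iff mult.commute)
      qed
    qed (use Li[OF wm wb] Li[OF um um'] LDi \<phi>(1) in auto)
    also have "\<dots> = (\<integral>x. deriv (L x) (u x) * d x \<partial>M) + (t * (B * c))\<^sup>2 * (\<integral>x. \<phi> x \<partial>M)" using LDi \<phi>(1) by simp
    finally have 2: "(\<integral>x. L x (w x) \<partial>M) - (\<integral>x. L x (u x) \<partial>M) \<le>
        (\<integral>x. deriv (L x) (u x) * d x \<partial>M) + (t * (B * c))\<^sup>2 * (\<integral>x. \<phi> x \<partial>M)" .
    have utw: "AE x in M. w x = ut t x"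
      using AE_lebesgue_on_lborel[OF U(2)[OF t' t(2)] \<Omega>_sets] by eventually_elim (simp add: w_def)
    have Lw: "(\<integral>x. L x (ut t x) \<partial>M) = (\<integral>x. L x (w x) \<partial>M)"
    proof -
      have "ut t \<in> borel_measurable M" by (rule borel_measurable_lebesgue_on_AE[OF \<Omega>_sets wm utw])
      moreover have "AE x in M. L x (ut t x) = L x (w x)" using utw by eventually_elim simp
      ultimately show ?thesis by (intro integral_cong_AE Lm wm)
    qed
    have Lu: "(\<integral>x. L x (u0 x) \<partial>M) = (\<integral>x. L x (u x) \<partial>M)"
    proof -
      have u0s: "AE x in M. u x = u0 x" using u0u by eventually_elim simp
      have "u0 \<in> borel_measurable M" by (rule borel_measurable_lebesgue_on_AE[OF \<Omega>_sets um u0s])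
      moreover have "AE x in M. L x (u0 x) = L x (u x)" using u0u by eventually_elim simp
      ultimately show ?thesis by (intro integral_cong_AE Lm um)
    qed
    have n2: "(L2_norm \<Omega> f)\<^sup>2 = (\<integral>x. (f x)\<^sup>2 \<partial>M)" for f
      by (simp add: L2_norm_def L2_inner_def power2_eq_square)
    have zsq: "(\<integral>x. (zt t x)\<^sup>2 \<partial>M) = (\<integral>x. (z x)\<^sup>2 \<partial>M) + 2 * t * (\<integral>x. g x * z x \<partial>M) + t\<^sup>2 * (\<integral>x. (g x)\<^sup>2 \<partial>M)"
    proof -
      have "(\<integral>x. (zt t x)\<^sup>2 \<partial>M) = (\<integral>x. (z x)\<^sup>2 + 2 * t * (g x * z x) + t\<^sup>2 * (g x)\<^sup>2 \<partial>M)"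
        by (simp add: zt_def power2_eq_square algebra_simps)
      then show ?thesis using z2i gzi gi by simp
    qed
    have "cost \<Omega> L \<alpha> (ut t) (zt t) - cost \<Omega> L \<alpha> u0 z =
       ((\<integral>x. L x (w x) \<partial>M) - (\<integral>x. L x (u x) \<partial>M)) + \<alpha> / 2 * (2 * t * (\<integral>x. g x * z x \<partial>M) + t\<^sup>2 * (\<integral>x. (g x)\<^sup>2 \<partial>M))"
      unfolding cost_def Lw Lu n2 zsq by (simp add: algebra_simps)
    also have "\<dots> \<le> t * (\<integral>x. g x * p x \<partial>M) + Ca * (t * (B * c))\<^sup>2 * (\<integral>x. \<bar>p x\<bar> \<partial>M) + (t * (B * c))\<^sup>2 * (\<integral>x. \<phi> x \<partial>M)
        + \<alpha> / 2 * (2 * t * (\<integral>x. g x * z x \<partial>M) + t\<^sup>2 * (\<integral>x. (g x)\<^sup>2 \<partial>M))"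
      using 1 2 by linarith
    also have "\<dots> = t * J' + t\<^sup>2 * W"
      unfolding J'_eq W_def by (simp add: power_mult_distrib algebra_simps)
    finally show ?thesis .
  qed
  obtain \<epsilon> where \<epsilon>: "0 < \<epsilon>" "\<And>y. y \<in> Z_ad lo hi \<Omega> \<Longrightarrow> L2_norm \<Omega> (\<lambda>x. y x - z x) \<le> \<epsilon> \<Longrightarrow>
       cost \<Omega> L \<alpha> (control_to_state s \<Omega> a z) z \<le> cost \<Omega> L \<alpha> (control_to_state s \<Omega> a y) y"
    using loc unfolding locally_optimal_control_def by blast
  define G where "G = sqrt (\<integral>x. (g x)\<^sup>2 \<partial>M)"
  have G: "0 \<le> G" by (simp add: G_def)
  \<comment> \<open>For \<open>t \<le> t1\<close> the perturbed control stays in the neighbourhood where \<open>z\<close> is optimal.\<close>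
  define t1 where "t1 = min 1 (\<epsilon> / (G + 1))"
  have t1: "0 < t1" "t1 \<le> 1" "t1 * G \<le> \<epsilon>"
  proof -
    show "0 < t1" "t1 \<le> 1" using \<epsilon> G by (auto simp: t1_def)
    have "t1 * G \<le> \<epsilon> / (G + 1) * (G + 1)" using \<epsilon> G by (intro mult_mono) (auto simp: t1_def)
    then show "t1 * G \<le> \<epsilon>" using G by simp
  qed
  have pos: "0 \<le> t * J' + t\<^sup>2 * W" if t: "0 < t" "t \<le> t1" for t
  proof -
    have tt: "0 < t" "t \<le> 1" "0 \<le> t" using t t1 by auto
    have "L2_norm \<Omega> (\<lambda>x. zt t x - z x) = t * G"
    proof -
      have "L2_inner \<Omega> (\<lambda>x. zt t x - z x) (\<lambda>x. zt t x - z x) = t\<^sup>2 * (\<integral>x. (g x)\<^sup>2 \<partial>M)"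
        unfolding L2_inner_def integral_mult_right_zero[symmetric]
        by (intro Bochner_Integration.integral_cong refl) (simp add: zt_def power2_eq_square)
      then show ?thesis using t by (simp add: L2_norm_def G_def real_sqrt_mult)
    qed
    also have "\<dots> \<le> t1 * G" using t G by (intro mult_right_mono)
    also have "\<dots> \<le> \<epsilon>" by (rule t1)
    finally have "cost \<Omega> L \<alpha> u0 z \<le> cost \<Omega> L \<alpha> (ut t) (zt t)"
      unfolding u0_def ut_def by (intro \<epsilon>(2) ztZ tt)
    then show ?thesis using diff[OF tt(1,2)] by linarith
  qed
  have "0 \<le> J'"
  proof (rule ccontr)
    assume neg: "\<not> 0 \<le> J'"
    define t where "t = min t1 (- J' / (2 * (\<bar>W\<bar> + 1)))"
    have t: "0 < t" "t \<le> t1" "t * (2 * (\<bar>W\<bar> + 1)) \<le> - J'"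
    proof -
      have "0 < - J' / (2 * (\<bar>W\<bar> + 1))" using neg by (intro divide_pos_pos) auto
      then show "0 < t" "t \<le> t1" using t1 unfolding t_def by linarith+
      have "t * (2 * (\<bar>W\<bar> + 1)) \<le> - J' / (2 * (\<bar>W\<bar> + 1)) * (2 * (\<bar>W\<bar> + 1))"
        by (intro mult_right_mono) (auto simp: t_def)
      then show "t * (2 * (\<bar>W\<bar> + 1)) \<le> - J'" by simp
    qed
    have "0 \<le> t * (J' + t * W)" using pos[OF t(1,2)] by (simp add: power2_eq_square algebra_simps)
    then have "0 \<le> J' + t * W" using t(1) by (simp add: zero_le_mult_iff)
    moreover have "t * W \<le> t * (\<bar>W\<bar> + 1)" using t(1) by (intro mult_left_mono) auto
    moreover have "t * (2 * (\<bar>W\<bar> + 1)) = 2 * (t * (\<bar>W\<bar> + 1))" by simp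
    ultimately show False using t(3) neg by linarith
  qed
  then show ?thesis by (simp add: J'_def g_def)
qed

end

section \<open>Regularity of optimal triplets\<close>

lemma clamp_lipschitz: "\<bar>max lo (min hi a) - max lo (min hi b)\<bar> \<le> \<bar>a - b :: real\<bar>"
  by (auto simp: max_def min_def)

text \<open>
  By the projection property, \<open>(\<zeta> - y) * (\<zeta> - z) \<le> 0\<close> for \<open>y = - p / \<alpha>\<close> and every \<open>z\<close> in the interval. Combined with the
  first-order condition this forces \<open>\<zeta> = z\<close>.
\<close>

lemma clamp_variational:
  fixes lo hi \<alpha> z p :: real
  assumes "0 < \<alpha>" "lo \<le> z" "z \<le> hi"
  defines "\<zeta> \<equiv> max lo (min hi (- p / \<alpha>))"
  shows "(p + \<alpha> * z) * (\<zeta> - z) \<le> - \<alpha> * (\<zeta> - z)\<^sup>2"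
proof -
  define y where "y = - p / \<alpha>"
  have p: "p = - (\<alpha> * y)" using assms by (simp add: y_def)
  have "(\<zeta> - y) * (\<zeta> - z) \<le> 0"
    using assms(2,3) unfolding \<zeta>_def y_def[symmetric]
    by (auto simp: max_def min_def mult_le_0_iff)
  then have "\<alpha> * ((\<zeta> - y) * (\<zeta> - z)) \<le> 0" using assms(1) by (simp add: mult_le_0_iff)
  then show ?thesis unfolding p by (simp add: power2_eq_square algebra_simps)
qed

lemma Lp_space_integrable:
  assumes f: "f \<in> Lp_space r \<Omega>" and r: "1 \<le> r" and fin: "finite_measure (lebesgue_on \<Omega>)"
  shows "integrable (lebesgue_on \<Omega>) f"
proof (rule Bochner_Integration.integrable_bound)
  have "integrable (lebesgue_on \<Omega>) (\<lambda>x. \<bar>f x\<bar> powr r)" using f by (simp add: Lp_space_def)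
  then show "integrable (lebesgue_on \<Omega>) (\<lambda>x. 1 + \<bar>f x\<bar> powr r)"
    by (rule Bochner_Integration.integrable_add[OF finite_measure.integrable_const[OF fin]])
  show "f \<in> borel_measurable (lebesgue_on \<Omega>)" using f by (simp add: Lp_space_def)
  show "AE x in lebesgue_on \<Omega>. norm (f x) \<le> norm (1 + \<bar>f x\<bar> powr r)"
  proof (rule AE_I2)
    fix x
    show "norm (f x) \<le> norm (1 + \<bar>f x\<bar> powr r)"
    proof (cases "\<bar>f x\<bar> \<le> 1")
      case False
      then have "\<bar>f x\<bar> powr 1 \<le> \<bar>f x\<bar> powr r" using r by (intro powr_mono) auto
      then show ?thesis using False by simp
    qed (simp add: add_increasing2)
  qed
qed

theorem theorem4p3:
  fixes \<Omega> :: "(real ^ 'n) set"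
    and s \<alpha> lo hi :: real
    and a L :: "real ^ 'n \<Rightarrow> real \<Rightarrow> real"
    and ubar pbar zbar :: "real ^ 'n \<Rightarrow> real"
  assumes "CARD('n) \<ge> 2" and "1/4 \<le> s" and "s < 1/2"
    and "bounded_lipschitz_domain \<Omega>" and "exterior_ball_condition \<Omega>"
    and "0 < \<alpha>" and "lo < hi"
    and "nonlinearity_assms s \<Omega> a" and "integrand_assms s \<Omega> L"
    and "\<forall>m>0. \<exists>C>0. AE x in lebesgue_on \<Omega>. \<forall>u\<in>{-m..m}.
           \<bar>a x u\<bar> \<le> C \<and> \<bar>deriv (L x) u\<bar> \<le> C"
    and "optimal_triplet s \<Omega> a L \<alpha> lo hi ubar pbar zbar"
  shows "(\<exists>g\<in>holder_space s UNIV. AE x in lebesgue. ubar x = g x) \<and>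
         (\<exists>g\<in>holder_space s UNIV. AE x in lebesgue. pbar x = g x) \<and>
         (\<exists>g\<in>holder_space s (closure \<Omega>). AE x in lebesgue_on \<Omega>. zbar x = g x)"
proof -
  note bd = assms(10)
  interpret state_equation s \<Omega> a "frac_const CARD('n) s / 2"
  proof
    show "open \<Omega>" "bounded \<Omega>" using assms(4) by (auto simp: bounded_lipschitz_domain_def)
    show "0 < s" "s < 1/2" using assms(2,3) by auto
    show "(\<lambda>x. a x t) \<in> borel_measurable (lebesgue_on \<Omega>)" for t
      using assms(8) by (auto simp: nonlinearity_assms_def caratheodory_function_def)
    show "AE x in lebesgue_on \<Omega>. C2_function (a x)" "AE x in lebesgue_on \<Omega>. \<forall>t. 0 \<le> deriv (a x) t"
      using assms(8) by (auto simp: nonlinearity_assms_def)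
    fix m :: real assume m: "0 < m"
    obtain C1 where C1: "0 < C1" "AE x in lebesgue_on \<Omega>. \<forall>u\<in>{-m..m}. \<forall>v\<in>{-m..m}. \<forall>w\<in>{-m..m}.
        (\<Sum>i=1..2. \<bar>(deriv ^^ i) (a x) u\<bar>) \<le> C1 \<and>
        \<bar>(deriv ^^ 2) (a x) v - (deriv ^^ 2) (a x) w\<bar> \<le> C1 * \<bar>v - w\<bar>"
      using assms(8) m unfolding nonlinearity_assms_def by blast
    obtain C2 where C2: "0 < C2" "AE x in lebesgue_on \<Omega>. \<forall>u\<in>{-m..m}. \<bar>a x u\<bar> \<le> C2 \<and> \<bar>deriv (L x) u\<bar> \<le> C2"
      using bd m by blast
    have "AE x in lebesgue_on \<Omega>. \<forall>t\<in>{-m..m}. \<bar>a x t\<bar> \<le> C1 + C2 \<and> \<bar>deriv (a x) t\<bar> \<le> C1 + C2 \<and> \<bar>(deriv ^^ 2) (a x) t\<bar> \<le> C1 + C2"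
      using C1(2) C2(2)
    proof eventually_elim
      case (elim x)
      show ?case
      proof
        fix t assume t: "t \<in> {-m..m}"
        have "(\<Sum>i=1..2. \<bar>(deriv ^^ i) (a x) t\<bar>) \<le> C1" using elim(1) t by blast
        moreover have "{1..2} = {1, 2 :: nat}" by auto
        ultimately have "\<bar>deriv (a x) t\<bar> + \<bar>(deriv ^^ 2) (a x) t\<bar> \<le> C1" by simp
        moreover have "\<bar>a x t\<bar> \<le> C2" using elim(2) t by blast
        ultimately show "\<bar>a x t\<bar> \<le> C1 + C2 \<and> \<bar>deriv (a x) t\<bar> \<le> C1 + C2 \<and> \<bar>(deriv ^^ 2) (a x) t\<bar> \<le> C1 + C2"
          using C1(1) C2(1) by (simp add: abs_le_iff) linarith
      qed
    qed
    then show "\<exists>C>0. AE x in lebesgue_on \<Omega>. \<forall>t\<in>{-m..m}. \<bar>a x t\<bar> \<le> C \<and> \<bar>deriv (a x) t\<bar> \<le> C \<and> \<bar>(deriv ^^ 2) (a x) t\<bar> \<le> C"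
      using C1(1) C2(1) by (intro exI[of _ "C1 + C2"]) auto
  qed (rule refl)
  have L_meas: "(\<lambda>x. L x t) \<in> borel_measurable M" for t
    using assms(9) by (auto simp: integrand_assms_def caratheodory_function_def)
  have L_C2: "AE x in M. C2_function (L x)" using assms(9) by (auto simp: integrand_assms_def)
  have L0: "integrable M (\<lambda>x. L x 0)"
    using assms(9) by (intro Lp_space_integrable[of _ 1] M_finite) (auto simp: integrand_assms_def)
  have L_bd: "\<exists>C>0. AE x in M. \<forall>t\<in>{-m..m}. \<bar>deriv (L x) t\<bar> \<le> C" if m: "0 < m" for m
  proof -
    obtain C where C: "0 < C" "AE x in M. \<forall>u\<in>{-m..m}. \<bar>a x u\<bar> \<le> C \<and> \<bar>deriv (L x) u\<bar> \<le> C" using bd m by blast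
    have "AE x in M. \<forall>t\<in>{-m..m}. \<bar>deriv (L x) t\<bar> \<le> C" using C(2) by eventually_elim blast
    then show ?thesis using C(1) by blast
  qed
  have L_bd2: "\<exists>\<phi>. integrable M \<phi> \<and> (AE x in M. \<forall>t\<in>{-m..m}. \<bar>(deriv ^^ 2) (L x) t\<bar> \<le> \<phi> x)" if m: "0 < m" for m
  proof -
    obtain r \<psi> \<phi> where r: "real CARD('n) / (2 * s) < r" "\<phi> \<in> Lp_space r \<Omega>"
      and \<phi>: "AE x in M. \<forall>u\<in>{-m..m}. \<bar>deriv (L x) u\<bar> \<le> \<psi> x \<and> \<bar>(deriv ^^ 2) (L x) u\<bar> \<le> \<phi> x"
      using assms(9) m unfolding integrand_assms_def by blast
    have "1 \<le> real CARD('n) / (2 * s)" using assms(1) s by (simp add: le_divide_eq)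
    then have "integrable M \<phi>" using r by (intro Lp_space_integrable[of _ r] M_finite) auto
    moreover have "AE x in M. \<forall>t\<in>{-m..m}. \<bar>(deriv ^^ 2) (L x) t\<bar> \<le> \<phi> x" using \<phi> by eventually_elim blast
    ultimately show ?thesis by blast
  qed
  have loc: "locally_optimal_control s \<Omega> a L \<alpha> lo hi zbar" and ust: "is_state s \<Omega> a zbar ubar"
    and pst: "is_adjoint_state s \<Omega> a L ubar pbar"
    using assms(11) by (auto simp: optimal_triplet_def)
  have zm [measurable]: "zbar \<in> borel_measurable M" and zlh: "AE x in M. lo \<le> zbar x \<and> zbar x \<le> hi"
    using loc by (auto simp: locally_optimal_control_def Z_ad_def Lp_space_def)
  obtain u where u: "weak_state zbar u" "AE x in lborel. ubar x = u x"
    by (rule weak_state_representative[OF ust zm])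
  have uX: "u \<in> X" and ueq: "\<And>v. v \<in> X \<Longrightarrow> frac_const CARD('n) s / 2 * energy_form s u v + (\<integral>x. a x (u x) * v x \<partial>M) = (\<integral>x. zbar x * v x \<partial>M)"
    using u(1) by (auto simp: weak_state_def)
  have um [measurable]: "u \<in> borel_measurable M" by (rule X_measurable[OF uX])
  have uu: "AE x in M. u x = ubar x" using AE_lebesgue_on_lborel[OF u(2) \<Omega>_sets] by eventually_elim simp
  obtain m where m: "0 < m" "AE x in M. \<bar>u x\<bar> \<le> m" using u(1) unfolding weak_state_def by blast
  obtain Ca where Ca: "0 < Ca" "AE x in M. \<forall>t\<in>{-m..m}. \<bar>a x t\<bar> \<le> Ca \<and> \<bar>deriv (a x) t\<bar> \<le> Ca \<and> \<bar>(deriv ^^ 2) (a x) t\<bar> \<le> Ca"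
    using a_bd[OF m(1)] by blast
  obtain CL where CL: "0 < CL" "AE x in M. \<forall>t\<in>{-m..m}. \<bar>deriv (L x) t\<bar> \<le> CL" using L_bd[OF m(1)] by blast
  have um': "AE x in M. u x \<in> {-m..m}" using m(2) by eventually_elim (auto simp: abs_le_iff)
  have aub: "AE x in M. \<bar>a x (u x)\<bar> \<le> Ca" using Ca(2) um' by eventually_elim blast
  have adb: "AE x in M. \<bar>deriv (a x) (u x)\<bar> \<le> Ca" using Ca(2) um' by eventually_elim blast
  have LDb: "AE x in M. \<bar>deriv (L x) (u x)\<bar> \<le> CL" using CL(2) um' by eventually_elim blast
  have Ldm: "(\<lambda>x. deriv (L x) (u x)) \<in> borel_measurable M"
  proof (rule superposition_deriv_measurable[OF \<Omega>_sets L_meas _ um])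
    show "AE x in M. \<forall>t. L x field_differentiable at t" using L_C2 by eventually_elim (simp add: C2_function_def)
  qed
  have adm: "(\<lambda>x. deriv (a x) (u x)) \<in> borel_measurable M" by (rule a_deriv_superposition[OF um])

  have zB: "AE x in M. \<bar>zbar x\<bar> \<le> \<bar>lo\<bar> + \<bar>hi\<bar>" using zlh by eventually_elim auto
  \<comment> \<open>The state has the bounded source \<open>zbar - a x u\<close>.\<close>
  have "\<exists>g\<in>holder_space s UNIV. AE x in lborel. u x = g x"
  proof (rule holder_if_bounded_source[OF assms(5) uX])
    show "AE x in M. \<bar>zbar x - a x (u x)\<bar> \<le> \<bar>lo\<bar> + \<bar>hi\<bar> + Ca"
      using zB aub by eventually_elim (simp add: abs_le_iff)
    fix v assume v: "v \<in> X"
    have "integrable M (\<lambda>x. zbar x * v x)" "integrable M (\<lambda>x. a x (u x) * v x)"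
      using integrable_bounded_mult[OF zm X_integrable[OF v] zB]
        integrable_bounded_mult[OF a_superposition[OF um] X_integrable[OF v] aub] by auto
    then show "frac_const CARD('n) s / 2 * energy_form s u v = (\<integral>x. (zbar x - a x (u x)) * v x \<partial>M)"
      using ueq[OF v] by (simp add: left_diff_distrib)
  qed
  then obtain gu where gu: "gu \<in> holder_space s UNIV" "AE x in lborel. u x = gu x" by blast
  have U: "AE x in lebesgue. ubar x = gu x"
    using AE_completion[OF u(2)] AE_completion[OF gu(2)] by eventually_elim simp

  have pH: "pbar \<in> Hs_tilde s \<Omega>" and pL: "pbar \<in> Linf_space \<Omega>" using pst by (auto simp: is_adjoint_state_def)
  obtain p where p: "p \<in> X" "AE x in lborel. pbar x = p x" using Hs_tilde_representative[OF pH] by blast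
  have pp: "AE x in M. p x = pbar x" using AE_lebesgue_on_lborel[OF p(2) \<Omega>_sets] by eventually_elim simp
  have pm [measurable]: "p \<in> borel_measurable M" by (rule X_measurable[OF p(1)])
  obtain P where P: "AE x in M. \<bar>pbar x\<bar> \<le> P" using pL by (auto simp: Linf_space_def)
  have pP: "AE x in M. \<bar>p x\<bar> \<le> P" using P pp by eventually_elim simp
  have adj: "frac_const CARD('n) s / 2 * energy_form s v p + (\<integral>x. deriv (a x) (u x) * p x * v x \<partial>M) = (\<integral>x. deriv (L x) (u x) * v x \<partial>M)"
    if v: "v \<in> X" for v
  proof -
    have vH: "v \<in> Hs_tilde s \<Omega>" by (rule energy_space_subset_Hs_tilde[OF v])
    have "frac_form s v pbar = frac_const CARD('n) s / 2 * energy_form s v p"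
      using Hs_tilde_measurable[OF vH] Hs_tilde_measurable[OF pH] energy_spaceD(1)[OF v] energy_spaceD(1)[OF p(1)] p(2)
      by (intro frac_form_representative) auto
    moreover have "(\<integral>x. deriv (a x) (u x) * p x * v x \<partial>M) = (\<integral>x. deriv (a x) (ubar x) * pbar x * v x \<partial>M)"
    proof (rule integral_mult_cong[OF _ _ X_measurable[OF v]])
      show "(\<lambda>x. deriv (a x) (u x) * p x) \<in> borel_measurable M" using adm by measurable
      show "AE x in M. deriv (a x) (u x) * p x = deriv (a x) (ubar x) * pbar x" using uu pp by eventually_elim simp
    qed simp
    moreover have "(\<integral>x. deriv (L x) (u x) * v x \<partial>M) = (\<integral>x. deriv (L x) (ubar x) * v x \<partial>M)"
    proof (rule integral_mult_cong[OF Ldm _ X_measurable[OF v]])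
      show "AE x in M. deriv (L x) (u x) = deriv (L x) (ubar x)" using uu by eventually_elim simp
    qed simp
    ultimately show ?thesis using pst vH by (auto simp: is_adjoint_state_def L2_inner_def)
  qed
  have "\<exists>g\<in>holder_space s UNIV. AE x in lborel. p x = g x"
  proof (rule holder_if_bounded_source[OF assms(5) p(1)])
    show "AE x in M. \<bar>deriv (L x) (u x) - deriv (a x) (u x) * p x\<bar> \<le> CL + Ca * P"
      using LDb adb pP
    proof eventually_elim
      case (elim x)
      have "\<bar>deriv (a x) (u x)\<bar> * \<bar>p x\<bar> \<le> Ca * P" using elim Ca by (intro mult_mono) auto
      then show ?case using elim(1) abs_triangle_ineq4[of "deriv (L x) (u x)" "deriv (a x) (u x) * p x"] by (simp add: abs_mult)
    qed
    fix v assume v: "v \<in> X"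
    have "integrable M (\<lambda>x. deriv (L x) (u x) * v x)" by (rule integrable_bounded_mult[OF Ldm X_integrable[OF v] LDb])
    moreover have "integrable M (\<lambda>x. deriv (a x) (u x) * p x * v x)"
    proof (rule integrable_bounded_mult[OF _ X_integrable[OF v]])
      show "(\<lambda>x. deriv (a x) (u x) * p x) \<in> borel_measurable M" using adm by measurable
      show "AE x in M. \<bar>deriv (a x) (u x) * p x\<bar> \<le> Ca * P"
        using adb pP by eventually_elim (simp add: abs_mult mult_mono)
    qed
    ultimately show "frac_const CARD('n) s / 2 * energy_form s p v = (\<integral>x. (deriv (L x) (u x) - deriv (a x) (u x) * p x) * v x \<partial>M)"
      using adj[OF v] by (simp add: left_diff_distrib energy_form_commute[of s p])
  qed
  then obtain gp where gp: "gp \<in> holder_space s UNIV" "AE x in lborel. p x = gp x" by blast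
  have Pp: "AE x in lebesgue. pbar x = gp x"
    using AE_completion[OF p(2)] AE_completion[OF gp(2)] by eventually_elim simp

  define \<zeta> where "\<zeta> = (\<lambda>x. max lo (min hi (- p x / \<alpha>)))"
  have \<zeta>m [measurable]: "\<zeta> \<in> borel_measurable M" unfolding \<zeta>_def by measurable
  have \<zeta>lh: "lo \<le> \<zeta> x" "\<zeta> x \<le> hi" for x using assms(7) by (auto simp: \<zeta>_def)
  have VI: "0 \<le> (\<integral>x. (p x + \<alpha> * zbar x) * (\<zeta> x - zbar x) \<partial>M)"
    by (rule first_order_condition[OF L_meas L_C2 L0 L_bd L_bd2 loc u(1) p(1) pP adj \<zeta>m \<zeta>lh])
  \<comment> \<open>The first-order condition in the direction of the projection \<open>\<zeta>\<close> gives \<open>\<alpha> * (\<integral>x. D x \<partial>M) \<le> 0\<close>.\<close>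
  define D where "D = (\<lambda>x. (\<zeta> x - zbar x)\<^sup>2)"
  have Db: "AE x in M. \<bar>\<zeta> x - zbar x\<bar> \<le> \<bar>lo\<bar> + \<bar>hi\<bar>"
    using zlh
  proof eventually_elim
    case (elim x)
    then show ?case using \<zeta>lh[of x] by (auto simp: abs_le_iff)
  qed
  have Di: "integrable M D"
  proof (rule integrable_bounded)
    show "D \<in> borel_measurable M" unfolding D_def by measurable
    show "AE x in M. \<bar>D x\<bar> \<le> (\<bar>lo\<bar> + \<bar>hi\<bar>)\<^sup>2"
      using Db by eventually_elim (simp add: D_def power2_le_iff_abs_le)
  qed
  have "(\<integral>x. (p x + \<alpha> * zbar x) * (\<zeta> x - zbar x) \<partial>M) \<le> (\<integral>x. - \<alpha> * D x \<partial>M)"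
  proof (rule integral_mono_AE)
    have zi: "integrable M zbar" by (rule integrable_bounded[OF zm zB])
    have "integrable M (\<lambda>x. (\<zeta> x - zbar x) * (p x + \<alpha> * zbar x))"
      using X_integrable[OF p(1)] zi by (intro integrable_bounded_mult[OF _ _ Db]) auto
    then show "integrable M (\<lambda>x. (p x + \<alpha> * zbar x) * (\<zeta> x - zbar x))" by (simp add: mult.commute)
    show "AE x in M. (p x + \<alpha> * zbar x) * (\<zeta> x - zbar x) \<le> - \<alpha> * D x"
      using zlh
    proof eventually_elim
      case (elim x)
      then show ?case using clamp_variational[of \<alpha> lo "zbar x" hi "p x"] assms(6) by (simp add: \<zeta>_def D_def)
    qed
  qed (use Di in simp)
  then have "\<alpha> * (\<integral>x. D x \<partial>M) \<le> 0" using VI by simp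
  then have "(\<integral>x. D x \<partial>M) \<le> 0" using assms(6) by (simp add: mult_le_0_iff)
  moreover have D0: "0 \<le> D x" for x by (simp add: D_def)
  then have "0 \<le> (\<integral>x. D x \<partial>M)" by (rule Bochner_Integration.integral_nonneg)
  ultimately have "(\<integral>x. D x \<partial>M) = 0" by linarith
  then have "AE x in M. D x = 0"
    using integral_nonneg_eq_0_iff_AE[OF Di AE_I2[OF D0]] by blast
  then have z\<zeta>: "AE x in M. zbar x = \<zeta> x" by eventually_elim (simp add: D_def)
  define gz where "gz = (\<lambda>x. max lo (min hi (- gp x / \<alpha>)))"
  have "AE x in M. zbar x = gz x"
    using z\<zeta> AE_lebesgue_on_lborel[OF gp(2) \<Omega>_sets] by eventually_elim (simp add: \<zeta>_def gz_def)
  moreover have "gz \<in> holder_space s (closure \<Omega>)"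
  proof -
    obtain C where C: "\<And>x y. \<bar>gp x - gp y\<bar> \<le> C * norm (x - y) powr s" using gp(1) by (auto simp: holder_space_def)
    have "\<bar>gz x - gz y\<bar> \<le> C / \<alpha> * norm (x - y) powr s" for x y
    proof -
      have "\<bar>gz x - gz y\<bar> \<le> \<bar>- gp x / \<alpha> - (- gp y / \<alpha>)\<bar>" unfolding gz_def by (rule clamp_lipschitz)
      also have "\<dots> = \<bar>gp x - gp y\<bar> / \<alpha>" using assms(6) by (simp add: diff_divide_distrib[symmetric] abs_minus_commute)
      also have "\<dots> \<le> C * norm (x - y) powr s / \<alpha>" using C[of x y] assms(6) by (intro divide_right_mono) auto
      finally show ?thesis by simp
    qed
    moreover have "bounded (gz ` closure \<Omega>)"
      unfolding bounded_iff using assms(7) by (intro exI[of _ "\<bar>lo\<bar> + \<bar>hi\<bar>"]) (auto simp: gz_def)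
    ultimately show ?thesis unfolding holder_space_def by blast
  qed
  ultimately show ?thesis using gu(1) gp(1) U Pp by blast
qed

end
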